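(* Let $R$ be a commutative Noetherian local ring, $N$ a finitely generated $R$-module, $M$ an $R$-module and $I\subseteq R$ an ideal with $IM\neq M$, and let $c=\operatorname{grade}(I,M)$. Then the following conditions are equivalent: (i) $M$ is cohomologically complete intersection with respect to the pair $(N,I)$, i.e. $H^i_I(N,M)=0$ for all $i\neq c$. (ii) $U^I_i(N,D(M))=0$ for all $i\neq c$. (iii) $L_i\Lambda^I (N,D(M))=0$ for all $i\neq c$.
   Context: For $R$-modules $N,X$ (all objects are $0$ for negative index): - $H^i_I(X)$ is ordinary local cohomology, and $H^i_I(N,X)=\varinjlim_s\operatorname{Ext}^i_R(N/I^sN,X)$. - $U^I_i(N,X)=\varprojlim_s\operatorname{Tor}_i^R(N/I^sN,X)$. - $L_i\Lambda^I(N,X)=H_i(\varprojlim_s(N/I^sN\otimes_R F_\cdot))$, where $F_\cdot$ is a flat resolution of $X$ (independent of the choice). - For $IM\ne M$, $\operatorname{grade}(I,M)=\inf\{i\in\mathbb{Z}: H^i_I(M)\neq 0\}$. - $D(\cdot)=\operatorname{Hom}_R(\cdot,E_R(k))$ is the Matlis dual functor, $k$ the residue field of the local ring $R$. *)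

theory Defs
  imports "HOL-Algebra.Module" "HOL-Algebra.Ideal_Product" "HOL-Algebra.Ring_Divisibility"
begin

section \<open>Modules: homomorphisms, quotients, spans\<close>

definition is_zero :: "('r, 'm, 'c) module_scheme \<Rightarrow> bool"
  where "is_zero M \<longleftrightarrow> carrier M = {\<zero>\<^bsub>M\<^esub>}"

definition mod_hom ::
    "('r, 'x) ring_scheme \<Rightarrow> ('r, 'a, 'c) module_scheme \<Rightarrow> ('r, 'b, 'd) module_scheme \<Rightarrow> ('a \<Rightarrow> 'b) set"
  where "mod_hom R A B =
    {f \<in> carrier A \<rightarrow> carrier B.
       (\<forall>x\<in>carrier A. \<forall>y\<in>carrier A. f (x \<oplus>\<^bsub>A\<^esub> y) = f x \<oplus>\<^bsub>B\<^esub> f y) \<and>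
       (\<forall>r\<in>carrier R. \<forall>x\<in>carrier A. f (r \<odot>\<^bsub>A\<^esub> x) = r \<odot>\<^bsub>B\<^esub> f x)}"

text \<open>The ring structure fields of a module record carry no meaning for a module; they are left
  \<open>undefined\<close> in all constructions below.\<close>

definition ring_module :: "('r, 'x) ring_scheme \<Rightarrow> ('r, 'r) module"
  where "ring_module R =
    \<lparr>carrier = carrier R, monoid.mult = undefined, monoid.one = undefined,
     ring.zero = \<zero>\<^bsub>R\<^esub>, ring.add = (\<oplus>\<^bsub>R\<^esub>), smult = (\<otimes>\<^bsub>R\<^esub>)\<rparr>"

text \<open>\<open>M / K\<close> for a submodule \<open>K\<close>, with the cosets of \<open>K\<close> as elements.\<close>

definition quot_mod :: "('r, 'm, 'c) module_scheme \<Rightarrow> 'm set \<Rightarrow> ('r, 'm set) module"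
  where "quot_mod M K =
    \<lparr>carrier = a_rcosets\<^bsub>M\<^esub> K, monoid.mult = undefined, monoid.one = undefined,
     ring.zero = K, ring.add = (<+>\<^bsub>M\<^esub>),
     smult = (\<lambda>r X. \<Union>x\<in>X. K +>\<^bsub>M\<^esub> (r \<odot>\<^bsub>M\<^esub> x))\<rparr>"

text \<open>The map \<open>M / K \<rightarrow> M' / K'\<close> induced by a homomorphism \<open>f : M \<rightarrow> M'\<close> with \<open>f K \<subseteq> K'\<close>: the cosets
  \<open>K' + f x\<close> coincide for all \<open>x\<close> in the given coset of \<open>K\<close>.\<close>

definition coset_map ::
    "('r, 'b, 'd) module_scheme \<Rightarrow> 'b set \<Rightarrow> ('a \<Rightarrow> 'b) \<Rightarrow> 'a set \<Rightarrow> 'b set"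
  where "coset_map M' K' f X = (\<Union>x\<in>X. K' +>\<^bsub>M'\<^esub> f x)"

definition submodule_span ::
    "('r, 'x) ring_scheme \<Rightarrow> ('r, 'm, 'c) module_scheme \<Rightarrow> 'm set \<Rightarrow> 'm set"
  where "submodule_span R M S = \<Inter>{H. submodule H R M \<and> S \<subseteq> H}"

definition finitely_generated ::
    "('r, 'x) ring_scheme \<Rightarrow> ('r, 'm, 'c) module_scheme \<Rightarrow> bool"
  where "finitely_generated R M \<longleftrightarrow>
    (\<exists>S. finite S \<and> S \<subseteq> carrier M \<and> submodule_span R M S = carrier M)"

definition ideal_smult ::
    "('r, 'x) ring_scheme \<Rightarrow> 'r set \<Rightarrow> ('r, 'm, 'c) module_scheme \<Rightarrow> 'm set"
  where "ideal_smult R I M = submodule_span R M {a \<odot>\<^bsub>M\<^esub> x | a x. a \<in> I \<and> x \<in> carrier M}"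

primrec ideal_pow :: "('r, 'x) ring_scheme \<Rightarrow> 'r set \<Rightarrow> nat \<Rightarrow> 'r set"
  where
    "ideal_pow R I 0 = carrier R"
  | "ideal_pow R I (Suc s) = ideal_prod R I (ideal_pow R I s)"

text \<open>The inverse system \<open>N / I\<^sup>s N\<close>, with its canonical projections
  \<open>N / I\<^sup>s\<^sup>+\<^sup>1 N \<rightarrow> N / I\<^sup>s N\<close>.\<close>

definition adic_quot ::
    "('r, 'x) ring_scheme \<Rightarrow> 'r set \<Rightarrow> ('r, 'n, 'c) module_scheme \<Rightarrow> nat \<Rightarrow> ('r, 'n set) module"
  where "adic_quot R I N s = quot_mod N (ideal_smult R (ideal_pow R I s) N)"

definition adic_proj ::
    "('r, 'x) ring_scheme \<Rightarrow> 'r set \<Rightarrow> ('r, 'n, 'c) module_scheme \<Rightarrow> nat \<Rightarrow> 'n set \<Rightarrow> 'n set"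
  where "adic_proj R I N s = coset_map N (ideal_smult R (ideal_pow R I s) N) (\<lambda>x. x)"

text \<open>Homology \<open>ker g / im f\<close> at the middle term of \<open>A \<rightarrow> B \<rightarrow> C\<close> (maps \<open>f\<close> and \<open>g\<close>).\<close>

definition homology ::
    "('r, 'a, 'c) module_scheme \<Rightarrow> ('a \<Rightarrow> 'b) \<Rightarrow> ('r, 'b, 'd) module_scheme \<Rightarrow> ('b \<Rightarrow> 'e)
      \<Rightarrow> ('r, 'e, 'f) module_scheme \<Rightarrow> ('r, 'b set) module"
  where "homology A f B g C = quot_mod (B\<lparr>carrier := a_kernel B C g\<rparr>) (f ` carrier A)"


section \<open>Hom modules, free modules and tensor products\<close>

definition Hom_mod ::
    "('r, 'x) ring_scheme \<Rightarrow> ('r, 'a, 'c) module_scheme \<Rightarrow> ('r, 'b, 'd) module_scheme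
      \<Rightarrow> ('r, 'a \<Rightarrow> 'b) module"
  where "Hom_mod R A B =
    \<lparr>carrier = mod_hom R A B \<inter> extensional (carrier A), monoid.mult = undefined, monoid.one = undefined,
     ring.zero = (\<lambda>x\<in>carrier A. \<zero>\<^bsub>B\<^esub>),
     ring.add = (\<lambda>f g. \<lambda>x\<in>carrier A. f x \<oplus>\<^bsub>B\<^esub> g x),
     smult = (\<lambda>r f. \<lambda>x\<in>carrier A. r \<odot>\<^bsub>B\<^esub> f x)\<rparr>"

text \<open>\<open>Hom(h, X) : Hom(A, X) \<rightarrow> Hom(A', X)\<close> for \<open>h : A' \<rightarrow> A\<close>.\<close>

definition precomp :: "('r, 'a, 'c) module_scheme \<Rightarrow> ('a \<Rightarrow> 'b) \<Rightarrow> ('b \<Rightarrow> 'e) \<Rightarrow> 'a \<Rightarrow> 'e"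
  where "precomp A' h u = (\<lambda>x\<in>carrier A'. u (h x))"

text \<open>The free module on a set \<open>S\<close>, as finitely supported functions; basis vectors are
  \<open>free_unit R s\<close>.\<close>

definition free_module :: "('r, 'x) ring_scheme \<Rightarrow> 's set \<Rightarrow> ('r, 's \<Rightarrow> 'r) module"
  where "free_module R S =
    \<lparr>carrier = {\<phi>. range \<phi> \<subseteq> carrier R \<and> {s. \<phi> s \<noteq> \<zero>\<^bsub>R\<^esub>} \<subseteq> S \<and> finite {s. \<phi> s \<noteq> \<zero>\<^bsub>R\<^esub>}},
     monoid.mult = undefined, monoid.one = undefined,
     ring.zero = (\<lambda>s. \<zero>\<^bsub>R\<^esub>),
     ring.add = (\<lambda>\<phi> \<psi> s. \<phi> s \<oplus>\<^bsub>R\<^esub> \<psi> s),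
     smult = (\<lambda>r \<phi> s. r \<otimes>\<^bsub>R\<^esub> \<phi> s)\<rparr>"

definition free_unit :: "('r, 'x) ring_scheme \<Rightarrow> 's \<Rightarrow> 's \<Rightarrow> 'r"
  where "free_unit R s = (\<lambda>t. if t = s then \<one>\<^bsub>R\<^esub> else \<zero>\<^bsub>R\<^esub>)"

text \<open>Linear extension to a free module of a map \<open>f\<close> given on the basis.\<close>

definition free_lift ::
    "('r, 'x) ring_scheme \<Rightarrow> ('r, 'm, 'c) module_scheme \<Rightarrow> ('s \<Rightarrow> 'm) \<Rightarrow> ('s \<Rightarrow> 'r) \<Rightarrow> 'm"
  where "free_lift R M f \<phi> = (\<Oplus>\<^bsub>M\<^esub>s\<in>{s. \<phi> s \<noteq> \<zero>\<^bsub>R\<^esub>}. \<phi> s \<odot>\<^bsub>M\<^esub> f s)"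

text \<open>The linear map between free modules sending the basis vector of \<open>s\<close> to that of \<open>h s\<close>.\<close>

definition free_push :: "('r, 'x) ring_scheme \<Rightarrow> ('s \<Rightarrow> 't) \<Rightarrow> ('s \<Rightarrow> 'r) \<Rightarrow> 't \<Rightarrow> 'r"
  where "free_push R h \<phi> = (\<lambda>t. \<Oplus>\<^bsub>R\<^esub>s\<in>{s. h s = t \<and> \<phi> s \<noteq> \<zero>\<^bsub>R\<^esub>}. \<phi> s)"

definition tensor_rels ::
    "('r, 'x) ring_scheme \<Rightarrow> ('r, 'a, 'c) module_scheme \<Rightarrow> ('r, 'b, 'd) module_scheme
      \<Rightarrow> ('a \<times> 'b \<Rightarrow> 'r) set"
  where "tensor_rels R A B =
    (let F = free_module R (carrier A \<times> carrier B); e = free_unit R in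
     submodule_span R F
      ({e (a \<oplus>\<^bsub>A\<^esub> a', b) \<ominus>\<^bsub>F\<^esub> (e (a, b) \<oplus>\<^bsub>F\<^esub> e (a', b)) | a a' b.
          a \<in> carrier A \<and> a' \<in> carrier A \<and> b \<in> carrier B} \<union>
       {e (a, b \<oplus>\<^bsub>B\<^esub> b') \<ominus>\<^bsub>F\<^esub> (e (a, b) \<oplus>\<^bsub>F\<^esub> e (a, b')) | a b b'.
          a \<in> carrier A \<and> b \<in> carrier B \<and> b' \<in> carrier B} \<union>
       {e (r \<odot>\<^bsub>A\<^esub> a, b) \<ominus>\<^bsub>F\<^esub> r \<odot>\<^bsub>F\<^esub> e (a, b) | r a b.
          r \<in> carrier R \<and> a \<in> carrier A \<and> b \<in> carrier B} \<union>
       {e (a, r \<odot>\<^bsub>B\<^esub> b) \<ominus>\<^bsub>F\<^esub> r \<odot>\<^bsub>F\<^esub> e (a, b) | r a b.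
          r \<in> carrier R \<and> a \<in> carrier A \<and> b \<in> carrier B}))"

definition tensor ::
    "('r, 'x) ring_scheme \<Rightarrow> ('r, 'a, 'c) module_scheme \<Rightarrow> ('r, 'b, 'd) module_scheme
      \<Rightarrow> ('r, ('a \<times> 'b \<Rightarrow> 'r) set) module"
  where "tensor R A B = quot_mod (free_module R (carrier A \<times> carrier B)) (tensor_rels R A B)"

text \<open>\<open>f \<otimes> g : A \<otimes> B \<rightarrow> A' \<otimes> B'\<close>; only the target modules are needed as arguments.\<close>

definition tensor_map ::
    "('r, 'x) ring_scheme \<Rightarrow> ('r, 'a, 'c) module_scheme \<Rightarrow> ('r, 'b, 'd) module_scheme
      \<Rightarrow> ('e \<Rightarrow> 'a) \<Rightarrow> ('f \<Rightarrow> 'b) \<Rightarrow> ('e \<times> 'f \<Rightarrow> 'r) set \<Rightarrow> ('a \<times> 'b \<Rightarrow> 'r) set"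
  where "tensor_map R A' B' f g =
    coset_map (free_module R (carrier A' \<times> carrier B')) (tensor_rels R A' B')
      (free_push R (map_prod f g))"


section \<open>Sequential limits\<close>

text \<open>Direct limit of \<open>A 0 \<rightarrow> A 1 \<rightarrow> \<dots>\<close> with maps \<open>f s : A s \<rightarrow> A (s + 1)\<close>: classes of pairs
  \<open>(s, x)\<close>, \<open>x \<in> A s\<close>, where two pairs are identified if they agree at some later stage.\<close>

primrec dir_trans :: "(nat \<Rightarrow> 'a \<Rightarrow> 'a) \<Rightarrow> nat \<Rightarrow> nat \<Rightarrow> 'a \<Rightarrow> 'a"
  where
    "dir_trans f s 0 x = x"
  | "dir_trans f s (Suc k) x = f (s + k) (dir_trans f s k x)"

definition dir_class ::
    "(nat \<Rightarrow> ('r, 'a, 'c) module_scheme) \<Rightarrow> (nat \<Rightarrow> 'a \<Rightarrow> 'a) \<Rightarrow> nat \<times> 'a \<Rightarrow> (nat \<times> 'a) set"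
  where "dir_class A f = (\<lambda>(s, x).
    {(t, y). y \<in> carrier (A t) \<and> (\<exists>k l. s + k = t + l \<and> dir_trans f s k x = dir_trans f t l y)})"

definition dir_lim ::
    "(nat \<Rightarrow> ('r, 'a, 'c) module_scheme) \<Rightarrow> (nat \<Rightarrow> 'a \<Rightarrow> 'a) \<Rightarrow> ('r, (nat \<times> 'a) set) module"
  where "dir_lim A f =
    \<lparr>carrier = {dir_class A f (s, x) | s x. x \<in> carrier (A s)},
     monoid.mult = undefined, monoid.one = undefined,
     ring.zero = dir_class A f (0, \<zero>\<^bsub>A 0\<^esub>),
     ring.add = (\<lambda>c c'. \<Union>{dir_class A f (s, x \<oplus>\<^bsub>A s\<^esub> y) | s x y. (s, x) \<in> c \<and> (s, y) \<in> c'}),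
     smult = (\<lambda>r c. \<Union>{dir_class A f (s, r \<odot>\<^bsub>A s\<^esub> x) | s x. (s, x) \<in> c})\<rparr>"

text \<open>Inverse limit of \<open>\<dots> \<rightarrow> A 1 \<rightarrow> A 0\<close> with maps \<open>f s : A (s + 1) \<rightarrow> A s\<close>.\<close>

definition inv_lim ::
    "(nat \<Rightarrow> ('r, 'a, 'c) module_scheme) \<Rightarrow> (nat \<Rightarrow> 'a \<Rightarrow> 'a) \<Rightarrow> ('r, nat \<Rightarrow> 'a) module"
  where "inv_lim A f =
    \<lparr>carrier = {x. (\<forall>s. x s \<in> carrier (A s)) \<and> (\<forall>s. f s (x (Suc s)) = x s)},
     monoid.mult = undefined, monoid.one = undefined,
     ring.zero = (\<lambda>s. \<zero>\<^bsub>A s\<^esub>),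
     ring.add = (\<lambda>x y s. x s \<oplus>\<^bsub>A s\<^esub> y s),
     smult = (\<lambda>r x s. r \<odot>\<^bsub>A s\<^esub> x s)\<rparr>"


section \<open>The canonical free resolution\<close>

text \<open>Functorial free resolution \<open>P\<close> of a module \<open>X\<close>: \<open>P 0\<close> is free on the elements of \<open>X\<close>, and
  \<open>P (n + 1)\<close> is free on names for the elements of the kernel of \<open>P n \<rightarrow> P (n - 1)\<close> (for \<open>n = 0\<close>:
  of the augmentation \<open>P 0 \<rightarrow> X\<close>).  The element named by \<open>Syz l\<close> is the linear combination of basis
  vectors listed in \<open>l\<close>; naming it by a list instead of using the element itself keeps all
  \<open>P n\<close> in one type, and one element having several names is harmless.\<close>

datatype ('r, 'a) gen = Gen 'a | Syz "('r \<times> ('r, 'a) gen) list"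

definition syz_elem :: "('r, 'x) ring_scheme \<Rightarrow> ('r \<times> 's) list \<Rightarrow> 's \<Rightarrow> 'r"
  where "syz_elem R l =
    foldr (\<lambda>(r, s) \<phi>. r \<odot>\<^bsub>free_module R UNIV\<^esub> free_unit R s \<oplus>\<^bsub>free_module R UNIV\<^esub> \<phi>) l
      \<zero>\<^bsub>free_module R UNIV\<^esub>"

definition res_aug ::
    "('r, 'x) ring_scheme \<Rightarrow> ('r, 'a, 'c) module_scheme \<Rightarrow> (('r, 'a) gen \<Rightarrow> 'r) \<Rightarrow> 'a"
  where "res_aug R X = free_lift R X (\<lambda>g. case g of Gen x \<Rightarrow> x | Syz l \<Rightarrow> \<zero>\<^bsub>X\<^esub>)"

definition res_diff :: "('r, 'x) ring_scheme \<Rightarrow> (('r, 'a) gen \<Rightarrow> 'r) \<Rightarrow> ('r, 'a) gen \<Rightarrow> 'r"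
  where "res_diff R = free_lift R (free_module R UNIV)
    (\<lambda>g. case g of Gen x \<Rightarrow> \<zero>\<^bsub>free_module R UNIV\<^esub> | Syz l \<Rightarrow> syz_elem R l)"

primrec res_gens ::
    "('r, 'x) ring_scheme \<Rightarrow> ('r, 'a, 'c) module_scheme \<Rightarrow> nat \<Rightarrow> ('r, 'a) gen set"
  where
    "res_gens R X 0 = Gen ` carrier X"
  | "res_gens R X (Suc n) =
      {Syz l | l. set l \<subseteq> carrier R \<times> res_gens R X n \<and>
        (if n = 0 then res_aug R X (syz_elem R l) = \<zero>\<^bsub>X\<^esub>
         else res_diff R (syz_elem R l) = \<zero>\<^bsub>free_module R UNIV\<^esub>)}"

definition free_res ::
    "('r, 'x) ring_scheme \<Rightarrow> ('r, 'a, 'c) module_scheme \<Rightarrow> int \<Rightarrow> ('r, ('r, 'a) gen \<Rightarrow> 'r) module"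
  where "free_res R X n = free_module R (if n < 0 then {} else res_gens R X (nat n))"

text \<open>The chain map of resolutions induced by \<open>h : X \<rightarrow> X'\<close>.\<close>

definition res_map ::
    "('r, 'x) ring_scheme \<Rightarrow> ('a \<Rightarrow> 'b) \<Rightarrow> (('r, 'a) gen \<Rightarrow> 'r) \<Rightarrow> ('r, 'b) gen \<Rightarrow> 'r"
  where "res_map R h = free_push R (map_gen (\<lambda>r. r) h)"


section \<open>Ext, Tor and local cohomology\<close>

text \<open>All functors are indexed by \<open>int\<close>; they vanish in negative degrees because \<open>free_res\<close> does.\<close>

definition Ext_cobound ::
    "('r, 'x) ring_scheme \<Rightarrow> ('r, 'a, 'c) module_scheme \<Rightarrow> int
      \<Rightarrow> ((('r, 'a) gen \<Rightarrow> 'r) \<Rightarrow> 'b) \<Rightarrow> (('r, 'a) gen \<Rightarrow> 'r) \<Rightarrow> 'b"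
  where "Ext_cobound R A n = precomp (free_res R A (n + 1)) (res_diff R)"

definition Ext ::
    "('r, 'x) ring_scheme \<Rightarrow> ('r, 'a, 'c) module_scheme \<Rightarrow> ('r, 'b, 'd) module_scheme \<Rightarrow> int
      \<Rightarrow> ('r, ((('r, 'a) gen \<Rightarrow> 'r) \<Rightarrow> 'b) set) module"
  where "Ext R A X n =
    homology (Hom_mod R (free_res R A (n - 1)) X) (Ext_cobound R A (n - 1))
      (Hom_mod R (free_res R A n) X) (Ext_cobound R A n)
      (Hom_mod R (free_res R A (n + 1)) X)"

text \<open>\<open>Ext(A, X) \<rightarrow> Ext(A', X)\<close> for \<open>h : A' \<rightarrow> A\<close>.\<close>

definition Ext_map ::
    "('r, 'x) ring_scheme \<Rightarrow> ('r, 'a, 'c) module_scheme \<Rightarrow> ('a \<Rightarrow> 'e) \<Rightarrow> ('r, 'b, 'd) module_scheme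
      \<Rightarrow> int \<Rightarrow> ((('r, 'e) gen \<Rightarrow> 'r) \<Rightarrow> 'b) set \<Rightarrow> ((('r, 'a) gen \<Rightarrow> 'r) \<Rightarrow> 'b) set"
  where "Ext_map R A' h X n =
    coset_map (Hom_mod R (free_res R A' n) X)
      (Ext_cobound R A' (n - 1) ` carrier (Hom_mod R (free_res R A' (n - 1)) X))
      (precomp (free_res R A' n) (res_map R h))"

definition Tor ::
    "('r, 'x) ring_scheme \<Rightarrow> ('r, 'a, 'c) module_scheme \<Rightarrow> ('r, 'b, 'd) module_scheme \<Rightarrow> int
      \<Rightarrow> ('r, ('a \<times> (('r, 'b) gen \<Rightarrow> 'r) \<Rightarrow> 'r) set set) module"
  where "Tor R A X n =
    homology (tensor R A (free_res R X (n + 1)))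
      (tensor_map R A (free_res R X n) (\<lambda>a. a) (res_diff R))
      (tensor R A (free_res R X n))
      (tensor_map R A (free_res R X (n - 1)) (\<lambda>a. a) (res_diff R))
      (tensor R A (free_res R X (n - 1)))"

text \<open>\<open>Tor(A, X) \<rightarrow> Tor(A', X)\<close> for \<open>h : A \<rightarrow> A'\<close>.\<close>

definition Tor_map ::
    "('r, 'x) ring_scheme \<Rightarrow> ('r, 'e, 'c) module_scheme \<Rightarrow> ('a \<Rightarrow> 'e) \<Rightarrow> ('r, 'b, 'd) module_scheme
      \<Rightarrow> int \<Rightarrow> ('a \<times> (('r, 'b) gen \<Rightarrow> 'r) \<Rightarrow> 'r) set set
      \<Rightarrow> ('e \<times> (('r, 'b) gen \<Rightarrow> 'r) \<Rightarrow> 'r) set set"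
  where "Tor_map R A' h X n =
    coset_map (tensor R A' (free_res R X n))
      (tensor_map R A' (free_res R X n) (\<lambda>a. a) (res_diff R)
        ` carrier (tensor R A' (free_res R X (n + 1))))
      (tensor_map R A' (free_res R X n) h (\<lambda>p. p))"

text \<open>\<open>H\<^sup>n\<^sub>I(N, X)\<close>, the direct limit of \<open>Ext\<^sup>n(N / I\<^sup>s N, X)\<close>.\<close>

definition gen_local_cohomology ::
    "('r, 'x) ring_scheme \<Rightarrow> 'r set \<Rightarrow> ('r, 'n, 'c) module_scheme \<Rightarrow> ('r, 'm, 'd) module_scheme \<Rightarrow> int
      \<Rightarrow> ('r, (nat \<times> ((('r, 'n set) gen \<Rightarrow> 'r) \<Rightarrow> 'm) set) set) module"
  where "gen_local_cohomology R I N X n =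
    dir_lim (\<lambda>s. Ext R (adic_quot R I N s) X n)
      (\<lambda>s. Ext_map R (adic_quot R I N (Suc s)) (adic_proj R I N s) X n)"

text \<open>\<open>H\<^sup>n\<^sub>I(X)\<close>, the direct limit of \<open>Ext\<^sup>n(R / I\<^sup>s, X)\<close>; over a Noetherian ring this is
  the \<open>n\<close>-th right derived functor of the \<open>I\<close>-torsion functor.\<close>

definition local_cohomology ::
    "('r, 'x) ring_scheme \<Rightarrow> 'r set \<Rightarrow> ('r, 'm, 'd) module_scheme \<Rightarrow> int
      \<Rightarrow> ('r, (nat \<times> ((('r, 'r set) gen \<Rightarrow> 'r) \<Rightarrow> 'm) set) set) module"
  where "local_cohomology R I X n = gen_local_cohomology R I (ring_module R) X n"

text \<open>Over a Noetherian ring the set is nonempty (and bounded below by \<open>0\<close>) whenever \<open>IM \<noteq> M\<close>,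
  the only case in which the grade is used.\<close>

definition grade :: "('r, 'x) ring_scheme \<Rightarrow> 'r set \<Rightarrow> ('r, 'm, 'd) module_scheme \<Rightarrow> int"
  where "grade R I M = Inf {i. \<not> is_zero (local_cohomology R I M i)}"

text \<open>\<open>U\<^sub>n(N, X)\<close>, the inverse limit of \<open>Tor\<^sub>n(N / I\<^sup>s N, X)\<close>.\<close>

definition Tor_lim ::
    "('r, 'x) ring_scheme \<Rightarrow> 'r set \<Rightarrow> ('r, 'n, 'c) module_scheme \<Rightarrow> ('r, 'm, 'd) module_scheme \<Rightarrow> int
      \<Rightarrow> ('r, nat \<Rightarrow> ('n set \<times> (('r, 'm) gen \<Rightarrow> 'r) \<Rightarrow> 'r) set set) module"
  where "Tor_lim R I N X n =
    inv_lim (\<lambda>s. Tor R (adic_quot R I N s) X n)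
      (\<lambda>s. Tor_map R (adic_quot R I N s) (adic_proj R I N s) X n)"


section \<open>Flat resolutions and left derived completion\<close>

text \<open>HOL cannot quantify over all modules of all types inside a definition.  The test modules
  in the next definition (and in that of injective modules below) have elements in the type of
  subsets of \<open>R\<^sup>\<nat>\<close>; up to isomorphism these include all quotients of submodules of the free module
  on \<open>nat\<close>, in particular all finitely generated modules and their submodules.  Flatness and
  (by Baer's criterion) injectivity against these imply the properties without size restriction.\<close>

definition flat_module :: "('r, 'x) ring_scheme \<Rightarrow> ('r, 'm, 'd) module_scheme \<Rightarrow> bool"
  where "flat_module R F \<longleftrightarrow> module R F \<and>
    (\<forall>(A :: ('r, (nat \<Rightarrow> 'r) set) module) (B :: ('r, (nat \<Rightarrow> 'r) set) module) f.
       module R A \<and> module R B \<and> f \<in> mod_hom R A B \<and> inj_on f (carrier A) \<longrightarrow>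
       inj_on (tensor_map R B F f (\<lambda>x. x)) (carrier (tensor R A F)))"

text \<open>\<open>\<dots> \<rightarrow> F 1 \<rightarrow> F 0 \<rightarrow> X \<rightarrow> 0\<close> exact with all \<open>F n\<close> flat; the differential is
  \<open>d n : F n \<rightarrow> F (n - 1)\<close>, the augmentation is \<open>\<epsilon>\<close>, and \<open>F n = 0\<close> for \<open>n < 0\<close>.\<close>

definition flat_resolution ::
    "('r, 'x) ring_scheme \<Rightarrow> ('r, 'm, 'c) module_scheme \<Rightarrow> (int \<Rightarrow> ('r, 'f, 'd) module_scheme)
      \<Rightarrow> (int \<Rightarrow> 'f \<Rightarrow> 'f) \<Rightarrow> ('f \<Rightarrow> 'm) \<Rightarrow> bool"
  where "flat_resolution R X F d \<epsilon> \<longleftrightarrow>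
    (\<forall>n. flat_module R (F n)) \<and>
    (\<forall>n<0. is_zero (F n)) \<and>
    (\<forall>n. d n \<in> mod_hom R (F n) (F (n - 1))) \<and>
    (\<forall>n>0. d (n + 1) ` carrier (F (n + 1)) = a_kernel (F n) (F (n - 1)) (d n)) \<and>
    \<epsilon> \<in> mod_hom R (F 0) X \<and>
    d 1 ` carrier (F 1) = a_kernel (F 0) X \<epsilon> \<and>
    \<epsilon> ` carrier (F 0) = carrier X"

text \<open>The complex \<open>lim (N / I\<^sup>s N \<otimes> F)\<close> and its homology \<open>L\<^sub>n\<Lambda>(N, X)\<close>, where \<open>F\<close> (with
  differential \<open>d\<close>) is a flat resolution of \<open>X\<close>.\<close>

definition completion_complex ::
    "('r, 'x) ring_scheme \<Rightarrow> 'r set \<Rightarrow> ('r, 'n, 'c) module_scheme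
      \<Rightarrow> (int \<Rightarrow> ('r, 'f, 'd) module_scheme) \<Rightarrow> int
      \<Rightarrow> ('r, nat \<Rightarrow> ('n set \<times> 'f \<Rightarrow> 'r) set) module"
  where "completion_complex R I N F n =
    inv_lim (\<lambda>s. tensor R (adic_quot R I N s) (F n))
      (\<lambda>s. tensor_map R (adic_quot R I N s) (F n) (adic_proj R I N s) (\<lambda>x. x))"

definition completion_diff ::
    "('r, 'x) ring_scheme \<Rightarrow> 'r set \<Rightarrow> ('r, 'n, 'c) module_scheme
      \<Rightarrow> (int \<Rightarrow> ('r, 'f, 'd) module_scheme) \<Rightarrow> (int \<Rightarrow> 'f \<Rightarrow> 'f) \<Rightarrow> int
      \<Rightarrow> (nat \<Rightarrow> ('n set \<times> 'f \<Rightarrow> 'r) set) \<Rightarrow> nat \<Rightarrow> ('n set \<times> 'f \<Rightarrow> 'r) set"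
  where "completion_diff R I N F d n x =
    (\<lambda>s. tensor_map R (adic_quot R I N s) (F (n - 1)) (\<lambda>a. a) (d n) (x s))"

definition left_derived_completion ::
    "('r, 'x) ring_scheme \<Rightarrow> 'r set \<Rightarrow> ('r, 'n, 'c) module_scheme
      \<Rightarrow> (int \<Rightarrow> ('r, 'f, 'd) module_scheme) \<Rightarrow> (int \<Rightarrow> 'f \<Rightarrow> 'f) \<Rightarrow> int
      \<Rightarrow> ('r, (nat \<Rightarrow> ('n set \<times> 'f \<Rightarrow> 'r) set) set) module"
  where "left_derived_completion R I N F d n =
    homology (completion_complex R I N F (n + 1)) (completion_diff R I N F d (n + 1))
      (completion_complex R I N F n) (completion_diff R I N F d n)
      (completion_complex R I N F (n - 1))"


section \<open>Local rings and Matlis duality\<close>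

definition noetherian_local_ring :: "('r, 'x) ring_scheme \<Rightarrow> bool"
  where "noetherian_local_ring R \<longleftrightarrow>
    cring R \<and> noetherian_ring R \<and> (\<exists>!\<mm>. maximalideal \<mm> R)"

text \<open>The residue field as an \<open>R\<close>-module.\<close>

definition residue_module :: "('r, 'x) ring_scheme \<Rightarrow> ('r, 'r set) module"
  where "residue_module R = quot_mod (ring_module R) (THE \<mm>. maximalideal \<mm> R)"

definition injective_module :: "('r, 'x) ring_scheme \<Rightarrow> ('r, 'm, 'd) module_scheme \<Rightarrow> bool"
  where "injective_module R E \<longleftrightarrow> module R E \<and>
    (\<forall>(A :: ('r, (nat \<Rightarrow> 'r) set) module) (B :: ('r, (nat \<Rightarrow> 'r) set) module) f g.
       module R A \<and> module R B \<and> f \<in> mod_hom R A B \<and> inj_on f (carrier A) \<and> g \<in> mod_hom R A E \<longrightarrow>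
       (\<exists>h\<in>mod_hom R B E. \<forall>x\<in>carrier A. h (f x) = g x))"

text \<open>\<open>\<iota> : X \<rightarrow> E\<close> is an essential embedding into an injective module.\<close>

definition injective_hull ::
    "('r, 'x) ring_scheme \<Rightarrow> ('r, 'm, 'c) module_scheme \<Rightarrow> ('r, 'e, 'd) module_scheme
      \<Rightarrow> ('m \<Rightarrow> 'e) \<Rightarrow> bool"
  where "injective_hull R X E \<iota> \<longleftrightarrow>
    injective_module R E \<and> \<iota> \<in> mod_hom R X E \<and> inj_on \<iota> (carrier X) \<and>
    (\<forall>H. submodule H R E \<and> H \<noteq> {\<zero>\<^bsub>E\<^esub>} \<longrightarrow> H \<inter> \<iota> ` carrier X \<noteq> {\<zero>\<^bsub>E\<^esub>})"

text \<open>The Matlis dual, relative to an injective hull \<open>E\<close> of the residue field.\<close>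

definition matlis_dual ::
    "('r, 'x) ring_scheme \<Rightarrow> ('r, 'e, 'd) module_scheme \<Rightarrow> ('r, 'm, 'c) module_scheme
      \<Rightarrow> ('r, 'm \<Rightarrow> 'e) module"
  where "matlis_dual R E X = Hom_mod R X E"

definition cohomologically_complete_intersection ::
    "('r, 'x) ring_scheme \<Rightarrow> 'r set \<Rightarrow> ('r, 'n, 'c) module_scheme \<Rightarrow> ('r, 'm, 'd) module_scheme \<Rightarrow> bool"
  where "cohomologically_complete_intersection R I N M \<longleftrightarrow>
    (\<forall>i. i \<noteq> grade R I M \<longrightarrow> is_zero (gen_local_cohomology R I N M i))"

end

theory Submission
  imports Defs
begin


text \<open>
  Write \<open>D = Hom(-, E)\<close> for the Matlis dual, \<open>X = D(M)\<close> and \<open>A\<^sub>s = N / I\<^sup>s N\<close>.  The three conditions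
  are equivalent degree by degree: for each \<open>i\<close>, the modules \<open>H\<^sup>i\<^sub>I(N, M)\<close>, \<open>U\<^sub>i(N, X)\<close> and
  \<open>L\<^sub>i\<Lambda>(N, X)\<close> are zero or nonzero together.

  Since \<open>E\<close> is injective and \<open>A\<^sub>s\<close> is finitely generated over a Noetherian ring, there is a natural
  isomorphism between \<open>Tor\<^sub>i(A\<^sub>s, D(M))\<close> and \<open>D(Ext\<^sup>i(A\<^sub>s, M))\<close>.  As \<open>D\<close> turns direct limits into
  inverse limits, \<open>U\<^sub>i(N, X)\<close> is \<open>D(H\<^sup>i\<^sub>I(N, M))\<close>, and \<open>D\<close> kills only the zero module because \<open>E\<close>
  contains the residue field of the local ring (\<open>matlis_separates\<close>).  Moreover the first derived
  limit of the tower \<open>Tor\<^sub>i\<^sub>+\<^sub>1(A\<^sub>s, X)\<close> vanishes, because the tower is dual to a direct system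
  (\<open>tower_lim1_zero\<close>); by the argument behind Milnor's exact sequence (\<open>homology_lim_zero_iff\<close>) the
  homology of \<open>lim (A\<^sub>s \<otimes> F)\<close>, which is \<open>L\<^sub>i\<Lambda>(N, X)\<close>, vanishes if and only if the limit of the
  homology modules \<open>Tor\<^sub>i(A\<^sub>s, X)\<close> does.

  The isomorphism is set up as a pairing.  A cocycle of \<open>Hom(P(A), M)\<close>, for \<open>P(A)\<close> the canonical
  resolution of \<open>A\<close>, evaluates cycles of \<open>P(A) \<otimes> X\<close> to elements of \<open>E\<close>.  The modules in \<open>P(A)\<close> have
  infinite rank in general, so evaluation is not perfect on the nose; but for finitely generated \<open>A\<close> the
  identity of \<open>P(A)\<close> is homotopic to an endomorphism of finite rank in each degree
  (\<open>finite_rank_homotopy\<close>), which makes it perfect on homology (\<open>perfect_detect\<close>,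
  \<open>perfect_represent\<close>).  The homology of \<open>A \<otimes> F\<close>, where \<open>X\<close> is resolved instead of \<open>A\<close>, is compared
  with that of \<open>P(A) \<otimes> X\<close> by staircases in the double complex \<open>P(A) \<otimes> F\<close>
  (\<open>stair_boundary_iff\<close>).  The rows and columns of the latter are exact because every
  \<open>Hom(F\<^sub>q, E)\<close> and \<open>Hom(P\<^sub>p, E)\<close> satisfies Baer's criterion: functionals on a tensor product
  then extend, and there are enough functionals to detect exactness (\<open>tensor_exact_left\<close>).  The
  same argument covers the canonical resolution of \<open>X\<close>, which defines \<open>Tor\<close>, and an arbitrary flat
  resolution.
\<close>

section \<open>Homomorphisms, submodules and quotients\<close>

lemma mod_homI:
  assumes "\<And>x. x \<in> carrier A \<Longrightarrow> f x \<in> carrier B"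
    and "\<And>x y. \<lbrakk>x \<in> carrier A; y \<in> carrier A\<rbrakk> \<Longrightarrow> f (x \<oplus>\<^bsub>A\<^esub> y) = f x \<oplus>\<^bsub>B\<^esub> f y"
    and "\<And>r x. \<lbrakk>r \<in> carrier R; x \<in> carrier A\<rbrakk> \<Longrightarrow> f (r \<odot>\<^bsub>A\<^esub> x) = r \<odot>\<^bsub>B\<^esub> f x"
  shows "f \<in> mod_hom R A B"
  using assms unfolding mod_hom_def by auto

lemma mod_hom_closed: "\<lbrakk>f \<in> mod_hom R A B; x \<in> carrier A\<rbrakk> \<Longrightarrow> f x \<in> carrier B"
  unfolding mod_hom_def by auto

lemma mod_hom_add:
  "\<lbrakk>f \<in> mod_hom R A B; x \<in> carrier A; y \<in> carrier A\<rbrakk> \<Longrightarrow> f (x \<oplus>\<^bsub>A\<^esub> y) = f x \<oplus>\<^bsub>B\<^esub> f y"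
  unfolding mod_hom_def by auto

lemma mod_hom_smult:
  "\<lbrakk>f \<in> mod_hom R A B; r \<in> carrier R; x \<in> carrier A\<rbrakk> \<Longrightarrow> f (r \<odot>\<^bsub>A\<^esub> x) = r \<odot>\<^bsub>B\<^esub> f x"
  unfolding mod_hom_def by auto

lemma module_add_closed: "\<lbrakk>module R A; x \<in> carrier A; y \<in> carrier A\<rbrakk> \<Longrightarrow> x \<oplus>\<^bsub>A\<^esub> y \<in> carrier A"
  by (simp add: abelian_monoid.a_closed module.axioms abelian_group.axioms(1))
lemma module_neg_closed: "\<lbrakk>module R A; x \<in> carrier A\<rbrakk> \<Longrightarrow> \<ominus>\<^bsub>A\<^esub> x \<in> carrier A"
  by (simp add: abelian_group.a_inv_closed module.axioms)
lemma module_minus_closed: "\<lbrakk>module R A; x \<in> carrier A; y \<in> carrier A\<rbrakk> \<Longrightarrow> x \<ominus>\<^bsub>A\<^esub> y \<in> carrier A"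
  by (simp add: a_minus_def module_add_closed module_neg_closed)
lemma module_zero_closed: "module R A \<Longrightarrow> \<zero>\<^bsub>A\<^esub> \<in> carrier A"
  by (simp add: abelian_monoid.zero_closed module.axioms abelian_group.axioms(1))
lemma module_smult_closed: "\<lbrakk>module R A; r \<in> carrier R; x \<in> carrier A\<rbrakk> \<Longrightarrow> r \<odot>\<^bsub>A\<^esub> x \<in> carrier A"
  by (rule module.smult_closed)
lemma module_cring: "module R A \<Longrightarrow> cring R"
  by (rule module.axioms(1))

lemmas module_closed = module_add_closed module_neg_closed module_minus_closed
  module_zero_closed module_smult_closed mod_hom_closed

lemma mod_hom_zero:
  assumes "module R A" "module R B" "f \<in> mod_hom R A B"
  shows "f \<zero>\<^bsub>A\<^esub> = \<zero>\<^bsub>B\<^esub>"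
proof -
  interpret A: module R A by fact
  interpret B: module R B by fact
  have "f \<zero>\<^bsub>A\<^esub> = f (\<zero>\<^bsub>R\<^esub> \<odot>\<^bsub>A\<^esub> \<zero>\<^bsub>A\<^esub>)" by simp
  also have "\<dots> = \<zero>\<^bsub>R\<^esub> \<odot>\<^bsub>B\<^esub> f \<zero>\<^bsub>A\<^esub>" by (rule mod_hom_smult[OF assms(3)]) auto
  also have "\<dots> = \<zero>\<^bsub>B\<^esub>" using mod_hom_closed[OF assms(3)] by simp
  finally show ?thesis .
qed

lemma module_neg_smult:
  assumes "module R A" "x \<in> carrier A"
  shows "\<ominus>\<^bsub>A\<^esub> x = (\<ominus>\<^bsub>R\<^esub> \<one>\<^bsub>R\<^esub>) \<odot>\<^bsub>A\<^esub> x"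
proof -
  interpret A: module R A by fact
  show ?thesis using A.smult_l_minus[of "\<one>\<^bsub>R\<^esub>" x] assms by simp
qed

lemma mod_hom_neg:
  assumes "module R A" "module R B" "f \<in> mod_hom R A B" "x \<in> carrier A"
  shows "f (\<ominus>\<^bsub>A\<^esub> x) = \<ominus>\<^bsub>B\<^esub> f x"
proof -
  interpret A: module R A by fact
  show ?thesis using assms mod_hom_smult[OF assms(3) _ assms(4), of "\<ominus>\<^bsub>R\<^esub> \<one>\<^bsub>R\<^esub>"]
    by (simp add: module_neg_smult[of R A] module_neg_smult[of R B] mod_hom_closed)
qed

lemma mod_hom_minus:
  assumes "module R A" "module R B" "f \<in> mod_hom R A B" "x \<in> carrier A" "y \<in> carrier A"
  shows "f (x \<ominus>\<^bsub>A\<^esub> y) = f x \<ominus>\<^bsub>B\<^esub> f y"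
  using assms by (simp add: a_minus_def mod_hom_add mod_hom_neg module_closed)

lemma mod_hom_comp: "\<lbrakk>f \<in> mod_hom R A B; g \<in> mod_hom R B C\<rbrakk> \<Longrightarrow> (\<lambda>x. g (f x)) \<in> mod_hom R A C"
  unfolding mod_hom_def by (auto simp: Pi_iff)

lemma mod_hom_id: "(\<lambda>x. x) \<in> mod_hom R A A"
  unfolding mod_hom_def by auto

lemma mod_hom_const_zero: "module R B \<Longrightarrow> (\<lambda>x. \<zero>\<^bsub>B\<^esub>) \<in> mod_hom R A B"
proof -
  assume "module R B" then interpret B: module R B .
  show ?thesis by (rule mod_homI) auto
qed

lemma mod_hom_cong:
  assumes "module R A" "f \<in> mod_hom R A B" "\<And>x. x \<in> carrier A \<Longrightarrow> g x = f x"
  shows "g \<in> mod_hom R A B"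
  using assms by (intro mod_homI) (auto simp: module_closed mod_hom_add mod_hom_smult)

lemma mod_hom_plus:
  assumes "module R B" "f \<in> mod_hom R A B" "g \<in> mod_hom R A B"
  shows "(\<lambda>x. f x \<oplus>\<^bsub>B\<^esub> g x) \<in> mod_hom R A B"
proof -
  interpret B: module R B by fact
  show ?thesis
    using assms by (intro mod_homI)
      (auto simp: mod_hom_closed mod_hom_add mod_hom_smult B.smult_r_distr B.M.a_ac)
qed

lemma mod_hom_scale:
  assumes "module R B" "f \<in> mod_hom R A B" "r \<in> carrier R"
  shows "(\<lambda>x. r \<odot>\<^bsub>B\<^esub> f x) \<in> mod_hom R A B"
proof -
  interpret B: module R B by fact
  show ?thesis
    using assms by (intro mod_homI)
      (auto simp: mod_hom_closed mod_hom_add mod_hom_smult B.smult_r_distr B.smult_assoc1[symmetric] B.R.m_comm)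
qed

lemma mod_hom_uminus:
  assumes "module R B" "f \<in> mod_hom R A B"
  shows "(\<lambda>x. \<ominus>\<^bsub>B\<^esub> f x) \<in> mod_hom R A B"
proof -
  interpret B: module R B by fact
  have *: "(\<lambda>x. (\<ominus>\<^bsub>R\<^esub> \<one>\<^bsub>R\<^esub>) \<odot>\<^bsub>B\<^esub> f x) \<in> mod_hom R A B"
    by (rule mod_hom_scale[OF assms]) simp
  show ?thesis
    using assms * by (auto simp: mod_hom_def Pi_iff module_neg_smult[OF assms(1)])
qed

lemma mod_hom_diff:
  assumes "module R B" "f \<in> mod_hom R A B" "g \<in> mod_hom R A B"
  shows "(\<lambda>x. f x \<ominus>\<^bsub>B\<^esub> g x) \<in> mod_hom R A B"
  unfolding a_minus_def by (intro mod_hom_plus mod_hom_uminus assms)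

lemma mod_hom_restrict_dom:
  assumes "f \<in> mod_hom R A B" "H \<subseteq> carrier A"
  shows "f \<in> mod_hom R (A\<lparr>carrier := H\<rparr>) B"
  using assms unfolding mod_hom_def by (auto simp: subset_iff)

lemma mod_hom_restrict_cod:
  assumes "f \<in> mod_hom R A B" "f ` carrier A \<subseteq> H"
  shows "f \<in> mod_hom R A (B\<lparr>carrier := H\<rparr>)"
  using assms unfolding mod_hom_def by auto

lemma module_minus_eq_zero_iff:
  assumes "module R A" "x \<in> carrier A" "y \<in> carrier A"
  shows "x \<ominus>\<^bsub>A\<^esub> y = \<zero>\<^bsub>A\<^esub> \<longleftrightarrow> x = y"
proof -
  interpret A: module R A by fact
  show ?thesis using assms A.M.add.inv_solve_right[of "\<zero>\<^bsub>A\<^esub>" x y] by (auto simp: a_minus_def)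
qed

lemma module_diff_eq_iff:
  assumes "module R A" "x \<in> carrier A" "y \<in> carrier A" "z \<in> carrier A"
  shows "x \<ominus>\<^bsub>A\<^esub> y = z \<longleftrightarrow> x = z \<oplus>\<^bsub>A\<^esub> y"
proof -
  interpret A: module R A by fact
  show ?thesis using assms A.M.add.inv_solve_right[of z x y] by (auto simp: a_minus_def)
qed

text \<open>Cancellation patterns that recur in diagram chases.\<close>

lemma module_add_minus_cancel:
  assumes "module R A" "x \<in> carrier A" "y \<in> carrier A"
  shows "x \<oplus>\<^bsub>A\<^esub> (y \<ominus>\<^bsub>A\<^esub> x) = y" "(y \<ominus>\<^bsub>A\<^esub> x) \<oplus>\<^bsub>A\<^esub> x = y" "(x \<oplus>\<^bsub>A\<^esub> y) \<ominus>\<^bsub>A\<^esub> x = y" "(y \<oplus>\<^bsub>A\<^esub> x) \<ominus>\<^bsub>A\<^esub> x = y"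
proof -
  interpret A: module R A by fact
  note d = module_diff_eq_iff[OF assms(1)]
  show b: "(x \<oplus>\<^bsub>A\<^esub> y) \<ominus>\<^bsub>A\<^esub> x = y"
    using assms by (subst d) (auto simp: A.M.a_comm)
  show "(y \<oplus>\<^bsub>A\<^esub> x) \<ominus>\<^bsub>A\<^esub> x = y"
    using assms by (subst d) auto
  show c: "(y \<ominus>\<^bsub>A\<^esub> x) \<oplus>\<^bsub>A\<^esub> x = y"
    using assms d[of y x "y \<ominus>\<^bsub>A\<^esub> x"] by (simp add: module_minus_closed[OF assms(1)])
  then show "x \<oplus>\<^bsub>A\<^esub> (y \<ominus>\<^bsub>A\<^esub> x) = y"
    using assms by (simp add: A.M.a_comm module_minus_closed[OF assms(1)])
qed

lemma submodule_sub: "submodule H R M \<Longrightarrow> H \<subseteq> carrier M"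
  using submodule.axioms(1) subgroup.subset by fastforce
lemma submodule_zero: "submodule H R M \<Longrightarrow> \<zero>\<^bsub>M\<^esub> \<in> H"
  using submodule.axioms(1) subgroup.one_closed by fastforce
lemma submodule_add: "\<lbrakk>submodule H R M; x \<in> H; y \<in> H\<rbrakk> \<Longrightarrow> x \<oplus>\<^bsub>M\<^esub> y \<in> H"
  using submodule.axioms(1) subgroup.m_closed by fastforce
lemma submodule_neg: "\<lbrakk>submodule H R M; x \<in> H\<rbrakk> \<Longrightarrow> \<ominus>\<^bsub>M\<^esub> x \<in> H"
  unfolding a_inv_def using submodule.axioms(1) subgroup.m_inv_closed by fastforce
lemma submodule_minus: "\<lbrakk>submodule H R M; x \<in> H; y \<in> H\<rbrakk> \<Longrightarrow> x \<ominus>\<^bsub>M\<^esub> y \<in> H"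
  unfolding a_minus_def by (intro submodule_add submodule_neg)
lemma submodule_smult: "\<lbrakk>submodule H R M; r \<in> carrier R; x \<in> H\<rbrakk> \<Longrightarrow> r \<odot>\<^bsub>M\<^esub> x \<in> H"
  by (rule submodule.smult_closed)

lemmas submodule_closed = submodule_zero submodule_add submodule_neg submodule_minus submodule_smult

lemma submodule_criterion:
  assumes "module R M" "H \<subseteq> carrier M" "\<zero>\<^bsub>M\<^esub> \<in> H"
    and "\<And>x y. \<lbrakk>x \<in> H; y \<in> H\<rbrakk> \<Longrightarrow> x \<oplus>\<^bsub>M\<^esub> y \<in> H"
    and s: "\<And>r x. \<lbrakk>r \<in> carrier R; x \<in> H\<rbrakk> \<Longrightarrow> r \<odot>\<^bsub>M\<^esub> x \<in> H"
  shows "submodule H R M"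
proof -
  interpret M: module R M by fact
  have "\<ominus>\<^bsub>M\<^esub> x \<in> H" if "x \<in> H" for x
    using s[OF _ that, of "\<ominus>\<^bsub>R\<^esub> \<one>\<^bsub>R\<^esub>"] module_neg_smult[OF assms(1)] that assms(2) by auto
  then show ?thesis using assms by (intro M.submoduleI) auto
qed

lemma submodule_module: "\<lbrakk>module R M; submodule H R M\<rbrakk> \<Longrightarrow> module R (M\<lparr>carrier := H\<rparr>)"
  by (rule submodule.submodule_is_module)

lemma submodule_neg_eq:
  assumes "module R M" "submodule H R M" "x \<in> H"
  shows "\<ominus>\<^bsub>M\<lparr>carrier := H\<rparr>\<^esub> x = \<ominus>\<^bsub>M\<^esub> x"
  using assms module_neg_smult[OF assms(1), of x] module_neg_smult[OF submodule_module[OF assms(1,2)], of x]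
    submodule_sub by fastforce

lemma submodule_minus_eq:
  assumes "module R M" "submodule H R M" "y \<in> H"
  shows "x \<ominus>\<^bsub>M\<lparr>carrier := H\<rparr>\<^esub> y = x \<ominus>\<^bsub>M\<^esub> y"
  using submodule_neg_eq[OF assms] by (simp add: a_minus_def)

lemma submodule_whole: "module R M \<Longrightarrow> submodule (carrier M) R M"
  by (rule module.carrier_is_submodule)


lemma submodule_in_submodule:
  assumes "module R M" "submodule H R M" "submodule K R M" "K \<subseteq> H"
  shows "submodule K R (M\<lparr>carrier := H\<rparr>)"
  using assms submodule_sub[OF assms(2)]
  by (intro submodule_criterion submodule_module) (auto simp: submodule_closed subset_iff)

lemma a_kernel_iff: "x \<in> a_kernel A B f \<longleftrightarrow> x \<in> carrier A \<and> f x = \<zero>\<^bsub>B\<^esub>"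
  by (auto simp: a_kernel_def')

lemma kernel_submodule:
  assumes "module R A" "module R B" "f \<in> mod_hom R A B"
  shows "submodule (a_kernel A B f) R A"
proof -
  interpret B: module R B by fact
  show ?thesis using assms
    by (intro submodule_criterion) (auto simp: a_kernel_iff module_closed mod_hom_zero mod_hom_add mod_hom_smult)
qed

lemma image_submodule:
  assumes "module R A" "module R B" "f \<in> mod_hom R A B" "submodule H R A"
  shows "submodule (f ` H) R B"
proof (rule submodule_criterion[OF assms(2)])
  have sub: "\<And>x. x \<in> H \<Longrightarrow> x \<in> carrier A" using submodule_sub[OF assms(4)] by auto
  show "f ` H \<subseteq> carrier B" using sub mod_hom_closed[OF assms(3)] by auto
  show "\<zero>\<^bsub>B\<^esub> \<in> f ` H" using mod_hom_zero[OF assms(1-3)] submodule_zero[OF assms(4)] by (metis image_eqI)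
  show "\<And>x y. x \<in> f ` H \<Longrightarrow> y \<in> f ` H \<Longrightarrow> x \<oplus>\<^bsub>B\<^esub> y \<in> f ` H"
    using sub mod_hom_add[OF assms(3)] submodule_add[OF assms(4)] by (smt (verit) image_iff)
  show "\<And>r x. r \<in> carrier R \<Longrightarrow> x \<in> f ` H \<Longrightarrow> r \<odot>\<^bsub>B\<^esub> x \<in> f ` H"
    using sub mod_hom_smult[OF assms(3)] submodule_smult[OF assms(4)] by (smt (verit) image_iff)
qed

lemma image_carrier_submodule:
  "\<lbrakk>module R A; module R B; f \<in> mod_hom R A B\<rbrakk> \<Longrightarrow> submodule (f ` carrier A) R B"
  by (rule image_submodule) (auto intro: submodule_whole)

lemma submodule_span_least: "\<lbrakk>submodule H R M; S \<subseteq> H\<rbrakk> \<Longrightarrow> submodule_span R M S \<subseteq> H"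
  unfolding submodule_span_def by auto
lemma submodule_span_incl: "S \<subseteq> submodule_span R M S"
  unfolding submodule_span_def by auto
lemma submodule_span_submodule:
  assumes "module R M" "S \<subseteq> carrier M"
  shows "submodule (submodule_span R M S) R M"
  using assms submodule_whole[OF assms(1)]
  by (intro submodule_criterion[OF assms(1)]) (auto simp: submodule_span_def submodule_closed)

lemma equalizer_submodule:
  assumes "module R A" "module R B" "f \<in> mod_hom R A B" "g \<in> mod_hom R A B"
  shows "submodule {x \<in> carrier A. f x = g x} R A"
  using assms by (intro submodule_criterion) (auto simp: module_closed mod_hom_zero mod_hom_add mod_hom_smult)

lemma hom_finsum:
  assumes "module R A" "module R B" "f \<in> mod_hom R A B" "g \<in> T \<rightarrow> carrier A"
  shows "f (\<Oplus>\<^bsub>A\<^esub>s\<in>T. g s) = (\<Oplus>\<^bsub>B\<^esub>s\<in>T. f (g s))"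
proof -
  interpret A: module R A by fact
  interpret B: module R B by fact
  show ?thesis
  proof (cases "finite T")
    case True then show ?thesis using assms(4)
    proof (induction T)
      case empty then show ?case using assms by (simp add: mod_hom_zero)
    next
      case (insert s T)
      then have "f (\<Oplus>\<^bsub>A\<^esub>s\<in>insert s T. g s) = f (g s) \<oplus>\<^bsub>B\<^esub> f (\<Oplus>\<^bsub>A\<^esub>s\<in>T. g s)"
        by (subst A.M.finsum_insert) (auto simp del: insert.IH simp: mod_hom_add[OF assms(3)] A.M.finsum_closed)
      also have "\<dots> = (\<Oplus>\<^bsub>B\<^esub>s\<in>insert s T. f (g s))"
        using insert mod_hom_closed[OF assms(3)] by (subst B.M.finsum_insert) (auto simp: Pi_iff)
      finally show ?case .
    qed
  next
    case False then show ?thesis using assms by (simp add: A.M.finsum_infinite B.M.finsum_infinite mod_hom_zero)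
  qed
qed


lemma mod_hom_finsum:
  assumes "module R B" "\<And>s. s \<in> T \<Longrightarrow> f s \<in> mod_hom R A B"
  shows "(\<lambda>x. \<Oplus>\<^bsub>B\<^esub>s\<in>T. f s x) \<in> mod_hom R A B"
proof -
  interpret B: module R B by fact
  show ?thesis
  proof (cases "finite T")
    case True
    note cl = mod_hom_closed[OF assms(2)]
    show ?thesis
    proof (rule mod_homI)
      fix r x assume "r \<in> carrier R" "x \<in> carrier A"
      then show "(\<Oplus>\<^bsub>B\<^esub>s\<in>T. f s (r \<odot>\<^bsub>A\<^esub> x)) = r \<odot>\<^bsub>B\<^esub> (\<Oplus>\<^bsub>B\<^esub>s\<in>T. f s x)"
        using True cl by (subst B.finsum_smult_ldistr) (auto simp: Pi_iff mod_hom_smult[OF assms(2)] intro!: B.M.finsum_cong')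
    next
      fix x y assume "x \<in> carrier A" "y \<in> carrier A"
      then have "(\<Oplus>\<^bsub>B\<^esub>s\<in>T. f s (x \<oplus>\<^bsub>A\<^esub> y)) = (\<Oplus>\<^bsub>B\<^esub>s\<in>T. f s x \<oplus>\<^bsub>B\<^esub> f s y)"
        using cl by (intro B.M.finsum_cong') (auto simp: mod_hom_add[OF assms(2)])
      then show "(\<Oplus>\<^bsub>B\<^esub>s\<in>T. f s (x \<oplus>\<^bsub>A\<^esub> y)) = (\<Oplus>\<^bsub>B\<^esub>s\<in>T. f s x) \<oplus>\<^bsub>B\<^esub> (\<Oplus>\<^bsub>B\<^esub>s\<in>T. f s y)"
        using cl \<open>x \<in> carrier A\<close> \<open>y \<in> carrier A\<close> by (simp add: B.M.finsum_addf Pi_iff)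
    qed (use True cl in \<open>auto simp: Pi_iff intro!: B.M.finsum_closed\<close>)
  qed (simp add: B.M.finsum_infinite mod_hom_const_zero[OF assms(1)])
qed

lemma coset_mem:
  assumes "module R M" "submodule K R M" "x \<in> carrier M"
  shows "y \<in> K +>\<^bsub>M\<^esub> x \<longleftrightarrow> y \<in> carrier M \<and> y \<ominus>\<^bsub>M\<^esub> x \<in> K"
proof -
  interpret M: module R M by fact
  have sub: "K \<subseteq> carrier M" by (rule submodule_sub[OF assms(2)])
  show ?thesis
    using sub assms module_add_minus_cancel[OF assms(1) assms(3)]
    by (auto simp: a_r_coset_def' image_iff) (metis subsetD)
qed

lemma coset_self: "\<lbrakk>module R M; submodule K R M; x \<in> carrier M\<rbrakk> \<Longrightarrow> x \<in> K +>\<^bsub>M\<^esub> x"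
  by (simp add: coset_mem module_minus_eq_zero_iff[THEN iffD2] submodule_zero)

lemma coset_eq_iff:
  assumes "module R M" "submodule K R M" "x \<in> carrier M" "y \<in> carrier M"
  shows "K +>\<^bsub>M\<^esub> x = K +>\<^bsub>M\<^esub> y \<longleftrightarrow> x \<ominus>\<^bsub>M\<^esub> y \<in> K"
proof
  assume "K +>\<^bsub>M\<^esub> x = K +>\<^bsub>M\<^esub> y"
  then show "x \<ominus>\<^bsub>M\<^esub> y \<in> K" using coset_self[OF assms(1-3)] coset_mem[OF assms(1,2,4)] by auto
next
  interpret M: module R M by fact
  assume k: "x \<ominus>\<^bsub>M\<^esub> y \<in> K"
  note d = module_diff_eq_iff[OF assms(1)]
  have "z \<ominus>\<^bsub>M\<^esub> x \<in> K \<longleftrightarrow> z \<ominus>\<^bsub>M\<^esub> y \<in> K" if z: "z \<in> carrier M" for z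
  proof -
    have "z \<ominus>\<^bsub>M\<^esub> y = (z \<ominus>\<^bsub>M\<^esub> x) \<oplus>\<^bsub>M\<^esub> (x \<ominus>\<^bsub>M\<^esub> y)"
      using z assms by (subst d) (auto simp: M.M.a_assoc module_add_minus_cancel[OF assms(1)] module_closed)
    moreover have "z \<ominus>\<^bsub>M\<^esub> x = (z \<ominus>\<^bsub>M\<^esub> y) \<ominus>\<^bsub>M\<^esub> (x \<ominus>\<^bsub>M\<^esub> y)"
    proof (subst d)
      have "z \<ominus>\<^bsub>M\<^esub> x \<oplus>\<^bsub>M\<^esub> (x \<ominus>\<^bsub>M\<^esub> y) = z \<ominus>\<^bsub>M\<^esub> y"
        using z assms \<open>z \<ominus>\<^bsub>M\<^esub> y = (z \<ominus>\<^bsub>M\<^esub> x) \<oplus>\<^bsub>M\<^esub> (x \<ominus>\<^bsub>M\<^esub> y)\<close> by simp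
      then have "z \<ominus>\<^bsub>M\<^esub> y \<ominus>\<^bsub>M\<^esub> (x \<ominus>\<^bsub>M\<^esub> y) = z \<ominus>\<^bsub>M\<^esub> x"
        using z assms by (subst d) (auto simp: module_closed(1-5)[OF assms(1)])
      then show "z = z \<ominus>\<^bsub>M\<^esub> y \<ominus>\<^bsub>M\<^esub> (x \<ominus>\<^bsub>M\<^esub> y) \<oplus>\<^bsub>M\<^esub> x"
        using z assms by (simp add: module_add_minus_cancel[OF assms(1)])
    qed (use z assms in \<open>auto simp: module_closed(1-5)[OF assms(1)]\<close>)
    ultimately show ?thesis using k submodule_closed[OF assms(2)] by metis
  qed
  then show "K +>\<^bsub>M\<^esub> x = K +>\<^bsub>M\<^esub> y"
    using coset_mem[OF assms(1,2,3)] coset_mem[OF assms(1,2,4)] by blast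
qed

lemma coset_zero: "\<lbrakk>module R M; submodule K R M\<rbrakk> \<Longrightarrow> K +>\<^bsub>M\<^esub> \<zero>\<^bsub>M\<^esub> = K"
  using submodule_sub abelian_group.a_coset_add_zero module.axioms(2) by metis

lemma coset_eq_zero_iff:
  assumes "module R M" "submodule K R M" "x \<in> carrier M"
  shows "K +>\<^bsub>M\<^esub> x = K \<longleftrightarrow> x \<in> K"
proof -
  interpret M: module R M by fact
  have "x \<ominus>\<^bsub>M\<^esub> \<zero>\<^bsub>M\<^esub> = x"
    using assms(3) by (subst module_diff_eq_iff[OF assms(1)]) auto
  then show ?thesis using coset_eq_iff[OF assms M.M.zero_closed] coset_zero[OF assms(1,2)] by simp
qed

lemma quot_carrier: "carrier (quot_mod M K) = (\<lambda>x. K +>\<^bsub>M\<^esub> x) ` carrier M"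
  by (auto simp: quot_mod_def A_RCOSETS_def')

lemma quot_carrierE:
  assumes "Z \<in> carrier (quot_mod M K)"
  obtains x where "x \<in> carrier M" "Z = K +>\<^bsub>M\<^esub> x"
  using assms by (auto simp: quot_carrier)

lemma quot_zero: "\<zero>\<^bsub>quot_mod M K\<^esub> = K"
  by (simp add: quot_mod_def)


lemma quot_add:
  assumes "module R M" "submodule K R M" "x \<in> carrier M" "y \<in> carrier M"
  shows "(K +>\<^bsub>M\<^esub> x) \<oplus>\<^bsub>quot_mod M K\<^esub> (K +>\<^bsub>M\<^esub> y) = K +>\<^bsub>M\<^esub> (x \<oplus>\<^bsub>M\<^esub> y)"
proof -
  interpret M: module R M by fact
  have "abelian_subgroup K M"
    by (rule abelian_subgroupI3[OF additive_subgroupI[OF submodule.axioms(1)[OF assms(2)]]]) (rule M.abelian_group_axioms)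
  then show ?thesis using assms by (simp add: quot_mod_def abelian_subgroup.a_rcos_sum)
qed

text \<open>All members of a coset of \<open>K\<close> have the same image modulo \<open>K'\<close>, so the union in
  \<open>coset_map\<close> is a union of equal sets.\<close>

lemma coset_union_eq:
  assumes "module R M" "submodule K R M" "module R M'" "submodule K' R M'"
    and "f \<in> mod_hom R M M'" "f ` K \<subseteq> K'" "x \<in> carrier M"
  shows "(\<Union>y\<in>K +>\<^bsub>M\<^esub> x. K' +>\<^bsub>M'\<^esub> f y) = K' +>\<^bsub>M'\<^esub> f x"
proof -
  have "K' +>\<^bsub>M'\<^esub> f y = K' +>\<^bsub>M'\<^esub> f x" if "y \<in> K +>\<^bsub>M\<^esub> x" for y
  proof -
    have y: "y \<in> carrier M" "y \<ominus>\<^bsub>M\<^esub> x \<in> K" using that coset_mem[OF assms(1,2,7)] by auto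
    then have "f y \<ominus>\<^bsub>M'\<^esub> f x \<in> K'" using mod_hom_minus[OF assms(1,3,5) y(1) assms(7)] assms(6) by auto
    then show ?thesis using coset_eq_iff[OF assms(3,4)] mod_hom_closed[OF assms(5)] y(1) assms(7) by auto
  qed
  then show ?thesis using coset_self[OF assms(1,2,7)] by blast
qed

lemma coset_map_coset:
  assumes "module R M" "submodule K R M" "module R M'" "submodule K' R M'"
    and "f \<in> mod_hom R M M'" "f ` K \<subseteq> K'" "x \<in> carrier M"
  shows "coset_map M' K' f (K +>\<^bsub>M\<^esub> x) = K' +>\<^bsub>M'\<^esub> f x"
  unfolding coset_map_def by (rule coset_union_eq[OF assms])

lemma quot_smult:
  assumes "module R M" "submodule K R M" "r \<in> carrier R" "x \<in> carrier M"
  shows "r \<odot>\<^bsub>quot_mod M K\<^esub> (K +>\<^bsub>M\<^esub> x) = K +>\<^bsub>M\<^esub> (r \<odot>\<^bsub>M\<^esub> x)"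
proof -
  have "(\<lambda>x. r \<odot>\<^bsub>M\<^esub> x) ` K \<subseteq> K" using submodule_smult[OF assms(2,3)] by auto
  moreover have "(\<lambda>x. r \<odot>\<^bsub>M\<^esub> x) \<in> mod_hom R M M" by (rule mod_hom_scale[OF assms(1) mod_hom_id assms(3)])
  ultimately show ?thesis
    using coset_union_eq[OF assms(1,2,1,2) _ _ assms(4), of "\<lambda>x. r \<odot>\<^bsub>M\<^esub> x"] by (simp add: quot_mod_def)
qed

lemma quot_module:
  assumes "module R M" "submodule K R M"
  shows "module R (quot_mod M K)"
proof -
  interpret M: module R M by fact
  let ?Q = "quot_mod M K"
  note ops = quot_add[OF assms] quot_smult[OF assms] quot_zero coset_zero[OF assms, symmetric]
  have z: "\<zero>\<^bsub>?Q\<^esub> = K +>\<^bsub>M\<^esub> \<zero>\<^bsub>M\<^esub>" by (simp add: quot_zero coset_zero[OF assms])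
  show ?thesis
  proof (rule moduleI)
    show "abelian_group ?Q"
    proof (rule abelian_groupI)
      fix x assume "x \<in> carrier ?Q"
      then obtain a where a: "a \<in> carrier M" "x = K +>\<^bsub>M\<^esub> a" by (rule quot_carrierE)
      show "\<exists>y\<in>carrier ?Q. y \<oplus>\<^bsub>?Q\<^esub> x = \<zero>\<^bsub>?Q\<^esub>"
        by (rule bexI[of _ "K +>\<^bsub>M\<^esub> (\<ominus>\<^bsub>M\<^esub> a)"]) (use a in \<open>simp_all add: ops(1) z M.M.l_neg quot_carrier\<close>)
    qed (auto simp: quot_carrier z ops(1) M.M.a_ac)
  qed (auto simp: quot_carrier ops(1,2) M.smult_l_distr M.smult_r_distr M.smult_assoc1 M.R.is_cring)
qed

lemma quot_proj_hom:
  assumes "module R M" "submodule K R M"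
  shows "(\<lambda>x. K +>\<^bsub>M\<^esub> x) \<in> mod_hom R M (quot_mod M K)"
  by (rule mod_homI) (auto simp: quot_carrier quot_add[OF assms] quot_smult[OF assms])

lemma quot_minus:
  assumes "module R M" "submodule K R M" "x \<in> carrier M" "y \<in> carrier M"
  shows "(K +>\<^bsub>M\<^esub> x) \<ominus>\<^bsub>quot_mod M K\<^esub> (K +>\<^bsub>M\<^esub> y) = K +>\<^bsub>M\<^esub> (x \<ominus>\<^bsub>M\<^esub> y)"
  using mod_hom_minus[OF assms(1) quot_module[OF assms(1,2)] quot_proj_hom[OF assms(1,2)] assms(3,4)] by simp

lemma quot_hom_eqI:
  assumes "module R M" "submodule K R M"
    and "\<And>x. x \<in> carrier M \<Longrightarrow> f (K +>\<^bsub>M\<^esub> x) \<in> carrier G"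
    and "(\<lambda>x. f (K +>\<^bsub>M\<^esub> x)) \<in> mod_hom R M G"
  shows "f \<in> mod_hom R (quot_mod M K) G"
  using assms(3) mod_hom_add[OF assms(4)] mod_hom_smult[OF assms(4)]
  by (intro mod_homI) (auto simp: quot_carrier quot_add[OF assms(1,2)] quot_smult[OF assms(1,2)])

lemma coset_map_hom:
  assumes "module R M" "submodule K R M" "module R M'" "submodule K' R M'"
    and "f \<in> mod_hom R M M'" "f ` K \<subseteq> K'"
  shows "coset_map M' K' f \<in> mod_hom R (quot_mod M K) (quot_mod M' K')"
proof (rule quot_hom_eqI[OF assms(1,2)])
  show "(\<lambda>x. coset_map M' K' f (K +>\<^bsub>M\<^esub> x)) \<in> mod_hom R M (quot_mod M' K')"
    by (rule mod_hom_cong[OF assms(1) mod_hom_comp[OF assms(5) quot_proj_hom[OF assms(3,4)]]])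
      (simp add: coset_map_coset[OF assms])
  show "coset_map M' K' f (K +>\<^bsub>M\<^esub> x) \<in> carrier (quot_mod M' K')" if "x \<in> carrier M" for x
    using that mod_hom_closed[OF assms(5) that] by (auto simp: coset_map_coset[OF assms] quot_carrier)
qed

text \<open>A homomorphism factors through a quotient by choosing representatives.\<close>

definition quot_lift :: "('a \<Rightarrow> 'b) \<Rightarrow> 'a set \<Rightarrow> 'b"
  where "quot_lift f Z = f (SOME x. x \<in> Z)"

lemma quot_lift_coset:
  assumes "module R M" "submodule K R M" "module R G" "f \<in> mod_hom R M G"
    and "\<And>x. x \<in> K \<Longrightarrow> f x = \<zero>\<^bsub>G\<^esub>" "x \<in> carrier M"
  shows "quot_lift f (K +>\<^bsub>M\<^esub> x) = f x"
proof -
  have "(SOME y. y \<in> K +>\<^bsub>M\<^esub> x) \<in> K +>\<^bsub>M\<^esub> x" using coset_self[OF assms(1,2,6)] by (rule someI)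
  then obtain y where y: "y = (SOME y. y \<in> K +>\<^bsub>M\<^esub> x)" "y \<in> carrier M" "y \<ominus>\<^bsub>M\<^esub> x \<in> K"
    using coset_mem[OF assms(1,2,6)] by auto
  have "f y \<ominus>\<^bsub>G\<^esub> f x = \<zero>\<^bsub>G\<^esub>" using assms(5)[OF y(3)] mod_hom_minus[OF assms(1,3,4) y(2) assms(6)] by simp
  then have "f y = f x"
    using module_minus_eq_zero_iff[OF assms(3)] mod_hom_closed[OF assms(4)] y(2) assms(6) by auto
  then show ?thesis by (simp add: quot_lift_def y(1)[symmetric])
qed

lemma quot_lift_hom:
  assumes "module R M" "submodule K R M" "module R G" "f \<in> mod_hom R M G"
    and "\<And>x. x \<in> K \<Longrightarrow> f x = \<zero>\<^bsub>G\<^esub>"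
  shows "quot_lift f \<in> mod_hom R (quot_mod M K) G"
proof (rule quot_hom_eqI[OF assms(1,2)])
  show "(\<lambda>x. quot_lift f (K +>\<^bsub>M\<^esub> x)) \<in> mod_hom R M G"
    by (rule mod_hom_cong[OF assms(1,4)]) (simp add: quot_lift_coset[OF assms])
qed (simp add: quot_lift_coset[OF assms] mod_hom_closed[OF assms(4)])

lemma is_zero_quot_iff:
  assumes "module R M" "submodule K R M"
  shows "is_zero (quot_mod M K) \<longleftrightarrow> carrier M \<subseteq> K"
proof -
  interpret M: module R M by fact
  have "is_zero (quot_mod M K) \<longleftrightarrow> (\<forall>x\<in>carrier M. K +>\<^bsub>M\<^esub> x = K)"
    using M.M.zero_closed unfolding is_zero_def quot_zero quot_carrier by (auto simp del: M.M.zero_closed)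
  then show ?thesis using coset_eq_zero_iff[OF assms] by auto
qed

section \<open>Modules of homomorphisms\<close>

lemma Hom_carrier: "carrier (Hom_mod R A B) = mod_hom R A B \<inter> extensional (carrier A)"
  by (simp add: Hom_mod_def)
lemma Hom_memD: "f \<in> carrier (Hom_mod R A B) \<Longrightarrow> f \<in> mod_hom R A B"
  by (simp add: Hom_mod_def)
lemma Hom_add: "x \<in> carrier A \<Longrightarrow> (f \<oplus>\<^bsub>Hom_mod R A B\<^esub> g) x = f x \<oplus>\<^bsub>B\<^esub> g x"
  by (simp add: Hom_mod_def)
lemma Hom_smult: "x \<in> carrier A \<Longrightarrow> (r \<odot>\<^bsub>Hom_mod R A B\<^esub> f) x = r \<odot>\<^bsub>B\<^esub> f x"
  by (simp add: Hom_mod_def)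
lemma Hom_zero: "x \<in> carrier A \<Longrightarrow> \<zero>\<^bsub>Hom_mod R A B\<^esub> x = \<zero>\<^bsub>B\<^esub>"
  by (simp add: Hom_mod_def)
lemma Hom_ext: 
  "\<lbrakk>f \<in> carrier (Hom_mod R A B); g \<in> carrier (Hom_mod R A B); \<And>x. x \<in> carrier A \<Longrightarrow> f x = g x\<rbrakk> \<Longrightarrow> f = g"
  unfolding Hom_carrier by (auto intro: extensionalityI)

lemma restrict_in_Hom:
  assumes "module R A" "f \<in> mod_hom R A B"
  shows "restrict f (carrier A) \<in> carrier (Hom_mod R A B)"
  unfolding Hom_carrier using mod_hom_cong[OF assms, of "restrict f (carrier A)"] by auto

lemma Hom_module:
  assumes "module R A" "module R B"
  shows "module R (Hom_mod R A B)"
proof -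
  interpret A: module R A by fact
  interpret B: module R B by fact
  let ?H = "Hom_mod R A B"
  have add: "f \<oplus>\<^bsub>?H\<^esub> g \<in> carrier ?H" if "f \<in> carrier ?H" "g \<in> carrier ?H" for f g
  proof -
    have "f \<oplus>\<^bsub>?H\<^esub> g = restrict (\<lambda>x. f x \<oplus>\<^bsub>B\<^esub> g x) (carrier A)" by (simp add: Hom_mod_def)
    then show ?thesis
      using restrict_in_Hom[OF assms(1) mod_hom_plus[OF assms(2) Hom_memD[OF that(1)] Hom_memD[OF that(2)]]] by simp
  qed
  have sc: "r \<odot>\<^bsub>?H\<^esub> f \<in> carrier ?H" if "f \<in> carrier ?H" "r \<in> carrier R" for f r
  proof -
    have "r \<odot>\<^bsub>?H\<^esub> f = restrict (\<lambda>x. r \<odot>\<^bsub>B\<^esub> f x) (carrier A)" by (simp add: Hom_mod_def)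
    then show ?thesis
      using restrict_in_Hom[OF assms(1) mod_hom_scale[OF assms(2) Hom_memD[OF that(1)] that(2)]] by simp
  qed
  have zero: "\<zero>\<^bsub>?H\<^esub> \<in> carrier ?H"
    using restrict_in_Hom[OF assms(1) mod_hom_const_zero[OF assms(2)]] by (simp add: Hom_mod_def)
  have cl: "f x \<in> carrier B" if "f \<in> carrier ?H" "x \<in> carrier A" for f x
    using that by (meson Hom_memD mod_hom_closed)
  show ?thesis
  proof (rule moduleI[OF A.R.is_cring])
    show "abelian_group ?H"
    proof (rule abelian_groupI)
      fix f assume f: "f \<in> carrier ?H"
      let ?g = "(\<ominus>\<^bsub>R\<^esub> \<one>\<^bsub>R\<^esub>) \<odot>\<^bsub>?H\<^esub> f"
      have g: "?g \<in> carrier ?H" using f by (intro sc) auto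
      show "\<exists>g\<in>carrier ?H. g \<oplus>\<^bsub>?H\<^esub> f = \<zero>\<^bsub>?H\<^esub>"
      proof (rule bexI[OF _ g], rule Hom_ext[OF add[OF g f] zero])
        fix x assume x: "x \<in> carrier A"
        then show "(?g \<oplus>\<^bsub>?H\<^esub> f) x = \<zero>\<^bsub>?H\<^esub> x"
          using cl[OF f x] module_neg_smult[OF assms(2) cl[OF f x]]
          by (simp add: Hom_add Hom_smult Hom_zero B.M.l_neg flip: module_neg_smult[OF assms(2)])
      qed
    qed (auto intro!: Hom_ext intro: add zero simp: Hom_add Hom_zero cl B.M.a_ac)
  qed (auto intro!: Hom_ext intro: add sc simp: Hom_add Hom_smult Hom_zero cl B.smult_l_distr B.smult_r_distr B.smult_assoc1)
qed


lemma precomp_apply: "x \<in> carrier A' \<Longrightarrow> precomp A' h u x = u (h x)"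
  by (simp add: precomp_def)

lemma precomp_closed:
  assumes "module R A'" "h \<in> mod_hom R A' A" "u \<in> carrier (Hom_mod R A B)"
  shows "precomp A' h u \<in> carrier (Hom_mod R A' B)"
  unfolding precomp_def by (rule restrict_in_Hom[OF assms(1) mod_hom_comp[OF assms(2) Hom_memD[OF assms(3)]]])

lemma precomp_hom:
  assumes "module R A'" "module R A" "module R B" "h \<in> mod_hom R A' A"
  shows "precomp A' h \<in> mod_hom R (Hom_mod R A B) (Hom_mod R A' B)"
proof -
  note cl = precomp_closed[OF assms(1,4)]
  note m = Hom_module[OF assms(2,3)] Hom_module[OF assms(1,3)]
  show ?thesis
    by (rule mod_homI) (auto intro!: Hom_ext cl module_closed(1,5)[OF m(1)] module_closed(1,5)[OF m(2)]
      simp: Hom_add Hom_smult precomp_apply mod_hom_closed[OF assms(4)])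
qed


section \<open>Free modules\<close>

lemma preimage_submodule:
  assumes "module R A" "module R B" "f \<in> mod_hom R A B" "submodule H R B"
  shows "submodule {x \<in> carrier A. f x \<in> H} R A"
  using assms by (intro submodule_criterion[OF assms(1)])
    (auto simp: module_closed submodule_closed mod_hom_zero[OF assms(1-3)] mod_hom_add[OF assms(3)] mod_hom_smult[OF assms(3)])

lemma ring_module_simps:
  "carrier (ring_module R) = carrier R" "\<zero>\<^bsub>ring_module R\<^esub> = \<zero>\<^bsub>R\<^esub>"
  "x \<oplus>\<^bsub>ring_module R\<^esub> y = x \<oplus>\<^bsub>R\<^esub> y" "r \<odot>\<^bsub>ring_module R\<^esub> x = r \<otimes>\<^bsub>R\<^esub> x"
  by (simp_all add: ring_module_def)

lemma ring_module_module:
  assumes "cring R" shows "module R (ring_module R)"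
proof -
  interpret cring R by fact
  show ?thesis
  proof (rule moduleI[OF assms])
    show "abelian_group (ring_module R)"
      by (rule abelian_groupI) (auto simp: ring_module_simps a_ac intro: l_neg bexI[of _ "\<ominus>\<^bsub>R\<^esub> x" for x])
  qed (auto simp: ring_module_simps l_distr r_distr m_assoc)
qed

lemma ring_module_neg:
  assumes "cring R" "x \<in> carrier R" shows "\<ominus>\<^bsub>ring_module R\<^esub> x = \<ominus>\<^bsub>R\<^esub> x"
proof -
  interpret cring R by fact
  show ?thesis using module_neg_smult[OF ring_module_module[OF assms(1)], of x] assms(2)
    by (simp add: ring_module_simps l_minus)
qed

lemma finsum_ring_module: "finsum (ring_module R) f T = finsum R f T"
proof -
  have "(\<oplus>\<^bsub>ring_module R\<^esub>) = (\<oplus>\<^bsub>R\<^esub>)" by (simp add: ring_module_def)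
  then show ?thesis unfolding finsum_def finprod_def by (simp add: ring_module_simps)
qed

lemma free_carrier:
  "\<phi> \<in> carrier (free_module R S) \<longleftrightarrow>
    (\<forall>s. \<phi> s \<in> carrier R) \<and> {s. \<phi> s \<noteq> \<zero>\<^bsub>R\<^esub>} \<subseteq> S \<and> finite {s. \<phi> s \<noteq> \<zero>\<^bsub>R\<^esub>}"
  by (auto simp: free_module_def)

lemma free_simps:
  "\<zero>\<^bsub>free_module R S\<^esub> = (\<lambda>s. \<zero>\<^bsub>R\<^esub>)"
  "\<phi> \<oplus>\<^bsub>free_module R S\<^esub> \<psi> = (\<lambda>s. \<phi> s \<oplus>\<^bsub>R\<^esub> \<psi> s)"
  "r \<odot>\<^bsub>free_module R S\<^esub> \<phi> = (\<lambda>s. r \<otimes>\<^bsub>R\<^esub> \<phi> s)"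
  by (simp_all add: free_module_def)

lemma free_module_module:
  assumes "cring R" shows "module R (free_module R S)"
proof -
  interpret cring R by fact
  let ?F = "free_module R S"
  have add: "\<phi> \<oplus>\<^bsub>?F\<^esub> \<psi> \<in> carrier ?F" if "\<phi> \<in> carrier ?F" "\<psi> \<in> carrier ?F" for \<phi> \<psi>
  proof -
    have "{s. \<phi> s \<oplus>\<^bsub>R\<^esub> \<psi> s \<noteq> \<zero>\<^bsub>R\<^esub>} \<subseteq> {s. \<phi> s \<noteq> \<zero>\<^bsub>R\<^esub>} \<union> {s. \<psi> s \<noteq> \<zero>\<^bsub>R\<^esub>}" by auto
    then show ?thesis using that unfolding free_carrier free_simps
      by (meson a_closed finite_UnI finite_subset le_sup_iff order_trans)
  qed
  have sc: "r \<odot>\<^bsub>?F\<^esub> \<phi> \<in> carrier ?F" if "r \<in> carrier R" "\<phi> \<in> carrier ?F" for r \<phi>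
  proof -
    have "{s. r \<otimes>\<^bsub>R\<^esub> \<phi> s \<noteq> \<zero>\<^bsub>R\<^esub>} \<subseteq> {s. \<phi> s \<noteq> \<zero>\<^bsub>R\<^esub>}" using that by auto
    then show ?thesis using that unfolding free_carrier free_simps
      by (meson m_closed finite_subset order_trans)
  qed
  have cl: "\<phi> s \<in> carrier R" if "\<phi> \<in> carrier ?F" for \<phi> s using that by (simp add: free_carrier)
  have zero: "\<zero>\<^bsub>?F\<^esub> \<in> carrier ?F" by (simp add: free_carrier free_simps)
  show ?thesis
  proof (rule moduleI[OF assms])
    show "abelian_group ?F"
    proof (rule abelian_groupI)
      fix \<phi> assume f: "\<phi> \<in> carrier ?F"
      show "\<exists>y\<in>carrier ?F. y \<oplus>\<^bsub>?F\<^esub> \<phi> = \<zero>\<^bsub>?F\<^esub>"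
        by (rule bexI[of _ "(\<ominus>\<^bsub>R\<^esub> \<one>\<^bsub>R\<^esub>) \<odot>\<^bsub>?F\<^esub> \<phi>"])
          (use f in \<open>simp_all add: free_simps(1,2) sc\<close>, use cl[OF f] in \<open>auto simp: free_simps l_minus l_neg\<close>)
    qed (rule add zero | simp; fail | auto simp: cl free_simps a_ac)+
  qed (rule sc | simp; fail | auto simp: cl free_simps l_distr r_distr m_assoc)+
qed

lemma free_unit_carrier: "\<lbrakk>cring R; s \<in> S\<rbrakk> \<Longrightarrow> free_unit R s \<in> carrier (free_module R S)"
proof -
  assume "cring R" and s: "s \<in> S" then interpret cring R by simp
  have "{t. free_unit R s t \<noteq> \<zero>\<^bsub>R\<^esub>} \<subseteq> {s}" by (auto simp: free_unit_def)
  moreover have "finite {t. free_unit R s t \<noteq> \<zero>\<^bsub>R\<^esub>}" by (rule finite_subset[OF calculation]) simp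
  ultimately show ?thesis using s by (auto simp: free_carrier free_unit_def)
qed

lemma free_mono: "S \<subseteq> T \<Longrightarrow> carrier (free_module R S) \<subseteq> carrier (free_module R T)"
  unfolding subset_iff free_carrier by blast

lemma free_restrict: "free_module R S = (free_module R T)\<lparr>carrier := carrier (free_module R S)\<rparr>"
  by (simp add: free_module_def)

lemma free_submodule: "\<lbrakk>cring R; S \<subseteq> T\<rbrakk> \<Longrightarrow> submodule (carrier (free_module R S)) R (free_module R T)"
  by (metis free_mono free_module_module free_restrict module.module_incl_imp_submodule)

text \<open>The unit vectors generate: peel off one coordinate of the support at a time.\<close>

lemma free_induct:
  assumes "cring R" "submodule H R (free_module R S)" "\<And>s. s \<in> S \<Longrightarrow> free_unit R s \<in> H"
    and "\<phi> \<in> carrier (free_module R S)"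
  shows "\<phi> \<in> H"
proof -
  interpret cring R by fact
  let ?F = "free_module R S"
  have "finite T \<Longrightarrow> \<phi> \<in> carrier ?F \<Longrightarrow> {s. \<phi> s \<noteq> \<zero>\<^bsub>R\<^esub>} \<subseteq> T \<Longrightarrow> \<phi> \<in> H" for T \<phi>
  proof (induction T arbitrary: \<phi> rule: finite_induct)
    case empty
    then have "\<phi> = \<zero>\<^bsub>?F\<^esub>" by (auto simp: free_simps)
    then show ?case using submodule_zero[OF assms(2)] by simp
  next
    case (insert t T)
    let ?\<psi> = "\<phi>(t := \<zero>\<^bsub>R\<^esub>)"
    have sub: "{s. ?\<psi> s \<noteq> \<zero>\<^bsub>R\<^esub>} \<subseteq> {s. \<phi> s \<noteq> \<zero>\<^bsub>R\<^esub>} \<inter> T" using insert.prems by auto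
    then have psi: "?\<psi> \<in> carrier ?F"
      using insert.prems finite_subset[OF sub] unfolding free_carrier
      by (metis (no_types, lifting) finite_Int fun_upd_apply le_inf_iff order_trans zero_closed)
    have "?\<psi> \<in> H" by (rule insert.IH[OF psi]) (use sub in blast)
    show ?case
    proof (cases "t \<in> S")
      case True
      have "\<phi> = \<phi> t \<odot>\<^bsub>?F\<^esub> free_unit R t \<oplus>\<^bsub>?F\<^esub> ?\<psi>"
        using insert.prems by (auto simp: free_simps free_unit_def free_carrier fun_eq_iff)
      moreover have "\<phi> t \<odot>\<^bsub>?F\<^esub> free_unit R t \<oplus>\<^bsub>?F\<^esub> ?\<psi> \<in> H"
        using insert.prems \<open>?\<psi> \<in> H\<close> True
        by (intro submodule_add[OF assms(2)] submodule_smult[OF assms(2)] assms(3)) (auto simp: free_carrier)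
      ultimately show ?thesis by metis
    next
      case False
      then have "\<phi> = ?\<psi>" using insert.prems by (auto simp: free_carrier fun_eq_iff)
      then show ?thesis using \<open>?\<psi> \<in> H\<close> by metis
    qed
  qed
  then show ?thesis using assms(4) by (auto simp: free_carrier)
qed

lemma free_hom_eqI:
  assumes "cring R" "module R G" "f \<in> mod_hom R (free_module R S) G" "g \<in> mod_hom R (free_module R S) G"
    and "\<And>s. s \<in> S \<Longrightarrow> f (free_unit R s) = g (free_unit R s)" "\<phi> \<in> carrier (free_module R S)"
  shows "f \<phi> = g \<phi>"
  using free_induct[OF assms(1) equalizer_submodule[OF free_module_module[OF assms(1)] assms(2-4)] _ assms(6)]
    assms(5) free_unit_carrier[OF assms(1), of _ S] by auto

lemma free_lift_superset:
  assumes "module R M" "finite T" "{s. \<phi> s \<noteq> \<zero>\<^bsub>R\<^esub>} \<subseteq> T" "\<And>s. s \<in> T \<Longrightarrow> f s \<in> carrier M"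
    and "\<And>s. \<phi> s \<in> carrier R"
  shows "free_lift R M f \<phi> = (\<Oplus>\<^bsub>M\<^esub>s\<in>T. \<phi> s \<odot>\<^bsub>M\<^esub> f s)"
proof -
  interpret M: module R M by fact
  show ?thesis unfolding free_lift_def
    using assms(2-5) by (intro M.M.add.finprod_mono_neutral_cong_left) auto
qed

lemma free_lift_hom:
  assumes "module R M" "\<And>s. s \<in> S \<Longrightarrow> f s \<in> carrier M"
  shows "free_lift R M f \<in> mod_hom R (free_module R S) M"
proof -
  interpret M: module R M by fact
  let ?F = "free_module R S"
  interpret F: module R ?F by (rule free_module_module[OF M.R.is_cring])
  show ?thesis
  proof (rule mod_homI)
    fix \<phi> assume "\<phi> \<in> carrier ?F"
    then show "free_lift R M f \<phi> \<in> carrier M"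
      unfolding free_lift_def using assms(2) by (intro M.M.finsum_closed) (auto simp: free_carrier)
  next
    fix \<phi> \<psi> assume p: "\<phi> \<in> carrier ?F" "\<psi> \<in> carrier ?F"
    let ?T = "{s. \<phi> s \<noteq> \<zero>\<^bsub>R\<^esub>} \<union> {s. \<psi> s \<noteq> \<zero>\<^bsub>R\<^esub>}"
    have T: "finite ?T" "?T \<subseteq> S" and c: "\<And>s. \<phi> s \<in> carrier R" "\<And>s. \<psi> s \<in> carrier R"
      using p by (auto simp: free_carrier)
    have fT: "\<And>s. s \<in> ?T \<Longrightarrow> f s \<in> carrier M" using T(2) assms(2) by blast
    have s: "{s. (\<phi> \<oplus>\<^bsub>?F\<^esub> \<psi>) s \<noteq> \<zero>\<^bsub>R\<^esub>} \<subseteq> ?T" using c by (auto simp: free_simps)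
    have "free_lift R M f (\<phi> \<oplus>\<^bsub>?F\<^esub> \<psi>) = (\<Oplus>\<^bsub>M\<^esub>s\<in>?T. (\<phi> \<oplus>\<^bsub>?F\<^esub> \<psi>) s \<odot>\<^bsub>M\<^esub> f s)"
      by (rule free_lift_superset[OF assms(1) T(1) s fT]) (auto simp: free_simps c)
    also have "\<dots> = (\<Oplus>\<^bsub>M\<^esub>s\<in>?T. \<phi> s \<odot>\<^bsub>M\<^esub> f s \<oplus>\<^bsub>M\<^esub> \<psi> s \<odot>\<^bsub>M\<^esub> f s)"
      by (rule M.M.finsum_cong') (use c fT in \<open>auto simp: free_simps M.smult_l_distr\<close>)
    also have "\<dots> = (\<Oplus>\<^bsub>M\<^esub>s\<in>?T. \<phi> s \<odot>\<^bsub>M\<^esub> f s) \<oplus>\<^bsub>M\<^esub> (\<Oplus>\<^bsub>M\<^esub>s\<in>?T. \<psi> s \<odot>\<^bsub>M\<^esub> f s)"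
      by (rule M.M.finsum_addf) (use c fT in auto)
    also have "(\<Oplus>\<^bsub>M\<^esub>s\<in>?T. \<phi> s \<odot>\<^bsub>M\<^esub> f s) = free_lift R M f \<phi>"
      by (rule free_lift_superset[OF assms(1) T(1) _ fT, symmetric]) (use c in auto)
    also have "(\<Oplus>\<^bsub>M\<^esub>s\<in>?T. \<psi> s \<odot>\<^bsub>M\<^esub> f s) = free_lift R M f \<psi>"
      by (rule free_lift_superset[OF assms(1) T(1) _ fT, symmetric]) (use c in auto)
    finally show "free_lift R M f (\<phi> \<oplus>\<^bsub>?F\<^esub> \<psi>) = free_lift R M f \<phi> \<oplus>\<^bsub>M\<^esub> free_lift R M f \<psi>" .
  next
    fix r \<phi> assume p: "r \<in> carrier R" "\<phi> \<in> carrier ?F"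
    let ?T = "{s. \<phi> s \<noteq> \<zero>\<^bsub>R\<^esub>}"
    have T: "finite ?T" "?T \<subseteq> S" and c: "\<And>s. \<phi> s \<in> carrier R"
      using p by (auto simp: free_carrier)
    have fT: "\<And>s. s \<in> ?T \<Longrightarrow> f s \<in> carrier M" using T(2) assms(2) by blast
    have "free_lift R M f (r \<odot>\<^bsub>?F\<^esub> \<phi>) = (\<Oplus>\<^bsub>M\<^esub>s\<in>?T. (r \<odot>\<^bsub>?F\<^esub> \<phi>) s \<odot>\<^bsub>M\<^esub> f s)"
      by (rule free_lift_superset[OF assms(1) T(1) _ fT]) (use p in \<open>auto simp: free_simps c\<close>)
    also have "\<dots> = (\<Oplus>\<^bsub>M\<^esub>s\<in>?T. r \<odot>\<^bsub>M\<^esub> (\<phi> s \<odot>\<^bsub>M\<^esub> f s))"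
      by (rule M.M.finsum_cong') (use c fT p in \<open>auto simp: free_simps M.smult_assoc1\<close>)
    also have "\<dots> = r \<odot>\<^bsub>M\<^esub> free_lift R M f \<phi>"
      unfolding free_lift_def using T fT c p by (intro M.finsum_smult_ldistr[symmetric]) auto
    finally show "free_lift R M f (r \<odot>\<^bsub>?F\<^esub> \<phi>) = r \<odot>\<^bsub>M\<^esub> free_lift R M f \<phi>" .
  qed
qed

lemma free_lift_unit:
  assumes "module R M" "f s \<in> carrier M"
  shows "free_lift R M f (free_unit R s) = f s"
proof -
  interpret M: module R M by fact
  have "free_lift R M f (free_unit R s) = (\<Oplus>\<^bsub>M\<^esub>t\<in>{s}. free_unit R s t \<odot>\<^bsub>M\<^esub> f t)"
    by (rule free_lift_superset[OF assms(1)]) (use assms in \<open>auto simp: free_unit_def\<close>)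
  then show ?thesis using assms by (simp add: free_unit_def)
qed

lemma free_eval_hom:
  assumes "cring R" shows "(\<lambda>\<phi>. \<phi> s) \<in> mod_hom R (free_module R S) (ring_module R)"
  by (rule mod_homI) (auto simp: free_carrier free_simps ring_module_simps)

text \<open>Pushing forward along \<open>h\<close> is the linear extension of \<open>s \<mapsto> e (h s)\<close>, which makes it a
  homomorphism.\<close>

lemma free_push_eq_lift:
  assumes "cring R" "\<phi> \<in> carrier (free_module R S)"
  shows "free_push R h \<phi> = free_lift R (free_module R UNIV) (\<lambda>s. free_unit R (h s)) \<phi>"
proof
  fix t
  interpret cring R by fact
  let ?T = "{s. \<phi> s \<noteq> \<zero>\<^bsub>R\<^esub>}"
  have c: "\<And>s. \<phi> s \<in> carrier R" "finite ?T" using assms(2) by (auto simp: free_carrier)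
  interpret F: module R "free_module R UNIV :: ('a, 'd \<Rightarrow> 'a) module" by (rule free_module_module[OF assms(1)])
  have "free_lift R (free_module R UNIV) (\<lambda>s. free_unit R (h s)) \<phi> t =
    (\<Oplus>\<^bsub>ring_module R\<^esub>s\<in>?T. (\<phi> s \<odot>\<^bsub>free_module R UNIV\<^esub> free_unit R (h s)) t)"
    unfolding free_lift_def
    by (rule hom_finsum[OF free_module_module[OF assms(1)] ring_module_module[OF assms(1)] free_eval_hom[OF assms(1)]])
      (use c in \<open>auto intro!: free_unit_carrier[OF assms(1)]\<close>)
  also have "\<dots> = (\<Oplus>\<^bsub>R\<^esub>s\<in>?T. \<phi> s \<otimes>\<^bsub>R\<^esub> free_unit R (h s) t)"
    by (simp add: finsum_ring_module free_simps)
  also have "\<dots> = free_push R h \<phi> t" unfolding free_push_def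
    by (rule add.finprod_mono_neutral_cong_right) (use c in \<open>auto simp: free_unit_def\<close>)
  finally show "free_push R h \<phi> t = free_lift R (free_module R UNIV) (\<lambda>s. free_unit R (h s)) \<phi> t" by simp
qed

lemma free_push_unit:
  assumes "cring R" shows "free_push R h (free_unit R s) = free_unit R (h s)"
  unfolding free_push_eq_lift[OF assms free_unit_carrier[OF assms UNIV_I]]
  by (rule free_lift_unit[OF free_module_module[OF assms]]) (rule free_unit_carrier[OF assms UNIV_I])

lemma free_push_hom:
  assumes "cring R" "h ` S \<subseteq> T"
  shows "free_push R h \<in> mod_hom R (free_module R S) (free_module R T)"
proof -
  note m = free_module_module[OF assms(1)]
  have *: "free_push R h \<in> mod_hom R (free_module R S) (free_module R UNIV)"
    by (rule mod_hom_cong[OF m free_lift_hom[OF m]]) (auto simp: free_push_eq_lift[OF assms(1)] intro!: free_unit_carrier[OF assms(1)])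
  have sub: "submodule {\<phi> \<in> carrier (free_module R S). free_push R h \<phi> \<in> carrier (free_module R T)} R (free_module R S)"
    by (rule preimage_submodule[OF m m * free_submodule[OF assms(1)]]) auto
  have "free_push R h ` carrier (free_module R S) \<subseteq> carrier (free_module R T)"
  proof
    fix x assume "x \<in> free_push R h ` carrier (free_module R S)"
    then obtain \<phi> where \<phi>: "\<phi> \<in> carrier (free_module R S)" "x = free_push R h \<phi>" by auto
    have "\<phi> \<in> {\<phi> \<in> carrier (free_module R S). free_push R h \<phi> \<in> carrier (free_module R T)}"
      by (rule free_induct[OF assms(1) sub _ \<phi>(1)])
        (use assms(2) in \<open>auto simp: free_push_unit[OF assms(1)] intro!: free_unit_carrier[OF assms(1)]\<close>)
    then show "x \<in> carrier (free_module R T)" using \<phi> by auto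
  qed
  then show ?thesis using mod_hom_restrict_cod[OF *, of "carrier (free_module R T)"]
    by (subst free_restrict[of R T UNIV])
qed

section \<open>Tensor products\<close>

definition pure_tensor ::
    "('r, 'x) ring_scheme \<Rightarrow> ('r, 'a, 'c) module_scheme \<Rightarrow> ('r, 'b, 'd) module_scheme
      \<Rightarrow> 'a \<Rightarrow> 'b \<Rightarrow> ('a \<times> 'b \<Rightarrow> 'r) set"
  where "pure_tensor R A B a b =
    tensor_rels R A B +>\<^bsub>free_module R (carrier A \<times> carrier B)\<^esub> free_unit R (a, b)"

text \<open>The generating set in \<open>tensor_rels\<close>, named so that claims about the relations reduce to its four
  kinds of members.\<close>

definition tensor_gens ::
    "('r, 'x) ring_scheme \<Rightarrow> ('r, 'a, 'c) module_scheme \<Rightarrow> ('r, 'b, 'd) module_scheme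
      \<Rightarrow> ('a \<times> 'b \<Rightarrow> 'r) set"
  where "tensor_gens R A B =
    (let F = free_module R (carrier A \<times> carrier B); e = free_unit R in
      ({e (a \<oplus>\<^bsub>A\<^esub> a', b) \<ominus>\<^bsub>F\<^esub> (e (a, b) \<oplus>\<^bsub>F\<^esub> e (a', b)) | a a' b.
          a \<in> carrier A \<and> a' \<in> carrier A \<and> b \<in> carrier B} \<union>
       {e (a, b \<oplus>\<^bsub>B\<^esub> b') \<ominus>\<^bsub>F\<^esub> (e (a, b) \<oplus>\<^bsub>F\<^esub> e (a, b')) | a b b'.
          a \<in> carrier A \<and> b \<in> carrier B \<and> b' \<in> carrier B} \<union>
       {e (r \<odot>\<^bsub>A\<^esub> a, b) \<ominus>\<^bsub>F\<^esub> r \<odot>\<^bsub>F\<^esub> e (a, b) | r a b.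
          r \<in> carrier R \<and> a \<in> carrier A \<and> b \<in> carrier B} \<union>
       {e (a, r \<odot>\<^bsub>B\<^esub> b) \<ominus>\<^bsub>F\<^esub> r \<odot>\<^bsub>F\<^esub> e (a, b) | r a b.
          r \<in> carrier R \<and> a \<in> carrier A \<and> b \<in> carrier B}))"

lemma tensor_rels_gens: "tensor_rels R A B = submodule_span R (free_module R (carrier A \<times> carrier B)) (tensor_gens R A B)"
  by (simp add: tensor_rels_def tensor_gens_def Let_def)

lemma tensor_gensI:
  fixes R A B
  defines "F \<equiv> free_module R (carrier A \<times> carrier B)"
  shows "\<lbrakk>a \<in> carrier A; a' \<in> carrier A; b \<in> carrier B\<rbrakk> \<Longrightarrow>
      free_unit R (a \<oplus>\<^bsub>A\<^esub> a', b) \<ominus>\<^bsub>F\<^esub> (free_unit R (a, b) \<oplus>\<^bsub>F\<^esub> free_unit R (a', b)) \<in> tensor_gens R A B"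
    and "\<lbrakk>a \<in> carrier A; b \<in> carrier B; b' \<in> carrier B\<rbrakk> \<Longrightarrow>
      free_unit R (a, b \<oplus>\<^bsub>B\<^esub> b') \<ominus>\<^bsub>F\<^esub> (free_unit R (a, b) \<oplus>\<^bsub>F\<^esub> free_unit R (a, b')) \<in> tensor_gens R A B"
    and "\<lbrakk>r \<in> carrier R; a \<in> carrier A; b \<in> carrier B\<rbrakk> \<Longrightarrow>
      free_unit R (r \<odot>\<^bsub>A\<^esub> a, b) \<ominus>\<^bsub>F\<^esub> r \<odot>\<^bsub>F\<^esub> free_unit R (a, b) \<in> tensor_gens R A B"
    and "\<lbrakk>r \<in> carrier R; a \<in> carrier A; b \<in> carrier B\<rbrakk> \<Longrightarrow>
      free_unit R (a, r \<odot>\<^bsub>B\<^esub> b) \<ominus>\<^bsub>F\<^esub> r \<odot>\<^bsub>F\<^esub> free_unit R (a, b) \<in> tensor_gens R A B"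
  unfolding tensor_gens_def Let_def F_def by blast+

lemma tensor_gensE:
  fixes R A B
  defines "F \<equiv> free_module R (carrier A \<times> carrier B)"
  assumes "g \<in> tensor_gens R A B"
  obtains (add_left) a a' b where "a \<in> carrier A" "a' \<in> carrier A" "b \<in> carrier B"
      "g = free_unit R (a \<oplus>\<^bsub>A\<^esub> a', b) \<ominus>\<^bsub>F\<^esub> (free_unit R (a, b) \<oplus>\<^bsub>F\<^esub> free_unit R (a', b))"
    | (add_right) a b b' where "a \<in> carrier A" "b \<in> carrier B" "b' \<in> carrier B"
      "g = free_unit R (a, b \<oplus>\<^bsub>B\<^esub> b') \<ominus>\<^bsub>F\<^esub> (free_unit R (a, b) \<oplus>\<^bsub>F\<^esub> free_unit R (a, b'))"
    | (smult_left) r a b where "r \<in> carrier R" "a \<in> carrier A" "b \<in> carrier B"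
      "g = free_unit R (r \<odot>\<^bsub>A\<^esub> a, b) \<ominus>\<^bsub>F\<^esub> r \<odot>\<^bsub>F\<^esub> free_unit R (a, b)"
    | (smult_right) r a b where "r \<in> carrier R" "a \<in> carrier A" "b \<in> carrier B"
      "g = free_unit R (a, r \<odot>\<^bsub>B\<^esub> b) \<ominus>\<^bsub>F\<^esub> r \<odot>\<^bsub>F\<^esub> free_unit R (a, b)"
  using assms(2) unfolding tensor_gens_def Let_def F_def by blast

definition bilinear ::
    "('r, 'x) ring_scheme \<Rightarrow> ('r, 'a, 'c) module_scheme \<Rightarrow> ('r, 'b, 'd) module_scheme
      \<Rightarrow> ('r, 'g, 'e) module_scheme \<Rightarrow> ('a \<Rightarrow> 'b \<Rightarrow> 'g) \<Rightarrow> bool"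
  where "bilinear R A B G \<beta> \<longleftrightarrow>
    (\<forall>a\<in>carrier A. (\<lambda>b. \<beta> a b) \<in> mod_hom R B G) \<and> (\<forall>b\<in>carrier B. (\<lambda>a. \<beta> a b) \<in> mod_hom R A G)"

definition tensor_lift ::
    "('r, 'x) ring_scheme \<Rightarrow> ('r, 'g, 'e) module_scheme \<Rightarrow> ('a \<Rightarrow> 'b \<Rightarrow> 'g) \<Rightarrow> ('a \<times> 'b \<Rightarrow> 'r) set \<Rightarrow> 'g"
  where "tensor_lift R G \<beta> = quot_lift (free_lift R G (\<lambda>(a, b). \<beta> a b))"

lemma bilinearI:
  "\<lbrakk>\<And>a. a \<in> carrier A \<Longrightarrow> (\<lambda>b. \<beta> a b) \<in> mod_hom R B G;
    \<And>b. b \<in> carrier B \<Longrightarrow> (\<lambda>a. \<beta> a b) \<in> mod_hom R A G\<rbrakk> \<Longrightarrow> bilinear R A B G \<beta>"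
  by (simp add: bilinear_def)

context
  fixes R :: "('r, 'x) ring_scheme" and A :: "('r, 'a, 'c) module_scheme" and B :: "('r, 'b, 'd) module_scheme"
  assumes A: "module R A" and B: "module R B"
begin

interpretation A: module R A by (rule A)
interpretation B: module R B by (rule B)

lemma tensor_free_module: "module R (free_module R (carrier A \<times> carrier B))"
  by (rule free_module_module[OF A.R.is_cring])

lemma pair_unit: "\<lbrakk>a \<in> carrier A; b \<in> carrier B\<rbrakk> \<Longrightarrow> free_unit R (a, b) \<in> carrier (free_module R (carrier A \<times> carrier B))"
  by (rule free_unit_carrier[OF A.R.is_cring]) simp

lemma tensor_gens_carrier: "tensor_gens R A B \<subseteq> carrier (free_module R (carrier A \<times> carrier B))"
proof
  fix g assume "g \<in> tensor_gens R A B"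
  then show "g \<in> carrier (free_module R (carrier A \<times> carrier B))"
    by (cases rule: tensor_gensE) (simp_all add: module_closed(1-5)[OF tensor_free_module] pair_unit)
qed

lemma tensor_rels_submodule: "submodule (tensor_rels R A B) R (free_module R (carrier A \<times> carrier B))"
  unfolding tensor_rels_gens by (rule submodule_span_submodule[OF tensor_free_module tensor_gens_carrier])

lemma tensor_module: "module R (tensor R A B)"
  unfolding tensor_def by (rule quot_module[OF tensor_free_module tensor_rels_submodule])

lemma pure_closed: "\<lbrakk>a \<in> carrier A; b \<in> carrier B\<rbrakk> \<Longrightarrow> pure_tensor R A B a b \<in> carrier (tensor R A B)"
  unfolding tensor_def pure_tensor_def quot_carrier by (rule imageI) (rule pair_unit)

lemma tensor_gen_in: "g \<in> tensor_gens R A B \<Longrightarrow> g \<in> tensor_rels R A B"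
  unfolding tensor_rels_gens by (rule subsetD[OF submodule_span_incl])

lemmas tensor_quot = tensor_free_module tensor_rels_submodule

lemma pure_bilinear: "bilinear R A B (tensor R A B) (pure_tensor R A B)"
proof -
  note cl = module_closed(1-5)[OF tensor_free_module] pair_unit
  show ?thesis
  proof (rule bilinearI; rule mod_homI)
    fix a b b' assume x: "a \<in> carrier A" "b \<in> carrier B" "b' \<in> carrier B"
    show "pure_tensor R A B a (b \<oplus>\<^bsub>B\<^esub> b') = pure_tensor R A B a b \<oplus>\<^bsub>tensor R A B\<^esub> pure_tensor R A B a b'"
      unfolding pure_tensor_def tensor_def
      by (simp add: quot_add[OF tensor_quot] coset_eq_iff[OF tensor_quot] x cl tensor_gen_in tensor_gensI)
  next
    fix a b r assume x: "a \<in> carrier A" "b \<in> carrier B" "r \<in> carrier R"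
    show "pure_tensor R A B a (r \<odot>\<^bsub>B\<^esub> b) = r \<odot>\<^bsub>tensor R A B\<^esub> pure_tensor R A B a b"
      unfolding pure_tensor_def tensor_def
      by (simp add: quot_smult[OF tensor_quot] coset_eq_iff[OF tensor_quot] x cl tensor_gen_in tensor_gensI)
  next
    fix b a a' assume x: "b \<in> carrier B" "a \<in> carrier A" "a' \<in> carrier A"
    show "pure_tensor R A B (a \<oplus>\<^bsub>A\<^esub> a') b = pure_tensor R A B a b \<oplus>\<^bsub>tensor R A B\<^esub> pure_tensor R A B a' b"
      unfolding pure_tensor_def tensor_def
      by (simp add: quot_add[OF tensor_quot] coset_eq_iff[OF tensor_quot] x cl tensor_gen_in tensor_gensI)
  next
    fix b a r assume x: "b \<in> carrier B" "a \<in> carrier A" "r \<in> carrier R"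
    show "pure_tensor R A B (r \<odot>\<^bsub>A\<^esub> a) b = r \<odot>\<^bsub>tensor R A B\<^esub> pure_tensor R A B a b"
      unfolding pure_tensor_def tensor_def
      by (simp add: quot_smult[OF tensor_quot] coset_eq_iff[OF tensor_quot] x cl tensor_gen_in tensor_gensI)
  qed (auto intro: pure_closed)
qed

lemma pure_hom_right: "a \<in> carrier A \<Longrightarrow> (\<lambda>b. pure_tensor R A B a b) \<in> mod_hom R B (tensor R A B)"
  using pure_bilinear by (auto simp: bilinear_def)
lemma pure_hom_left: "b \<in> carrier B \<Longrightarrow> (\<lambda>a. pure_tensor R A B a b) \<in> mod_hom R A (tensor R A B)"
  using pure_bilinear by (auto simp: bilinear_def)

lemma tensor_induct:
  assumes "submodule H R (tensor R A B)"
    and "\<And>a b. \<lbrakk>a \<in> carrier A; b \<in> carrier B\<rbrakk> \<Longrightarrow> pure_tensor R A B a b \<in> H"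
    and "z \<in> carrier (tensor R A B)"
  shows "z \<in> H"
proof -
  let ?F = "free_module R (carrier A \<times> carrier B)"
  obtain \<phi> where \<phi>: "\<phi> \<in> carrier ?F" "z = tensor_rels R A B +>\<^bsub>?F\<^esub> \<phi>"
    using assms(3) unfolding tensor_def by (rule quot_carrierE)
  have "\<phi> \<in> {\<phi> \<in> carrier ?F. tensor_rels R A B +>\<^bsub>?F\<^esub> \<phi> \<in> H}"
    using assms(2) pair_unit
    by (intro free_induct[OF A.R.is_cring preimage_submodule[OF tensor_free_module tensor_module[unfolded tensor_def]
        quot_proj_hom[OF tensor_quot] assms(1)[unfolded tensor_def]] _ \<phi>(1)])
      (auto simp: pure_tensor_def)
  then show ?thesis using \<phi> by auto
qed

lemma tensor_hom_eqI:
  assumes "module R G" "f \<in> mod_hom R (tensor R A B) G" "g \<in> mod_hom R (tensor R A B) G"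
    and "\<And>a b. \<lbrakk>a \<in> carrier A; b \<in> carrier B\<rbrakk> \<Longrightarrow> f (pure_tensor R A B a b) = g (pure_tensor R A B a b)"
    and "z \<in> carrier (tensor R A B)"
  shows "f z = g z"
  using tensor_induct[OF equalizer_submodule[OF tensor_module assms(1-3)] _ assms(5)] assms(4) pure_closed by auto

context
  fixes G :: "('r, 'g, 'e) module_scheme" and \<beta> :: "'a \<Rightarrow> 'b \<Rightarrow> 'g"
  assumes G: "module R G" and \<beta>: "bilinear R A B G \<beta>"
begin

interpretation G: module R G by (rule G)

lemma bilinear_lift_hom:
  "free_lift R G (\<lambda>(a, b). \<beta> a b) \<in> mod_hom R (free_module R (carrier A \<times> carrier B)) G"
  using \<beta> by (intro free_lift_hom[OF G]) (auto simp: bilinear_def mod_hom_closed)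

lemma bilinear_lift_unit:
  assumes "a \<in> carrier A" "b \<in> carrier B"
  shows "free_lift R G (\<lambda>(a, b). \<beta> a b) (free_unit R (a, b)) = \<beta> a b"
  using \<beta> assms free_lift_unit[OF G, of "\<lambda>(a, b). \<beta> a b" "(a, b)"] by (auto simp: bilinear_def mod_hom_closed)

lemma bilinear_kills_rels:
  assumes "x \<in> tensor_rels R A B"
  shows "free_lift R G (\<lambda>(a, b). \<beta> a b) x = \<zero>\<^bsub>G\<^esub>"
proof -
  let ?f = "free_lift R G (\<lambda>(a, b). \<beta> a b)" and ?F = "free_module R (carrier A \<times> carrier B)"
  note h = bilinear_lift_hom
  note cl = module_closed(1-5)[OF tensor_free_module] pair_unit
  have b1: "\<And>a. a \<in> carrier A \<Longrightarrow> (\<lambda>b. \<beta> a b) \<in> mod_hom R B G"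
   and b2: "\<And>b. b \<in> carrier B \<Longrightarrow> (\<lambda>a. \<beta> a b) \<in> mod_hom R A G" using \<beta> by (auto simp: bilinear_def)
  have "tensor_gens R A B \<subseteq> a_kernel ?F G ?f"
  proof
    fix g assume g: "g \<in> tensor_gens R A B"
    then have "?f g = \<zero>\<^bsub>G\<^esub>"
      by (cases rule: tensor_gensE)
        (simp_all add: mod_hom_minus[OF tensor_free_module G h] mod_hom_add[OF h] mod_hom_smult[OF h] cl
          bilinear_lift_unit mod_hom_add[OF b1] mod_hom_add[OF b2] mod_hom_smult[OF b1] mod_hom_smult[OF b2]
          module_minus_eq_zero_iff[OF G] mod_hom_closed[OF b1])
    then show "g \<in> a_kernel ?F G ?f" using g tensor_gens_carrier by (auto simp: a_kernel_iff)
  qed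
  then have "tensor_rels R A B \<subseteq> a_kernel ?F G ?f" unfolding tensor_rels_gens
    by (rule submodule_span_least[OF kernel_submodule[OF tensor_free_module G h]])
  then show ?thesis using assms by (auto simp: a_kernel_iff)
qed

lemma tensor_lift_hom: "tensor_lift R G \<beta> \<in> mod_hom R (tensor R A B) G"
  unfolding tensor_lift_def tensor_def
  by (rule quot_lift_hom[OF tensor_quot G bilinear_lift_hom bilinear_kills_rels])

lemma tensor_lift_pure:
  "\<lbrakk>a \<in> carrier A; b \<in> carrier B\<rbrakk> \<Longrightarrow> tensor_lift R G \<beta> (pure_tensor R A B a b) = \<beta> a b"
  unfolding tensor_lift_def pure_tensor_def
  by (subst quot_lift_coset[OF tensor_quot G bilinear_lift_hom bilinear_kills_rels])
    (auto intro: pair_unit simp: bilinear_lift_unit)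

end

end

context
  fixes R :: "('r, 'x) ring_scheme" and A :: "('r, 'a, 'c) module_scheme" and B :: "('r, 'b, 'd) module_scheme"
    and A' :: "('r, 'a1, 'c1) module_scheme" and B' :: "('r, 'b1, 'd1) module_scheme" and f g
  assumes A: "module R A" and B: "module R B" and A': "module R A'" and B': "module R B'"
    and f: "f \<in> mod_hom R A A'" and g: "g \<in> mod_hom R B B'"
begin

interpretation A: module R A by (rule A)
interpretation B: module R B by (rule B)

lemma push_rels:
  shows "free_push R (map_prod f g) \<in> mod_hom R (free_module R (carrier A \<times> carrier B)) (free_module R (carrier A' \<times> carrier B'))"
    and "free_push R (map_prod f g) ` tensor_rels R A B \<subseteq> tensor_rels R A' B'"
proof -
  let ?F = "free_module R (carrier A \<times> carrier B)" and ?F' = "free_module R (carrier A' \<times> carrier B')"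
  let ?p = "free_push R (map_prod f g)"
  note m = tensor_free_module[OF A B] tensor_free_module[OF A' B']
  show h: "?p \<in> mod_hom R ?F ?F'"
    using mod_hom_closed[OF f] mod_hom_closed[OF g] by (intro free_push_hom[OF A.R.is_cring]) auto
  note cl = module_closed(1-5)[OF m(1)] pair_unit[OF A B]
  have "tensor_gens R A B \<subseteq> {x \<in> carrier ?F. ?p x \<in> tensor_rels R A' B'}"
  proof
    fix x assume x: "x \<in> tensor_gens R A B"
    then have "?p x \<in> tensor_gens R A' B'"
      by (cases rule: tensor_gensE)
        (simp_all add: mod_hom_minus[OF m h] mod_hom_add[OF h] mod_hom_smult[OF h] cl
         free_push_unit[OF A.R.is_cring] mod_hom_add[OF f] mod_hom_add[OF g] mod_hom_smult[OF f] mod_hom_smult[OF g]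
         tensor_gensI mod_hom_closed[OF f] mod_hom_closed[OF g])
    then show "x \<in> {x \<in> carrier ?F. ?p x \<in> tensor_rels R A' B'}"
      using x tensor_gens_carrier[OF A B] tensor_gen_in[OF A' B'] by auto
  qed
  then have "tensor_rels R A B \<subseteq> {x \<in> carrier ?F. ?p x \<in> tensor_rels R A' B'}"
    unfolding tensor_rels_gens[of R A B]
    by (rule submodule_span_least[OF preimage_submodule[OF m h tensor_rels_submodule[OF A' B']]])
  then show "?p ` tensor_rels R A B \<subseteq> tensor_rels R A' B'" by auto
qed

lemma tensor_map_hom: "tensor_map R A' B' f g \<in> mod_hom R (tensor R A B) (tensor R A' B')"
  unfolding tensor_map_def tensor_def
  by (rule coset_map_hom[OF tensor_quot[OF A B] tensor_quot[OF A' B'] push_rels])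

lemma tensor_map_pure:
  assumes "a \<in> carrier A" "b \<in> carrier B"
  shows "tensor_map R A' B' f g (pure_tensor R A B a b) = pure_tensor R A' B' (f a) (g b)"
  unfolding tensor_map_def pure_tensor_def
  by (subst coset_map_coset[OF tensor_quot[OF A B] tensor_quot[OF A' B'] push_rels])
    (auto simp: free_push_unit[OF A.R.is_cring] pair_unit[OF A B assms])

end


section \<open>Baer's criterion and the Matlis dual\<close>

lemma ideal_iff_submodule:
  assumes "cring R"
  shows "ideal I R \<longleftrightarrow> submodule I R (ring_module R)"
proof -
  interpret cring R by fact
  interpret M: module R "ring_module R" by (rule ring_module_module[OF assms])
  show ?thesis
  proof
    assume "ideal I R"
    then interpret I: ideal I R .
    show "submodule I R (ring_module R)"
      by (rule submodule_criterion[OF M.module_axioms]) (auto simp: ring_module_simps I.I_l_closed dest: I.Icarr)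
  next
    assume s: "submodule I R (ring_module R)"
    note c = submodule_closed[OF s, unfolded ring_module_simps]
    have sub: "I \<subseteq> carrier R" using submodule_sub[OF s] by (simp add: ring_module_simps)
    have neg: "\<ominus>\<^bsub>R\<^esub> x \<in> I" if "x \<in> I" for x
      using submodule_neg[OF s that] ring_module_neg[OF assms, of x] sub that by auto
    show "ideal I R"
    proof (rule idealI[OF ring_axioms])
      show "subgroup I (add_monoid R)"
        using sub c(1,2) neg
        by (intro add.subgroupI) (auto simp flip: a_inv_def)
      show "x \<otimes>\<^bsub>R\<^esub> a \<in> I" if "a \<in> I" "x \<in> carrier R" for a x using that c(5) by auto
      then show "a \<otimes>\<^bsub>R\<^esub> x \<in> I" if "a \<in> I" "x \<in> carrier R" for a x using that sub m_comm by (metis subsetD)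
    qed
  qed
qed

text \<open>A homomorphism from \<open>R\<close> is multiplication by the image of \<open>1\<close>, so \<open>j\<close> is an extension of \<open>g\<close> from
  \<open>I\<close> to \<open>R\<close>.  In contrast to injectivity this condition involves no modules of other types, and by
  \<open>baer_extend\<close> it implies the extension property for modules of all types.\<close>

definition baer :: "('r, 'x) ring_scheme \<Rightarrow> ('r, 'j, 'c) module_scheme \<Rightarrow> bool"
  where "baer R J \<longleftrightarrow> module R J \<and>
    (\<forall>I g. ideal I R \<and> g \<in> mod_hom R ((ring_module R)\<lparr>carrier := I\<rparr>) J \<longrightarrow>
       (\<exists>j\<in>carrier J. \<forall>a\<in>I. g a = a \<odot>\<^bsub>J\<^esub> j))"

lemma baer_module: "baer R J \<Longrightarrow> module R J"
  by (simp add: baer_def)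

text \<open>A partial homomorphism is represented by its graph, so that the union of a chain of partial
  homomorphisms is a union of sets.  Uniqueness of values only needs to be required at zero.\<close>

definition linear_graph ::
    "('r, 'x) ring_scheme \<Rightarrow> ('r, 'b, 'c) module_scheme \<Rightarrow> ('r, 'j, 'd) module_scheme \<Rightarrow> ('b \<times> 'j) set \<Rightarrow> bool"
  where "linear_graph R B J G \<longleftrightarrow> G \<subseteq> carrier B \<times> carrier J \<and>
    (\<forall>x y x' y'. (x, y) \<in> G \<and> (x', y') \<in> G \<longrightarrow> (x \<oplus>\<^bsub>B\<^esub> x', y \<oplus>\<^bsub>J\<^esub> y') \<in> G) \<and>
    (\<forall>r\<in>carrier R. \<forall>x y. (x, y) \<in> G \<longrightarrow> (r \<odot>\<^bsub>B\<^esub> x, r \<odot>\<^bsub>J\<^esub> y) \<in> G) \<and>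
    (\<forall>y. (\<zero>\<^bsub>B\<^esub>, y) \<in> G \<longrightarrow> y = \<zero>\<^bsub>J\<^esub>)"

lemma linear_graph_unique:
  assumes "module R B" "module R J" "linear_graph R B J G" "(x, y) \<in> G" "(x, y') \<in> G"
  shows "y = y'"
proof -
  interpret B: module R B by fact
  interpret J: module R J by fact
  have c: "x \<in> carrier B" "y \<in> carrier J" "y' \<in> carrier J" using assms(3-5) by (auto simp: linear_graph_def)
  have "((\<ominus>\<^bsub>R\<^esub> \<one>\<^bsub>R\<^esub>) \<odot>\<^bsub>B\<^esub> x, (\<ominus>\<^bsub>R\<^esub> \<one>\<^bsub>R\<^esub>) \<odot>\<^bsub>J\<^esub> y') \<in> G"
    using assms(3,5) B.R.a_inv_closed[OF B.R.one_closed] unfolding linear_graph_def by blast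
  then have "(x \<oplus>\<^bsub>B\<^esub> (\<ominus>\<^bsub>R\<^esub> \<one>\<^bsub>R\<^esub>) \<odot>\<^bsub>B\<^esub> x, y \<oplus>\<^bsub>J\<^esub> (\<ominus>\<^bsub>R\<^esub> \<one>\<^bsub>R\<^esub>) \<odot>\<^bsub>J\<^esub> y') \<in> G"
    using assms(3,4) unfolding linear_graph_def by blast
  then have "(\<zero>\<^bsub>B\<^esub>, y \<ominus>\<^bsub>J\<^esub> y') \<in> G"
    using c by (simp add: module_neg_smult[OF assms(1), symmetric] module_neg_smult[OF assms(2), symmetric] B.M.r_neg a_minus_def)
  then have "y \<ominus>\<^bsub>J\<^esub> y' = \<zero>\<^bsub>J\<^esub>" using assms(3) unfolding linear_graph_def by blast
  then show ?thesis using c module_minus_eq_zero_iff[OF assms(2)] by auto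
qed

text \<open>One step of the extension: if \<open>x\<close> is outside the domain of a partial homomorphism \<open>G\<close>, the
  multipliers \<open>r\<close> with \<open>r x\<close> in the domain form an ideal, and the value at \<open>x\<close> is dictated by
  Baer's condition for that ideal.\<close>

lemma baer_extend_step:
  assumes "baer R J" "module R B" "linear_graph R B J G" "G \<noteq> {}" "x \<in> carrier B"
  obtains G' where "linear_graph R B J G'" "G \<subseteq> G'" "x \<in> Domain G'"
proof -
  have mJ: "module R J" by (rule baer_module[OF assms(1)])
  interpret B: module R B by fact
  interpret J: module R J by (rule mJ)
  have Gc: "\<And>u v. (u, v) \<in> G \<Longrightarrow> u \<in> carrier B \<and> v \<in> carrier J"
   and Ga: "\<And>u v u' v'. (u, v) \<in> G \<Longrightarrow> (u', v') \<in> G \<Longrightarrow> (u \<oplus>\<^bsub>B\<^esub> u', v \<oplus>\<^bsub>J\<^esub> v') \<in> G"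
   and Gs: "\<And>r u v. r \<in> carrier R \<Longrightarrow> (u, v) \<in> G \<Longrightarrow> (r \<odot>\<^bsub>B\<^esub> u, r \<odot>\<^bsub>J\<^esub> v) \<in> G"
   and Gz: "\<And>v. (\<zero>\<^bsub>B\<^esub>, v) \<in> G \<Longrightarrow> v = \<zero>\<^bsub>J\<^esub>"
    using assms(3) unfolding linear_graph_def by blast+
  obtain u0 v0 where uv0: "(u0, v0) \<in> G" using assms(4) by auto
  have G0: "(\<zero>\<^bsub>B\<^esub>, \<zero>\<^bsub>J\<^esub>) \<in> G" using Gs[OF B.R.zero_closed uv0] Gc[OF uv0] by simp
  note U = linear_graph_unique[OF assms(2) mJ assms(3)]
  define I where "I = {r \<in> carrier R. r \<odot>\<^bsub>B\<^esub> x \<in> Domain G}"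
  define g where "g r = (THE y. (r \<odot>\<^bsub>B\<^esub> x, y) \<in> G)" for r
  have g: "g r = y" if "(r \<odot>\<^bsub>B\<^esub> x, y) \<in> G" for r y
    unfolding g_def using that U by blast
  have Icl: "r \<oplus>\<^bsub>R\<^esub> r' \<in> I \<and> g (r \<oplus>\<^bsub>R\<^esub> r') = g r \<oplus>\<^bsub>J\<^esub> g r'" if rr: "r \<in> I" "r' \<in> I" for r r'
  proof -
    obtain y y' where y: "(r \<odot>\<^bsub>B\<^esub> x, y) \<in> G" "(r' \<odot>\<^bsub>B\<^esub> x, y') \<in> G" "r \<in> carrier R" "r' \<in> carrier R"
      using rr unfolding I_def by blast
    have "((r \<oplus>\<^bsub>R\<^esub> r') \<odot>\<^bsub>B\<^esub> x, y \<oplus>\<^bsub>J\<^esub> y') \<in> G" using Ga[OF y(1,2)] y(3,4) assms(5) by (simp add: B.smult_l_distr)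
    then show ?thesis using y by (auto simp: I_def g)
  qed
  have Isc: "s \<otimes>\<^bsub>R\<^esub> r \<in> I \<and> g (s \<otimes>\<^bsub>R\<^esub> r) = s \<odot>\<^bsub>J\<^esub> g r" if rs: "r \<in> I" "s \<in> carrier R" for r s
  proof -
    obtain y where y: "(r \<odot>\<^bsub>B\<^esub> x, y) \<in> G" "r \<in> carrier R"
      using rs unfolding I_def by blast
    have "((s \<otimes>\<^bsub>R\<^esub> r) \<odot>\<^bsub>B\<^esub> x, s \<odot>\<^bsub>J\<^esub> y) \<in> G" using Gs[OF rs(2) y(1)] y(2) rs assms(5) by (simp add: B.smult_assoc1)
    then show ?thesis using y rs by (auto simp: I_def g)
  qed
  have subm: "submodule I R (ring_module R)"
    using Icl Isc G0 assms(5) B.R.zero_closed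
    by (intro submodule_criterion[OF ring_module_module[OF B.R.is_cring]])
      (auto simp: ring_module_simps, auto simp: I_def)
  have gI: "g r \<in> carrier J" if "r \<in> I" for r using that g Gc by (auto simp: I_def)
  have "g \<in> mod_hom R ((ring_module R)\<lparr>carrier := I\<rparr>) J"
    by (rule mod_homI) (use Icl Isc gI in \<open>auto simp: ring_module_simps\<close>)
  then obtain j where j: "j \<in> carrier J" "\<And>a. a \<in> I \<Longrightarrow> g a = a \<odot>\<^bsub>J\<^esub> j"
    using assms(1) subm ideal_iff_submodule[OF B.R.is_cring] unfolding baer_def by blast
  define G' where "G' = {(u \<oplus>\<^bsub>B\<^esub> r \<odot>\<^bsub>B\<^esub> x, v \<oplus>\<^bsub>J\<^esub> r \<odot>\<^bsub>J\<^esub> j) | u v r. (u, v) \<in> G \<and> r \<in> carrier R}"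
  have G'I: "(u \<oplus>\<^bsub>B\<^esub> r \<odot>\<^bsub>B\<^esub> x, v \<oplus>\<^bsub>J\<^esub> r \<odot>\<^bsub>J\<^esub> j) \<in> G'" if "(u, v) \<in> G" "r \<in> carrier R" for u v r
    unfolding G'_def using that by blast
  have "G \<subseteq> G'"
  proof
    fix z assume z: "z \<in> G"
    obtain u v where uv: "z = (u, v)" by (cases z)
    show "z \<in> G'" using G'I[of u v "\<zero>\<^bsub>R\<^esub>"] z Gc[of u v] j(1) assms(5) by (simp add: uv)
  qed
  moreover have "x \<in> Domain G'"
    using G'I[OF G0 B.R.one_closed] assms(5) by auto
  moreover have "linear_graph R B J G'"
    unfolding linear_graph_def
  proof (intro conjI allI ballI impI)
    show "G' \<subseteq> carrier B \<times> carrier J" using Gc j(1) assms(5) by (auto simp: G'_def)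
  next
    fix a b a' b' assume "(a, b) \<in> G' \<and> (a', b') \<in> G'"
    then obtain u v r u' v' r' where 1: "(u, v) \<in> G" "r \<in> carrier R" "a = u \<oplus>\<^bsub>B\<^esub> r \<odot>\<^bsub>B\<^esub> x" "b = v \<oplus>\<^bsub>J\<^esub> r \<odot>\<^bsub>J\<^esub> j"
      and 2: "(u', v') \<in> G" "r' \<in> carrier R" "a' = u' \<oplus>\<^bsub>B\<^esub> r' \<odot>\<^bsub>B\<^esub> x" "b' = v' \<oplus>\<^bsub>J\<^esub> r' \<odot>\<^bsub>J\<^esub> j"
      unfolding G'_def by blast
    have "a \<oplus>\<^bsub>B\<^esub> a' = (u \<oplus>\<^bsub>B\<^esub> u') \<oplus>\<^bsub>B\<^esub> (r \<oplus>\<^bsub>R\<^esub> r') \<odot>\<^bsub>B\<^esub> x" "b \<oplus>\<^bsub>J\<^esub> b' = (v \<oplus>\<^bsub>J\<^esub> v') \<oplus>\<^bsub>J\<^esub> (r \<oplus>\<^bsub>R\<^esub> r') \<odot>\<^bsub>J\<^esub> j"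
      using 1 2 Gc[OF 1(1)] Gc[OF 2(1)] assms(5) j(1)
      by (auto simp: B.smult_l_distr J.smult_l_distr B.M.a_ac J.M.a_ac)
    then show "(a \<oplus>\<^bsub>B\<^esub> a', b \<oplus>\<^bsub>J\<^esub> b') \<in> G'" using G'I[OF Ga[OF 1(1) 2(1)] B.R.a_closed[OF 1(2) 2(2)]] by simp
  next
    fix s a b assume s: "s \<in> carrier R" and "(a, b) \<in> G'"
    then obtain u v r where 1: "(u, v) \<in> G" "r \<in> carrier R" "a = u \<oplus>\<^bsub>B\<^esub> r \<odot>\<^bsub>B\<^esub> x" "b = v \<oplus>\<^bsub>J\<^esub> r \<odot>\<^bsub>J\<^esub> j"
      unfolding G'_def by blast
    have "s \<odot>\<^bsub>B\<^esub> a = s \<odot>\<^bsub>B\<^esub> u \<oplus>\<^bsub>B\<^esub> (s \<otimes>\<^bsub>R\<^esub> r) \<odot>\<^bsub>B\<^esub> x" "s \<odot>\<^bsub>J\<^esub> b = s \<odot>\<^bsub>J\<^esub> v \<oplus>\<^bsub>J\<^esub> (s \<otimes>\<^bsub>R\<^esub> r) \<odot>\<^bsub>J\<^esub> j"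
      using 1 s Gc[OF 1(1)] assms(5) j(1)
      by (auto simp: B.smult_r_distr J.smult_r_distr B.smult_assoc1 J.smult_assoc1)
    then show "(s \<odot>\<^bsub>B\<^esub> a, s \<odot>\<^bsub>J\<^esub> b) \<in> G'" using G'I[OF Gs[OF s 1(1)] B.R.m_closed[OF s 1(2)]] by simp
  next
    fix b assume "(\<zero>\<^bsub>B\<^esub>, b) \<in> G'"
    then obtain u v r where 1: "(u, v) \<in> G" "r \<in> carrier R" "\<zero>\<^bsub>B\<^esub> = u \<oplus>\<^bsub>B\<^esub> r \<odot>\<^bsub>B\<^esub> x" "b = v \<oplus>\<^bsub>J\<^esub> r \<odot>\<^bsub>J\<^esub> j"
      unfolding G'_def by blast
    have uv: "u \<in> carrier B" "v \<in> carrier J" using Gc[OF 1(1)] by auto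
    have "r \<odot>\<^bsub>B\<^esub> x = \<ominus>\<^bsub>B\<^esub> u"
      using 1(2,3) uv assms(5) by (metis B.M.a_comm B.M.minus_equality B.smult_closed)
    then have "(r \<odot>\<^bsub>B\<^esub> x, \<ominus>\<^bsub>J\<^esub> v) \<in> G"
      using Gs[OF B.R.a_inv_closed[OF B.R.one_closed] 1(1)] uv
      by (simp add: module_neg_smult[OF assms(2), symmetric] module_neg_smult[OF mJ, symmetric])
    then have "r \<in> I" "g r = \<ominus>\<^bsub>J\<^esub> v" using 1(2) g by (auto simp: I_def)
    then show "b = \<zero>\<^bsub>J\<^esub>" using j(2)[of r] 1(4) uv by (simp add: J.M.r_neg)
  qed
  ultimately show ?thesis using that by blast
qed

text \<open>A homomorphism to \<open>J\<close> that vanishes on the kernel of \<open>f\<close> factors through \<open>f\<close>: take, by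
  Zorn's lemma, a maximal partial homomorphism that extends \<open>f x \<mapsto> \<phi> x\<close>.\<close>

theorem baer_extend:
  assumes "baer R J" "module R A" "module R B" "f \<in> mod_hom R A B" "\<phi> \<in> mod_hom R A J"
    and ker: "\<And>x. \<lbrakk>x \<in> carrier A; f x = \<zero>\<^bsub>B\<^esub>\<rbrakk> \<Longrightarrow> \<phi> x = \<zero>\<^bsub>J\<^esub>"
  obtains \<psi> where "\<psi> \<in> mod_hom R B J" "\<And>x. x \<in> carrier A \<Longrightarrow> \<psi> (f x) = \<phi> x"
proof -
  have mJ: "module R J" by (rule baer_module[OF assms(1)])
  define G0 where "G0 = (\<lambda>x. (f x, \<phi> x)) ` carrier A"
  have G0: "linear_graph R B J G0"
    unfolding linear_graph_def
  proof (intro conjI allI ballI impI)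
    have G0I: "x \<in> carrier A \<Longrightarrow> (f x, \<phi> x) \<in> G0" for x by (auto simp: G0_def)
    show "G0 \<subseteq> carrier B \<times> carrier J"
      using mod_hom_closed[OF assms(4)] mod_hom_closed[OF assms(5)] by (auto simp: G0_def)
    show "(x \<oplus>\<^bsub>B\<^esub> x', y \<oplus>\<^bsub>J\<^esub> y') \<in> G0" if xy: "(x, y) \<in> G0 \<and> (x', y') \<in> G0" for x y x' y'
    proof -
      obtain u u' where u: "u \<in> carrier A" "x = f u" "y = \<phi> u" "u' \<in> carrier A" "x' = f u'" "y' = \<phi> u'"
        using xy by (auto simp: G0_def)
      then show ?thesis using G0I[OF module_add_closed[OF assms(2) u(1,4)]]
        by (simp add: mod_hom_add[OF assms(4)] mod_hom_add[OF assms(5)])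
    qed
    show "(r \<odot>\<^bsub>B\<^esub> x, r \<odot>\<^bsub>J\<^esub> y) \<in> G0" if rx: "r \<in> carrier R" "(x, y) \<in> G0" for r x y
    proof -
      obtain u where u: "u \<in> carrier A" "x = f u" "y = \<phi> u" using rx(2) by (auto simp: G0_def)
      then show ?thesis using G0I[OF module_smult_closed[OF assms(2) rx(1) u(1)]] rx(1)
        by (simp add: mod_hom_smult[OF assms(4)] mod_hom_smult[OF assms(5)])
    qed
    show "y = \<zero>\<^bsub>J\<^esub>" if "(\<zero>\<^bsub>B\<^esub>, y) \<in> G0" for y
      using that ker by (auto simp: G0_def)
  qed
  have G0n: "G0 \<noteq> {}" using module_zero_closed[OF assms(2)] by (auto simp: G0_def)
  let ?\<A> = "{G. linear_graph R B J G \<and> G0 \<subseteq> G}"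
  have "\<exists>G\<in>?\<A>. \<forall>X\<in>?\<A>. G \<subseteq> X \<longrightarrow> X = G"
  proof (rule subset_Zorn_nonempty)
    show "?\<A> \<noteq> {}" using G0 by auto
  next
    fix C assume C: "C \<noteq> {}" "subset.chain ?\<A> C"
    have two: "\<exists>G\<in>C. p \<in> G \<and> q \<in> G" if pq: "p \<in> \<Union>C" "q \<in> \<Union>C" for p q
    proof -
      obtain P Q where PQ: "P \<in> C" "p \<in> P" "Q \<in> C" "q \<in> Q" using pq by blast
      then have "P \<subseteq> Q \<or> Q \<subseteq> P" using C(2) unfolding subset_chain_def by blast
      then show ?thesis using PQ by blast
    qed
    have lin: "linear_graph R B J G" "G0 \<subseteq> G" if "G \<in> C" for G using that C(2) by (auto simp: subset_chain_def)
    have "linear_graph R B J (\<Union>C)"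
      unfolding linear_graph_def
    proof (intro conjI allI ballI impI)
      show "\<Union>C \<subseteq> carrier B \<times> carrier J" using lin(1) unfolding linear_graph_def by (intro Union_least) blast
      show "(x \<oplus>\<^bsub>B\<^esub> x', y \<oplus>\<^bsub>J\<^esub> y') \<in> \<Union>C" if "(x, y) \<in> \<Union>C \<and> (x', y') \<in> \<Union>C" for x y x' y'
        using two[of "(x, y)" "(x', y')"] that lin(1) unfolding linear_graph_def by blast
      show "(r \<odot>\<^bsub>B\<^esub> x, r \<odot>\<^bsub>J\<^esub> y) \<in> \<Union>C" if "r \<in> carrier R" "(x, y) \<in> \<Union>C" for r x y
        using that lin(1) unfolding linear_graph_def by blast
      show "y = \<zero>\<^bsub>J\<^esub>" if "(\<zero>\<^bsub>B\<^esub>, y) \<in> \<Union>C" for y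
        using that lin(1) unfolding linear_graph_def by blast
    qed
    then show "\<Union>C \<in> ?\<A>" using lin(2) C(1) by auto
  qed
  then obtain G where G: "linear_graph R B J G" "G0 \<subseteq> G"
    and max: "\<And>X. linear_graph R B J X \<Longrightarrow> G \<subseteq> X \<Longrightarrow> X = G" by (auto dest: order_trans)
  have Gn: "G \<noteq> {}" using G(2) G0n by auto
  have dom: "\<exists>y. (x, y) \<in> G" if "x \<in> carrier B" for x
    using baer_extend_step[OF assms(1,3) G(1) Gn that] max by (metis DomainE)
  note U = linear_graph_unique[OF assms(3) mJ G(1)]
  define \<psi> where "\<psi> x = (THE y. (x, y) \<in> G)" for x
  have psi: "\<psi> x = y" if "(x, y) \<in> G" for x y unfolding \<psi>_def using that U by blast
  have psi_in: "(x, \<psi> x) \<in> G" if "x \<in> carrier B" for x using dom[OF that] psi by auto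
  have "\<psi> \<in> mod_hom R B J"
    using psi_in G(1) unfolding linear_graph_def by (intro mod_homI) (blast intro: psi)+
  moreover have "\<psi> (f x) = \<phi> x" if "x \<in> carrier A" for x
    using that G(2) by (intro psi) (auto simp: G0_def)
  ultimately show ?thesis using that by blast
qed

text \<open>A copy of a module in another type, along an injection \<open>h\<close> with left inverse \<open>k\<close>.  It moves ideals
  of \<open>R\<close> into the type of the test modules in \<open>injective_module\<close> and \<open>flat_module\<close>: the copy of
  \<open>a\<close> is the singleton of the constant sequence \<open>a\<close>.\<close>

definition transport_module :: "('a \<Rightarrow> 'b) \<Rightarrow> ('b \<Rightarrow> 'a) \<Rightarrow> ('r, 'a, 'c) module_scheme \<Rightarrow> ('r, 'b) module"
  where "transport_module h k M =
    \<lparr>carrier = h ` carrier M, monoid.mult = undefined, monoid.one = undefined,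
     ring.zero = h \<zero>\<^bsub>M\<^esub>, ring.add = (\<lambda>x y. h (k x \<oplus>\<^bsub>M\<^esub> k y)), smult = (\<lambda>r x. h (r \<odot>\<^bsub>M\<^esub> k x))\<rparr>"

lemma transport_module:
  assumes "module R M" "\<And>x. k (h x) = x"
  shows "module R (transport_module h k M)"
proof -
  interpret M: module R M by fact
  let ?T = "transport_module h k M"
  show ?thesis
  proof (rule moduleI[OF M.R.is_cring])
    show "abelian_group ?T"
    proof (rule abelian_groupI)
      fix x assume "x \<in> carrier ?T"
      then obtain a where "a \<in> carrier M" "x = h a" by (auto simp: transport_module_def)
      then show "\<exists>y\<in>carrier ?T. y \<oplus>\<^bsub>?T\<^esub> x = \<zero>\<^bsub>?T\<^esub>"
        by (intro bexI[of _ "h (\<ominus>\<^bsub>M\<^esub> a)"]) (auto simp: transport_module_def assms(2) M.M.l_neg)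
    qed (auto simp: transport_module_def assms(2) M.M.a_ac)
  qed (auto simp: transport_module_def assms(2) M.smult_l_distr M.smult_r_distr M.smult_assoc1)
qed

lemma transport_homs:
  assumes "\<And>x. k (h x) = x"
  shows "h \<in> mod_hom R M (transport_module h k M)" "k \<in> mod_hom R (transport_module h k M) M"
  using assms by (auto simp: mod_hom_def transport_module_def)

abbreviation seq_const :: "'r \<Rightarrow> (nat \<Rightarrow> 'r) set" where "seq_const a \<equiv> {\<lambda>_. a}"
abbreviation seq_dest :: "(nat \<Rightarrow> 'r) set \<Rightarrow> 'r" where "seq_dest Z \<equiv> the_elem Z 0"

lemma transport_seq: "seq_dest \<in> mod_hom R (transport_module seq_const seq_dest M) M"
  by (rule transport_homs(2)) simp

lemma injective_imp_baer:
  assumes "cring R" "injective_module R E"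
  shows "baer R E"
  unfolding baer_def
proof (intro conjI allI impI; (elim conjE)?)
  interpret cring R by fact
  show "module R E" using assms(2) by (simp add: injective_module_def)
  fix I g assume I: "ideal I R" and g: "g \<in> mod_hom R ((ring_module R)\<lparr>carrier := I\<rparr>) E"
  have s: "submodule I R (ring_module R)" using I ideal_iff_submodule[OF assms(1)] by simp
  let ?A = "transport_module seq_const seq_dest ((ring_module R)\<lparr>carrier := I\<rparr>)"
  let ?B = "transport_module seq_const seq_dest (ring_module R)"
  have k: "\<And>x. seq_dest (seq_const x) = x" by simp
  have m: "module R ?A" "module R ?B"
    by (intro transport_module k submodule_module ring_module_module assms s)+
  have f: "(\<lambda>x. x) \<in> mod_hom R ?A ?B"
    using submodule_sub[OF s] by (auto simp: mod_hom_def transport_module_def)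
  have g': "(\<lambda>x. g (seq_dest x)) \<in> mod_hom R ?A E"
    by (rule mod_hom_comp[OF transport_seq g])
  obtain h where h: "h \<in> mod_hom R ?B E" "\<And>x. x \<in> carrier ?A \<Longrightarrow> h x = g (seq_dest x)"
    using assms(2)[unfolded injective_module_def, THEN conjunct2, rule_format, of ?A ?B "\<lambda>x. x" "\<lambda>x. g (seq_dest x)"] m f g'
    by (auto simp: inj_on_def)
  have one: "seq_const \<one>\<^bsub>R\<^esub> \<in> carrier ?B" by (auto simp: transport_module_def ring_module_simps)
  show "\<exists>j\<in>carrier E. \<forall>a\<in>I. g a = a \<odot>\<^bsub>E\<^esub> j"
  proof (intro bexI[of _ "h (seq_const \<one>\<^bsub>R\<^esub>)"] ballI)
    fix a assume a: "a \<in> I"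
    then have ac: "a \<in> carrier R" using submodule_sub[OF s] by (auto simp: ring_module_simps)
    have "a \<odot>\<^bsub>E\<^esub> h (seq_const \<one>\<^bsub>R\<^esub>) = h (a \<odot>\<^bsub>?B\<^esub> seq_const \<one>\<^bsub>R\<^esub>)" by (rule mod_hom_smult[OF h(1) ac one, symmetric])
    also have "a \<odot>\<^bsub>?B\<^esub> seq_const \<one>\<^bsub>R\<^esub> = seq_const a" using ac by (simp add: transport_module_def ring_module_simps)
    also have "h (seq_const a) = g a" using h(2)[of "seq_const a"] a by (simp add: transport_module_def)
    finally show "g a = a \<odot>\<^bsub>E\<^esub> h (seq_const \<one>\<^bsub>R\<^esub>)" by simp
  qed (rule mod_hom_closed[OF h(1) one])
qed

lemma bilinear_of_hom:
  assumes "\<psi> \<in> mod_hom R A (Hom_mod R B G)"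
  shows "bilinear R A B G (\<lambda>a b. \<psi> a b)"
proof (rule bilinearI)
  show "(\<lambda>b. \<psi> a b) \<in> mod_hom R B G" if "a \<in> carrier A" for a
    using Hom_memD[OF mod_hom_closed[OF assms that]] by simp
  then show "(\<lambda>a. \<psi> a b) \<in> mod_hom R A G" if "b \<in> carrier B" for b
    using that mod_hom_add[OF assms] mod_hom_smult[OF assms]
    by (intro mod_homI) (auto simp: Hom_add Hom_smult dest: mod_hom_closed)
qed

lemma hom_of_bilinear:
  assumes "module R B" "module R G" "bilinear R A B G \<beta>"
  shows "(\<lambda>a. \<lambda>b\<in>carrier B. \<beta> a b) \<in> mod_hom R A (Hom_mod R B G)"
proof -
  have b: "\<And>a. a \<in> carrier A \<Longrightarrow> (\<lambda>b. \<beta> a b) \<in> mod_hom R B G"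
    "\<And>b. b \<in> carrier B \<Longrightarrow> (\<lambda>a. \<beta> a b) \<in> mod_hom R A G"
    using assms(3) by (auto simp: bilinear_def)
  show ?thesis
    using restrict_in_Hom[OF assms(1) b(1)] mod_hom_add[OF b(2)] mod_hom_smult[OF b(2)]
    by (intro mod_homI) (auto simp: Hom_mod_def fun_eq_iff)
qed

text \<open>For \<open>I\<close> an ideal, a homomorphism from \<open>I\<close> to \<open>Hom(F, E)\<close> is a homomorphism from
  \<open>I \<otimes> F \<subseteq> R \<otimes> F\<close> to \<open>E\<close>, which extends to \<open>R \<otimes> F\<close>.\<close>

lemma flat_imp_baer_dual:
  assumes E: "baer R E" and "flat_module R F"
  shows "baer R (Hom_mod R F E)"
  unfolding baer_def
proof (intro conjI allI impI; (elim conjE)?)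
  have mE: "module R E" by (rule baer_module[OF E])
  interpret E: module R E by (rule mE)
  have mF: "module R F" using assms(2) by (simp add: flat_module_def)
  show "module R (Hom_mod R F E)" by (rule Hom_module[OF mF mE])
  fix I g assume I: "ideal I R" and g: "g \<in> mod_hom R ((ring_module R)\<lparr>carrier := I\<rparr>) (Hom_mod R F E)"
  note R = E.R.is_cring
  have s: "submodule I R (ring_module R)" using I ideal_iff_submodule[OF R] by simp
  let ?A = "transport_module seq_const seq_dest ((ring_module R)\<lparr>carrier := I\<rparr>)"
  let ?B = "transport_module seq_const seq_dest (ring_module R)"
  have k: "\<And>x. seq_dest (seq_const x) = x" by simp
  have m: "module R ?A" "module R ?B"
    by (intro transport_module k submodule_module ring_module_module R s)+
  have f: "(\<lambda>x. x) \<in> mod_hom R ?A ?B"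
    using submodule_sub[OF s] by (auto simp: mod_hom_def transport_module_def)
  let ?t = "tensor_map R ?B F (\<lambda>x. x) (\<lambda>x. x)"
  have t: "?t \<in> mod_hom R (tensor R ?A F) (tensor R ?B F)"
    by (rule tensor_map_hom[OF m(1) mF m(2) mF f mod_hom_id])
  have inj: "inj_on ?t (carrier (tensor R ?A F))"
    using assms(2)[unfolded flat_module_def, THEN conjunct2, rule_format, of ?A ?B "\<lambda>x. x"] m f by (auto simp: inj_on_def)
  have bil: "bilinear R ?A F E (\<lambda>a x. g (seq_dest a) x)"
    by (rule bilinear_of_hom[OF mod_hom_comp[OF transport_seq g]])
  let ?l = "tensor_lift R E (\<lambda>a x. g (seq_dest a) x)"
  have l: "?l \<in> mod_hom R (tensor R ?A F) E" by (rule tensor_lift_hom[OF m(1) mF mE bil])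
  have mT: "module R (tensor R ?A F)" "module R (tensor R ?B F)" by (intro tensor_module m mF)+
  have "?l z = \<zero>\<^bsub>E\<^esub>" if "z \<in> carrier (tensor R ?A F)" "?t z = \<zero>\<^bsub>tensor R ?B F\<^esub>" for z
  proof -
    have "z = \<zero>\<^bsub>tensor R ?A F\<^esub>"
      using that mod_hom_zero[OF mT t] inj_onD[OF inj] module_zero_closed[OF mT(1)] by metis
    then show ?thesis using mod_hom_zero[OF mT(1) mE l] by simp
  qed
  then obtain \<mu> where \<mu>: "\<mu> \<in> mod_hom R (tensor R ?B F) E" "\<And>z. z \<in> carrier (tensor R ?A F) \<Longrightarrow> \<mu> (?t z) = ?l z"
    using baer_extend[OF E mT t l] by blast
  have one: "seq_const \<one>\<^bsub>R\<^esub> \<in> carrier ?B" by (auto simp: transport_module_def ring_module_simps)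
  let ?j = "\<lambda>x\<in>carrier F. \<mu> (pure_tensor R ?B F (seq_const \<one>\<^bsub>R\<^esub>) x)"
  have j: "?j \<in> carrier (Hom_mod R F E)"
    by (rule restrict_in_Hom[OF mF mod_hom_comp[OF pure_hom_right[OF m(2) mF one] \<mu>(1)]])
  show "\<exists>j\<in>carrier (Hom_mod R F E). \<forall>a\<in>I. g a = a \<odot>\<^bsub>Hom_mod R F E\<^esub> j"
  proof (intro bexI[OF _ j] ballI)
    fix a assume a: "a \<in> I"
    then have ac: "a \<in> carrier R" using submodule_sub[OF s] by (auto simp: ring_module_simps)
    have aA: "seq_const a \<in> carrier ?A" using a by (simp add: transport_module_def)
    show "g a = a \<odot>\<^bsub>Hom_mod R F E\<^esub> ?j"
    proof (rule Hom_ext)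
      show "g a \<in> carrier (Hom_mod R F E)" using mod_hom_closed[OF g, of a] a by simp
      show "a \<odot>\<^bsub>Hom_mod R F E\<^esub> ?j \<in> carrier (Hom_mod R F E)"
        by (rule module_smult_closed[OF Hom_module[OF mF mE] ac j])
      fix x assume x: "x \<in> carrier F"
      have "a \<odot>\<^bsub>E\<^esub> \<mu> (pure_tensor R ?B F (seq_const \<one>\<^bsub>R\<^esub>) x)
          = \<mu> (a \<odot>\<^bsub>tensor R ?B F\<^esub> pure_tensor R ?B F (seq_const \<one>\<^bsub>R\<^esub>) x)"
        by (rule mod_hom_smult[OF \<mu>(1) ac pure_closed[OF m(2) mF one x], symmetric])
      also have "a \<odot>\<^bsub>tensor R ?B F\<^esub> pure_tensor R ?B F (seq_const \<one>\<^bsub>R\<^esub>) x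
          = pure_tensor R ?B F (a \<odot>\<^bsub>?B\<^esub> seq_const \<one>\<^bsub>R\<^esub>) x"
        by (rule mod_hom_smult[OF pure_hom_left[OF m(2) mF x] ac one, symmetric])
      also have "a \<odot>\<^bsub>?B\<^esub> seq_const \<one>\<^bsub>R\<^esub> = seq_const a" using ac by (simp add: transport_module_def ring_module_simps)
      also have "pure_tensor R ?B F (seq_const a) x = ?t (pure_tensor R ?A F (seq_const a) x)"
        by (rule tensor_map_pure[OF m(1) mF m(2) mF f mod_hom_id aA x, symmetric])
      also have "\<mu> \<dots> = ?l (pure_tensor R ?A F (seq_const a) x)" by (rule \<mu>(2)[OF pure_closed[OF m(1) mF aA x]])
      also have "\<dots> = g a x" by (subst tensor_lift_pure[OF m(1) mF mE bil aA x]) simp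
      finally show "g a x = (a \<odot>\<^bsub>Hom_mod R F E\<^esub> ?j) x" using x by (simp add: Hom_smult)
    qed
  qed
qed

text \<open>\<open>Hom\<close> from a free module is a product of copies of \<open>E\<close>: the elements that extend the components
  are found one basis vector at a time.\<close>

lemma free_imp_baer_dual:
  assumes E: "baer R E"
  shows "baer R (Hom_mod R (free_module R S) E)"
  unfolding baer_def
proof (intro conjI allI impI; (elim conjE)?)
  have mE: "module R E" by (rule baer_module[OF E])
  interpret E: module R E by (rule mE)
  let ?F = "free_module R S"
  note R = E.R.is_cring
  have mF: "module R ?F" by (rule free_module_module[OF R])
  show mH: "module R (Hom_mod R ?F E)" by (rule Hom_module[OF mF mE])
  fix I g assume I: "ideal I R" and g: "g \<in> mod_hom R ((ring_module R)\<lparr>carrier := I\<rparr>) (Hom_mod R ?F E)"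
  have Isub: "I \<subseteq> carrier R" using I by (simp add: additive_subgroup.a_subset ideal.axioms(1))
  have "\<exists>j. j \<in> carrier E \<and> (\<forall>a\<in>I. g a (free_unit R s) = a \<odot>\<^bsub>E\<^esub> j)" if "s \<in> S" for s
  proof -
    have "(\<lambda>a. g a (free_unit R s)) \<in> mod_hom R ((ring_module R)\<lparr>carrier := I\<rparr>) E"
      using bilinear_of_hom[OF g] free_unit_carrier[OF R that] by (auto simp: bilinear_def)
    then show ?thesis using E I unfolding baer_def by blast
  qed
  then obtain j where j: "\<And>s. s \<in> S \<Longrightarrow> j s \<in> carrier E" "\<And>s a. s \<in> S \<Longrightarrow> a \<in> I \<Longrightarrow> g a (free_unit R s) = a \<odot>\<^bsub>E\<^esub> j s"
    by metis
  let ?j = "restrict (free_lift R E j) (carrier ?F)"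
  have jH: "?j \<in> carrier (Hom_mod R ?F E)" by (rule restrict_in_Hom[OF mF free_lift_hom[OF mE j(1)]])
  show "\<exists>j\<in>carrier (Hom_mod R ?F E). \<forall>a\<in>I. g a = a \<odot>\<^bsub>Hom_mod R ?F E\<^esub> j"
  proof (intro bexI[OF _ jH] ballI)
    fix a assume a: "a \<in> I"
    have ga: "g a \<in> carrier (Hom_mod R ?F E)" using mod_hom_closed[OF g, of a] a by simp
    have ja: "a \<odot>\<^bsub>Hom_mod R ?F E\<^esub> ?j \<in> carrier (Hom_mod R ?F E)"
      using a Isub by (intro module_smult_closed[OF mH _ jH]) auto
    show "g a = a \<odot>\<^bsub>Hom_mod R ?F E\<^esub> ?j"
    proof (rule Hom_ext[OF ga ja], rule free_hom_eqI[OF R mE Hom_memD[OF ga] Hom_memD[OF ja]])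
      fix s assume s: "s \<in> S"
      show "g a (free_unit R s) = (a \<odot>\<^bsub>Hom_mod R ?F E\<^esub> ?j) (free_unit R s)"
        using free_unit_carrier[OF R s] j(2)[OF s a] free_lift_unit[OF mE, of j s] j(1)[OF s] by (simp add: Hom_smult)
    qed
  qed
qed

text \<open>An ideal maximal among those that contain \<open>I\<close> but not \<open>1\<close> is a maximal ideal, hence the only one.\<close>

lemma proper_ideal_in_maximal:
  assumes "noetherian_local_ring R" "ideal I R" "\<one>\<^bsub>R\<^esub> \<notin> I"
  shows "I \<subseteq> (THE \<mm>. maximalideal \<mm> R)" "maximalideal (THE \<mm>. maximalideal \<mm> R) R"
proof -
  have ex: "\<exists>!\<mm>. maximalideal \<mm> R" using assms(1) by (simp add: noetherian_local_ring_def)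
  show "maximalideal (THE \<mm>. maximalideal \<mm> R) R" by (rule theI'[OF ex])
  interpret R: noetherian_ring R using assms(1) by (simp add: noetherian_local_ring_def)
  let ?\<A> = "{J. ideal J R \<and> I \<subseteq> J \<and> \<one>\<^bsub>R\<^esub> \<notin> J}"
  have "\<exists>J\<in>?\<A>. \<forall>X\<in>?\<A>. J \<subseteq> X \<longrightarrow> X = J"
  proof (rule subset_Zorn_nonempty)
    fix C assume C: "C \<noteq> {}" "subset.chain ?\<A> C"
    then have "subset.chain {J. ideal J R} C" by (auto simp: subset_chain_def)
    then have "\<Union>C \<in> C" by (rule R.ideal_chain_is_trivial[OF C(1)])
    then show "\<Union>C \<in> ?\<A>" using C(2) by (auto simp: subset_chain_def)
  qed (use assms in auto)
  then obtain J where J: "ideal J R" "I \<subseteq> J" "\<one>\<^bsub>R\<^esub> \<notin> J"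
    and max: "\<And>X. ideal X R \<Longrightarrow> J \<subseteq> X \<Longrightarrow> \<one>\<^bsub>R\<^esub> \<notin> X \<Longrightarrow> X = J" by (auto dest: order_trans)
  have "maximalideal J R"
    using J max ideal.one_imp_carrier by (intro maximalidealI) blast+
  then have "J = (THE \<mm>. maximalideal \<mm> R)" using ex by (metis the1_equality)
  then show "I \<subseteq> (THE \<mm>. maximalideal \<mm> R)" using J(2) by simp
qed

text \<open>An element outside a submodule generates a nonzero cyclic module modulo it, which maps onto
  the residue field and hence to \<open>E\<close>.\<close>

theorem matlis_separates:
  assumes R: "noetherian_local_ring R" and hull: "injective_hull R (residue_module R) E \<iota>"
    and B: "module R B" and K: "submodule K R B" and x: "x \<in> carrier B" "x \<notin> K"
  obtains \<chi> where "\<chi> \<in> mod_hom R B E" "\<And>y. y \<in> K \<Longrightarrow> \<chi> y = \<zero>\<^bsub>E\<^esub>" "\<chi> x \<noteq> \<zero>\<^bsub>E\<^esub>"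
proof -
  interpret B: module R B by fact
  note cR = B.R.is_cring
  have E: "baer R E" using hull by (intro injective_imp_baer[OF cR]) (simp add: injective_hull_def)
  have mE: "module R E" by (rule baer_module[OF E])
  let ?m = "THE \<mm>. maximalideal \<mm> R" and ?RM = "ring_module R"
  have mR: "module R ?RM" by (rule ring_module_module[OF cR])
  have h: "(\<lambda>r. r \<odot>\<^bsub>B\<^esub> x) \<in> mod_hom R ?RM B"
    by (rule mod_homI) (use x in \<open>auto simp: ring_module_simps B.smult_l_distr B.smult_assoc1\<close>)
  let ?I = "{r \<in> carrier ?RM. r \<odot>\<^bsub>B\<^esub> x \<in> K}"
  have "ideal ?I R" using preimage_submodule[OF mR B h K] ideal_iff_submodule[OF cR] by simp
  moreover have "\<one>\<^bsub>R\<^esub> \<notin> ?I" using x by simp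
  ultimately have sub: "?I \<subseteq> ?m" and max: "maximalideal ?m R" using proper_ideal_in_maximal[OF R] by blast+
  have sm: "submodule ?m R ?RM" using max ideal_iff_submodule[OF cR] maximalideal.axioms(1) by blast
  have one: "\<one>\<^bsub>R\<^esub> \<notin> ?m"
    using max ideal.one_imp_carrier[OF maximalideal.axioms(1)[OF max]] maximalideal.I_notcarr by metis
  have mk: "module R (residue_module R)" unfolding residue_module_def by (rule quot_module[OF mR sm])
  have \<iota>: "\<iota> \<in> mod_hom R (residue_module R) E" "inj_on \<iota> (carrier (residue_module R))"
    using hull by (auto simp: injective_hull_def)
  let ?\<phi> = "\<lambda>r. \<iota> (?m +>\<^bsub>?RM\<^esub> r)"
  have phi: "?\<phi> \<in> mod_hom R ?RM E"
    by (rule mod_hom_comp[OF quot_proj_hom[OF mR sm] \<iota>(1)[unfolded residue_module_def]])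
  have hq: "(\<lambda>r. K +>\<^bsub>B\<^esub> (r \<odot>\<^bsub>B\<^esub> x)) \<in> mod_hom R ?RM (quot_mod B K)"
    by (rule mod_hom_comp[OF h quot_proj_hom[OF B K]])
  have "?\<phi> r = \<zero>\<^bsub>E\<^esub>" if r: "r \<in> carrier ?RM" "K +>\<^bsub>B\<^esub> (r \<odot>\<^bsub>B\<^esub> x) = \<zero>\<^bsub>quot_mod B K\<^esub>" for r
  proof -
    have "r \<odot>\<^bsub>B\<^esub> x \<in> K"
      using r coset_eq_zero_iff[OF B K] x by (simp add: quot_zero ring_module_simps)
    then have "?m +>\<^bsub>?RM\<^esub> r = \<zero>\<^bsub>residue_module R\<^esub>"
      using r(1) sub coset_eq_zero_iff[OF mR sm r(1)] by (auto simp: quot_zero residue_module_def)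
    then show ?thesis using mod_hom_zero[OF mk mE \<iota>(1)] by simp
  qed
  then obtain \<psi> where \<psi>: "\<psi> \<in> mod_hom R (quot_mod B K) E"
    "\<And>r. r \<in> carrier ?RM \<Longrightarrow> \<psi> (K +>\<^bsub>B\<^esub> (r \<odot>\<^bsub>B\<^esub> x)) = ?\<phi> r"
    using baer_extend[OF E mR quot_module[OF B K] hq phi] by blast
  show ?thesis
  proof (rule that)
    show "(\<lambda>y. \<psi> (K +>\<^bsub>B\<^esub> y)) \<in> mod_hom R B E" by (rule mod_hom_comp[OF quot_proj_hom[OF B K] \<psi>(1)])
    show "\<psi> (K +>\<^bsub>B\<^esub> y) = \<zero>\<^bsub>E\<^esub>" if "y \<in> K" for y
    proof -
      have "K +>\<^bsub>B\<^esub> y = \<zero>\<^bsub>quot_mod B K\<^esub>"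
        using that coset_eq_zero_iff[OF B K, of y] submodule_sub[OF K] by (auto simp: quot_zero)
      then show ?thesis using mod_hom_zero[OF quot_module[OF B K] mE \<psi>(1)] by simp
    qed
    have 1: "\<one>\<^bsub>R\<^esub> \<in> carrier ?RM" by (simp add: ring_module_simps)
    have "?m +>\<^bsub>?RM\<^esub> \<one>\<^bsub>R\<^esub> \<noteq> \<zero>\<^bsub>residue_module R\<^esub>"
      using one coset_eq_zero_iff[OF mR sm 1] by (simp add: quot_zero residue_module_def)
    moreover have "?m +>\<^bsub>?RM\<^esub> \<one>\<^bsub>R\<^esub> \<in> carrier (residue_module R)"
      using 1 by (auto simp: residue_module_def quot_carrier)
    ultimately have "?\<phi> \<one>\<^bsub>R\<^esub> \<noteq> \<zero>\<^bsub>E\<^esub>"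
      using \<iota>(2) mod_hom_zero[OF mk mE \<iota>(1)] module_zero_closed[OF mk] by (metis inj_onD)
    then show "\<psi> (K +>\<^bsub>B\<^esub> x) \<noteq> \<zero>\<^bsub>E\<^esub>" using \<psi>(2)[OF 1] x by simp
  qed
qed


section \<open>Exactness of tensor products by duality\<close>

locale matlis =
  fixes R :: "('r, 'x) ring_scheme" and E :: "('r, 'e, 'y) module_scheme" and \<iota> :: "'r set \<Rightarrow> 'e"
  assumes local: "noetherian_local_ring R" and hull: "injective_hull R (residue_module R) E \<iota>"
begin

lemma R_cring: "cring R" using local by (simp add: noetherian_local_ring_def)
lemma E_baer: "baer R E" using hull by (intro injective_imp_baer[OF R_cring]) (simp add: injective_hull_def)
lemma E_module: "module R E" by (rule baer_module[OF E_baer])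

lemmas separates = matlis_separates[OF local hull]

text \<open>Exactness is tested on functionals: an element of \<open>V\<close> outside the image of \<open>f\<close> would be separated
  from the image by a functional.\<close>

lemma exact_by_duality:
  assumes "module R U" "module R V" "f \<in> mod_hom R U V"
    and "\<And>\<chi>. \<lbrakk>\<chi> \<in> mod_hom R V E; \<And>u. u \<in> carrier U \<Longrightarrow> \<chi> (f u) = \<zero>\<^bsub>E\<^esub>\<rbrakk> \<Longrightarrow> \<chi> v = \<zero>\<^bsub>E\<^esub>"
    and "v \<in> carrier V"
  shows "v \<in> f ` carrier U"
proof (rule ccontr)
  assume "v \<notin> f ` carrier U"
  then obtain \<chi> where "\<chi> \<in> mod_hom R V E" "\<And>y. y \<in> f ` carrier U \<Longrightarrow> \<chi> y = \<zero>\<^bsub>E\<^esub>" "\<chi> v \<noteq> \<zero>\<^bsub>E\<^esub>"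
    using separates[OF assms(2) image_carrier_submodule[OF assms(1-3)] assms(5)] by blast
  then show False using assms(4) by blast
qed

text \<open>A functional on \<open>A \<otimes> B\<close> is a homomorphism from \<open>A\<close> to \<open>Hom(B, E)\<close>.  If the latter module
  satisfies Baer's condition, such homomorphisms extend along maps of \<open>A\<close>, which by duality is
  exactness of \<open>- \<otimes> B\<close>.\<close>

lemma tensor_exact_left:
  assumes m: "module R A'" "module R A" "module R A''" "module R B"
    and f: "f \<in> mod_hom R A' A" and g: "g \<in> mod_hom R A A''"
    and exact: "\<And>a. \<lbrakk>a \<in> carrier A; g a = \<zero>\<^bsub>A''\<^esub>\<rbrakk> \<Longrightarrow> a \<in> f ` carrier A'"
    and B: "baer R (Hom_mod R B E)"
    and z: "z \<in> carrier (tensor R A B)" "tensor_map R A'' B g (\<lambda>x. x) z = \<zero>\<^bsub>tensor R A'' B\<^esub>"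
  shows "z \<in> tensor_map R A B f (\<lambda>x. x) ` carrier (tensor R A' B)"
proof -
  let ?f = "tensor_map R A B f (\<lambda>x. x)" and ?g = "tensor_map R A'' B g (\<lambda>x. x)"
  have T: "module R (tensor R A' B)" "module R (tensor R A B)" "module R (tensor R A'' B)"
    by (intro tensor_module m)+
  have F: "?f \<in> mod_hom R (tensor R A' B) (tensor R A B)" by (intro tensor_map_hom m f mod_hom_id)
  have G: "?g \<in> mod_hom R (tensor R A B) (tensor R A'' B)" by (intro tensor_map_hom m g mod_hom_id)
  show ?thesis
  proof (rule exact_by_duality[OF T(1,2) F _ z(1)])
    fix \<chi> assume chi: "\<chi> \<in> mod_hom R (tensor R A B) E"
      and 0: "\<And>u. u \<in> carrier (tensor R A' B) \<Longrightarrow> \<chi> (?f u) = \<zero>\<^bsub>E\<^esub>"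
    let ?\<phi> = "\<lambda>a. \<lambda>x\<in>carrier B. \<chi> (pure_tensor R A B a x)"
    have bil: "bilinear R A B E (\<lambda>a x. \<chi> (pure_tensor R A B a x))"
      by (rule bilinearI) (auto intro: mod_hom_comp[OF pure_hom_right[OF m(2,4)] chi] mod_hom_comp[OF pure_hom_left[OF m(2,4)] chi])
    have phi: "?\<phi> \<in> mod_hom R A (Hom_mod R B E)" by (rule hom_of_bilinear[OF m(4) E_module bil])
    have "?\<phi> a = \<zero>\<^bsub>Hom_mod R B E\<^esub>" if a: "a \<in> carrier A" "g a = \<zero>\<^bsub>A''\<^esub>" for a
    proof -
      obtain a' where a': "a' \<in> carrier A'" "a = f a'" using exact[OF a] by auto
      have "\<chi> (pure_tensor R A B a x) = \<zero>\<^bsub>E\<^esub>" if x: "x \<in> carrier B" for x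
        using 0[OF pure_closed[OF m(1,4) a'(1) x]] tensor_map_pure[OF m(1,4,2,4) f mod_hom_id a'(1) x] a'(2) by simp
      then show ?thesis by (auto simp: Hom_mod_def fun_eq_iff)
    qed
    then obtain \<psi> where \<psi>: "\<psi> \<in> mod_hom R A'' (Hom_mod R B E)" "\<And>a. a \<in> carrier A \<Longrightarrow> \<psi> (g a) = ?\<phi> a"
      using baer_extend[OF B m(2,3) g phi] by blast
    let ?\<mu> = "tensor_lift R E (\<lambda>a x. \<psi> a x)"
    have mu: "?\<mu> \<in> mod_hom R (tensor R A'' B) E"
      by (rule tensor_lift_hom[OF m(3,4) E_module bilinear_of_hom[OF \<psi>(1)]])
    have "\<chi> z = ?\<mu> (?g z)"
    proof (rule tensor_hom_eqI[OF m(2,4) E_module chi mod_hom_comp[OF G mu] _ z(1)])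
      fix a x assume ax: "a \<in> carrier A" "x \<in> carrier B"
      then show "\<chi> (pure_tensor R A B a x) = ?\<mu> (?g (pure_tensor R A B a x))"
        using tensor_map_pure[OF m(2,4,3,4) g mod_hom_id ax] \<psi>(2)[OF ax(1)]
          tensor_lift_pure[OF m(3,4) E_module bilinear_of_hom[OF \<psi>(1)] mod_hom_closed[OF g ax(1)] ax(2)] by simp
    qed
    then show "\<chi> z = \<zero>\<^bsub>E\<^esub>" using z(2) mod_hom_zero[OF T(3) E_module mu] by simp
  qed
qed

lemma tensor_exact_right:
  assumes m: "module R B'" "module R B" "module R B''" "module R A"
    and f: "f \<in> mod_hom R B' B" and g: "g \<in> mod_hom R B B''"
    and exact: "\<And>b. \<lbrakk>b \<in> carrier B; g b = \<zero>\<^bsub>B''\<^esub>\<rbrakk> \<Longrightarrow> b \<in> f ` carrier B'"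
    and A: "baer R (Hom_mod R A E)"
    and z: "z \<in> carrier (tensor R A B)" "tensor_map R A B'' (\<lambda>x. x) g z = \<zero>\<^bsub>tensor R A B''\<^esub>"
  shows "z \<in> tensor_map R A B (\<lambda>x. x) f ` carrier (tensor R A B')"
proof -
  let ?f = "tensor_map R A B (\<lambda>x. x) f" and ?g = "tensor_map R A B'' (\<lambda>x. x) g"
  have T: "module R (tensor R A B')" "module R (tensor R A B)" "module R (tensor R A B'')"
    by (intro tensor_module m)+
  have F: "?f \<in> mod_hom R (tensor R A B') (tensor R A B)" by (intro tensor_map_hom m f mod_hom_id)
  have G: "?g \<in> mod_hom R (tensor R A B) (tensor R A B'')" by (intro tensor_map_hom m g mod_hom_id)
  show ?thesis
  proof (rule exact_by_duality[OF T(1,2) F _ z(1)])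
    fix \<chi> assume chi: "\<chi> \<in> mod_hom R (tensor R A B) E"
      and 0: "\<And>u. u \<in> carrier (tensor R A B') \<Longrightarrow> \<chi> (?f u) = \<zero>\<^bsub>E\<^esub>"
    let ?\<phi> = "\<lambda>b. \<lambda>x\<in>carrier A. \<chi> (pure_tensor R A B x b)"
    have bil: "bilinear R B A E (\<lambda>b x. \<chi> (pure_tensor R A B x b))"
      by (rule bilinearI) (auto intro: mod_hom_comp[OF pure_hom_right[OF m(4,2)] chi] mod_hom_comp[OF pure_hom_left[OF m(4,2)] chi])
    have phi: "?\<phi> \<in> mod_hom R B (Hom_mod R A E)" by (rule hom_of_bilinear[OF m(4) E_module bil])
    have "?\<phi> b = \<zero>\<^bsub>Hom_mod R A E\<^esub>" if b: "b \<in> carrier B" "g b = \<zero>\<^bsub>B''\<^esub>" for b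
    proof -
      obtain b' where b': "b' \<in> carrier B'" "b = f b'" using exact[OF b] by auto
      have "\<chi> (pure_tensor R A B x b) = \<zero>\<^bsub>E\<^esub>" if x: "x \<in> carrier A" for x
        using 0[OF pure_closed[OF m(4,1) x b'(1)]] tensor_map_pure[OF m(4,1,4,2) mod_hom_id f x b'(1)] b'(2) by simp
      then show ?thesis by (auto simp: Hom_mod_def fun_eq_iff)
    qed
    then obtain \<psi> where \<psi>: "\<psi> \<in> mod_hom R B'' (Hom_mod R A E)" "\<And>b. b \<in> carrier B \<Longrightarrow> \<psi> (g b) = ?\<phi> b"
      using baer_extend[OF A m(2,3) g phi] by blast
    have bil': "bilinear R A B'' E (\<lambda>x b. \<psi> b x)"
      using bilinear_of_hom[OF \<psi>(1)] by (auto simp: bilinear_def)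
    let ?\<mu> = "tensor_lift R E (\<lambda>x b. \<psi> b x)"
    have mu: "?\<mu> \<in> mod_hom R (tensor R A B'') E"
      by (rule tensor_lift_hom[OF m(4,3) E_module bil'])
    have "\<chi> z = ?\<mu> (?g z)"
    proof (rule tensor_hom_eqI[OF m(4,2) E_module chi mod_hom_comp[OF G mu] _ z(1)])
      fix x b assume ax: "x \<in> carrier A" "b \<in> carrier B"
      then show "\<chi> (pure_tensor R A B x b) = ?\<mu> (?g (pure_tensor R A B x b))"
        using tensor_map_pure[OF m(4,2,4,3) mod_hom_id g ax] \<psi>(2)[OF ax(2)]
          tensor_lift_pure[OF m(4,3) E_module bil' ax(1) mod_hom_closed[OF g ax(2)]] by simp
    qed
    then show "\<chi> z = \<zero>\<^bsub>E\<^esub>" using z(2) mod_hom_zero[OF T(3) E_module mu] by simp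
  qed
qed

end

lemma tensor_map_surj:
  assumes m: "module R A" "module R B" "module R A'" "module R B'"
    and f: "f \<in> mod_hom R A A'" and g: "g \<in> mod_hom R B B'"
    and "f ` carrier A = carrier A'" "g ` carrier B = carrier B'"
  shows "tensor_map R A' B' f g ` carrier (tensor R A B) = carrier (tensor R A' B')"
proof (intro equalityI subsetI)
  let ?t = "tensor_map R A' B' f g"
  have t: "?t \<in> mod_hom R (tensor R A B) (tensor R A' B')" by (rule tensor_map_hom[OF m f g])
  show "z \<in> carrier (tensor R A' B')" if "z \<in> ?t ` carrier (tensor R A B)" for z
    using that mod_hom_closed[OF t] by auto
  fix z assume z: "z \<in> carrier (tensor R A' B')"
  show "z \<in> ?t ` carrier (tensor R A B)"
  proof (rule tensor_induct[OF m(3,4) image_carrier_submodule[OF tensor_module[OF m(1,2)] tensor_module[OF m(3,4)] t] _ z])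
    fix a b assume "a \<in> carrier A'" "b \<in> carrier B'"
    then obtain a0 b0 where "a0 \<in> carrier A" "a = f a0" "b0 \<in> carrier B" "b = g b0" using assms(7,8) by blast
    then show "pure_tensor R A' B' a b \<in> ?t ` carrier (tensor R A B)"
      using tensor_map_pure[OF m f g] pure_closed[OF m(1,2)] by (metis image_eqI)
  qed
qed

lemma tensor_map_comp:
  assumes m: "module R A" "module R B" "module R A'" "module R B'" "module R A''" "module R B''"
    and f: "f \<in> mod_hom R A A'" and g: "g \<in> mod_hom R B B'"
    and f': "f' \<in> mod_hom R A' A''" and g': "g' \<in> mod_hom R B' B''"
    and h: "h \<in> mod_hom R A A''" and k: "k \<in> mod_hom R B B''"
    and "\<And>a. a \<in> carrier A \<Longrightarrow> f' (f a) = h a" "\<And>b. b \<in> carrier B \<Longrightarrow> g' (g b) = k b"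
    and z: "z \<in> carrier (tensor R A B)"
  shows "tensor_map R A'' B'' f' g' (tensor_map R A' B' f g z) = tensor_map R A'' B'' h k z"
proof (rule tensor_hom_eqI[OF m(1,2) tensor_module[OF m(5,6)]
    mod_hom_comp[OF tensor_map_hom[OF m(1-4) f g] tensor_map_hom[OF m(3-6) f' g']]
    tensor_map_hom[OF m(1,2,5,6) h k] _ z])
  fix a b assume ab: "a \<in> carrier A" "b \<in> carrier B"
  then show "tensor_map R A'' B'' f' g' (tensor_map R A' B' f g (pure_tensor R A B a b)) =
      tensor_map R A'' B'' h k (pure_tensor R A B a b)"
    using assms(13,14) by (simp add: tensor_map_pure[OF m(1-4) f g] tensor_map_pure[OF m(3-6) f' g']
       tensor_map_pure[OF m(1,2,5,6) h k] mod_hom_closed[OF f] mod_hom_closed[OF g])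
qed

lemma tensor_map_square:
  assumes m: "module R A" "module R B" "module R A1" "module R B1" "module R A2" "module R B2" "module R A3" "module R B3"
    and f: "f \<in> mod_hom R A A1" and g: "g \<in> mod_hom R B B1"
    and f': "f' \<in> mod_hom R A1 A3" and g': "g' \<in> mod_hom R B1 B3"
    and h: "h \<in> mod_hom R A A2" and k: "k \<in> mod_hom R B B2"
    and h': "h' \<in> mod_hom R A2 A3" and k': "k' \<in> mod_hom R B2 B3"
    and "\<And>a. a \<in> carrier A \<Longrightarrow> f' (f a) = h' (h a)" "\<And>b. b \<in> carrier B \<Longrightarrow> g' (g b) = k' (k b)"
    and z: "z \<in> carrier (tensor R A B)"
  shows "tensor_map R A3 B3 f' g' (tensor_map R A1 B1 f g z) = tensor_map R A3 B3 h' k' (tensor_map R A2 B2 h k z)"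
  using tensor_map_comp[OF m(1-4,7,8) f g f' g' mod_hom_comp[OF h h'] mod_hom_comp[OF k k'] assms(17,18) z]
    tensor_map_comp[OF m(1,2,5-8) h k h' k' mod_hom_comp[OF h h'] mod_hom_comp[OF k k'] refl refl z] by simp

lemma tensor_map_zero:
  assumes m: "module R A" "module R B" "module R A'" "module R B'"
    and f: "f \<in> mod_hom R A A'" and g: "g \<in> mod_hom R B B'"
    and "(\<forall>a\<in>carrier A. f a = \<zero>\<^bsub>A'\<^esub>) \<or> (\<forall>b\<in>carrier B. g b = \<zero>\<^bsub>B'\<^esub>)"
    and z: "z \<in> carrier (tensor R A B)"
  shows "tensor_map R A' B' f g z = \<zero>\<^bsub>tensor R A' B'\<^esub>"
proof -
  note T = tensor_module[OF m(3,4)]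
  show ?thesis
  proof (rule tensor_hom_eqI[OF m(1,2) T tensor_map_hom[OF m f g] mod_hom_const_zero[OF T] _ z])
    fix a b assume ab: "a \<in> carrier A" "b \<in> carrier B"
    then show "tensor_map R A' B' f g (pure_tensor R A B a b) = \<zero>\<^bsub>tensor R A' B'\<^esub>"
      using assms(7) mod_hom_zero[OF m(4) T pure_hom_right[OF m(3,4)]] mod_hom_zero[OF m(3) T pure_hom_left[OF m(3,4)]]
        mod_hom_closed[OF f ab(1)] mod_hom_closed[OF g ab(2)]
      by (auto simp: tensor_map_pure[OF m f g ab])
  qed
qed

section \<open>The canonical resolution\<close>

text \<open>A \<open>flat_resolution\<close> without flatness.  This form also covers the canonical resolution, whose
  members enter through \<open>free_imp_baer_dual\<close> rather than \<open>flat_imp_baer_dual\<close>.\<close>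

definition resolution ::
    "('r, 'x) ring_scheme \<Rightarrow> ('r, 'm, 'c) module_scheme \<Rightarrow> (int \<Rightarrow> ('r, 'f, 'd) module_scheme)
      \<Rightarrow> (int \<Rightarrow> 'f \<Rightarrow> 'f) \<Rightarrow> ('f \<Rightarrow> 'm) \<Rightarrow> bool"
  where "resolution R X F d \<epsilon> \<longleftrightarrow>
    (\<forall>n. module R (F n)) \<and>
    (\<forall>n<0. is_zero (F n)) \<and>
    (\<forall>n. d n \<in> mod_hom R (F n) (F (n - 1))) \<and>
    (\<forall>n>0. d (n + 1) ` carrier (F (n + 1)) = a_kernel (F n) (F (n - 1)) (d n)) \<and>
    \<epsilon> \<in> mod_hom R (F 0) X \<and>
    d 1 ` carrier (F 1) = a_kernel (F 0) X \<epsilon> \<and>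
    \<epsilon> ` carrier (F 0) = carrier X"

lemma flat_resolution_imp_resolution: "flat_resolution R X F d \<epsilon> \<Longrightarrow> resolution R X F d \<epsilon>"
  by (auto simp: flat_resolution_def resolution_def flat_module_def)

text \<open>The value of the differential at the basis vector of a generator.\<close>

definition gen_val :: "('r, 'x) ring_scheme \<Rightarrow> ('r, 'a) gen \<Rightarrow> ('r, 'a) gen \<Rightarrow> 'r"
  where "gen_val R g = (case g of Gen x \<Rightarrow> \<zero>\<^bsub>free_module R UNIV\<^esub> | Syz l \<Rightarrow> syz_elem R l)"

lemma res_diff_lift: "res_diff R = free_lift R (free_module R UNIV) (gen_val R)"
  unfolding res_diff_def gen_val_def[abs_def] ..

context
  fixes R :: "('r, 'x) ring_scheme"
  assumes R: "cring R"
begin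

interpretation R: cring R by (rule R)

lemma syz_elem_Cons: "syz_elem R ((r, s) # l) = (\<lambda>t. r \<otimes>\<^bsub>R\<^esub> free_unit R s t \<oplus>\<^bsub>R\<^esub> syz_elem R l t)"
  by (simp add: syz_elem_def free_simps)

lemma syz_elem_Nil: "syz_elem R [] = (\<lambda>t. \<zero>\<^bsub>R\<^esub>)"
  by (simp add: syz_elem_def free_simps)

lemma syz_elem_Cons_free:
  "syz_elem R ((r, s) # l) = r \<odot>\<^bsub>free_module R S\<^esub> free_unit R s \<oplus>\<^bsub>free_module R S\<^esub> syz_elem R l"
  by (simp add: syz_elem_Cons free_simps)

lemma syz_elem_closed: "set l \<subseteq> carrier R \<times> S \<Longrightarrow> syz_elem R l \<in> carrier (free_module R S)"
proof (induction l)
  case Nil then show ?case by (simp add: syz_elem_Nil free_carrier)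
next
  case (Cons p l)
  obtain r s where p: "p = (r, s)" by (cases p)
  show ?case using Cons unfolding p syz_elem_Cons_free[of r s l S]
    by (intro module_add_closed[OF free_module_module[OF R]] module_smult_closed[OF free_module_module[OF R]] free_unit_carrier[OF R]) auto
qed

lemma syz_elem_append:
  "\<lbrakk>set l \<subseteq> carrier R \<times> UNIV; set l' \<subseteq> carrier R \<times> UNIV\<rbrakk> \<Longrightarrow>
    syz_elem R (l @ l') = syz_elem R l \<oplus>\<^bsub>free_module R S\<^esub> syz_elem R l'"
proof (induction l)
  case Nil
  then show ?case using syz_elem_closed[OF Nil(2)] by (auto simp: syz_elem_Nil free_simps free_carrier)
next
  case (Cons p l)
  obtain r s where p: "p = (r, s)" by (cases p)
  have "syz_elem R l \<in> carrier (free_module R UNIV)" "syz_elem R l' \<in> carrier (free_module R UNIV)"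
    using Cons.prems by (auto intro: syz_elem_closed)
  then show ?case using Cons by (auto simp: p syz_elem_Cons free_simps free_carrier free_unit_def R.a_assoc)
qed

lemma syz_elem_scale:
  "\<lbrakk>set l \<subseteq> carrier R \<times> UNIV; r \<in> carrier R\<rbrakk> \<Longrightarrow>
    syz_elem R (map (\<lambda>(a, s). (r \<otimes>\<^bsub>R\<^esub> a, s)) l) = r \<odot>\<^bsub>free_module R S\<^esub> syz_elem R l"
proof (induction l)
  case Nil
  then show ?case by (auto simp: syz_elem_Nil free_simps)
next
  case (Cons p l)
  obtain a s where p: "p = (a, s)" by (cases p)
  have "syz_elem R l \<in> carrier (free_module R UNIV)"
    using Cons.prems by (auto intro: syz_elem_closed)
  then show ?case using Cons by (auto simp: p syz_elem_Cons free_simps free_carrier free_unit_def R.r_distr R.m_assoc)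
qed

text \<open>Every element is named by some list: this is why each cycle is the boundary of the basis vector of
  one of its names.\<close>

lemma syz_elem_exhaust:
  assumes "\<phi> \<in> carrier (free_module R S)"
  obtains l where "set l \<subseteq> carrier R \<times> S" "syz_elem R l = \<phi>"
proof -
  let ?H = "syz_elem R ` {l. set l \<subseteq> carrier R \<times> S}"
  have up: "set l \<subseteq> carrier R \<times> UNIV" if "set l \<subseteq> carrier R \<times> S" for l :: "('r \<times> 'a) list" using that by auto
  have "submodule ?H R (free_module R S)"
  proof (rule submodule_criterion[OF free_module_module[OF R]])
    show "?H \<subseteq> carrier (free_module R S)" using syz_elem_closed by auto
    show "\<zero>\<^bsub>free_module R S\<^esub> \<in> ?H" by (rule image_eqI[of _ _ "[]"]) (auto simp: syz_elem_Nil free_simps)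
    fix x y assume "x \<in> ?H" "y \<in> ?H"
    then obtain l l' where l: "x = syz_elem R l" "set l \<subseteq> carrier R \<times> S" "y = syz_elem R l'" "set l' \<subseteq> carrier R \<times> S" by auto
    then show "x \<oplus>\<^bsub>free_module R S\<^esub> y \<in> ?H"
      using syz_elem_append[OF up[OF l(2)] up[OF l(4)], of S] by (intro image_eqI[of _ _ "l @ l'"]) auto
  next
    fix r x assume r: "r \<in> carrier R" "x \<in> ?H"
    then obtain l where l: "x = syz_elem R l" "set l \<subseteq> carrier R \<times> S" by auto
    then show "r \<odot>\<^bsub>free_module R S\<^esub> x \<in> ?H"
      using r syz_elem_scale[OF up[OF l(2)] r(1), of S]
      by (intro image_eqI[of _ _ "map (\<lambda>(a, s). (r \<otimes>\<^bsub>R\<^esub> a, s)) l"]) auto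
  qed
  moreover have "free_unit R s \<in> ?H" if "s \<in> S" for s
    using that by (intro image_eqI[of _ _ "[(\<one>\<^bsub>R\<^esub>, s)]"]) (auto simp: syz_elem_Cons syz_elem_Nil free_unit_def fun_eq_iff)
  ultimately have "\<phi> \<in> ?H" using assms by (rule free_induct[OF R])
  then show ?thesis using that by auto
qed

text \<open>The differential is only meaningful on generators whose syzygies have coefficients in \<open>R\<close>.\<close>

definition wf_gens :: "('r, 'a) gen set"
  where "wf_gens = range Gen \<union> {Syz l | l. set l \<subseteq> carrier R \<times> UNIV}"

lemma gen_val_closed: "g \<in> wf_gens \<Longrightarrow> gen_val R g \<in> carrier (free_module R UNIV)"
  unfolding wf_gens_def gen_val_def using syz_elem_closed[of _ UNIV] module_zero_closed[OF free_module_module[OF R]] by auto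

lemma res_diff_hom_wf: "S \<subseteq> wf_gens \<Longrightarrow> res_diff R \<in> mod_hom R (free_module R S) (free_module R UNIV)"
  unfolding res_diff_lift by (rule free_lift_hom[OF free_module_module[OF R]]) (auto intro: gen_val_closed)

lemma res_diff_unit: "g \<in> wf_gens \<Longrightarrow> res_diff R (free_unit R g) = gen_val R g"
  unfolding res_diff_lift by (rule free_lift_unit[OF free_module_module[OF R]]) (rule gen_val_closed)

lemma push_syz_elem:
  "set l \<subseteq> carrier R \<times> UNIV \<Longrightarrow>
    free_push R h (syz_elem R l) = syz_elem R (map (map_prod (\<lambda>r. r) h) l)"
proof (induction l)
  case Nil
  show ?case using mod_hom_zero[OF free_module_module[OF R] free_module_module[OF R] free_push_hom[OF R, of h UNIV UNIV]]
    by (simp add: syz_elem_Nil free_simps)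
next
  case (Cons p l)
  obtain r s where p: "p = (r, s)" by (cases p)
  note h = free_push_hom[OF R, of h UNIV UNIV, OF subset_UNIV]
  note m = free_module_module[OF R, of UNIV]
  have c: "syz_elem R l \<in> carrier (free_module R UNIV)" "r \<in> carrier R" using Cons.prems by (auto simp: p intro: syz_elem_closed)
  show ?case unfolding p syz_elem_Cons_free[of r s l UNIV]
    using c Cons by (simp add: syz_elem_Cons_free[of _ _ _ UNIV] mod_hom_add[OF h] mod_hom_smult[OF h]
      module_smult_closed[OF m] free_unit_carrier[OF R] free_push_unit[OF R])
qed

lemma push_res_diff:
  assumes "S \<subseteq> wf_gens" "\<phi> \<in> carrier (free_module R S)"
  shows "res_diff R (res_map R h \<phi>) = res_map R h (res_diff R \<phi>)"
proof -
  let ?m = "map_gen (\<lambda>r. r) h"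
  have wf: "?m ` wf_gens \<subseteq> wf_gens" by (fastforce simp: wf_gens_def)
  note m = free_module_module[OF R]
  have h1: "res_map R h \<in> mod_hom R (free_module R S) (free_module R wf_gens)"
    unfolding res_map_def using assms wf by (intro free_push_hom[OF R]) auto
  have h2: "res_map R h \<in> mod_hom R (free_module R UNIV) (free_module R UNIV)"
    unfolding res_map_def by (intro free_push_hom[OF R]) auto
  show ?thesis
  proof (rule free_hom_eqI[OF R m mod_hom_comp[OF h1 res_diff_hom_wf] mod_hom_comp[OF res_diff_hom_wf[OF assms(1)] h2] _ assms(2)])
    fix g assume "g \<in> S"
    then have g: "g \<in> wf_gens" "?m g \<in> wf_gens" using assms wf by auto
    have "gen_val R (?m g) = res_map R h (gen_val R g)"
    proof (cases g)
      case (Gen x)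
      then show ?thesis using mod_hom_zero[OF m m h2] by (simp add: gen_val_def)
    next
      case (Syz l)
      then have "set l \<subseteq> carrier R \<times> UNIV" using g by (auto simp: wf_gens_def)
      then show ?thesis using push_syz_elem[of l ?m] by (simp add: Syz gen_val_def res_map_def)
    qed
    then show "res_diff R (res_map R h (free_unit R g)) = res_map R h (res_diff R (free_unit R g))"
      unfolding res_map_def by (simp add: free_push_unit[OF R] res_diff_unit[OF g(1)] res_diff_unit[OF g(2)])
  qed simp
qed

end

text \<open>The canonical resolution is studied with natural number indices, which suit its recursive
  definition; integer indices return in \<open>canonical_resolution\<close>.\<close>

locale canonical_res =
  fixes R :: "('r, 'x) ring_scheme" and X :: "('r, 'a, 'c) module_scheme"
  assumes X: "module R X"
begin

lemma R: "cring R" by (rule module_cring[OF X])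
interpretation X: module R X by (rule X)

abbreviation "P n \<equiv> free_module R (res_gens R X n)"

lemma P_module: "module R (P n)" by (rule free_module_module[OF R])

lemma gens_wf: "res_gens R X n \<subseteq> wf_gens R"
  by (cases n) (auto simp: wf_gens_def[OF R])

lemma res_diff_Suc_hom: "res_diff R \<in> mod_hom R (P (Suc n)) (P n)"
proof -
  note m = free_module_module[OF R]
  note h = res_diff_hom_wf[OF R gens_wf, of "Suc n"]
  note sub = preimage_submodule[OF m m h free_submodule[OF R subset_UNIV, of "res_gens R X n"]]
  have "\<phi> \<in> {\<phi> \<in> carrier (P (Suc n)). res_diff R \<phi> \<in> carrier (P n)}" if "\<phi> \<in> carrier (P (Suc n))" for \<phi>
  proof (rule free_induct[OF R sub _ that])
    fix g assume g: "g \<in> res_gens R X (Suc n)"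
    then obtain l where l: "g = Syz l" "set l \<subseteq> carrier R \<times> res_gens R X n" by auto
    then show "free_unit R g \<in> {\<phi> \<in> carrier (P (Suc n)). res_diff R \<phi> \<in> carrier (P n)}"
      using res_diff_unit[OF R, of g] gens_wf[of "Suc n"] g free_unit_carrier[OF R g] syz_elem_closed[OF R l(2)]
      by (auto simp: gen_val_def)
  qed
  then have "res_diff R ` carrier (P (Suc n)) \<subseteq> carrier (P n)" by auto
  then show ?thesis using mod_hom_restrict_cod[OF h] free_restrict[of R "res_gens R X n" UNIV] by metis
qed

lemma res_diff_0: "\<phi> \<in> carrier (P 0) \<Longrightarrow> res_diff R \<phi> = \<zero>\<^bsub>free_module R S\<^esub>"
proof -
  assume a: "\<phi> \<in> carrier (P 0)"
  note m = free_module_module[OF R]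
  have "res_diff R \<phi> = \<zero>\<^bsub>free_module R UNIV\<^esub>"
    by (rule free_hom_eqI[OF R m res_diff_hom_wf[OF R gens_wf] mod_hom_const_zero[OF m] _ a])
      (use res_diff_unit[OF R subsetD[OF gens_wf[of 0]]] in \<open>auto simp: gen_val_def\<close>)
  then show ?thesis by (simp add: free_simps)
qed

lemma res_aug_hom: "res_aug R X \<in> mod_hom R (P 0) X"
  unfolding res_aug_def by (rule free_lift_hom[OF X]) auto

lemma res_aug_unit: "x \<in> carrier X \<Longrightarrow> res_aug R X (free_unit R (Gen x)) = x"
  unfolding res_aug_def by (subst free_lift_unit[OF X]) auto

lemma res_aug_surj: "res_aug R X ` carrier (P 0) = carrier X"
  using mod_hom_closed[OF res_aug_hom] res_aug_unit free_unit_carrier[OF R, of "Gen _" "res_gens R X 0"]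
  by (force simp: image_iff)

lemma res_diff_syz: "Syz l \<in> res_gens R X (Suc n) \<Longrightarrow> res_diff R (free_unit R (Syz l)) = syz_elem R l"
  using res_diff_unit[OF R, of "Syz l"] gens_wf[of "Suc n"] by (auto simp: gen_val_def)

lemma aug_diff: "\<phi> \<in> carrier (P 1) \<Longrightarrow> res_aug R X (res_diff R \<phi>) = \<zero>\<^bsub>X\<^esub>"
proof (rule free_hom_eqI[OF R X mod_hom_comp[OF res_diff_Suc_hom[of 0] res_aug_hom] mod_hom_const_zero[OF X]])
  fix g assume "g \<in> res_gens R X (Suc 0)"
  then obtain l where "g = Syz l" "res_aug R X (syz_elem R l) = \<zero>\<^bsub>X\<^esub>" "Syz l \<in> res_gens R X (Suc 0)" by auto
  then show "res_aug R X (res_diff R (free_unit R g)) = \<zero>\<^bsub>X\<^esub>" using res_diff_syz[of l 0] by simp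
qed simp

lemma diff_diff: "\<phi> \<in> carrier (P (Suc (Suc n))) \<Longrightarrow> res_diff R (res_diff R \<phi>) = \<zero>\<^bsub>P n\<^esub>"
proof (rule free_hom_eqI[OF R P_module mod_hom_comp[OF res_diff_Suc_hom res_diff_Suc_hom] mod_hom_const_zero[OF P_module]])
  fix g assume g: "g \<in> res_gens R X (Suc (Suc n))"
  then obtain l where "g = Syz l" "res_diff R (syz_elem R l) = \<zero>\<^bsub>free_module R UNIV\<^esub>"
    by (auto split: if_splits)
  then show "res_diff R (res_diff R (free_unit R g)) = \<zero>\<^bsub>P n\<^esub>" using res_diff_syz[of l "Suc n"] g by (simp add: free_simps)
qed

lemma aug_exact:
  assumes "\<phi> \<in> carrier (P 0)" "res_aug R X \<phi> = \<zero>\<^bsub>X\<^esub>"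
  shows "\<phi> \<in> res_diff R ` carrier (P 1)"
proof -
  obtain l where l: "set l \<subseteq> carrier R \<times> res_gens R X 0" "syz_elem R l = \<phi>" by (rule syz_elem_exhaust[OF R assms(1)])
  then have g: "Syz l \<in> res_gens R X (Suc 0)" using assms(2) by auto
  show ?thesis using res_diff_syz[OF g] l(2) free_unit_carrier[OF R g] by auto
qed

lemma diff_exact:
  assumes "\<phi> \<in> carrier (P (Suc n))" "res_diff R \<phi> = \<zero>\<^bsub>P n\<^esub>"
  shows "\<phi> \<in> res_diff R ` carrier (P (Suc (Suc n)))"
proof -
  obtain l where l: "set l \<subseteq> carrier R \<times> res_gens R X (Suc n)" "syz_elem R l = \<phi>" by (rule syz_elem_exhaust[OF R assms(1)])
  then have g: "Syz l \<in> res_gens R X (Suc (Suc n))"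
    using assms(2) by (subst res_gens.simps(2)) (simp add: free_simps)
  show ?thesis using res_diff_syz[OF g] l(2) free_unit_carrier[OF R g] by (auto simp del: res_gens.simps)
qed

lemma free_empty_zero: "is_zero (free_module R {})"
  unfolding is_zero_def set_eq_iff free_carrier by (auto simp: free_simps fun_eq_iff)

lemma free_res_nat: "free_res R X (int n) = P n" "free_res R X (int n + 1) = P (Suc n)"
  by (auto simp: free_res_def nat_add_distrib)

lemma free_res_neg: "n < 0 \<Longrightarrow> free_res R X n = free_module R {}"
  by (simp add: free_res_def)

lemma free_res_module: "module R (free_res R X n)"
  by (simp add: free_res_def free_module_module[OF R])

lemma res_diff_hom: "res_diff R \<in> mod_hom R (free_res R X n) (free_res R X (n - 1))"
proof (cases "n > 0")
  case True
  then obtain k where "n = int (Suc k)" by (metis gr0_implies_Suc zero_less_imp_eq_int)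
  then show ?thesis using res_diff_Suc_hom[of k] by (simp add: free_res_def nat_add_distrib)
next
  case False
  then have "carrier (free_res R X n) \<subseteq> carrier (P 0)" by (auto simp: free_res_def free_carrier)
  then have z: "res_diff R \<phi> = \<zero>\<^bsub>free_res R X (n - 1)\<^esub>" if "\<phi> \<in> carrier (free_res R X n)" for \<phi>
    using that res_diff_0 by (auto simp: free_res_def)
  show ?thesis by (rule mod_hom_cong[OF free_res_module mod_hom_const_zero[OF free_res_module] z])
qed

theorem canonical_resolution: "resolution R X (free_res R X) (\<lambda>_. res_diff R) (res_aug R X)"
  unfolding resolution_def
proof (intro conjI allI impI)
  fix n :: int
  show "module R (free_res R X n)" "res_diff R \<in> mod_hom R (free_res R X n) (free_res R X (n - 1))"
    by (rule free_res_module res_diff_hom)+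
  show "is_zero (free_res R X n)" if "n < 0" using that by (simp add: free_res_neg free_empty_zero)
  show "res_diff R ` carrier (free_res R X (n + 1)) = a_kernel (free_res R X n) (free_res R X (n - 1)) (res_diff R)" if "0 < n"
  proof -
    obtain k where k: "n = int (Suc k)" using \<open>0 < n\<close> by (metis gr0_implies_Suc zero_less_imp_eq_int)
    have e: "free_res R X n = P (Suc k)" "free_res R X (n - 1) = P k" "free_res R X (n + 1) = P (Suc (Suc k))"
      by (simp_all add: k free_res_def nat_add_distrib)
    show ?thesis unfolding e using diff_diff[of _ k] diff_exact[of _ k] mod_hom_closed[OF res_diff_Suc_hom]
      by (auto simp: a_kernel_iff simp del: res_gens.simps)
  qed
next
  show "res_aug R X \<in> mod_hom R (free_res R X 0) X" using res_aug_hom by (simp add: free_res_def)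
  show "res_aug R X ` carrier (free_res R X 0) = carrier X" using res_aug_surj by (simp add: free_res_def)
  have "free_res R X 1 = P 1" "free_res R X 0 = P 0" by (simp_all add: free_res_def)
  then show "res_diff R ` carrier (free_res R X 1) = a_kernel (free_res R X 0) X (res_aug R X)"
    using aug_diff aug_exact mod_hom_closed[OF res_diff_Suc_hom[of 0]]
    by (auto simp: a_kernel_iff simp del: res_gens.simps)
qed

end

context
  fixes R :: "('r, 'x) ring_scheme" and X :: "('r, 'a, 'c) module_scheme" and X' :: "('r, 'b, 'd) module_scheme" and h
  assumes X: "module R X" and X': "module R X'" and h: "h \<in> mod_hom R X X'"
begin

interpretation X: canonical_res R X by (rule canonical_res.intro[OF X])
interpretation X': canonical_res R X' by (rule canonical_res.intro[OF X'])

lemma res_map_gens0: "map_gen (\<lambda>r. r) h ` res_gens R X 0 \<subseteq> res_gens R X' 0"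
  using mod_hom_closed[OF h] by auto

lemma res_aug_map:
  assumes "\<phi> \<in> carrier (free_module R (res_gens R X 0))"
  shows "res_aug R X' (res_map R h \<phi>) = h (res_aug R X \<phi>)"
proof -
  have m: "res_map R h \<in> mod_hom R (free_module R (res_gens R X 0)) (free_module R (res_gens R X' 0))"
    unfolding res_map_def by (rule free_push_hom[OF X.R res_map_gens0])
  show ?thesis
  proof (rule free_hom_eqI[OF X.R X' mod_hom_comp[OF m X'.res_aug_hom] mod_hom_comp[OF X.res_aug_hom h] _ assms])
    fix g assume "g \<in> res_gens R X 0"
    then show "res_aug R X' (res_map R h (free_unit R g)) = h (res_aug R X (free_unit R g))"
      using mod_hom_closed[OF h] by (auto simp: res_map_def free_push_unit[OF X.R] X.res_aug_unit X'.res_aug_unit)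
  qed
qed

lemma res_map_gens: "map_gen (\<lambda>r. r) h ` res_gens R X n \<subseteq> res_gens R X' n"
proof (induction n)
  case (Suc n)
  let ?m = "map_gen (\<lambda>r. r) h"
  show ?case
  proof
    fix g' assume "g' \<in> ?m ` res_gens R X (Suc n)"
    then obtain l where l: "g' = Syz (map (map_prod (\<lambda>r. r) ?m) l)" "set l \<subseteq> carrier R \<times> res_gens R X n"
      and z: "if n = 0 then res_aug R X (syz_elem R l) = \<zero>\<^bsub>X\<^esub> else res_diff R (syz_elem R l) = \<zero>\<^bsub>free_module R UNIV\<^esub>"
      by auto
    have s: "syz_elem R (map (map_prod (\<lambda>r. r) ?m) l) = res_map R h (syz_elem R l)"
      using l(2) push_syz_elem[OF X.R, of l ?m] by (force simp: res_map_def)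
    note c = syz_elem_closed[OF X.R l(2)]
    have "res_map R h \<in> mod_hom R (free_module R UNIV) (free_module R UNIV)"
      unfolding res_map_def by (rule free_push_hom[OF X.R]) simp
    then have z': "res_map R h \<zero>\<^bsub>free_module R UNIV\<^esub> = \<zero>\<^bsub>free_module R UNIV\<^esub>"
      by (rule mod_hom_zero[OF free_module_module[OF X.R] free_module_module[OF X.R]])
    have "set (map (map_prod (\<lambda>r. r) ?m) l) \<subseteq> carrier R \<times> res_gens R X' n"
      using l(2) Suc by force
    moreover have "if n = 0 then res_aug R X' (res_map R h (syz_elem R l)) = \<zero>\<^bsub>X'\<^esub>
        else res_diff R (res_map R h (syz_elem R l)) = \<zero>\<^bsub>free_module R UNIV\<^esub>"
      using z z' c res_aug_map[of "syz_elem R l"] push_res_diff[OF X.R X.gens_wf c, of h] mod_hom_zero[OF X X' h]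
      by (auto split: if_splits)
    ultimately show "g' \<in> res_gens R X' (Suc n)" unfolding l(1) by (simp add: s)
  qed
qed (rule res_map_gens0)

lemma res_map_hom: "res_map R h \<in> mod_hom R (free_res R X n) (free_res R X' n)"
  unfolding res_map_def free_res_def using res_map_gens by (intro free_push_hom[OF X.R]) auto

lemma res_diff_map:
  assumes "\<phi> \<in> carrier (free_res R X n)"
  shows "res_diff R (res_map R h \<phi>) = res_map R h (res_diff R \<phi>)"
  using assms X.gens_wf by (intro push_res_diff[OF X.R, of "if n < 0 then {} else res_gens R X (nat n)"]) (auto simp: free_res_def)

end


section \<open>Finiteness over a Noetherian ring\<close>

declare res_gens.simps [simp del]

lemma submodule_span_mono: "S \<subseteq> T \<Longrightarrow> submodule_span R M S \<subseteq> submodule_span R M T"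
  unfolding submodule_span_def by auto

text \<open>Induction on the rank: the coordinates at \<open>s\<close> of the members of \<open>K\<close> form a finitely generated
  ideal, and after subtracting suitable lifts of its generators the coordinate at \<open>s\<close> vanishes.\<close>

lemma noetherian_free_submodule:
  fixes R :: "('a, 'x) ring_scheme" and K :: "('b \<Rightarrow> 'a) set"
  assumes "cring R" "noetherian_ring R" "finite S"
    and "submodule K R (free_module R UNIV)" "K \<subseteq> carrier (free_module R S)"
  obtains T where "finite T" "T \<subseteq> K" "K \<subseteq> submodule_span R (free_module R UNIV) T"
proof -
  interpret cring R by fact
  interpret N: noetherian_ring R by fact
  let ?U = "free_module R UNIV :: ('a, 'b \<Rightarrow> 'a) module"
  note m = free_module_module[OF assms(1), of UNIV]
  interpret U: module R ?U by (rule m)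
  have "\<exists>T. finite T \<and> T \<subseteq> K \<and> K \<subseteq> submodule_span R ?U T"
    using assms(3-5)
  proof (induction S arbitrary: K rule: finite_induct)
    case empty
    have "K \<subseteq> {\<zero>\<^bsub>?U\<^esub>}"
    proof
      fix \<phi> assume "\<phi> \<in> K"
      then have "\<phi> \<in> carrier (free_module R {})" using empty by blast
      then show "\<phi> \<in> {\<zero>\<^bsub>?U\<^esub>}" by (auto simp: free_simps free_carrier)
    qed
    then show ?case using submodule_zero[OF submodule_span_submodule[OF m empty_subsetI]] by blast
  next
    case (insert s S)
    note Ks = submodule_closed[OF insert.prems(1)] and Kc = submodule_sub[OF insert.prems(1)]
    let ?ev = "\<lambda>\<phi> :: 'b \<Rightarrow> 'a. \<phi> s"
    have ev: "?ev \<in> mod_hom R ?U (ring_module R)" by (rule free_eval_hom[OF assms(1)])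
    note mR = ring_module_module[OF assms(1)]
    have evK: "ideal (?ev ` K) R" unfolding ideal_iff_submodule[OF assms(1)]
      by (rule image_submodule[OF m mR ev insert.prems(1)])
    then obtain A where A: "A \<subseteq> carrier R" "finite A" "?ev ` K = Idl\<^bsub>R\<^esub> A"
      using N.finetely_gen[OF evK] by auto
    have "A \<subseteq> ?ev ` K" unfolding A(3) by (rule genideal_self[OF A(1)])
    then obtain T1 where T1: "T1 \<subseteq> K" "finite T1" "A = ?ev ` T1" using finite_subset_image[OF A(2)] by blast
    have T1c: "T1 \<subseteq> carrier ?U" using T1(1) Kc by auto
    note sp1 = submodule_span_submodule[OF m T1c]
    have sub1: "submodule_span R ?U T1 \<subseteq> K" by (rule submodule_span_least[OF insert.prems(1) T1(1)])
    have "ideal (?ev ` submodule_span R ?U T1) R" unfolding ideal_iff_submodule[OF assms(1)]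
      by (rule image_submodule[OF m mR ev sp1])
    moreover have "A \<subseteq> ?ev ` submodule_span R ?U T1" unfolding T1(3) by (rule image_mono[OF submodule_span_incl])
    ultimately have cover: "?ev ` K \<subseteq> ?ev ` submodule_span R ?U T1" unfolding A(3) by (rule genideal_minimal)
    let ?K' = "K \<inter> carrier (free_module R S)"
    have K': "submodule ?K' R ?U"
      using Ks Kc submodule_closed[OF free_submodule[OF assms(1) subset_UNIV[of S]]]
      by (intro submodule_criterion[OF m]) auto
    obtain T2 where T2: "finite T2" "T2 \<subseteq> ?K'" "?K' \<subseteq> submodule_span R ?U T2"
      using insert.IH[OF K' Int_lower2] by (elim exE conjE)
    have "T1 \<union> T2 \<subseteq> carrier ?U" using T1c T2(2) Kc by auto
    note sp = submodule_span_submodule[OF m this]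
    have "K \<subseteq> submodule_span R ?U (T1 \<union> T2)"
    proof
      fix \<phi> assume \<phi>: "\<phi> \<in> K"
      then have "\<phi> s \<in> ?ev ` submodule_span R ?U T1" using cover by blast
      then obtain \<psi> where \<psi>: "\<psi> \<in> submodule_span R ?U T1" "\<phi> s = \<psi> s" by auto
      have \<psi>K: "\<psi> \<in> K" using \<psi> sub1 by auto
      have c: "\<phi> \<in> carrier ?U" "\<psi> \<in> carrier ?U" using \<phi> \<psi>K Kc by auto
      have d: "\<phi> \<ominus>\<^bsub>?U\<^esub> \<psi> \<in> K" using \<phi> \<psi>K Ks by auto
      then have d': "\<phi> \<ominus>\<^bsub>?U\<^esub> \<psi> \<in> carrier (free_module R (insert s S))" using insert.prems(2) by auto
      have "(\<phi> \<ominus>\<^bsub>?U\<^esub> \<psi>) s = \<phi> s \<ominus>\<^bsub>ring_module R\<^esub> \<psi> s"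
        using mod_hom_minus[OF m mR ev c] by simp
      also have "\<dots> = \<zero>\<^bsub>R\<^esub>"
        using module_minus_eq_zero_iff[OF mR, of "\<psi> s" "\<psi> s"] mod_hom_closed[OF ev c(2)] \<psi>(2) by (simp add: ring_module_simps)
      finally have "\<phi> \<ominus>\<^bsub>?U\<^esub> \<psi> \<in> carrier (free_module R S)"
        using d' unfolding free_carrier by auto
      then have "\<phi> \<ominus>\<^bsub>?U\<^esub> \<psi> \<in> submodule_span R ?U (T1 \<union> T2)"
        using d T2(3) submodule_span_mono[of T2 "T1 \<union> T2" R ?U] by blast
      moreover have "\<psi> \<in> submodule_span R ?U (T1 \<union> T2)"
        using \<psi>(1) submodule_span_mono[of T1 "T1 \<union> T2" R ?U] by blast
      ultimately have "\<psi> \<oplus>\<^bsub>?U\<^esub> (\<phi> \<ominus>\<^bsub>?U\<^esub> \<psi>) \<in> submodule_span R ?U (T1 \<union> T2)"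
        using submodule_add[OF sp] by blast
      then show "\<phi> \<in> submodule_span R ?U (T1 \<union> T2)" using module_add_minus_cancel(1)[OF m c(2,1)] by simp
    qed
    then show ?case using T1 T2 by (intro exI[of _ "T1 \<union> T2"]) auto
  qed
  then show ?thesis using that by blast
qed

context canonical_res
begin

interpretation X: module R X by (rule X)

text \<open>Finitely many generators in each degree already form a resolution: the syzygies between
  finitely many generators are finitely generated.\<close>

lemma finite_subresolution:
  assumes N: "noetherian_ring R" and fg: "finitely_generated R X"
  obtains S where "\<And>n. finite (S n)" "\<And>n. S n \<subseteq> res_gens R X n"
    and "res_aug R X ` carrier (free_module R (S 0)) = carrier X"
    and "\<And>p. \<lbrakk>p \<in> carrier (free_module R (S 0)); res_aug R X p = \<zero>\<^bsub>X\<^esub>\<rbrakk> \<Longrightarrow> p \<in> res_diff R ` carrier (free_module R (S 1))"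
    and "\<And>n p. \<lbrakk>p \<in> carrier (free_module R (S (Suc n))); res_diff R p = \<zero>\<^bsub>P n\<^esub>\<rbrakk> \<Longrightarrow>
      p \<in> res_diff R ` carrier (free_module R (S (Suc (Suc n))))"
proof -
  note m = free_module_module[OF R]
  let ?U = "free_module R UNIV :: ('r, ('r, 'a) gen \<Rightarrow> 'r) module"
  \<comment> \<open>the zero of a free module does not depend on the basis, so one zero serves all positive degrees\<close>
  define cyc where "cyc n = {p \<in> carrier (P n). if n = 0 then res_aug R X p = \<zero>\<^bsub>X\<^esub> else res_diff R p = \<zero>\<^bsub>?U\<^esub>}" for n
  have cyc: "submodule (cyc n) R (P n)" for n
  proof (cases n)
    case 0
    have "cyc n = a_kernel (P 0) X (res_aug R X)" by (auto simp: cyc_def 0 a_kernel_iff)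
    then show ?thesis using kernel_submodule[OF m X res_aug_hom] 0 by simp
  next
    case (Suc k)
    have "cyc n = a_kernel (P (Suc k)) (P k) (res_diff R)"
      by (auto simp: cyc_def Suc a_kernel_iff free_simps)
    then show ?thesis using kernel_submodule[OF m m res_diff_Suc_hom[of k]] Suc by simp
  qed
  have "\<exists>S. \<forall>n. (finite (S n) \<and> S n \<subseteq> res_gens R X n \<and> (n = 0 \<longrightarrow> carrier X \<subseteq> res_aug R X ` carrier (free_module R (S n)))) \<and>
      cyc n \<inter> carrier (free_module R (S n)) \<subseteq> res_diff R ` carrier (free_module R (S (Suc n)))"
  proof (rule dependent_nat_choice)
    obtain T where T: "finite T" "T \<subseteq> carrier X" "submodule_span R X T = carrier X"
      using fg by (auto simp: finitely_generated_def)
    let ?S = "Gen ` T"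
    have h: "res_aug R X \<in> mod_hom R (free_module R ?S) X"
      unfolding res_aug_def by (rule free_lift_hom[OF X]) (use T(2) in auto)
    have "T \<subseteq> res_aug R X ` carrier (free_module R ?S)"
    proof
      fix t assume "t \<in> T"
      then show "t \<in> res_aug R X ` carrier (free_module R ?S)"
        using T(2) free_unit_carrier[OF R, of "Gen t" ?S] res_aug_unit[of t] by (metis image_eqI subsetD)
    qed
    then have "submodule_span R X T \<subseteq> res_aug R X ` carrier (free_module R ?S)"
      by (rule submodule_span_least[OF image_carrier_submodule[OF m X h]])
    then have "carrier X \<subseteq> res_aug R X ` carrier (free_module R ?S)" by (simp only: T(3))
    then show "\<exists>S. finite S \<and> S \<subseteq> res_gens R X 0 \<and> (0 = 0 \<longrightarrow> carrier X \<subseteq> res_aug R X ` carrier (free_module R S))"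
      using T by (intro exI[of _ ?S]) (auto simp: res_gens.simps)
  next
    fix S n assume S: "finite S \<and> S \<subseteq> res_gens R X n \<and> (n = 0 \<longrightarrow> carrier X \<subseteq> res_aug R X ` carrier (free_module R S))"
    let ?K = "cyc n \<inter> carrier (free_module R S)"
    have cU: "submodule (cyc n) R ?U"
    proof (rule submodule_criterion[OF m])
      show "cyc n \<subseteq> carrier ?U" using submodule_sub[OF cyc] free_mono[OF subset_UNIV] by blast
    qed (use submodule_closed[OF cyc[of n]] in \<open>auto simp: free_simps\<close>)
    have fU: "submodule (carrier (free_module R S)) R ?U" by (rule free_submodule[OF R subset_UNIV])
    have K: "submodule ?K R ?U"
      using submodule_closed[OF cU] submodule_closed[OF fU] submodule_sub[OF cU]
      by (intro submodule_criterion[OF m]) auto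
    obtain T where T: "finite T" "T \<subseteq> ?K" "?K \<subseteq> submodule_span R ?U T"
      using noetherian_free_submodule[OF R N _ K] S by blast
    have "\<exists>l. set l \<subseteq> carrier R \<times> S \<and> syz_elem R l = t" if "t \<in> T" for t
      using syz_elem_exhaust[OF R, of t S] that T(2) by (metis IntD2 subsetD)
    then obtain l where l: "\<And>t. t \<in> T \<Longrightarrow> set (l t) \<subseteq> carrier R \<times> S" "\<And>t. t \<in> T \<Longrightarrow> syz_elem R (l t) = t" by metis
    let ?S' = "(\<lambda>t. Syz (l t)) ` T"
    have S': "Syz (l t) \<in> res_gens R X (Suc n)" if "t \<in> T" for t
    proof -
      have "set (l t) \<subseteq> carrier R \<times> res_gens R X n" using l(1)[OF that] S by auto
      moreover have "t \<in> cyc n" using that T(2) by auto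
      ultimately show ?thesis using l(2)[OF that] unfolding res_gens.simps(2) cyc_def by auto
    qed
    then have sub: "?S' \<subseteq> res_gens R X (Suc n)" by auto
    have h: "res_diff R \<in> mod_hom R (free_module R ?S') ?U"
      by (rule res_diff_hom_wf[OF R order_trans[OF sub gens_wf]])
    have "T \<subseteq> res_diff R ` carrier (free_module R ?S')"
    proof
      fix t assume t: "t \<in> T"
      then show "t \<in> res_diff R ` carrier (free_module R ?S')"
        using res_diff_syz[OF S'[OF t]] l(2)[OF t] free_unit_carrier[OF R, of "Syz (l t)" ?S'] by (metis image_eqI)
    qed
    then have "?K \<subseteq> res_diff R ` carrier (free_module R ?S')"
      using submodule_span_least[OF image_carrier_submodule[OF m m h]] T(3) by blast
    then show "\<exists>S'. (finite S' \<and> S' \<subseteq> res_gens R X (Suc n) \<and> (Suc n = 0 \<longrightarrow> carrier X \<subseteq> res_aug R X ` carrier (free_module R S'))) \<and>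
        ?K \<subseteq> res_diff R ` carrier (free_module R S')"
      using T(1) sub by (intro exI[of _ ?S'] conjI) auto
  qed
  then obtain S where SS: "\<forall>n. (finite (S n) \<and> S n \<subseteq> res_gens R X n \<and> (n = 0 \<longrightarrow> carrier X \<subseteq> res_aug R X ` carrier (free_module R (S n)))) \<and>
      cyc n \<inter> carrier (free_module R (S n)) \<subseteq> res_diff R ` carrier (free_module R (S (Suc n)))" by (elim exE)
  then have S: "\<And>n. finite (S n)" "\<And>n. S n \<subseteq> res_gens R X n"
    "carrier X \<subseteq> res_aug R X ` carrier (free_module R (S 0))"
    "\<And>n. cyc n \<inter> carrier (free_module R (S n)) \<subseteq> res_diff R ` carrier (free_module R (S (Suc n)))" by simp_all
  have SP: "carrier (free_module R (S n)) \<subseteq> carrier (P n)" for n by (rule free_mono[OF S(2)])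
  show ?thesis
  proof (rule that[OF S(1,2)])
    show "res_aug R X ` carrier (free_module R (S 0)) = carrier X"
      using S(3) SP[of 0] mod_hom_closed[OF res_aug_hom] by blast
    show "p \<in> res_diff R ` carrier (free_module R (S 1))"
      if "p \<in> carrier (free_module R (S 0))" "res_aug R X p = \<zero>\<^bsub>X\<^esub>" for p
      using that SP[of 0] S(4)[of 0] by (auto simp: cyc_def)
    show "p \<in> res_diff R ` carrier (free_module R (S (Suc (Suc n))))"
      if "p \<in> carrier (free_module R (S (Suc n)))" "res_diff R p = \<zero>\<^bsub>P n\<^esub>" for n p
      using that SP[of "Suc n"] S(4)[of "Suc n"] by (auto simp: cyc_def free_simps)
  qed
qed

text \<open>The identity of the resolution is homotopic to an endomorphism of finite rank in each degree.
  The homotopy \<open>h\<close> is built degree by degree on generators \<open>e\<close>: the boundary of \<open>y = e - h d e\<close> is a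
  cycle in the finite subresolution, hence the boundary of some \<open>q\<close> there, and the cycle \<open>y - q\<close> is a
  boundary, which is declared to be the boundary of \<open>h e\<close>.\<close>

lemma finite_rank_homotopy_nat:
  assumes N: "noetherian_ring R" and fg: "finitely_generated R X"
  obtains h S where "\<And>n. finite (S n)" "\<And>n. h n \<in> mod_hom R (P n) (P (Suc n))"
    and "\<And>p. p \<in> carrier (P 0) \<Longrightarrow> p \<ominus>\<^bsub>P 0\<^esub> res_diff R (h 0 p) \<in> carrier (free_module R (S 0))"
    and "\<And>n p. p \<in> carrier (P (Suc n)) \<Longrightarrow>
      p \<ominus>\<^bsub>P (Suc n)\<^esub> (res_diff R (h (Suc n) p) \<oplus>\<^bsub>P (Suc n)\<^esub> h n (res_diff R p)) \<in> carrier (free_module R (S (Suc n)))"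
proof -
  note m = free_module_module[OF R]
  note d = res_diff_Suc_hom
  obtain S where S: "\<And>n. finite (S n)" "\<And>n. S n \<subseteq> res_gens R X n"
    and S0: "res_aug R X ` carrier (free_module R (S 0)) = carrier X"
    and S1: "\<And>p. \<lbrakk>p \<in> carrier (free_module R (S 0)); res_aug R X p = \<zero>\<^bsub>X\<^esub>\<rbrakk> \<Longrightarrow> p \<in> res_diff R ` carrier (free_module R (S 1))"
    and S2: "\<And>n p. \<lbrakk>p \<in> carrier (free_module R (S (Suc n))); res_diff R p = \<zero>\<^bsub>P n\<^esub>\<rbrakk> \<Longrightarrow>
      p \<in> res_diff R ` carrier (free_module R (S (Suc (Suc n))))"
    by (rule finite_subresolution[OF N fg]) blast
  let ?Q = "\<lambda>n. carrier (free_module R (S n))"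
  have Q: "submodule (?Q n) R (P n)" for n by (rule free_submodule[OF R S(2)])
  note Qc = subsetD[OF submodule_sub[OF Q]]
  \<comment> \<open>The recursion needs of \<open>h n\<close> that \<open>d p - d (h (d p))\<close> lies in the finite part of degree \<open>n\<close>,
    for this is the boundary of the element \<open>y\<close> in the next degree.\<close>
  define good where "good n h \<longleftrightarrow> h \<in> mod_hom R (P n) (P (Suc n)) \<and>
      (\<forall>p\<in>carrier (P (Suc n)). res_diff R p \<ominus>\<^bsub>P n\<^esub> res_diff R (h (res_diff R p)) \<in> ?Q n) \<and>
      (n = 0 \<longrightarrow> (\<forall>p\<in>carrier (P n). p \<ominus>\<^bsub>P n\<^esub> res_diff R (h p) \<in> ?Q n))" for n h
  have "\<exists>h. \<forall>n. good n (h n) \<and> (\<forall>p\<in>carrier (P (Suc n)).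
      p \<ominus>\<^bsub>P (Suc n)\<^esub> (res_diff R (h (Suc n) p) \<oplus>\<^bsub>P (Suc n)\<^esub> h n (res_diff R p)) \<in> ?Q (Suc n))"
  proof (rule dependent_nat_choice)
    have "\<exists>b. b \<in> carrier (P 1) \<and> free_unit R e \<ominus>\<^bsub>P 0\<^esub> res_diff R b \<in> ?Q 0" if e: "e \<in> res_gens R X 0" for e
    proof -
      have u: "free_unit R e \<in> carrier (P 0)" by (rule free_unit_carrier[OF R e])
      then have "res_aug R X (free_unit R e) \<in> res_aug R X ` ?Q 0" using S0 mod_hom_closed[OF res_aug_hom] by simp
      then obtain q where q: "q \<in> ?Q 0" "res_aug R X (free_unit R e) = res_aug R X q" by blast
      have qc: "q \<in> carrier (P 0)" by (rule Qc[OF q(1)])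
      have "res_aug R X (free_unit R e \<ominus>\<^bsub>P 0\<^esub> q) = \<zero>\<^bsub>X\<^esub>"
        using q(2) mod_hom_minus[OF m X res_aug_hom u qc] mod_hom_closed[OF res_aug_hom qc] module_minus_eq_zero_iff[OF X] by simp
      then have "free_unit R e \<ominus>\<^bsub>P 0\<^esub> q \<in> res_diff R ` carrier (P 1)" by (rule aug_exact[OF module_minus_closed[OF m u qc]])
      then obtain b where b: "b \<in> carrier (P 1)" "free_unit R e \<ominus>\<^bsub>P 0\<^esub> q = res_diff R b" by blast
      have db: "res_diff R b \<in> carrier (P 0)" using mod_hom_closed[OF d[of 0]] b(1) by simp
      have "free_unit R e = q \<oplus>\<^bsub>P 0\<^esub> res_diff R b"
        using module_add_minus_cancel(1)[OF m qc u] b(2) by simp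
      then have "free_unit R e \<ominus>\<^bsub>P 0\<^esub> res_diff R b = q" using module_add_minus_cancel(4)[OF m db qc] by simp
      then show ?thesis using b q by auto
    qed
    then obtain b where b: "\<And>e. e \<in> res_gens R X 0 \<Longrightarrow> b e \<in> carrier (P 1)"
      "\<And>e. e \<in> res_gens R X 0 \<Longrightarrow> free_unit R e \<ominus>\<^bsub>P 0\<^esub> res_diff R (b e) \<in> ?Q 0" by metis
    let ?h = "free_lift R (P 1) b"
    have h: "?h \<in> mod_hom R (P 0) (P 1)" by (rule free_lift_hom[OF m b(1)])
    have h': "?h \<in> mod_hom R (P 0) (P (Suc 0))" using h by simp
    have k: "(\<lambda>p. p \<ominus>\<^bsub>P 0\<^esub> res_diff R (?h p)) \<in> mod_hom R (P 0) (P 0)"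
      by (rule mod_hom_diff[OF m mod_hom_id mod_hom_comp[OF h' d]])
    have all: "p \<ominus>\<^bsub>P 0\<^esub> res_diff R (?h p) \<in> ?Q 0" if "p \<in> carrier (P 0)" for p
    proof -
      have "p \<in> {p \<in> carrier (P 0). p \<ominus>\<^bsub>P 0\<^esub> res_diff R (?h p) \<in> ?Q 0}"
      proof (rule free_induct[OF R preimage_submodule[OF m m k Q] _ that])
        fix e assume e: "e \<in> res_gens R X 0"
        show "free_unit R e \<in> {p \<in> carrier (P 0). p \<ominus>\<^bsub>P 0\<^esub> res_diff R (?h p) \<in> ?Q 0}"
          using b(2)[OF e] free_unit_carrier[OF R e] free_lift_unit[OF P_module, of b e] b(1)[OF e] by simp
      qed
      then show ?thesis by simp
    qed
    have "good 0 ?h" unfolding good_def using h' all mod_hom_closed[OF d[of 0]] by (auto)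
    then show "\<exists>h. good 0 h" by blast
  next
    fix h n assume "good n h"
    then have h: "h \<in> mod_hom R (P n) (P (Suc n))"
      and hd: "\<And>p. p \<in> carrier (P (Suc n)) \<Longrightarrow> res_diff R p \<ominus>\<^bsub>P n\<^esub> res_diff R (h (res_diff R p)) \<in> ?Q n"
      by (auto simp: good_def)
    let ?n = "Suc n" and ?m = "Suc (Suc n)"
    note dc = mod_hom_closed[OF d] and hc = mod_hom_closed[OF h]
    have "\<exists>b. b \<in> carrier (P ?m) \<and> free_unit R e \<ominus>\<^bsub>P ?n\<^esub> (res_diff R b \<oplus>\<^bsub>P ?n\<^esub> h (res_diff R (free_unit R e))) \<in> ?Q ?n"
      if e: "e \<in> res_gens R X ?n" for e
    proof -
      let ?e = "free_unit R e" 
      let ?y = "?e \<ominus>\<^bsub>P ?n\<^esub> h (res_diff R ?e)"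
      have u: "?e \<in> carrier (P ?n)" by (rule free_unit_carrier[OF R e])
      have hu: "h (res_diff R ?e) \<in> carrier (P ?n)" using u dc hc by blast
      have y: "?y \<in> carrier (P ?n)" by (rule module_minus_closed[OF m u hu])
      have dy: "res_diff R ?y = res_diff R ?e \<ominus>\<^bsub>P n\<^esub> res_diff R (h (res_diff R ?e))"
        by (rule mod_hom_minus[OF m m d u hu])
      then have dyQ: "res_diff R ?y \<in> ?Q n" using hd[OF u] by simp
      have "res_diff R ?y \<in> res_diff R ` ?Q ?n"
      proof (cases n)
        case 0
        then show ?thesis using S1[of "res_diff R ?y"] dyQ aug_diff[of ?y] y by simp
      next
        case (Suc k)
        then show ?thesis using S2[of "res_diff R ?y" k] dyQ diff_diff[of ?y k] y by (simp)
      qed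
      then obtain q where q: "q \<in> ?Q ?n" "res_diff R ?y = res_diff R q" by blast
      have qc: "q \<in> carrier (P ?n)" by (rule Qc[OF q(1)])
      have "res_diff R (?y \<ominus>\<^bsub>P ?n\<^esub> q) = \<zero>\<^bsub>P n\<^esub>"
        using q(2) mod_hom_minus[OF m m d y qc] dc[OF qc] module_minus_eq_zero_iff[OF P_module] by simp
      then have "?y \<ominus>\<^bsub>P ?n\<^esub> q \<in> res_diff R ` carrier (P ?m)" by (rule diff_exact[OF module_minus_closed[OF m y qc]])
      then obtain b where b: "b \<in> carrier (P ?m)" "?y \<ominus>\<^bsub>P ?n\<^esub> q = res_diff R b" by blast
      have db: "res_diff R b \<in> carrier (P ?n)" by (rule dc[OF b(1)])
      have "?y = q \<oplus>\<^bsub>P ?n\<^esub> res_diff R b"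
        using module_add_minus_cancel(1)[OF m qc y] b(2) by simp
      then have "?e = (q \<oplus>\<^bsub>P ?n\<^esub> res_diff R b) \<oplus>\<^bsub>P ?n\<^esub> h (res_diff R ?e)"
        using module_add_minus_cancel(2)[OF m hu u] by simp
      also have "\<dots> = q \<oplus>\<^bsub>P ?n\<^esub> (res_diff R b \<oplus>\<^bsub>P ?n\<^esub> h (res_diff R ?e))"
        using qc db hu by (auto simp: free_simps free_carrier fun_eq_iff cring.cring_simprules[OF R])
      finally have "?e \<ominus>\<^bsub>P ?n\<^esub> (res_diff R b \<oplus>\<^bsub>P ?n\<^esub> h (res_diff R ?e)) = q"
        using module_add_minus_cancel(4)[OF m module_add_closed[OF m db hu] qc] by simp
      then show ?thesis using b q by auto
    qed
    then obtain b where b: "\<And>e. e \<in> res_gens R X ?n \<Longrightarrow> b e \<in> carrier (P ?m)"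
      "\<And>e. e \<in> res_gens R X ?n \<Longrightarrow> free_unit R e \<ominus>\<^bsub>P ?n\<^esub> (res_diff R (b e) \<oplus>\<^bsub>P ?n\<^esub> h (res_diff R (free_unit R e))) \<in> ?Q ?n"
      by metis
    let ?h = "free_lift R (P ?m) b"
    have h': "?h \<in> mod_hom R (P ?n) (P ?m)" by (rule free_lift_hom[OF m b(1)])
    have k: "(\<lambda>p. p \<ominus>\<^bsub>P ?n\<^esub> (res_diff R (?h p) \<oplus>\<^bsub>P ?n\<^esub> h (res_diff R p))) \<in> mod_hom R (P ?n) (P ?n)"
      by (rule mod_hom_diff[OF m mod_hom_id mod_hom_plus[OF m mod_hom_comp[OF h' d] mod_hom_comp[OF d h]]])
    have all: "p \<ominus>\<^bsub>P ?n\<^esub> (res_diff R (?h p) \<oplus>\<^bsub>P ?n\<^esub> h (res_diff R p)) \<in> ?Q ?n" if "p \<in> carrier (P ?n)" for p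
    proof -
      have "p \<in> {p \<in> carrier (P ?n). p \<ominus>\<^bsub>P ?n\<^esub> (res_diff R (?h p) \<oplus>\<^bsub>P ?n\<^esub> h (res_diff R p)) \<in> ?Q ?n}"
      proof (rule free_induct[OF R preimage_submodule[OF m m k Q] _ that])
        fix e assume e: "e \<in> res_gens R X ?n"
        show "free_unit R e \<in> {p \<in> carrier (P ?n). p \<ominus>\<^bsub>P ?n\<^esub> (res_diff R (?h p) \<oplus>\<^bsub>P ?n\<^esub> h (res_diff R p)) \<in> ?Q ?n}"
          using b(2)[OF e] free_unit_carrier[OF R e] free_lift_unit[OF P_module, of b e] b(1)[OF e] by simp
      qed
      then show ?thesis by simp
    qed
    have "res_diff R p \<ominus>\<^bsub>P ?n\<^esub> res_diff R (?h (res_diff R p)) \<in> ?Q ?n" if p: "p \<in> carrier (P ?m)" for p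
    proof -
      interpret Pn: module R "P ?n" by (rule m)
      have "h (res_diff R (res_diff R p)) = \<zero>\<^bsub>P ?n\<^esub>" using diff_diff[OF p] mod_hom_zero[OF m m h] by simp
      moreover have "res_diff R (?h (res_diff R p)) \<in> carrier (P ?n)" using p dc mod_hom_closed[OF h'] by blast
      ultimately show ?thesis using all[OF dc[OF p]] by simp
    qed
    then have "good ?n ?h" unfolding good_def using h' by auto
    then show "\<exists>h'. good ?n h' \<and> (\<forall>p\<in>carrier (P ?n). p \<ominus>\<^bsub>P ?n\<^esub> (res_diff R (h' p) \<oplus>\<^bsub>P ?n\<^esub> h (res_diff R p)) \<in> ?Q ?n)"
      using all by blast
  qed
  then obtain h where h: "\<And>n. good n (h n)" "\<And>n p. p \<in> carrier (P (Suc n)) \<Longrightarrow>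
      p \<ominus>\<^bsub>P (Suc n)\<^esub> (res_diff R (h (Suc n) p) \<oplus>\<^bsub>P (Suc n)\<^esub> h n (res_diff R p)) \<in> ?Q (Suc n)" by blast
  show ?thesis
    by (rule that[of S h]) (use h S in \<open>auto simp: good_def\<close>)
qed

text \<open>The endomorphism is \<open>g = 1 - (d h + h d)\<close>.  It commutes with \<open>d\<close> because
  \<open>d (d h + h d) = d h d = (d h + h d) d\<close>.\<close>

theorem finite_rank_homotopy:
  assumes N: "noetherian_ring R" and fg: "finitely_generated R X"
  obtains g h S where "\<And>n. finite (S n)"
    and "\<And>n. g n \<in> mod_hom R (free_res R X n) (free_res R X n)"
    and "\<And>n. h n \<in> mod_hom R (free_res R X n) (free_res R X (n + 1))"
    and "\<And>n p. p \<in> carrier (free_res R X n) \<Longrightarrow> g n p \<in> carrier (free_module R (S n))"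
    and "\<And>n p. p \<in> carrier (free_res R X n) \<Longrightarrow>
      p = g n p \<oplus>\<^bsub>free_res R X n\<^esub> (res_diff R (h n p) \<oplus>\<^bsub>free_res R X n\<^esub> h (n - 1) (res_diff R p))"
    and "\<And>n p. p \<in> carrier (free_res R X n) \<Longrightarrow> g (n - 1) (res_diff R p) = res_diff R (g n p)"
proof -
  let ?Q = "free_res R X"
  obtain h S where S: "\<And>n. finite (S n)" and h: "\<And>n. h n \<in> mod_hom R (P n) (P (Suc n))"
    and h0: "\<And>p. p \<in> carrier (P 0) \<Longrightarrow> p \<ominus>\<^bsub>P 0\<^esub> res_diff R (h 0 p) \<in> carrier (free_module R (S 0))"
    and h1: "\<And>n p. p \<in> carrier (P (Suc n)) \<Longrightarrow>
      p \<ominus>\<^bsub>P (Suc n)\<^esub> (res_diff R (h (Suc n) p) \<oplus>\<^bsub>P (Suc n)\<^esub> h n (res_diff R p)) \<in> carrier (free_module R (S (Suc n)))"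
    by (rule finite_rank_homotopy_nat[OF N fg]) blast
  define h' where "h' n = (if n < 0 then (\<lambda>_. \<zero>\<^bsub>?Q (n + 1)\<^esub>) else h (nat n))" for n :: int
  define S' where "S' n = (if n < 0 then {} else S (nat n))" for n :: int
  have d: "res_diff R \<in> mod_hom R (?Q n) (?Q (n - 1))" for n by (rule res_diff_hom)
  note m = free_res_module
  have h': "h' n \<in> mod_hom R (?Q n) (?Q (n + 1))" for n
  proof (cases "n < 0")
    case True then show ?thesis by (simp add: h'_def mod_hom_const_zero[OF m])
  next
    case False
    then obtain k where "n = int k" by (metis nonneg_int_cases not_less)
    then show ?thesis using h[of k] by (simp add: h'_def free_res_nat)
  qed
  have d': "res_diff R \<in> mod_hom R (?Q (n + 1)) (?Q n)" for n using d[of "n + 1"] by simp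
  have h'': "h' (n - 1) \<in> mod_hom R (?Q (n - 1)) (?Q n)" for n using h'[of "n - 1"] by simp
  let ?k = "\<lambda>n p. res_diff R (h' n p) \<oplus>\<^bsub>?Q n\<^esub> h' (n - 1) (res_diff R p)"
  define g where "g n p = p \<ominus>\<^bsub>?Q n\<^esub> ?k n p" for n p
  have k: "?k n \<in> mod_hom R (?Q n) (?Q n)" for n
    by (rule mod_hom_plus[OF m mod_hom_comp[OF h' d'] mod_hom_comp[OF d h'']])
  have g: "g n \<in> mod_hom R (?Q n) (?Q n)" for n
    unfolding g_def by (rule mod_hom_diff[OF m mod_hom_id k])
  have dd: "res_diff R (res_diff R p) = \<zero>\<^bsub>?Q (n - 1 - 1)\<^esub>" if p: "p \<in> carrier (?Q n)" for n p
  proof (cases "n > 1")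
    case True
    then obtain j where j: "n = int (Suc (Suc j))" by (intro that[of "nat (n - 2)"]) auto
    then show ?thesis using diff_diff[of p j] p by (simp add: free_res_def nat_add_distrib free_simps)
  next
    case False
    have c: "res_diff R p \<in> carrier (?Q (n - 1))" by (rule mod_hom_closed[OF d p])
    have "carrier (?Q (n - 1)) \<subseteq> carrier (P 0)" using False by (auto simp: free_res_def free_carrier)
    then show ?thesis using c res_diff_0[of "res_diff R p"] by (auto simp: free_res_def)
  qed
  have split: "p = g n p \<oplus>\<^bsub>?Q n\<^esub> ?k n p" if "p \<in> carrier (?Q n)" for n p
    unfolding g_def using module_add_minus_cancel(2)[OF m mod_hom_closed[OF k that] that] by simp
  show ?thesis
  proof (rule that[of S' g h'])
    show "finite (S' n)" for n using S by (simp add: S'_def)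
    show "g n p \<in> carrier (free_module R (S' n))" if p: "p \<in> carrier (?Q n)" for n p
    proof (cases "n < 0")
      case True
      then have "?Q n = free_module R {}" by (rule free_res_neg)
      then show ?thesis using mod_hom_closed[OF g p] True by (simp add: S'_def)
    next
      case False
      then obtain j where j: "n = int j" by (metis nonneg_int_cases not_less)
      show ?thesis
      proof (cases j)
        case 0
        have e: "?Q n = P 0" by (simp add: j 0 free_res_def)
        have "h' (n - 1) (res_diff R p) = \<zero>\<^bsub>P 0\<^esub>" by (simp add: h'_def j 0 free_simps free_res_def)
        moreover have "res_diff R (h 0 p) \<in> carrier (P 0)" using p e mod_hom_closed[OF res_diff_Suc_hom[of 0]] mod_hom_closed[OF h[of 0]] by auto
        ultimately have "g n p = p \<ominus>\<^bsub>P 0\<^esub> res_diff R (h 0 p)"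
          unfolding g_def e using abelian_monoid.r_zero[OF abelian_group.axioms(1)[OF module.axioms(2)[OF m[of 0]]]] by (simp add: h'_def j 0 free_res_def)
        then show ?thesis using h0 p e by (simp add: S'_def j 0)
      next
        case (Suc i)
        have e: "?Q n = P (Suc i)" by (simp add: j Suc free_res_def nat_add_distrib)
        show ?thesis using h1[of p i] p unfolding g_def e by (simp add: h'_def S'_def j Suc nat_add_distrib)
      qed
    qed
    show "g (n - 1) (res_diff R p) = res_diff R (g n p)" if p: "p \<in> carrier (?Q n)" for n p
    proof -
      interpret Q1: module R "?Q (n - 1)" by (rule m)
      have dp: "res_diff R p \<in> carrier (?Q (n - 1))" by (rule mod_hom_closed[OF d p])
      have kp: "?k n p \<in> carrier (?Q n)" by (rule mod_hom_closed[OF k p])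
      have hp: "h' n p \<in> carrier (?Q (n + 1))" by (rule mod_hom_closed[OF h' p])
      have hdp: "h' (n - 1) (res_diff R p) \<in> carrier (?Q n)" by (rule mod_hom_closed[OF h'' dp])
      have "res_diff R (?k n p) = res_diff R (res_diff R (h' n p)) \<oplus>\<^bsub>?Q (n - 1)\<^esub> res_diff R (h' (n - 1) (res_diff R p))"
        by (rule mod_hom_add[OF d mod_hom_closed[OF d' hp] hdp])
      also have "\<dots> = res_diff R (h' (n - 1) (res_diff R p))"
        using dd[OF hp] mod_hom_closed[OF d hdp] by simp
      also have "\<dots> = ?k (n - 1) (res_diff R p)"
        using dd[OF p] mod_hom_zero[OF m m h''[of "n - 1"]] mod_hom_closed[OF d hdp] by simp
      finally show ?thesis unfolding g_def using mod_hom_minus[OF m m d p kp] by simp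
    qed
  qed (rule g h' split; assumption?)+
qed

end


section \<open>Double complexes\<close>

text \<open>A first quadrant double complex \<open>C\<close>, augmented to complexes \<open>Y\<close> (along \<open>h\<close>) and \<open>W\<close>
  (along \<open>v\<close>), and exact along \<open>h\<close>.  The two differentials commute, so that no signs occur.\<close>

locale double_complex =
  fixes R :: "('r, 'x) ring_scheme" and C :: "nat \<Rightarrow> nat \<Rightarrow> ('r, 'a, 'b) module_scheme"
    and h v :: "nat \<Rightarrow> nat \<Rightarrow> 'a \<Rightarrow> 'a"
    and Y :: "nat \<Rightarrow> ('r, 'y, 'c) module_scheme" and \<eta> :: "nat \<Rightarrow> 'a \<Rightarrow> 'y" and dY :: "nat \<Rightarrow> 'y \<Rightarrow> 'y"
    and W :: "nat \<Rightarrow> ('r, 'w, 'd) module_scheme" and \<epsilon> :: "nat \<Rightarrow> 'a \<Rightarrow> 'w" and dW :: "nat \<Rightarrow> 'w \<Rightarrow> 'w"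
  assumes mC: "\<And>p q. module R (C p q)" and mY: "\<And>q. module R (Y q)" and mW: "\<And>p. module R (W p)"
    and h: "\<And>p q. h p q \<in> mod_hom R (C (Suc p) q) (C p q)"
    and v: "\<And>p q. v p q \<in> mod_hom R (C p (Suc q)) (C p q)"
    and \<eta>: "\<And>q. \<eta> q \<in> mod_hom R (C 0 q) (Y q)" and dY: "\<And>q. dY q \<in> mod_hom R (Y (Suc q)) (Y q)"
    and \<epsilon>: "\<And>p. \<epsilon> p \<in> mod_hom R (C p 0) (W p)" and dW: "\<And>p. dW p \<in> mod_hom R (W (Suc p)) (W p)"
    and hv: "\<And>p q x. x \<in> carrier (C (Suc p) (Suc q)) \<Longrightarrow> h p q (v (Suc p) q x) = v p q (h p (Suc q) x)"
    and \<eta>v: "\<And>q x. x \<in> carrier (C 0 (Suc q)) \<Longrightarrow> \<eta> q (v 0 q x) = dY q (\<eta> (Suc q) x)"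
    and \<epsilon>h: "\<And>p x. x \<in> carrier (C (Suc p) 0) \<Longrightarrow> \<epsilon> p (h p 0 x) = dW p (\<epsilon> (Suc p) x)"
    and vv: "\<And>p q x. x \<in> carrier (C p (Suc (Suc q))) \<Longrightarrow> v p q (v p (Suc q) x) = \<zero>\<^bsub>C p q\<^esub>"
    and \<epsilon>v: "\<And>p x. x \<in> carrier (C p (Suc 0)) \<Longrightarrow> \<epsilon> p (v p 0 x) = \<zero>\<^bsub>W p\<^esub>"
    and \<eta>_surj: "\<And>q. \<eta> q ` carrier (C 0 q) = carrier (Y q)"
    and \<eta>_exact: "\<And>q x. \<lbrakk>x \<in> carrier (C 0 q); \<eta> q x = \<zero>\<^bsub>Y q\<^esub>\<rbrakk> \<Longrightarrow> x \<in> h 0 q ` carrier (C (Suc 0) q)"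
    and h_exact: "\<And>p q x. \<lbrakk>x \<in> carrier (C (Suc p) q); h p q x = \<zero>\<^bsub>C p q\<^esub>\<rbrakk> \<Longrightarrow> x \<in> h (Suc p) q ` carrier (C (Suc (Suc p)) q)"

text \<open>The elements \<open>z\<close> of \<open>Y i\<close> and \<open>w\<close> of \<open>W i\<close> are the two ends of a staircase through the
  double complex; this relation induces the comparison of the homology of \<open>Y\<close> and \<open>W\<close>.\<close>

definition staircase where
  "staircase C h v \<eta> \<epsilon> i z w \<longleftrightarrow> (\<exists>c. (\<forall>p q. p + q = i \<longrightarrow> c p \<in> carrier (C p q)) \<and>
     \<eta> i (c 0) = z \<and> \<epsilon> i (c i) = w \<and>
     (\<forall>p q. Suc (p + q) = i \<longrightarrow> v p q (c p) = h p q (c (Suc p))))"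

text \<open>The steps of the staircase, numbered from the other end.\<close>

lemma staircase_swap:
  assumes "staircase C h v \<eta> \<epsilon> i z w"
  shows "staircase (\<lambda>p q. C q p) (\<lambda>p q. v q p) (\<lambda>p q. h q p) \<epsilon> \<eta> i w z"
proof -
  obtain c where c: "\<And>p q. p + q = i \<Longrightarrow> c p \<in> carrier (C p q)" "\<eta> i (c 0) = z" "\<epsilon> i (c i) = w"
     "\<And>p q. Suc (p + q) = i \<Longrightarrow> v p q (c p) = h p q (c (Suc p))"
    using assms unfolding staircase_def by blast
  have "h q p (c (i - p)) = v q p (c (i - Suc p))" if pq: "Suc (p + q) = i" for p q
  proof -
    have "i - p = Suc q" "i - Suc p = q" "Suc (q + p) = i" using pq by auto
    then show ?thesis using c(4) by metis
  qed
  moreover have "c (i - p) \<in> carrier (C q p)" if "p + q = i" for p q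
    using c(1)[of q p] that by (metis add.commute add_diff_cancel_left')
  ultimately show ?thesis unfolding staircase_def using c(2,3)
    by (intro exI[of _ "\<lambda>p. c (i - p)"]) auto
qed

context double_complex
begin

lemma staircase_add:
  assumes "staircase C h v \<eta> \<epsilon> i z w" "staircase C h v \<eta> \<epsilon> i z' w'"
  shows "staircase C h v \<eta> \<epsilon> i (z \<oplus>\<^bsub>Y i\<^esub> z') (w \<oplus>\<^bsub>W i\<^esub> w')"
proof -
  obtain c where c: "\<And>p q. p + q = i \<Longrightarrow> c p \<in> carrier (C p q)" "\<eta> i (c 0) = z" "\<epsilon> i (c i) = w"
     "\<And>p q. Suc (p + q) = i \<Longrightarrow> v p q (c p) = h p q (c (Suc p))"
    using assms(1) unfolding staircase_def by blast
  obtain c' where c': "\<And>p q. p + q = i \<Longrightarrow> c' p \<in> carrier (C p q)" "\<eta> i (c' 0) = z'" "\<epsilon> i (c' i) = w'"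
     "\<And>p q. Suc (p + q) = i \<Longrightarrow> v p q (c' p) = h p q (c' (Suc p))"
    using assms(2) unfolding staircase_def by blast
  let ?c = "\<lambda>p. c p \<oplus>\<^bsub>C p (i - p)\<^esub> c' p"
  have e: "?c p = c p \<oplus>\<^bsub>C p q\<^esub> c' p" if "p + q = i" for p q
    using that by (metis add_diff_cancel_left')
  show ?thesis unfolding staircase_def
  proof (intro exI[of _ ?c] conjI allI impI)
    show "?c p \<in> carrier (C p q)" if "p + q = i" for p q
      unfolding e[OF that] by (rule module_add_closed[OF mC c(1)[OF that] c'(1)[OF that]])
    show "\<eta> i (?c 0) = z \<oplus>\<^bsub>Y i\<^esub> z'"
      using e[of 0 i] c(1)[of 0 i] c'(1)[of 0 i] c(2) c'(2) by (simp add: mod_hom_add[OF \<eta>])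
    show "\<epsilon> i (?c i) = w \<oplus>\<^bsub>W i\<^esub> w'"
      using e[of i 0] c(1)[of i 0] c'(1)[of i 0] c(3) c'(3) by (simp add: mod_hom_add[OF \<epsilon>])
    fix p q assume pq: "Suc (p + q) = i"
    then have a: "p + Suc q = i" "Suc p + q = i" by auto
    show "v p q (?c p) = h p q (?c (Suc p))"
      unfolding e[OF a(1)] e[OF a(2)] using c(1)[OF a(1)] c'(1)[OF a(1)] c(1)[OF a(2)] c'(1)[OF a(2)] c(4)[OF pq] c'(4)[OF pq]
      by (simp add: mod_hom_add[OF v] mod_hom_add[OF h])
  qed
qed

lemma staircase_smult:
  assumes "r \<in> carrier R" "staircase C h v \<eta> \<epsilon> i z w"
  shows "staircase C h v \<eta> \<epsilon> i (r \<odot>\<^bsub>Y i\<^esub> z) (r \<odot>\<^bsub>W i\<^esub> w)"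
proof -
  obtain c where c: "\<And>p q. p + q = i \<Longrightarrow> c p \<in> carrier (C p q)" "\<eta> i (c 0) = z" "\<epsilon> i (c i) = w"
     "\<And>p q. Suc (p + q) = i \<Longrightarrow> v p q (c p) = h p q (c (Suc p))"
    using assms(2) unfolding staircase_def by blast
  let ?c = "\<lambda>p. r \<odot>\<^bsub>C p (i - p)\<^esub> c p"
  have e: "?c p = r \<odot>\<^bsub>C p q\<^esub> c p" if "p + q = i" for p q
    using that by (metis add_diff_cancel_left')
  show ?thesis unfolding staircase_def
  proof (intro exI[of _ ?c] conjI allI impI)
    show "?c p \<in> carrier (C p q)" if "p + q = i" for p q
      unfolding e[OF that] by (rule module_smult_closed[OF mC assms(1) c(1)[OF that]])
    show "\<eta> i (?c 0) = r \<odot>\<^bsub>Y i\<^esub> z"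
      using e[of 0 i] c(1)[of 0 i] c(2) assms(1) by (simp add: mod_hom_smult[OF \<eta>])
    show "\<epsilon> i (?c i) = r \<odot>\<^bsub>W i\<^esub> w"
      using e[of i 0] c(1)[of i 0] c(3) assms(1) by (simp add: mod_hom_smult[OF \<epsilon>])
    fix p q assume pq: "Suc (p + q) = i"
    then have a: "p + Suc q = i" "Suc p + q = i" by auto
    show "v p q (?c p) = h p q (?c (Suc p))"
      unfolding e[OF a(1)] e[OF a(2)] using c(1)[OF a(1)] c(1)[OF a(2)] c(4)[OF pq] assms(1)
      by (simp add: mod_hom_smult[OF v] mod_hom_smult[OF h])
  qed
qed

lemma staircase_carrier:
  assumes "staircase C h v \<eta> \<epsilon> i z w"
  shows "z \<in> carrier (Y i)" "w \<in> carrier (W i)"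
  using assms mod_hom_closed[OF \<eta>] mod_hom_closed[OF \<epsilon>] unfolding staircase_def by auto

lemma staircase_minus:
  assumes "staircase C h v \<eta> \<epsilon> i z w" "staircase C h v \<eta> \<epsilon> i z' w'"
  shows "staircase C h v \<eta> \<epsilon> i (z \<ominus>\<^bsub>Y i\<^esub> z') (w \<ominus>\<^bsub>W i\<^esub> w')"
proof -
  interpret Y: module R "Y i" by (rule mY)
  have "\<ominus>\<^bsub>R\<^esub> \<one>\<^bsub>R\<^esub> \<in> carrier R" by simp
  then show ?thesis
    using staircase_add[OF assms(1) staircase_smult[OF _ assms(2)]] staircase_carrier[OF assms(2)]
    by (simp add: a_minus_def module_neg_smult[OF mY] module_neg_smult[OF mW])
qed

lemma staircase_end_cycle:
  assumes "staircase C h v \<eta> \<epsilon> (Suc j) z w"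
  shows "dW j w = \<zero>\<^bsub>W j\<^esub>"
proof -
  obtain c where c: "\<And>p q. p + q = Suc j \<Longrightarrow> c p \<in> carrier (C p q)" "\<epsilon> (Suc j) (c (Suc j)) = w"
     "\<And>p q. Suc (p + q) = Suc j \<Longrightarrow> v p q (c p) = h p q (c (Suc p))"
    using assms unfolding staircase_def by blast
  show ?thesis
    using c(1)[of j "Suc 0"] c(1)[of "Suc j" 0] c(2) c(3)[of j 0] \<epsilon>h[of "c (Suc j)" j] \<epsilon>v[of "c j" j] by simp
qed

text \<open>Descend from a lift of \<open>z\<close> to \<open>C 0 i\<close>.  At each step \<open>v (c p)\<close> is a cycle for \<open>h\<close>, since \<open>h\<close> of it is
  \<open>v\<close> of the previous step's \<open>v (c (p - 1))\<close>, so exactness along \<open>h\<close> provides \<open>c (p + 1)\<close>.\<close>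

lemma staircase_exists:
  assumes z: "z \<in> carrier (Y i)" and cyc: "\<And>j. i = Suc j \<Longrightarrow> dY j z = \<zero>\<^bsub>Y j\<^esub>"
  obtains w where "staircase C h v \<eta> \<epsilon> i z w"
proof -
  have "\<exists>c. (\<forall>p q. p \<le> k \<longrightarrow> p + q = i \<longrightarrow> c p \<in> carrier (C p q)) \<and> \<eta> i (c 0) = z \<and>
     (\<forall>p q. p < k \<longrightarrow> Suc (p + q) = i \<longrightarrow> v p q (c p) = h p q (c (Suc p)))" if "k \<le> i" for k
    using that
  proof (induction k)
    case 0
    have "z \<in> \<eta> i ` carrier (C 0 i)" by (simp only: \<eta>_surj z)
    then obtain x where "x \<in> carrier (C 0 i)" "\<eta> i x = z" by blast
    then show ?case by (intro exI[of _ "\<lambda>_. x"]) auto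
  next
    case (Suc k)
    then obtain c where c: "\<And>p q. p \<le> k \<Longrightarrow> p + q = i \<Longrightarrow> c p \<in> carrier (C p q)" "\<eta> i (c 0) = z"
      "\<And>p q. p < k \<Longrightarrow> Suc (p + q) = i \<Longrightarrow> v p q (c p) = h p q (c (Suc p))" by (meson Suc_leD)
    obtain q where q: "i = Suc (k + q)" using Suc.prems by (metis Suc_le_lessD less_iff_Suc_add)
    let ?u = "v k q (c k)"
    have ck: "c k \<in> carrier (C k (Suc q))" by (rule c(1)) (auto simp: q)
    have u: "?u \<in> carrier (C k q)" by (rule mod_hom_closed[OF v ck])
    have "?u \<in> h k q ` carrier (C (Suc k) q)"
    proof (cases k)
      case 0
      then have "\<eta> q ?u = \<zero>\<^bsub>Y q\<^esub>" using \<eta>v[of "c 0" q] ck c(2) cyc[of q] q by simp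
      then show ?thesis using \<eta>_exact[of ?u q] u 0 by simp
    next
      case (Suc j)
      have cj: "c j \<in> carrier (C j (Suc (Suc q)))" by (rule c(1)) (auto simp: q Suc)
      have "v j (Suc q) (c j) = h j (Suc q) (c (Suc j))" by (rule c(3)) (auto simp: q Suc)
      then have "h j q ?u = \<zero>\<^bsub>C j q\<^esub>" using hv[of "c k" j q] vv[OF cj] ck Suc by simp
      then show ?thesis using h_exact[of ?u j q] u Suc by simp
    qed
    then obtain b where b: "b \<in> carrier (C (Suc k) q)" "?u = h k q b" by blast
    let ?c = "c(Suc k := b)"
    show ?case
    proof (intro exI[of _ ?c] conjI allI impI)
      fix p q' assume "p \<le> Suc k" "p + q' = i"
      then show "?c p \<in> carrier (C p q')" using c(1)[of p q'] b(1) q by (cases "p = Suc k") auto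
    next
      fix p q' assume "p < Suc k" "Suc (p + q') = i"
      then show "v p q' (?c p) = h p q' (?c (Suc p))" using c(3)[of p q'] b(2) q by (cases "p = k") auto
    qed (use c(2) in simp)
  qed
  from this[OF order_refl] obtain c where c: "\<And>p q. p \<le> i \<Longrightarrow> p + q = i \<Longrightarrow> c p \<in> carrier (C p q)" "\<eta> i (c 0) = z"
      "\<And>p q. p < i \<Longrightarrow> Suc (p + q) = i \<Longrightarrow> v p q (c p) = h p q (c (Suc p))" by blast
  show ?thesis
    by (rule that[of "\<epsilon> i (c i)"]) (use c in \<open>auto simp: staircase_def intro!: exI[of _ c]\<close>)
qed

text \<open>The whole staircase is then a boundary: starting from a lift of \<open>y\<close>, exactness along \<open>h\<close> yields
  \<open>b\<close> with \<open>c p = v (b p) + h (b (p + 1))\<close>.  At the lower end the augmentation kills the first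
  summand and turns the second into a boundary.\<close>

lemma staircase_boundary:
  assumes st: "staircase C h v \<eta> \<epsilon> i z w" and y: "y \<in> carrier (Y (Suc i))" "z = dY i y"
  shows "w \<in> dW i ` carrier (W (Suc i))"
proof -
  obtain c where c: "\<And>p q. p + q = i \<Longrightarrow> c p \<in> carrier (C p q)" "\<eta> i (c 0) = z" "\<epsilon> i (c i) = w"
     "\<And>p q. Suc (p + q) = i \<Longrightarrow> v p q (c p) = h p q (c (Suc p))"
    using st unfolding staircase_def by blast
  have "\<exists>b. (\<forall>p q. p \<le> k \<longrightarrow> p + q = Suc i \<longrightarrow> b p \<in> carrier (C p q)) \<and> \<eta> (Suc i) (b 0) = y \<and>
     (\<forall>p q. p < k \<longrightarrow> p + q = i \<longrightarrow> c p = v p q (b p) \<oplus>\<^bsub>C p q\<^esub> h p q (b (Suc p)))" if "k \<le> Suc i" for k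
    using that
  proof (induction k)
    case 0
    have "y \<in> \<eta> (Suc i) ` carrier (C 0 (Suc i))" by (simp only: \<eta>_surj y(1))
    then obtain x where "x \<in> carrier (C 0 (Suc i))" "\<eta> (Suc i) x = y" by blast
    then show ?case by (intro exI[of _ "\<lambda>_. x"]) auto
  next
    case (Suc k)
    then obtain b where b: "\<And>p q. p \<le> k \<Longrightarrow> p + q = Suc i \<Longrightarrow> b p \<in> carrier (C p q)" "\<eta> (Suc i) (b 0) = y"
      "\<And>p q. p < k \<Longrightarrow> p + q = i \<Longrightarrow> c p = v p q (b p) \<oplus>\<^bsub>C p q\<^esub> h p q (b (Suc p))" by (meson Suc_leD)
    obtain q where q: "i = k + q" using Suc.prems by (metis Suc_le_mono le_iff_add)
    have bk: "b k \<in> carrier (C k (Suc q))" by (rule b(1)) (auto simp: q)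
    have ck: "c k \<in> carrier (C k q)" by (rule c(1)) (auto simp: q)
    have vb: "v k q (b k) \<in> carrier (C k q)" by (rule mod_hom_closed[OF v bk])
    let ?u = "c k \<ominus>\<^bsub>C k q\<^esub> v k q (b k)"
    have u: "?u \<in> carrier (C k q)" by (rule module_minus_closed[OF mC ck vb])
    have "?u \<in> h k q ` carrier (C (Suc k) q)"
    proof (cases k)
      case 0
      then have "\<eta> q (c k) = \<eta> q (v k q (b k))" using \<eta>v[of "b 0" q] bk b(2) c(2) y(2) q by simp
      then have "\<eta> q ?u = \<zero>\<^bsub>Y q\<^esub>"
        using mod_hom_minus[OF mC mY \<eta>, of "c k" q "v k q (b k)"] ck vb mod_hom_closed[OF \<eta>, of "c k" q] 0
        by (simp add: module_minus_eq_zero_iff[OF mY])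
      then show ?thesis using \<eta>_exact[of ?u q] u 0 by simp
    next
      case (Suc j)
      have bj: "b j \<in> carrier (C j (Suc (Suc q)))" by (rule b(1)) (auto simp: q Suc)
      have bk': "b (Suc j) \<in> carrier (C (Suc j) (Suc q))" using bk Suc by simp
      have cj: "c j \<in> carrier (C j (Suc q))" by (rule c(1)) (auto simp: q Suc)
      have ce: "c j = v j (Suc q) (b j) \<oplus>\<^bsub>C j (Suc q)\<^esub> h j (Suc q) (b (Suc j))" by (rule b(3)) (auto simp: q Suc)
      have vbj: "v j (Suc q) (b j) \<in> carrier (C j (Suc q))" by (rule mod_hom_closed[OF v bj])
      have hbk: "h j (Suc q) (b (Suc j)) \<in> carrier (C j (Suc q))" by (rule mod_hom_closed[OF h bk'])
      interpret Cjq: module R "C j q" by (rule mC)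
      have "h j q (c k) = v j q (c j)" using c(4)[of j q] q Suc by simp
      also have "\<dots> = v j q (h j (Suc q) (b (Suc j)))"
        unfolding ce using mod_hom_closed[OF v hbk] by (simp add: mod_hom_add[OF v vbj hbk] vv[OF bj])
      also have "\<dots> = h j q (v k q (b k))" using hv[OF bk'] Suc by simp
      finally have "h j q ?u = \<zero>\<^bsub>C j q\<^esub>"
        using mod_hom_minus[OF mC mC h, of "c k" j q "v k q (b k)"] ck vb mod_hom_closed[OF h, of "c k" j q] Suc
        by (simp add: module_minus_eq_zero_iff[OF mC])
      then show ?thesis using h_exact[of ?u j q] u Suc by simp
    qed
    then obtain b' where b': "b' \<in> carrier (C (Suc k) q)" "?u = h k q b'" by blast
    have ck': "c k = v k q (b k) \<oplus>\<^bsub>C k q\<^esub> h k q b'"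
      using module_add_minus_cancel(1)[OF mC vb ck] b'(2) by simp
    let ?b = "b(Suc k := b')"
    show ?case
    proof (intro exI[of _ ?b] conjI allI impI)
      fix p q' assume "p \<le> Suc k" "p + q' = Suc i"
      then show "?b p \<in> carrier (C p q')" using b(1)[of p q'] b'(1) q by (cases "p = Suc k") auto
    next
      fix p q' assume "p < Suc k" "p + q' = i"
      then show "c p = v p q' (?b p) \<oplus>\<^bsub>C p q'\<^esub> h p q' (?b (Suc p))" using b(3)[of p q'] ck' q by (cases "p = k") auto
    qed (use b(2) in simp)
  qed
  from this[of "Suc i"] obtain b where b: "\<And>p q. p + q = Suc i \<Longrightarrow> b p \<in> carrier (C p q)"
      "\<And>p q. p + q = i \<Longrightarrow> c p = v p q (b p) \<oplus>\<^bsub>C p q\<^esub> h p q (b (Suc p))"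
    by (metis le_add1 le_refl less_Suc_eq_le)
  have bi: "b i \<in> carrier (C i (Suc 0))" "b (Suc i) \<in> carrier (C (Suc i) 0)" using b(1) by auto
  note vb = mod_hom_closed[OF v bi(1)] and hb = mod_hom_closed[OF h bi(2)]
  interpret Wi: module R "W i" by (rule mW)
  have "w = \<epsilon> i (v i 0 (b i) \<oplus>\<^bsub>C i 0\<^esub> h i 0 (b (Suc i)))" using c(3) b(2)[of i 0] by simp
  also have "\<dots> = \<epsilon> i (h i 0 (b (Suc i)))"
    using mod_hom_closed[OF \<epsilon> hb] by (simp add: mod_hom_add[OF \<epsilon> vb hb] \<epsilon>v[OF bi(1)])
  also have "\<dots> = dW i (\<epsilon> (Suc i) (b (Suc i)))" by (rule \<epsilon>h[OF bi(2)])
  finally show ?thesis using mod_hom_closed[OF \<epsilon> bi(2)] by blast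
qed

end


section \<open>Balancing\<close>

context
  fixes R :: "('r, 'x) ring_scheme" and X :: "('r, 'm, 'c) module_scheme" and F :: "int \<Rightarrow> ('r, 'f, 'd) module_scheme"
    and d \<epsilon>
  assumes res: "resolution R X F d \<epsilon>"
begin

lemma res_module: "module R (F n)" using res by (simp add: resolution_def)
lemma res_hom: "d n \<in> mod_hom R (F n) (F (n - 1))" using res by (simp add: resolution_def)
lemma res_nat_hom: "d (int (Suc q)) \<in> mod_hom R (F (int (Suc q))) (F (int q))"
  using res_hom[of "int (Suc q)"] by simp
lemma res_aug_mod_hom: "\<epsilon> \<in> mod_hom R (F (int 0)) X" using res by (simp add: resolution_def)
lemma res_aug_onto: "\<epsilon> ` carrier (F (int 0)) = carrier X" using res by (simp add: resolution_def)
lemma res_neg: "n < 0 \<Longrightarrow> carrier (F n) = {\<zero>\<^bsub>F n\<^esub>}" using res by (simp add: resolution_def is_zero_def)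

lemma res_exact_pos: "0 < n \<Longrightarrow> d (n + 1) ` carrier (F (n + 1)) = a_kernel (F n) (F (n - 1)) (d n)"
  using res by (simp add: resolution_def)
lemma res_exact_zero: "d 1 ` carrier (F 1) = a_kernel (F 0) X \<epsilon>" using res by (simp add: resolution_def)

lemma res_nat_dd: "x \<in> carrier (F (int (Suc (Suc q)))) \<Longrightarrow> d (int (Suc q)) (d (int (Suc (Suc q))) x) = \<zero>\<^bsub>F (int q)\<^esub>"
  using res_exact_pos[of "int (Suc q)"] unfolding set_eq_iff a_kernel_iff by (auto simp: add_ac)

lemma res_nat_exact:
  "\<lbrakk>x \<in> carrier (F (int (Suc q))); d (int (Suc q)) x = \<zero>\<^bsub>F (int q)\<^esub>\<rbrakk> \<Longrightarrow> x \<in> d (int (Suc (Suc q))) ` carrier (F (int (Suc (Suc q))))"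
  using res_exact_pos[of "int (Suc q)"] a_kernel_iff[of x "F (int (Suc q))" "F (int q)"] by (simp add: add_ac)

lemma res_aug_dd: "x \<in> carrier (F (int (Suc 0))) \<Longrightarrow> \<epsilon> (d (int (Suc 0)) x) = \<zero>\<^bsub>X\<^esub>"
  using res_exact_zero unfolding set_eq_iff a_kernel_iff by auto

lemma res_aug_exact: "\<lbrakk>x \<in> carrier (F (int 0)); \<epsilon> x = \<zero>\<^bsub>X\<^esub>\<rbrakk> \<Longrightarrow> x \<in> d (int (Suc 0)) ` carrier (F (int (Suc 0)))"
  using res_exact_zero a_kernel_iff[of x "F 0" X \<epsilon>] by simp

lemma res_dd: "x \<in> carrier (F n) \<Longrightarrow> d (n - 1) (d n x) = \<zero>\<^bsub>F (n - 1 - 1)\<^esub>"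
proof (cases "n > 1")
  case True
  assume x: "x \<in> carrier (F n)"
  obtain q where "n = int (Suc (Suc q))" using True by (intro that[of "nat (n - 2)"]) auto
  then show ?thesis using res_nat_dd[of x q] x by (simp add: algebra_simps)
next
  case False
  assume x: "x \<in> carrier (F n)"
  have "d (n - 1) (d n x) \<in> carrier (F (n - 1 - 1))" by (rule mod_hom_closed[OF res_hom mod_hom_closed[OF res_hom x]])
  then show ?thesis using res_neg[of "n - 1 - 1"] False by simp
qed

end

context matlis
begin

text \<open>Columns \<open>P \<otimes> F\<^sub>q\<close> are exact because \<open>Hom(F\<^sub>q, E)\<close> satisfies Baer's criterion.\<close>

lemma tensor_double_complex:
  assumes P: "resolution R A P dP \<eta>" "module R A" and F: "resolution R X F dF \<epsilon>" "module R X"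
    and baer: "\<And>n. baer R (Hom_mod R (F n) E)"
  shows "double_complex R (\<lambda>p q. tensor R (P (int p)) (F (int q)))
      (\<lambda>p q. tensor_map R (P (int p)) (F (int q)) (dP (int (Suc p))) (\<lambda>x. x))
      (\<lambda>p q. tensor_map R (P (int p)) (F (int q)) (\<lambda>x. x) (dF (int (Suc q))))
      (\<lambda>q. tensor R A (F (int q))) (\<lambda>q. tensor_map R A (F (int q)) \<eta> (\<lambda>x. x))
      (\<lambda>q. tensor_map R A (F (int q)) (\<lambda>x. x) (dF (int (Suc q))))
      (\<lambda>p. tensor R (P (int p)) X) (\<lambda>p. tensor_map R (P (int p)) X (\<lambda>x. x) \<epsilon>)
      (\<lambda>p. tensor_map R (P (int p)) X (dP (int (Suc p))) (\<lambda>x. x))"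
proof -
  note m = res_module[OF P(1)] res_module[OF F(1)] P(2) F(2)
  note homs = res_nat_hom[OF P(1)] res_nat_hom[OF F(1)] res_aug_mod_hom[OF P(1)] res_aug_mod_hom[OF F(1)] mod_hom_id
  show ?thesis
  proof (rule double_complex.intro, goal_cases)
    case (10 p q x) then show ?case by (intro tensor_map_square[OF m(1,2,1,2,1,2,1,2) homs(5,2,1,5,1,5,5,2)]) auto
  next
    case (11 q x) then show ?case by (intro tensor_map_square[OF m(1,2,1,2,3,2,3,2) homs(5,2,3,5,3,5,5,2)]) auto
  next
    case (12 p x) then show ?case by (intro tensor_map_square[OF m(1,2,1,2,1,4,1,4) homs(1,5,5,4,5,4,1,5)]) auto
  next
    case (13 p q x)
    have "tensor_map R (P (int p)) (F (int q)) (\<lambda>x. x) (dF (int (Suc q)))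
       (tensor_map R (P (int p)) (F (int (Suc q))) (\<lambda>x. x) (dF (int (Suc (Suc q)))) x) =
      tensor_map R (P (int p)) (F (int q)) (\<lambda>x. x) (\<lambda>x. \<zero>\<^bsub>F (int q)\<^esub>) x"
      by (rule tensor_map_comp[OF m(1,2,1,2,1,2) homs(5,2,5,2,5) mod_hom_const_zero[OF m(2)] _ _ 13])
        (simp_all add: res_nat_dd[OF F(1)] del: of_nat_Suc)
    also have "\<dots> = \<zero>\<^bsub>tensor R (P (int p)) (F (int q))\<^esub>"
      by (rule tensor_map_zero[OF m(1,2,1,2) homs(5) mod_hom_const_zero[OF m(2)] _ 13]) simp
    finally show ?case .
  next
    case (14 p x)
    have "tensor_map R (P (int p)) X (\<lambda>x. x) \<epsilon> (tensor_map R (P (int p)) (F (int 0)) (\<lambda>x. x) (dF (int (Suc 0))) x) =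
      tensor_map R (P (int p)) X (\<lambda>x. x) (\<lambda>x. \<zero>\<^bsub>X\<^esub>) x"
      by (rule tensor_map_comp[OF m(1,2,1,2,1,4) homs(5,2,5,4,5) mod_hom_const_zero[OF m(4)] _ _ 14])
        (simp_all add: res_aug_dd[OF F(1)] del: of_nat_Suc)
    also have "\<dots> = \<zero>\<^bsub>tensor R (P (int p)) X\<^esub>"
      by (rule tensor_map_zero[OF m(1,2,1,4) homs(5) mod_hom_const_zero[OF m(4)] _ 14]) simp
    finally show ?case .
  next
    case (15 q) show ?case
      by (rule tensor_map_surj[OF m(1,2,3,2) homs(3,5) res_aug_onto[OF P(1)]]) simp
  next
    case (16 q x) then show ?case
      by (intro tensor_exact_left[OF m(1,1,3,2) homs(1,3) res_aug_exact[OF P(1)] baer]) auto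
  next
    case (17 p q x) then show ?case
      by (intro tensor_exact_left[OF m(1,1,1,2) homs(1,1) res_nat_exact[OF P(1)] baer]) auto
  qed (intro tensor_module tensor_map_hom m homs)+
qed

text \<open>The same double complex with the two directions exchanged; now exactness of \<open>P\<^sub>p \<otimes> F\<close> is at stake,
  and the modules \<open>Hom(P\<^sub>p, E)\<close> account for it.\<close>

lemma tensor_double_complex_swap:
  assumes P: "resolution R A P dP \<eta>" "module R A" and F: "resolution R X F dF \<epsilon>" "module R X"
    and baer: "\<And>n. baer R (Hom_mod R (P n) E)"
  shows "double_complex R (\<lambda>q p. tensor R (P (int p)) (F (int q)))
      (\<lambda>q p. tensor_map R (P (int p)) (F (int q)) (\<lambda>x. x) (dF (int (Suc q))))
      (\<lambda>q p. tensor_map R (P (int p)) (F (int q)) (dP (int (Suc p))) (\<lambda>x. x))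
      (\<lambda>p. tensor R (P (int p)) X) (\<lambda>p. tensor_map R (P (int p)) X (\<lambda>x. x) \<epsilon>)
      (\<lambda>p. tensor_map R (P (int p)) X (dP (int (Suc p))) (\<lambda>x. x))
      (\<lambda>q. tensor R A (F (int q))) (\<lambda>q. tensor_map R A (F (int q)) \<eta> (\<lambda>x. x))
      (\<lambda>q. tensor_map R A (F (int q)) (\<lambda>x. x) (dF (int (Suc q))))"
proof -
  note m = res_module[OF P(1)] res_module[OF F(1)] P(2) F(2)
  note homs = res_nat_hom[OF P(1)] res_nat_hom[OF F(1)] res_aug_mod_hom[OF P(1)] res_aug_mod_hom[OF F(1)] mod_hom_id
  show ?thesis
  proof (rule double_complex.intro, goal_cases)
    case (10 p q x) then show ?case by (intro tensor_map_square[OF m(1,2,1,2,1,2,1,2) homs(1,5,5,2,5,2,1,5)]) auto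
  next
    case (11 q x) then show ?case by (intro tensor_map_square[OF m(1,2,1,2,1,4,1,4) homs(1,5,5,4,5,4,1,5)]) auto
  next
    case (12 p x) then show ?case by (intro tensor_map_square[OF m(1,2,1,2,3,2,3,2) homs(5,2,3,5,3,5,5,2)]) auto
  next
    case (13 q p x)
    have "tensor_map R (P (int p)) (F (int q)) (dP (int (Suc p))) (\<lambda>x. x)
       (tensor_map R (P (int (Suc p))) (F (int q)) (dP (int (Suc (Suc p)))) (\<lambda>x. x) x) =
      tensor_map R (P (int p)) (F (int q)) (\<lambda>x. \<zero>\<^bsub>P (int p)\<^esub>) (\<lambda>x. x) x"
      by (rule tensor_map_comp[OF m(1,2,1,2,1,2) homs(1,5,1,5) mod_hom_const_zero[OF m(1)] homs(5) _ _ 13])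
        (simp_all add: res_nat_dd[OF P(1)] del: of_nat_Suc)
    also have "\<dots> = \<zero>\<^bsub>tensor R (P (int p)) (F (int q))\<^esub>"
      by (rule tensor_map_zero[OF m(1,2,1,2) mod_hom_const_zero[OF m(1)] homs(5) _ 13]) simp
    finally show ?case .
  next
    case (14 q x)
    have "tensor_map R A (F (int q)) \<eta> (\<lambda>x. x) (tensor_map R (P (int 0)) (F (int q)) (dP (int (Suc 0))) (\<lambda>x. x) x) =
      tensor_map R A (F (int q)) (\<lambda>x. \<zero>\<^bsub>A\<^esub>) (\<lambda>x. x) x"
      by (rule tensor_map_comp[OF m(1,2,1,2,3,2) homs(1,5,3,5) mod_hom_const_zero[OF m(3)] homs(5) _ _ 14])
        (simp_all add: res_aug_dd[OF P(1)] del: of_nat_Suc)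
    also have "\<dots> = \<zero>\<^bsub>tensor R A (F (int q))\<^esub>"
      by (rule tensor_map_zero[OF m(1,2,3,2) mod_hom_const_zero[OF m(3)] homs(5) _ 14]) simp
    finally show ?case .
  next
    case (15 p) show ?case
      by (rule tensor_map_surj[OF m(1,2,1,4) homs(5,4) _ res_aug_onto[OF F(1)]]) simp
  next
    case (16 p x) then show ?case
      by (intro tensor_exact_right[OF m(2,2,4,1) homs(2,4) res_aug_exact[OF F(1)] baer]) auto
  next
    case (17 q p x) then show ?case
      by (intro tensor_exact_right[OF m(2,2,2,1) homs(2,2) res_nat_exact[OF F(1)] baer]) auto
  qed (intro tensor_module tensor_map_hom m homs)+
qed

end

definition tensor_stair where
  "tensor_stair R A X F dF \<epsilon> i z w \<longleftrightarrow>
    staircase (\<lambda>p q. tensor R (free_res R A (int p)) (F (int q)))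
      (\<lambda>p q. tensor_map R (free_res R A (int p)) (F (int q)) (res_diff R) (\<lambda>x. x))
      (\<lambda>p q. tensor_map R (free_res R A (int p)) (F (int q)) (\<lambda>x. x) (dF (int (Suc q))))
      (\<lambda>q. tensor_map R A (F (int q)) (res_aug R A) (\<lambda>x. x))
      (\<lambda>p. tensor_map R (free_res R A (int p)) X (\<lambda>x. x) \<epsilon>) i z w"

text \<open>Both \<open>A \<otimes> F\<close> and \<open>P(A) \<otimes> X\<close> compute \<open>Tor(A, X)\<close>.  The relation \<open>tensor_stair\<close> between their cycles
  is linear, total in both directions, and matches boundaries with boundaries, so that it induces an
  isomorphism on homology without naming one.\<close>

locale balanced = matlis R E \<iota>
  for R :: "('r, 'x) ring_scheme" and E :: "('r, 'e, 'y) module_scheme" and \<iota> :: "'r set \<Rightarrow> 'e" +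
  fixes X :: "('r, 'm, 'c) module_scheme" and F :: "int \<Rightarrow> ('r, 'f, 'd) module_scheme"
    and d :: "int \<Rightarrow> 'f \<Rightarrow> 'f" and \<epsilon> :: "'f \<Rightarrow> 'm"
  assumes X: "module R X" and res: "resolution R X F d \<epsilon>" and F_baer: "\<And>n. baer R (Hom_mod R (F n) E)"
begin

abbreviation "AF A n \<equiv> tensor R A (F n)"
abbreviation "PX A n \<equiv> tensor R (free_res R A n) X"
abbreviation "dAF A n \<equiv> tensor_map R A (F (n - 1)) (\<lambda>x. x) (d n)"
abbreviation "dPX A n \<equiv> tensor_map R (free_res R A (n - 1)) X (res_diff R) (\<lambda>x. x)"

lemma F_module: "module R (F n)" by (rule res_module[OF res])

context
  fixes A :: "('r, 'a, 'k) module_scheme" assumes A: "module R A"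
begin

interpretation A: canonical_res R A by (rule canonical_res.intro[OF A])

lemma AF_module: "module R (AF A n)" by (intro tensor_module A F_module)
lemma PX_module: "module R (PX A n)" by (intro tensor_module A.free_res_module X)
lemma dAF_hom: "dAF A n \<in> mod_hom R (AF A n) (AF A (n - 1))"
  by (intro tensor_map_hom A F_module mod_hom_id res_hom[OF res])
lemma dPX_hom: "dPX A n \<in> mod_hom R (PX A n) (PX A (n - 1))"
  by (intro tensor_map_hom A.free_res_module X mod_hom_id A.res_diff_hom)

interpretation L: double_complex R
      "\<lambda>p q. tensor R (free_res R A (int p)) (F (int q))"
      "\<lambda>p q. tensor_map R (free_res R A (int p)) (F (int q)) (res_diff R) (\<lambda>x. x)"
      "\<lambda>p q. tensor_map R (free_res R A (int p)) (F (int q)) (\<lambda>x. x) (d (int (Suc q)))"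
      "\<lambda>q. AF A (int q)" "\<lambda>q. tensor_map R A (F (int q)) (res_aug R A) (\<lambda>x. x)"
      "\<lambda>q. tensor_map R A (F (int q)) (\<lambda>x. x) (d (int (Suc q)))"
      "\<lambda>p. PX A (int p)" "\<lambda>p. tensor_map R (free_res R A (int p)) X (\<lambda>x. x) \<epsilon>"
      "\<lambda>p. tensor_map R (free_res R A (int p)) X (res_diff R) (\<lambda>x. x)"
  by (rule tensor_double_complex[OF A.canonical_resolution A res X F_baer])

interpretation L': double_complex R
      "\<lambda>q p. tensor R (free_res R A (int p)) (F (int q))"
      "\<lambda>q p. tensor_map R (free_res R A (int p)) (F (int q)) (\<lambda>x. x) (d (int (Suc q)))"
      "\<lambda>q p. tensor_map R (free_res R A (int p)) (F (int q)) (res_diff R) (\<lambda>x. x)"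
      "\<lambda>p. PX A (int p)" "\<lambda>p. tensor_map R (free_res R A (int p)) X (\<lambda>x. x) \<epsilon>"
      "\<lambda>p. tensor_map R (free_res R A (int p)) X (res_diff R) (\<lambda>x. x)"
      "\<lambda>q. AF A (int q)" "\<lambda>q. tensor_map R A (F (int q)) (res_aug R A) (\<lambda>x. x)"
      "\<lambda>q. tensor_map R A (F (int q)) (\<lambda>x. x) (d (int (Suc q)))"
  by (rule tensor_double_complex_swap[OF A.canonical_resolution A res X]) 
    (simp add: free_res_def free_imp_baer_dual[OF E_baer])

abbreviation "stair i z w \<equiv> tensor_stair R A X F d \<epsilon> i z w"

lemma stair_add: "\<lbrakk>stair i z w; stair i z' w'\<rbrakk> \<Longrightarrow> stair i (z \<oplus>\<^bsub>AF A (int i)\<^esub> z') (w \<oplus>\<^bsub>PX A (int i)\<^esub> w')"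
  unfolding tensor_stair_def by (rule L.staircase_add)
lemma stair_smult: "\<lbrakk>r \<in> carrier R; stair i z w\<rbrakk> \<Longrightarrow> stair i (r \<odot>\<^bsub>AF A (int i)\<^esub> z) (r \<odot>\<^bsub>PX A (int i)\<^esub> w)"
  unfolding tensor_stair_def by (rule L.staircase_smult)
lemma stair_minus: "\<lbrakk>stair i z w; stair i z' w'\<rbrakk> \<Longrightarrow> stair i (z \<ominus>\<^bsub>AF A (int i)\<^esub> z') (w \<ominus>\<^bsub>PX A (int i)\<^esub> w')"
  unfolding tensor_stair_def by (rule L.staircase_minus)
lemma stair_carrier: "stair i z w \<Longrightarrow> z \<in> carrier (AF A (int i))" "stair i z w \<Longrightarrow> w \<in> carrier (PX A (int i))"
  unfolding tensor_stair_def using L.staircase_carrier by auto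

lemma PX_neg: assumes "z \<in> carrier (PX A n)" "n < 0" shows "z = \<zero>\<^bsub>PX A n\<^esub>"
proof -
  have "tensor_map R (free_res R A n) X (\<lambda>x. \<zero>\<^bsub>free_res R A n\<^esub>) (\<lambda>x. x) z = z"
  proof (rule tensor_hom_eqI[OF A.free_res_module X PX_module tensor_map_hom mod_hom_id _ assms(1)])
    fix p x assume px: "p \<in> carrier (free_res R A n)" "x \<in> carrier X"
    then have "p = \<zero>\<^bsub>free_res R A n\<^esub>" using res_neg[OF A.canonical_resolution assms(2)] by simp
    then show "tensor_map R (free_res R A n) X (\<lambda>x. \<zero>\<^bsub>free_res R A n\<^esub>) (\<lambda>x. x) (pure_tensor R (free_res R A n) X p x) = pure_tensor R (free_res R A n) X p x"
      using tensor_map_pure[OF A.free_res_module X A.free_res_module X mod_hom_const_zero[OF A.free_res_module] mod_hom_id px] by simp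
  qed (intro A.free_res_module X mod_hom_const_zero mod_hom_id)+
  then show ?thesis
    using tensor_map_zero[OF A.free_res_module X A.free_res_module X mod_hom_const_zero[OF A.free_res_module] mod_hom_id _ assms(1)] by simp
qed

lemma AF_neg: assumes "z \<in> carrier (AF A n)" "n < 0" shows "z = \<zero>\<^bsub>AF A n\<^esub>"
proof -
  have "tensor_map R A (F n) (\<lambda>x. x) (\<lambda>x. \<zero>\<^bsub>F n\<^esub>) z = z"
  proof (rule tensor_hom_eqI[OF A F_module AF_module tensor_map_hom mod_hom_id _ assms(1)])
    fix a x assume px: "a \<in> carrier A" "x \<in> carrier (F n)"
    then have "x = \<zero>\<^bsub>F n\<^esub>" using res_neg[OF res assms(2)] by simp
    then show "tensor_map R A (F n) (\<lambda>x. x) (\<lambda>x. \<zero>\<^bsub>F n\<^esub>) (pure_tensor R A (F n) a x) = pure_tensor R A (F n) a x"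
      using tensor_map_pure[OF A F_module A F_module mod_hom_id mod_hom_const_zero[OF F_module] px] by simp
  qed (intro A F_module mod_hom_const_zero mod_hom_id)+
  then show ?thesis
    using tensor_map_zero[OF A F_module A F_module mod_hom_id mod_hom_const_zero[OF F_module] _ assms(1)] by simp
qed

lemma stair_exists:
  assumes "z \<in> carrier (AF A (int i))" "dAF A (int i) z = \<zero>\<^bsub>AF A (int i - 1)\<^esub>"
  obtains w where "stair i z w"
proof (rule L.staircase_exists[OF assms(1)], goal_cases)
  case (1 j)
  then show ?case using assms(2) by simp
next
  case (2 w)
  from 2(2) show ?case by (rule 2(1)[unfolded tensor_stair_def])
qed

lemma stair_exists':
  assumes "w \<in> carrier (PX A (int i))" "dPX A (int i) w = \<zero>\<^bsub>PX A (int i - 1)\<^esub>"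
  obtains z where "stair i z w"
proof (rule L'.staircase_exists[OF assms(1)], goal_cases)
  case (1 j)
  then show ?case using assms(2) by simp
next
  case (2 z)
  from staircase_swap[OF 2(2)] show ?case by (rule 2(1)[unfolded tensor_stair_def])
qed

lemma stair_cycle_PX:
  assumes "stair i z w" shows "dPX A (int i) w = \<zero>\<^bsub>PX A (int i - 1)\<^esub>"
proof (cases i)
  case 0
  have "dPX A (int i) w \<in> carrier (PX A (int i - 1))" by (rule mod_hom_closed[OF dPX_hom stair_carrier(2)[OF assms]])
  then show ?thesis using PX_neg 0 by simp
next
  case (Suc j)
  then show ?thesis using L.staircase_end_cycle[of j z w] assms by (simp add: tensor_stair_def)
qed

lemma stair_cycle_AF:
  assumes "stair i z w" shows "dAF A (int i) z = \<zero>\<^bsub>AF A (int i - 1)\<^esub>"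
proof (cases i)
  case 0
  have "dAF A (int i) z \<in> carrier (AF A (int i - 1))" by (rule mod_hom_closed[OF dAF_hom stair_carrier(1)[OF assms]])
  then show ?thesis using AF_neg 0 by simp
next
  case (Suc j)
  then show ?thesis using L'.staircase_end_cycle[of j w z] staircase_swap[OF assms[unfolded tensor_stair_def]] by simp
qed

text \<open>Each direction uses exactness of the double complex along one of its two directions.\<close>

lemma stair_boundary_iff:
  assumes "stair i z w"
  shows "z \<in> dAF A (int i + 1) ` carrier (AF A (int i + 1)) \<longleftrightarrow> w \<in> dPX A (int i + 1) ` carrier (PX A (int i + 1))"
proof
  assume "z \<in> dAF A (int i + 1) ` carrier (AF A (int i + 1))"
  then obtain y where "y \<in> carrier (AF A (int i + 1))" "z = dAF A (int i + 1) y" by (rule imageE)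
  then show "w \<in> dPX A (int i + 1) ` carrier (PX A (int i + 1))"
    using L.staircase_boundary[OF assms[unfolded tensor_stair_def], of y] by (simp add: add.commute)
next
  assume "w \<in> dPX A (int i + 1) ` carrier (PX A (int i + 1))"
  then obtain y where "y \<in> carrier (PX A (int i + 1))" "w = dPX A (int i + 1) y" by (rule imageE)
  then show "z \<in> dAF A (int i + 1) ` carrier (AF A (int i + 1))"
    using L'.staircase_boundary[OF staircase_swap[OF assms[unfolded tensor_stair_def]], of y] by (simp add: add.commute)
qed

end

text \<open>A homomorphism \<open>f\<close> lifts to a chain map of canonical resolutions, which carries a staircase step by
  step to a staircase.\<close>

lemma stair_natural:
  assumes A: "module R A" and A': "module R A'" and f: "f \<in> mod_hom R A A'"
    and st: "tensor_stair R A X F d \<epsilon> i z w"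
  shows "tensor_stair R A' X F d \<epsilon> i (tensor_map R A' (F (int i)) f (\<lambda>x. x) z)
    (tensor_map R (free_res R A' (int i)) X (res_map R f) (\<lambda>x. x) w)"
proof -
  interpret A: canonical_res R A by (rule canonical_res.intro[OF A])
  interpret A': canonical_res R A' by (rule canonical_res.intro[OF A'])
  note m = A.free_res_module A'.free_res_module F_module X A A'
  note rm = res_map_hom[OF A A' f]
  note dF = res_nat_hom[OF res]
  note dP = res_nat_hom[OF A.canonical_resolution] res_nat_hom[OF A'.canonical_resolution]
  note aug = res_aug_mod_hom[OF A.canonical_resolution] res_aug_mod_hom[OF A'.canonical_resolution]
  obtain c where c: "\<And>p q. p + q = i \<Longrightarrow> c p \<in> carrier (tensor R (free_res R A (int p)) (F (int q)))"
      "tensor_map R A (F (int i)) (res_aug R A) (\<lambda>x. x) (c 0) = z"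
      "tensor_map R (free_res R A (int i)) X (\<lambda>x. x) \<epsilon> (c i) = w"
      "\<And>p q. Suc (p + q) = i \<Longrightarrow> tensor_map R (free_res R A (int p)) (F (int q)) (\<lambda>x. x) (d (int (Suc q))) (c p) =
         tensor_map R (free_res R A (int p)) (F (int q)) (res_diff R) (\<lambda>x. x) (c (Suc p))"
    using st unfolding tensor_stair_def staircase_def by blast
  let ?t = "\<lambda>p q. tensor_map R (free_res R A' (int p)) (F (int q)) (res_map R f) (\<lambda>x. x)"
  let ?c = "\<lambda>p. ?t p (i - p) (c p)"
  have e: "?c p = ?t p q (c p)" if "p + q = i" for p q using that by auto
  show ?thesis unfolding tensor_stair_def staircase_def
  proof (intro exI[of _ ?c] conjI allI impI)
    fix p q assume pq: "p + q = i"
    show "?c p \<in> carrier (tensor R (free_res R A' (int p)) (F (int q)))"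
      unfolding e[OF pq] by (rule mod_hom_closed[OF tensor_map_hom[OF m(1,3,2,3) rm mod_hom_id] c(1)[OF pq]])
  next
    have c0: "c 0 \<in> carrier (tensor R (free_res R A (int 0)) (F (int i)))" by (rule c(1)) simp
    have aug': "\<And>a. a \<in> carrier (free_res R A (int 0)) \<Longrightarrow> res_aug R A' (res_map R f a) = f (res_aug R A a)"
      using res_aug_map[OF A A' f] by (simp add: free_res_def)
    have "tensor_map R A' (F (int i)) (res_aug R A') (\<lambda>x. x) (?t 0 i (c 0)) =
        tensor_map R A' (F (int i)) f (\<lambda>x. x) (tensor_map R A (F (int i)) (res_aug R A) (\<lambda>x. x) (c 0))"
      by (rule tensor_map_square[OF m(1,3,2,3,5,3,6,3) rm mod_hom_id aug(2) mod_hom_id aug(1) mod_hom_id f mod_hom_id _ _ c0])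
        (rule aug' refl; assumption)+
    then show "tensor_map R A' (F (int i)) (res_aug R A') (\<lambda>x. x) (?c 0) = tensor_map R A' (F (int i)) f (\<lambda>x. x) z"
      using c(2) by simp
  next
    have ci: "c i \<in> carrier (tensor R (free_res R A (int i)) (F (int 0)))" by (rule c(1)) simp
    show "tensor_map R (free_res R A' (int i)) X (\<lambda>x. x) \<epsilon> (?c i) =
        tensor_map R (free_res R A' (int i)) X (res_map R f) (\<lambda>x. x) w"
    proof -
      have "tensor_map R (free_res R A' (int i)) X (\<lambda>x. x) \<epsilon> (?t i 0 (c i)) =
          tensor_map R (free_res R A' (int i)) X (res_map R f) (\<lambda>x. x) (tensor_map R (free_res R A (int i)) X (\<lambda>x. x) \<epsilon> (c i))"
        by (rule tensor_map_square[OF m(1,3,2,3,1,4,2,4) rm mod_hom_id mod_hom_id res_aug_mod_hom[OF res] mod_hom_id res_aug_mod_hom[OF res] rm mod_hom_id _ _ ci])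
          (rule refl)+
      then show ?thesis using c(3) by simp
    qed
  next
    fix p q assume pq: "Suc (p + q) = i"
    then have a: "p + Suc q = i" "Suc p + q = i" by auto
    have dm: "\<And>a. a \<in> carrier (free_res R A (int (Suc p))) \<Longrightarrow> res_map R f (res_diff R a) = res_diff R (res_map R f a)"
      using res_diff_map[OF A A' f] by simp
    have "tensor_map R (free_res R A' (int p)) (F (int q)) (\<lambda>x. x) (d (int (Suc q))) (?t p (Suc q) (c p)) =
        ?t p q (tensor_map R (free_res R A (int p)) (F (int q)) (\<lambda>x. x) (d (int (Suc q))) (c p))"
      by (rule tensor_map_square[OF m(1,3,2,3,1,3,2,3) rm mod_hom_id mod_hom_id dF mod_hom_id dF rm mod_hom_id _ _ c(1)[OF a(1)]]) (rule refl)+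
    also have "\<dots> = ?t p q (tensor_map R (free_res R A (int p)) (F (int q)) (res_diff R) (\<lambda>x. x) (c (Suc p)))"
      by (simp only: c(4)[OF pq])
    also have "\<dots> = tensor_map R (free_res R A' (int p)) (F (int q)) (res_diff R) (\<lambda>x. x) (?t (Suc p) q (c (Suc p)))"
      by (rule tensor_map_square[OF m(1,3,1,3,2,3,2,3) dP(1) mod_hom_id rm mod_hom_id rm mod_hom_id dP(2) mod_hom_id _ _ c(1)[OF a(2)]]) (simp_all only: dm)
    finally show "tensor_map R (free_res R A' (int p)) (F (int q)) (\<lambda>x. x) (d (int (Suc q))) (?c p) =
        tensor_map R (free_res R A' (int p)) (F (int q)) (res_diff R) (\<lambda>x. x) (?c (Suc p))"
      unfolding e[OF a(1)] e[OF a(2)] .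
  qed
qed

end


section \<open>Duality between Tor and Ext\<close>

lemma tensor_map_plus:
  assumes m: "module R A" "module R B" "module R A'" "module R B'"
    and f: "f \<in> mod_hom R A A'" "f' \<in> mod_hom R A A'" and g: "g \<in> mod_hom R B B'"
    and h: "h \<in> mod_hom R A A'" "\<And>a. a \<in> carrier A \<Longrightarrow> h a = f a \<oplus>\<^bsub>A'\<^esub> f' a"
    and z: "z \<in> carrier (tensor R A B)"
  shows "tensor_map R A' B' h g z = tensor_map R A' B' f g z \<oplus>\<^bsub>tensor R A' B'\<^esub> tensor_map R A' B' f' g z"
proof (rule tensor_hom_eqI[OF m(1,2) tensor_module[OF m(3,4)] tensor_map_hom[OF m h(1) g]
      mod_hom_plus[OF tensor_module[OF m(3,4)] tensor_map_hom[OF m f(1) g] tensor_map_hom[OF m f(2) g]] _ z])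
  fix a b assume ab: "a \<in> carrier A" "b \<in> carrier B"
  show "tensor_map R A' B' h g (pure_tensor R A B a b) =
      tensor_map R A' B' f g (pure_tensor R A B a b) \<oplus>\<^bsub>tensor R A' B'\<^esub> tensor_map R A' B' f' g (pure_tensor R A B a b)"
    using ab mod_hom_add[OF pure_hom_left[OF m(3,4) mod_hom_closed[OF g ab(2)]] mod_hom_closed[OF f(1) ab(1)] mod_hom_closed[OF f(2) ab(1)]]
    by (simp add: tensor_map_pure[OF m h(1) g] tensor_map_pure[OF m f(1) g] tensor_map_pure[OF m f(2) g] h(2))
qed

lemma tensor_map_id:
  assumes m: "module R A" "module R B" and z: "z \<in> carrier (tensor R A B)"
    and f: "f \<in> mod_hom R A A" "\<And>a. a \<in> carrier A \<Longrightarrow> f a = a"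
  shows "tensor_map R A B f (\<lambda>x. x) z = z"
  by (rule tensor_hom_eqI[OF m tensor_module[OF m] tensor_map_hom[OF m m f(1) mod_hom_id] mod_hom_id _ z])
    (simp add: tensor_map_pure[OF m m f(1) mod_hom_id] f(2))

text \<open>A linear form \<open>u\<close> on \<open>P\<close> with values in \<open>M\<close> evaluates elements of \<open>P \<otimes> D(M)\<close>.\<close>

locale dual_setting = matlis R E \<iota>
  for R :: "('r, 'x) ring_scheme" and E :: "('r, 'e, 'y) module_scheme" and \<iota> :: "'r set \<Rightarrow> 'e" +
  fixes M :: "('r, 'm, 'c) module_scheme"
  assumes M: "module R M"
begin

abbreviation "X \<equiv> Hom_mod R M E"
abbreviation "ev u \<equiv> tensor_lift R E (\<lambda>p \<phi>. \<phi> (u p))"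

lemma X_module: "module R X" by (rule Hom_module[OF M E_module])

lemma apply_hom: "m \<in> carrier M \<Longrightarrow> (\<lambda>\<phi>. \<phi> m) \<in> mod_hom R X E"
  by (rule mod_homI) (auto simp: Hom_add Hom_smult dest: Hom_memD mod_hom_closed)

lemma ev_bilinear: "u \<in> mod_hom R P M \<Longrightarrow> bilinear R P X E (\<lambda>p \<phi>. \<phi> (u p))"
  by (rule bilinearI) (auto intro: apply_hom mod_hom_comp Hom_memD dest: mod_hom_closed)

context
  fixes P :: "('r, 'p, 'k) module_scheme" assumes P: "module R P"
begin

lemma ev_hom: "u \<in> mod_hom R P M \<Longrightarrow> ev u \<in> mod_hom R (tensor R P X) E"
  by (rule tensor_lift_hom[OF P X_module E_module ev_bilinear])

lemma ev_pure: "\<lbrakk>u \<in> mod_hom R P M; p \<in> carrier P; \<phi> \<in> carrier X\<rbrakk> \<Longrightarrow> ev u (pure_tensor R P X p \<phi>) = \<phi> (u p)"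
  by (rule tensor_lift_pure[OF P X_module E_module ev_bilinear])


lemma ev_hom_left:
  assumes w: "w \<in> carrier (tensor R P X)"
  shows "(\<lambda>u. ev u w) \<in> mod_hom R (Hom_mod R P M) E"
proof (rule mod_homI)
  interpret H: module R "Hom_mod R P M" by (rule Hom_module[OF P M])
  fix u assume u: "u \<in> carrier (Hom_mod R P M)"
  show "ev u w \<in> carrier E" by (rule mod_hom_closed[OF ev_hom[OF Hom_memD[OF u]] w])
  fix u' assume u': "u' \<in> carrier (Hom_mod R P M)"
  note h = Hom_memD[OF u] Hom_memD[OF u'] Hom_memD[OF H.M.a_closed[OF u u']]
  show "ev (u \<oplus>\<^bsub>Hom_mod R P M\<^esub> u') w = ev u w \<oplus>\<^bsub>E\<^esub> ev u' w"
  proof (rule tensor_hom_eqI[OF P X_module E_module ev_hom[OF h(3)] mod_hom_plus[OF E_module ev_hom[OF h(1)] ev_hom[OF h(2)]] _ w])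
    fix p \<phi> assume p: "p \<in> carrier P" "\<phi> \<in> carrier X"
    show "ev (u \<oplus>\<^bsub>Hom_mod R P M\<^esub> u') (pure_tensor R P X p \<phi>) = ev u (pure_tensor R P X p \<phi>) \<oplus>\<^bsub>E\<^esub> ev u' (pure_tensor R P X p \<phi>)"
      using mod_hom_add[OF Hom_memD[OF p(2)] mod_hom_closed[OF h(1) p(1)] mod_hom_closed[OF h(2) p(1)]]
      by (simp add: ev_pure[OF h(1) p] ev_pure[OF h(2) p] ev_pure[OF h(3) p] Hom_add[OF p(1)])
  qed
next
  interpret H: module R "Hom_mod R P M" by (rule Hom_module[OF P M])
  fix r u assume r: "r \<in> carrier R" and u: "u \<in> carrier (Hom_mod R P M)"
  note h = Hom_memD[OF u] Hom_memD[OF H.smult_closed[OF r u]]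
  show "ev (r \<odot>\<^bsub>Hom_mod R P M\<^esub> u) w = r \<odot>\<^bsub>E\<^esub> ev u w"
  proof (rule tensor_hom_eqI[OF P X_module E_module ev_hom[OF h(2)] mod_hom_scale[OF E_module ev_hom[OF h(1)] r] _ w])
    fix p \<phi> assume p: "p \<in> carrier P" "\<phi> \<in> carrier X"
    show "ev (r \<odot>\<^bsub>Hom_mod R P M\<^esub> u) (pure_tensor R P X p \<phi>) = r \<odot>\<^bsub>E\<^esub> ev u (pure_tensor R P X p \<phi>)"
      using mod_hom_smult[OF Hom_memD[OF p(2)] r mod_hom_closed[OF h(1) p(1)]]
      by (simp add: ev_pure[OF h(1) p] ev_pure[OF h(2) p] Hom_smult[OF p(1)])
  qed
qed

end

lemma ev_natural:
  assumes P: "module R P" "module R P'" and f: "f \<in> mod_hom R P P'" and u: "u \<in> carrier (Hom_mod R P' M)"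
    and w: "w \<in> carrier (tensor R P X)"
  shows "ev u (tensor_map R P' X f (\<lambda>x. x) w) = ev (precomp P f u) w"
proof (rule tensor_hom_eqI[OF P(1) X_module E_module mod_hom_comp[OF tensor_map_hom[OF P(1) X_module P(2) X_module f mod_hom_id]
      ev_hom[OF P(2) Hom_memD[OF u]]] ev_hom[OF P(1) Hom_memD[OF precomp_closed[OF P(1) f u]]] _ w])
  fix p \<phi> assume p: "p \<in> carrier P" "\<phi> \<in> carrier X"
  show "ev u (tensor_map R P' X f (\<lambda>x. x) (pure_tensor R P X p \<phi>)) = ev (precomp P f u) (pure_tensor R P X p \<phi>)"
    using p by (simp add: tensor_map_pure[OF P(1) X_module P(2) X_module f mod_hom_id p] precomp_apply
      ev_pure[OF P(2) Hom_memD[OF u] mod_hom_closed[OF f p(1)] p(2)]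
      ev_pure[OF P(1) Hom_memD[OF precomp_closed[OF P(1) f u]] p])
qed

text \<open>Over a free module, an endomorphism \<open>g\<close> of finite rank makes the evaluation pairing perfect:
  coordinates detect elements of the form \<open>(g \<otimes> 1) w\<close>, and every functional composed with \<open>g\<close> is
  evaluation at an element.\<close>

context
  fixes G :: "'g set" and g :: "('g \<Rightarrow> 'r) \<Rightarrow> 'g \<Rightarrow> 'r" and S :: "'g set"
  assumes S: "finite S" and g: "g \<in> mod_hom R (free_module R G) (free_module R G)"
    and gS: "\<And>p. p \<in> carrier (free_module R G) \<Longrightarrow> g p \<in> carrier (free_module R S)"
begin

private abbreviation "P \<equiv> free_module R G"
private abbreviation "S' \<equiv> S \<inter> G"

private lemma P: "module R P" by (rule free_module_module[OF R_cring])
private lemma S': "finite S'" using S by simp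

private lemma gS': "p \<in> carrier P \<Longrightarrow> g p \<in> carrier (free_module R S')"
  using gS[of p] mod_hom_closed[OF g, of p] by (auto simp: free_carrier)

private lemma unitP: "s \<in> S' \<Longrightarrow> free_unit R s \<in> carrier P"
  by (rule free_unit_carrier[OF R_cring]) auto

lemma finite_free_expand:
  assumes T: "module R T" "finite S'" and k: "k \<in> mod_hom R P T" and q: "q \<in> carrier (free_module R S')"
  shows "k q = (\<Oplus>\<^bsub>T\<^esub>s\<in>S'. q s \<odot>\<^bsub>T\<^esub> k (free_unit R s))"
proof -
  have cl: "k (free_unit R s) \<in> carrier T" if "s \<in> S'" for s by (rule mod_hom_closed[OF k unitP[OF that]])
  have k': "k \<in> mod_hom R (free_module R S') T"
    using k mod_hom_restrict_dom[OF k free_mono[of S' G R]] free_restrict[of R S' G] by auto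
  have "k q = free_lift R T (\<lambda>s. k (free_unit R s)) q"
    by (rule free_hom_eqI[OF R_cring T(1) k' free_lift_hom[OF T(1) cl] _ q])
      (simp_all add: free_lift_unit[OF T(1)] cl)
  also have "\<dots> = (\<Oplus>\<^bsub>T\<^esub>s\<in>S'. q s \<odot>\<^bsub>T\<^esub> k (free_unit R s))"
    using q cl by (intro free_lift_superset[OF T]) (auto simp: free_carrier)
  finally show ?thesis .
qed

text \<open>The form \<open>p \<mapsto> p\<^sub>s m\<close> on \<open>P\<close>, and the component at \<open>s\<close> of an element of \<open>P \<otimes> X\<close>, which is an element
  of \<open>X\<close>.  The value of the latter at \<open>m\<close> is an evaluation (\<open>coord_ev\<close>), so evaluations determine
  all components.\<close>

private definition "coord_form s m = (\<lambda>p\<in>carrier P. p s \<odot>\<^bsub>M\<^esub> m)"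
private definition "coord s = tensor_lift R X (\<lambda>p \<phi>. p s \<odot>\<^bsub>X\<^esub> \<phi>)"

private lemma eval_scale_hom:
  assumes "module R T" "t \<in> carrier T" shows "(\<lambda>p. p s \<odot>\<^bsub>T\<^esub> t) \<in> mod_hom R P T"
proof -
  interpret T: module R T by fact
  show ?thesis by (rule mod_homI) (use assms in \<open>auto simp: free_carrier free_simps T.smult_l_distr T.smult_assoc1\<close>)
qed

private lemma coord_form: "m \<in> carrier M \<Longrightarrow> coord_form s m \<in> carrier (Hom_mod R P M)"
  unfolding coord_form_def by (rule restrict_in_Hom[OF P eval_scale_hom[OF M]])

private lemma coord_form_hom: "coord_form s \<in> mod_hom R M (Hom_mod R P M)"
proof -
  interpret M: module R M by (rule M)
  note H = Hom_module[OF P M]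
  show ?thesis
    by (rule mod_homI)
      (auto intro!: Hom_ext coord_form module_closed(1,5)[OF H] simp: Hom_add Hom_smult, auto simp: coord_form_def free_carrier M.smult_r_distr
         M.smult_assoc1[symmetric] M.R.m_comm)
qed

private lemma coord_bilinear: "bilinear R P X X (\<lambda>p \<phi>. p s \<odot>\<^bsub>X\<^esub> \<phi>)"
  by (rule bilinearI) (auto intro: eval_scale_hom[OF X_module] mod_hom_scale[OF X_module mod_hom_id] simp: free_carrier)

private lemma coord_hom: "coord s \<in> mod_hom R (tensor R P X) X"
  unfolding coord_def by (rule tensor_lift_hom[OF P X_module X_module coord_bilinear])

private lemma coord_pure: "\<lbrakk>p \<in> carrier P; \<phi> \<in> carrier X\<rbrakk> \<Longrightarrow> coord s (pure_tensor R P X p \<phi>) = p s \<odot>\<^bsub>X\<^esub> \<phi>"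
  unfolding coord_def by (rule tensor_lift_pure[OF P X_module X_module coord_bilinear])

private lemma coord_ev:
  assumes w: "w \<in> carrier (tensor R P X)" and m: "m \<in> carrier M"
  shows "coord s w m = ev (coord_form s m) w"
proof (rule tensor_hom_eqI[OF P X_module E_module mod_hom_comp[OF coord_hom apply_hom[OF m]] ev_hom[OF P Hom_memD[OF coord_form[OF m]]] _ w])
  fix p \<phi> assume p: "p \<in> carrier P" "\<phi> \<in> carrier X"
  show "coord s (pure_tensor R P X p \<phi>) m = ev (coord_form s m) (pure_tensor R P X p \<phi>)"
    unfolding ev_pure[OF P Hom_memD[OF coord_form[OF m]] p] coord_pure[OF p]
    using p m mod_hom_smult[OF Hom_memD[OF p(2)], of "p s" m] by (simp add: coord_form_def Hom_smult free_carrier)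
qed

private abbreviation "gT \<equiv> tensor_map R P X g (\<lambda>x. x)"

private lemma gT: "gT \<in> mod_hom R (tensor R P X) (tensor R P X)"
  by (rule tensor_map_hom[OF P X_module P X_module g mod_hom_id])

text \<open>An arbitrary element of \<open>P \<otimes> X\<close> is a finite sum of its components too, but the index set then
  depends on the element; after \<open>g\<close> the fixed finite set \<open>S'\<close> suffices.\<close>

private lemma finite_rank_expand:
  assumes w: "w \<in> carrier (tensor R P X)"
  shows "gT w = (\<Oplus>\<^bsub>tensor R P X\<^esub>s\<in>S'. pure_tensor R P X (free_unit R s) (coord s (gT w)))"
proof -
  note T = tensor_module[OF P X_module]
  interpret T: module R "tensor R P X" by (rule T)
  have r: "(\<lambda>w. \<Oplus>\<^bsub>tensor R P X\<^esub>s\<in>S'. pure_tensor R P X (free_unit R s) (coord s (gT w))) \<in> mod_hom R (tensor R P X) (tensor R P X)"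
    by (rule mod_hom_finsum[OF T mod_hom_comp[OF mod_hom_comp[OF gT coord_hom] pure_hom_right[OF P X_module unitP]]])
  show ?thesis
  proof (rule tensor_hom_eqI[OF P X_module T gT r _ w])
    fix p \<phi> assume p: "p \<in> carrier P" "\<phi> \<in> carrier X"
    have gp: "g p \<in> carrier P" by (rule mod_hom_closed[OF g p(1)])
    have gps: "g p s \<in> carrier R" for s using gp by (simp add: free_carrier)
    have "gT (pure_tensor R P X p \<phi>) = pure_tensor R P X (g p) \<phi>"
      by (rule tensor_map_pure[OF P X_module P X_module g mod_hom_id p])
    also have "\<dots> = (\<Oplus>\<^bsub>tensor R P X\<^esub>s\<in>S'. g p s \<odot>\<^bsub>tensor R P X\<^esub> pure_tensor R P X (free_unit R s) \<phi>)"
      by (rule finite_free_expand[OF T S' pure_hom_left[OF P X_module p(2)] gS'[OF p(1)]])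
    also have "\<dots> = (\<Oplus>\<^bsub>tensor R P X\<^esub>s\<in>S'. pure_tensor R P X (free_unit R s) (coord s (gT (pure_tensor R P X p \<phi>))))"
    proof (rule T.M.finsum_cong'[OF refl])
      show "(\<lambda>s. pure_tensor R P X (free_unit R s) (coord s (gT (pure_tensor R P X p \<phi>)))) \<in> S' \<rightarrow> carrier (tensor R P X)"
        by (intro Pi_I pure_closed[OF P X_module] unitP mod_hom_closed[OF coord_hom] mod_hom_closed[OF gT] p)
      fix s assume s: "s \<in> S'"
      have "coord s (gT (pure_tensor R P X p \<phi>)) = g p s \<odot>\<^bsub>X\<^esub> \<phi>"
        unfolding \<open>gT (pure_tensor R P X p \<phi>) = pure_tensor R P X (g p) \<phi>\<close> by (rule coord_pure[OF gp p(2)])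
      then show "g p s \<odot>\<^bsub>tensor R P X\<^esub> pure_tensor R P X (free_unit R s) \<phi> = pure_tensor R P X (free_unit R s) (coord s (gT (pure_tensor R P X p \<phi>)))"
        using mod_hom_smult[OF pure_hom_right[OF P X_module unitP[OF s]] gps p(2)] by simp
    qed
    finally show "gT (pure_tensor R P X p \<phi>) = (\<Oplus>\<^bsub>tensor R P X\<^esub>s\<in>S'. pure_tensor R P X (free_unit R s) (coord s (gT (pure_tensor R P X p \<phi>))))" .
  qed
qed

lemma finite_rank_detect:
  assumes w: "w \<in> carrier (tensor R P X)" and 0: "\<And>u. u \<in> carrier (Hom_mod R P M) \<Longrightarrow> ev u (gT w) = \<zero>\<^bsub>E\<^esub>"
  shows "gT w = \<zero>\<^bsub>tensor R P X\<^esub>"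
proof -
  note T = tensor_module[OF P X_module]
  interpret T: module R "tensor R P X" by (rule T)
  have gw: "gT w \<in> carrier (tensor R P X)" by (rule mod_hom_closed[OF gT w])
  have c: "coord s (gT w) = \<zero>\<^bsub>X\<^esub>" for s
    by (rule Hom_ext[OF mod_hom_closed[OF coord_hom gw] module_zero_closed[OF X_module]])
      (simp add: coord_ev[OF gw] 0 coord_form Hom_zero)
  have "pure_tensor R P X (free_unit R s) (coord s (gT w)) = \<zero>\<^bsub>tensor R P X\<^esub>" if "s \<in> S'" for s
    unfolding c by (rule mod_hom_zero[OF X_module T pure_hom_right[OF P X_module unitP[OF that]]])
  then have "(\<Oplus>\<^bsub>tensor R P X\<^esub>s\<in>S'. pure_tensor R P X (free_unit R s) (coord s (gT w))) = (\<Oplus>\<^bsub>tensor R P X\<^esub>s\<in>S'. \<zero>\<^bsub>tensor R P X\<^esub>)"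
    by (intro T.M.finsum_cong'[OF refl]) auto
  then show ?thesis by (subst finite_rank_expand[OF w]) simp
qed

text \<open>The component of \<open>y\<close> at \<open>s\<close> is the restriction of \<open>\<chi>\<close>, composed with \<open>g\<close>, to the forms concentrated
  at \<open>s\<close>.  Finitely many components suffice because \<open>u \<circ> g\<close> is the sum over \<open>S'\<close> of its parts.\<close>

lemma finite_rank_represent:
  assumes l: "\<chi> \<in> mod_hom R (Hom_mod R P M) E"
  obtains y where "y \<in> carrier (tensor R P X)" "\<And>u. u \<in> carrier (Hom_mod R P M) \<Longrightarrow> ev u y = \<chi> (precomp P g u)"
proof -
  note T = tensor_module[OF P X_module] and H = Hom_module[OF P M]
  interpret T: module R "tensor R P X" by (rule T)
  interpret E: module R E by (rule E_module)
  let ?\<phi> = "\<lambda>s. \<lambda>m\<in>carrier M. \<chi> (precomp P g (coord_form s m))"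
  have pg: "precomp P g \<in> mod_hom R (Hom_mod R P M) (Hom_mod R P M)" by (rule precomp_hom[OF P P M g])
  have phi: "?\<phi> s \<in> carrier X" for s
    by (rule restrict_in_Hom[OF M mod_hom_comp[OF mod_hom_comp[OF coord_form_hom pg] l]])
  let ?y = "\<Oplus>\<^bsub>tensor R P X\<^esub>s\<in>S'. pure_tensor R P X (free_unit R s) (?\<phi> s)"
  have t: "(\<lambda>s. pure_tensor R P X (free_unit R s) (?\<phi> s)) \<in> S' \<rightarrow> carrier (tensor R P X)"
    by (intro Pi_I pure_closed[OF P X_module] unitP phi)
  show ?thesis
  proof (rule that)
    show "?y \<in> carrier (tensor R P X)" by (rule T.M.finsum_closed[OF t])
    fix u assume u: "u \<in> carrier (Hom_mod R P M)"
    note uh = Hom_memD[OF u]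
    have us: "u (free_unit R s) \<in> carrier M" if "s \<in> S'" for s by (rule mod_hom_closed[OF uh unitP[OF that]])
    let ?c = "\<lambda>s. precomp P g (coord_form s (u (free_unit R s)))"
    have cH: "?c \<in> S' \<rightarrow> carrier (Hom_mod R P M)" by (intro Pi_I mod_hom_closed[OF pg] coord_form us)
    have sum: "(\<Oplus>\<^bsub>Hom_mod R P M\<^esub>s\<in>S'. ?c s) = precomp P g u"
    proof (rule Hom_ext)
      interpret H: module R "Hom_mod R P M" by (rule H)
      interpret M: module R M by (rule M)
      show "(\<Oplus>\<^bsub>Hom_mod R P M\<^esub>s\<in>S'. ?c s) \<in> carrier (Hom_mod R P M)" by (rule H.M.finsum_closed[OF cH])
      show "precomp P g u \<in> carrier (Hom_mod R P M)" by (rule mod_hom_closed[OF pg u])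
      fix p assume p: "p \<in> carrier P"
      have gp: "g p \<in> carrier P" by (rule mod_hom_closed[OF g p])
      have ap: "(\<lambda>u. u p) \<in> mod_hom R (Hom_mod R P M) M"
        by (rule mod_homI) (use p in \<open>auto simp: Hom_add Hom_smult dest: Hom_memD mod_hom_closed\<close>)
      have "(\<Oplus>\<^bsub>Hom_mod R P M\<^esub>s\<in>S'. ?c s) p = (\<Oplus>\<^bsub>M\<^esub>s\<in>S'. ?c s p)" by (rule hom_finsum[OF H M ap cH])
      also have "\<dots> = (\<Oplus>\<^bsub>M\<^esub>s\<in>S'. g p s \<odot>\<^bsub>M\<^esub> u (free_unit R s))"
        by (rule M.M.finsum_cong'[OF refl])
          (use gp us p in \<open>auto simp: precomp_apply coord_form_def free_carrier\<close>)
      also have "\<dots> = u (g p)" by (rule finite_free_expand[OF M S' uh gS'[OF p], symmetric])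
      finally show "(\<Oplus>\<^bsub>Hom_mod R P M\<^esub>s\<in>S'. ?c s) p = precomp P g u p" using p by (simp add: precomp_apply)
    qed
    have "ev u ?y = (\<Oplus>\<^bsub>E\<^esub>s\<in>S'. ev u (pure_tensor R P X (free_unit R s) (?\<phi> s)))"
      by (rule hom_finsum[OF T E_module ev_hom[OF P uh] t])
    also have "\<dots> = (\<Oplus>\<^bsub>E\<^esub>s\<in>S'. \<chi> (?c s))"
      by (rule E.M.finsum_cong'[OF refl])
        (use us cH in \<open>auto simp: ev_pure[OF P uh unitP phi] intro!: mod_hom_closed[OF l]\<close>)
    also have "\<dots> = \<chi> (precomp P g u)" unfolding sum[symmetric] by (rule hom_finsum[OF H E_module l cH, symmetric])
    finally show "ev u ?y = \<chi> (precomp P g u)" .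
  qed
qed

end

text \<open>The complexes \<open>Hom(P(A), M)\<close>, with homology \<open>Ext(A, M)\<close>, and \<open>P(A) \<otimes> X\<close>, with homology
  \<open>Tor(A, X)\<close>.\<close>

abbreviation "HM A n \<equiv> Hom_mod R (free_res R A n) M"
abbreviation "cocycles A n \<equiv> a_kernel (HM A n) (HM A (n + 1)) (Ext_cobound R A n)"
abbreviation "coboundaries A n \<equiv> Ext_cobound R A (n - 1) ` carrier (HM A (n - 1))"
abbreviation "TX A n \<equiv> tensor R (free_res R A n) X"
abbreviation "dTX A n \<equiv> tensor_map R (free_res R A (n - 1)) X (res_diff R) (\<lambda>x. x)"

context
  fixes A :: "('r, 'a, 'k) module_scheme" assumes A: "module R A"
begin

interpretation A: canonical_res R A by (rule canonical_res.intro[OF A])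

lemma HM_module: "module R (HM A n)" by (rule Hom_module[OF A.free_res_module M])
lemma TX_module: "module R (TX A n)" by (rule tensor_module[OF A.free_res_module X_module])

lemma cobound_hom: "Ext_cobound R A n \<in> mod_hom R (HM A n) (HM A (n + 1))"
  unfolding Ext_cobound_def using A.res_diff_hom[of "n + 1"] by (intro precomp_hom A.free_res_module M) simp

lemma cobound_hom': "Ext_cobound R A (n - 1) \<in> mod_hom R (HM A (n - 1)) (HM A n)"
  using cobound_hom[of "n - 1"] by simp

lemma cobound_cobound:
  assumes "u \<in> carrier (HM A (n - 1))" shows "Ext_cobound R A n (Ext_cobound R A (n - 1) u) = \<zero>\<^bsub>HM A (n + 1)\<^esub>"
proof (rule Hom_ext)
  show "Ext_cobound R A n (Ext_cobound R A (n - 1) u) \<in> carrier (HM A (n + 1))"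
    by (rule mod_hom_closed[OF cobound_hom mod_hom_closed[OF cobound_hom' assms]])
  show "\<zero>\<^bsub>HM A (n + 1)\<^esub> \<in> carrier (HM A (n + 1))" by (rule module_zero_closed[OF HM_module])
  fix p assume p: "p \<in> carrier (free_res R A (n + 1))"
  have dp: "res_diff R p \<in> carrier (free_res R A n)" using mod_hom_closed[OF A.res_diff_hom p] by simp
  have "res_diff R (res_diff R p) = \<zero>\<^bsub>free_res R A (n - 1)\<^esub>"
    using res_dd[OF A.canonical_resolution p] by simp
  then show "Ext_cobound R A n (Ext_cobound R A (n - 1) u) p = \<zero>\<^bsub>HM A (n + 1)\<^esub> p"
    using p dp mod_hom_zero[OF A.free_res_module M Hom_memD[OF assms]] by (simp add: Ext_cobound_def precomp_apply Hom_zero)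
qed

lemma cocycles_submodule: "submodule (cocycles A n) R (HM A n)"
  by (rule kernel_submodule[OF HM_module HM_module cobound_hom])

lemma coboundaries_submodule: "submodule (coboundaries A n) R (HM A n)"
  by (rule image_carrier_submodule[OF HM_module HM_module cobound_hom'])

lemma coboundaries_cocycles: "coboundaries A n \<subseteq> cocycles A n"
  using cobound_cobound mod_hom_closed[OF cobound_hom'] by (auto simp: a_kernel_iff)

lemma dTX_hom: "dTX A n \<in> mod_hom R (TX A n) (TX A (n - 1))"
  by (intro tensor_map_hom A.free_res_module X_module mod_hom_id A.res_diff_hom)

lemma ev_cobound:
  assumes "u \<in> carrier (HM A (n - 1))" "w \<in> carrier (TX A n)"
  shows "ev u (dTX A n w) = ev (Ext_cobound R A (n - 1) u) w"
  using ev_natural[OF A.free_res_module A.free_res_module A.res_diff_hom assms] by (simp add: Ext_cobound_def)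

context
  assumes N: "noetherian_ring R" and fg: "finitely_generated R A"
begin

text \<open>No nonzero class of \<open>P(A) \<otimes> X\<close> is orthogonal to all cocycles.  Evaluation at \<open>w\<close> factors through
  the coboundary operator as some \<open>\<chi>\<close>; if \<open>\<chi>\<close> were evaluation at an element \<open>y\<close>, then \<open>w\<close> and the
  boundary of \<open>y\<close> would have the same evaluations.  The endomorphism \<open>g\<close> makes \<open>\<chi>\<close> representable and
  lets evaluations detect equality.\<close>

lemma perfect_detect:
  assumes w: "w \<in> carrier (TX A n)" and cyc: "dTX A n w = \<zero>\<^bsub>TX A (n - 1)\<^esub>"
    and 0: "\<And>u. u \<in> cocycles A n \<Longrightarrow> ev u w = \<zero>\<^bsub>E\<^esub>"
  shows "w \<in> dTX A (n + 1) ` carrier (TX A (n + 1))"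
proof -
  obtain g h S where S: "\<And>n. finite (S n)"
    and g: "\<And>n. g n \<in> mod_hom R (free_res R A n) (free_res R A n)"
    and h: "\<And>n. h n \<in> mod_hom R (free_res R A n) (free_res R A (n + 1))"
    and gS: "\<And>n p. p \<in> carrier (free_res R A n) \<Longrightarrow> g n p \<in> carrier (free_module R (S n))"
    and split: "\<And>n p. p \<in> carrier (free_res R A n) \<Longrightarrow>
      p = g n p \<oplus>\<^bsub>free_res R A n\<^esub> (res_diff R (h n p) \<oplus>\<^bsub>free_res R A n\<^esub> h (n - 1) (res_diff R p))"
    and gd: "\<And>n p. p \<in> carrier (free_res R A n) \<Longrightarrow> g (n - 1) (res_diff R p) = res_diff R (g n p)"
    by (rule A.finite_rank_homotopy[OF N fg]) blast
  let ?Q = "free_res R A"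
  note m = A.free_res_module X_module
  note d = A.res_diff_hom
  have d': "res_diff R \<in> mod_hom R (?Q (n + 1)) (?Q n)" for n using d[of "n + 1"] by simp
  have h': "h (n - 1) \<in> mod_hom R (?Q (n - 1)) (?Q n)" for n using h[of "n - 1"] by simp
  let ?G = "\<lambda>n. tensor_map R (?Q n) X (g n) (\<lambda>x. x)"
  let ?D = "dTX A (n + 1)"
  have D: "?D \<in> mod_hom R (TX A (n + 1)) (TX A n)" using dTX_hom[of "n + 1"] by simp
  have G: "?G k \<in> mod_hom R (TX A k) (TX A k)" for k by (intro tensor_map_hom m g mod_hom_id)
  have im: "submodule (?D ` carrier (TX A (n + 1))) R (TX A n)" by (rule image_carrier_submodule[OF TX_module TX_module D])
  interpret TX: module R "TX A n" by (rule TX_module)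
  have free: "?Q k = free_module R (if k < 0 then {} else res_gens R A (nat k))" for k by (simp add: free_res_def)
  have GD: "?G n (?D z) = ?D (?G (n + 1) z)" if "z \<in> carrier (TX A (n + 1))" for z
    unfolding add_diff_cancel_right'
    by (rule tensor_map_square[OF m m m m d' mod_hom_id g mod_hom_id g mod_hom_id d' mod_hom_id _ _ that])
      (use gd[of _ "n + 1"] in simp_all)
  \<comment> \<open>by the homotopy, the cycle \<open>w\<close> is homologous to its image under \<open>G\<close>\<close>
  have key: "\<exists>b \<in> ?D ` carrier (TX A (n + 1)). w = ?G n w \<oplus>\<^bsub>TX A n\<^esub> b"
  proof -
    let ?k = "\<lambda>p. res_diff R (h n p) \<oplus>\<^bsub>?Q n\<^esub> h (n - 1) (res_diff R p)"
    have k: "?k \<in> mod_hom R (?Q n) (?Q n)" by (rule mod_hom_plus[OF m(1) mod_hom_comp[OF h d'] mod_hom_comp[OF d h']])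
    have "w = tensor_map R (?Q n) X (\<lambda>p. p) (\<lambda>x. x) w" by (rule tensor_map_id[OF m w mod_hom_id refl, symmetric])
    also have "\<dots> = ?G n w \<oplus>\<^bsub>TX A n\<^esub> tensor_map R (?Q n) X ?k (\<lambda>x. x) w"
      by (rule tensor_map_plus[OF m m g k mod_hom_id mod_hom_id split w])
    also have "tensor_map R (?Q n) X ?k (\<lambda>x. x) w = tensor_map R (?Q n) X (\<lambda>p. res_diff R (h n p)) (\<lambda>x. x) w
        \<oplus>\<^bsub>TX A n\<^esub> tensor_map R (?Q n) X (\<lambda>p. h (n - 1) (res_diff R p)) (\<lambda>x. x) w"
      by (rule tensor_map_plus[OF m m mod_hom_comp[OF h d'] mod_hom_comp[OF d h'] mod_hom_id k refl w])
    also have "tensor_map R (?Q n) X (\<lambda>p. h (n - 1) (res_diff R p)) (\<lambda>x. x) w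
        = tensor_map R (?Q n) X (h (n - 1)) (\<lambda>x. x) (dTX A n w)"
      by (rule sym, rule tensor_map_comp[OF m m m d mod_hom_id h' mod_hom_id mod_hom_comp[OF d h'] mod_hom_id _ _ w]) (rule refl)+
    also have "\<dots> = \<zero>\<^bsub>TX A n\<^esub>"
      unfolding cyc by (rule mod_hom_zero[OF TX_module TX_module tensor_map_hom[OF m m h' mod_hom_id]])
    also have "tensor_map R (?Q n) X (\<lambda>p. res_diff R (h n p)) (\<lambda>x. x) w = ?D (tensor_map R (?Q (n + 1)) X (h n) (\<lambda>x. x) w)"
      unfolding add_diff_cancel_right'
      by (rule sym, rule tensor_map_comp[OF m m m h mod_hom_id d' mod_hom_id mod_hom_comp[OF h d'] mod_hom_id _ _ w]) (rule refl)+
    finally have "w = ?G n w \<oplus>\<^bsub>TX A n\<^esub> (?D (tensor_map R (?Q (n + 1)) X (h n) (\<lambda>x. x) w) \<oplus>\<^bsub>TX A n\<^esub> \<zero>\<^bsub>TX A n\<^esub>)" .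
    moreover have hw: "tensor_map R (?Q (n + 1)) X (h n) (\<lambda>x. x) w \<in> carrier (TX A (n + 1))"
      by (rule mod_hom_closed[OF tensor_map_hom[OF m m h mod_hom_id] w])
    moreover have "?D (tensor_map R (?Q (n + 1)) X (h n) (\<lambda>x. x) w) \<in> carrier (TX A n)" by (rule mod_hom_closed[OF D hw])
    ultimately show ?thesis by (metis TX.M.r_zero image_eqI)
  qed
  then obtain b where b: "b \<in> ?D ` carrier (TX A (n + 1))" "w = ?G n w \<oplus>\<^bsub>TX A n\<^esub> b" by blast
  have bc: "b \<in> carrier (TX A n)" using b(1) submodule_sub[OF im] by blast
  have Gw: "?G n w \<in> carrier (TX A n)" by (rule mod_hom_closed[OF G w])
  \<comment> \<open>evaluation at \<open>w\<close> factors through the coboundary operator, since it kills cocycles\<close>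
  have "ev u w = \<zero>\<^bsub>E\<^esub>" if "u \<in> carrier (HM A n)" "Ext_cobound R A n u = \<zero>\<^bsub>HM A (n + 1)\<^esub>" for u
    using 0 that by (simp add: a_kernel_iff)
  then obtain \<chi> where \<chi>: "\<chi> \<in> mod_hom R (HM A (n + 1)) E" "\<And>u. u \<in> carrier (HM A n) \<Longrightarrow> \<chi> (Ext_cobound R A n u) = ev u w"
    using baer_extend[OF E_baer HM_module HM_module cobound_hom ev_hom_left[OF m(1) w]] by blast
  obtain y where y: "y \<in> carrier (TX A (n + 1))"
    "\<And>u. u \<in> carrier (HM A (n + 1)) \<Longrightarrow> ev u y = \<chi> (precomp (?Q (n + 1)) (g (n + 1)) u)"
    using finite_rank_represent[OF S[of "n + 1"] g[of "n + 1", unfolded free] gS[of _ "n + 1", unfolded free] \<chi>(1)[unfolded free]]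
    unfolding free[symmetric] by blast
  \<comment> \<open>\<open>D y\<close> and \<open>G w\<close> have the same evaluations, which only shows that their images under \<open>G\<close> agree;
    hence \<open>w\<close> is compared with \<open>G (G w)\<close> in the end\<close>
  let ?t = "?D y \<ominus>\<^bsub>TX A n\<^esub> ?G n w"
  have Dy: "?D y \<in> carrier (TX A n)" by (rule mod_hom_closed[OF D y(1)])
  have tc: "?t \<in> carrier (TX A n)" by (rule module_minus_closed[OF TX_module Dy Gw])
  have evt: "ev u ?t = \<zero>\<^bsub>E\<^esub>" if u: "u \<in> carrier (HM A n)" for u
  proof -
    have pu: "precomp (?Q n) (g n) u \<in> carrier (HM A n)" by (rule precomp_closed[OF m(1) g u])
    have "precomp (?Q (n + 1)) (g (n + 1)) (Ext_cobound R A n u) = Ext_cobound R A n (precomp (?Q n) (g n) u)"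
    proof (rule Hom_ext)
      show "precomp (?Q (n + 1)) (g (n + 1)) (Ext_cobound R A n u) \<in> carrier (HM A (n + 1))"
        by (rule precomp_closed[OF m(1) g mod_hom_closed[OF cobound_hom u]])
      show "Ext_cobound R A n (precomp (?Q n) (g n) u) \<in> carrier (HM A (n + 1))" by (rule mod_hom_closed[OF cobound_hom pu])
      fix p assume p: "p \<in> carrier (?Q (n + 1))"
      then show "precomp (?Q (n + 1)) (g (n + 1)) (Ext_cobound R A n u) p = Ext_cobound R A n (precomp (?Q n) (g n) u) p"
        using mod_hom_closed[OF g p] mod_hom_closed[OF d' p] gd[OF p] by (simp add: Ext_cobound_def precomp_apply)
    qed
    then have "\<chi> (precomp (?Q (n + 1)) (g (n + 1)) (Ext_cobound R A n u)) = ev (precomp (?Q n) (g n) u) w"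
      using \<chi>(2)[OF pu] by simp
    moreover have "ev u (?D y) = ev (Ext_cobound R A n u) y" using ev_cobound[of u "n + 1" y] u y(1) by simp
    moreover have "ev u (?G n w) = ev (precomp (?Q n) (g n) u) w" by (rule ev_natural[OF m(1) m(1) g u w])
    ultimately have "ev u (?D y) = ev u (?G n w)" using y(2)[OF mod_hom_closed[OF cobound_hom u]] by simp
    then show ?thesis
      using mod_hom_minus[OF TX_module E_module ev_hom[OF m(1) Hom_memD[OF u]] Dy Gw]
        module_minus_eq_zero_iff[OF E_module] mod_hom_closed[OF ev_hom[OF m(1) Hom_memD[OF u]] Gw] by simp
  qed
  have "?G n ?t = \<zero>\<^bsub>TX A n\<^esub>"
  proof -
    have "ev u (?G n ?t) = \<zero>\<^bsub>E\<^esub>" if u: "u \<in> carrier (HM A n)" for u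
      using ev_natural[OF m(1) m(1) g u tc] evt[OF precomp_closed[OF m(1) g u]] by simp
    then show ?thesis
      using finite_rank_detect[OF S[of n] g[of n, unfolded free] gS[of _ n, unfolded free] tc[unfolded free]]
      unfolding free[symmetric] by blast
  qed
  then have "?G n (?D y) = ?G n (?G n w)"
    using mod_hom_minus[OF TX_module TX_module G Dy Gw] module_minus_eq_zero_iff[OF TX_module mod_hom_closed[OF G Dy] mod_hom_closed[OF G Gw]] by simp
  then have GGw: "?G n (?G n w) \<in> ?D ` carrier (TX A (n + 1))"
    using GD[OF y(1)] mod_hom_closed[OF G y(1)] by (metis image_eqI)
  obtain b0 where b0: "b0 \<in> carrier (TX A (n + 1))" "b = ?D b0" using b(1) by blast
  have "?G n b \<in> ?D ` carrier (TX A (n + 1))" using GD[OF b0(1)] mod_hom_closed[OF G b0(1)] b0(2) by (metis image_eqI)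
  then have "?G n (?G n w) \<oplus>\<^bsub>TX A n\<^esub> ?G n b \<in> ?D ` carrier (TX A (n + 1))" by (rule submodule_add[OF im GGw])
  moreover have "?G n (?G n w) \<oplus>\<^bsub>TX A n\<^esub> ?G n b = ?G n w" using mod_hom_add[OF G Gw bc] b(2) by simp
  ultimately have "?G n w \<in> ?D ` carrier (TX A (n + 1))" by simp
  then have "?G n w \<oplus>\<^bsub>TX A n\<^esub> b \<in> ?D ` carrier (TX A (n + 1))" by (rule submodule_add[OF im _ b(1)])
  then show ?thesis using b(2) by simp
qed

text \<open>Extend \<open>\<chi>\<close> to all cochains, and represent the extension composed with \<open>g\<close> by some \<open>y\<close>.  The boundary
  of \<open>y\<close> has zero evaluations, so \<open>G y\<close> is a cycle; and on cocycles composition with \<open>g\<close> changes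
  nothing modulo coboundaries, on which \<open>\<chi>\<close> vanishes.\<close>

lemma perfect_represent:
  assumes l: "\<chi> \<in> mod_hom R ((HM A n)\<lparr>carrier := cocycles A n\<rparr>) E"
    and kill: "\<And>u. u \<in> coboundaries A n \<Longrightarrow> \<chi> u = \<zero>\<^bsub>E\<^esub>"
  obtains w where "w \<in> carrier (TX A n)" "dTX A n w = \<zero>\<^bsub>TX A (n - 1)\<^esub>" "\<And>u. u \<in> cocycles A n \<Longrightarrow> ev u w = \<chi> u"
proof -
  obtain g h S where S: "\<And>n. finite (S n)"
    and g: "\<And>n. g n \<in> mod_hom R (free_res R A n) (free_res R A n)"
    and h: "\<And>n. h n \<in> mod_hom R (free_res R A n) (free_res R A (n + 1))"
    and gS: "\<And>n p. p \<in> carrier (free_res R A n) \<Longrightarrow> g n p \<in> carrier (free_module R (S n))"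
    and split: "\<And>n p. p \<in> carrier (free_res R A n) \<Longrightarrow>
      p = g n p \<oplus>\<^bsub>free_res R A n\<^esub> (res_diff R (h n p) \<oplus>\<^bsub>free_res R A n\<^esub> h (n - 1) (res_diff R p))"
    and gd: "\<And>n p. p \<in> carrier (free_res R A n) \<Longrightarrow> g (n - 1) (res_diff R p) = res_diff R (g n p)"
    by (rule A.finite_rank_homotopy[OF N fg]) blast
  let ?Q = "free_res R A"
  note m = A.free_res_module X_module
  note d = A.res_diff_hom
  have d': "res_diff R \<in> mod_hom R (?Q (n + 1)) (?Q n)" for n using d[of "n + 1"] by simp
  have h': "h (n - 1) \<in> mod_hom R (?Q (n - 1)) (?Q n)" for n using h[of "n - 1"] by simp
  let ?G = "\<lambda>n. tensor_map R (?Q n) X (g n) (\<lambda>x. x)"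
  have G: "?G k \<in> mod_hom R (TX A k) (TX A k)" for k by (intro tensor_map_hom m g mod_hom_id)
  have free: "?Q k = free_module R (if k < 0 then {} else res_gens R A (nat k))" for k by (simp add: free_res_def)
  let ?Z = "(HM A n)\<lparr>carrier := cocycles A n\<rparr>"
  have mZ: "module R ?Z" by (rule submodule_module[OF HM_module cocycles_submodule])
  have incl: "(\<lambda>x. x) \<in> mod_hom R ?Z (HM A n)"
    by (rule mod_hom_restrict_dom[OF mod_hom_id submodule_sub[OF cocycles_submodule]])
  have "\<chi> u = \<zero>\<^bsub>E\<^esub>" if "u \<in> carrier ?Z" "u = \<zero>\<^bsub>HM A n\<^esub>" for u
    using mod_hom_zero[OF mZ E_module l] that by simp
  then obtain \<psi> where \<psi>: "\<psi> \<in> mod_hom R (HM A n) E" "\<And>u. u \<in> cocycles A n \<Longrightarrow> \<psi> u = \<chi> u"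
    using baer_extend[OF E_baer mZ HM_module incl l] by auto
  let ?pg = "precomp (?Q n) (g n)"
  have pg: "?pg \<in> mod_hom R (HM A n) (HM A n)" by (rule precomp_hom[OF m(1) m(1) M g])
  have pg_cyc: "?pg u \<in> cocycles A n \<and> \<chi> (?pg u) = \<chi> u" if u: "u \<in> cocycles A n" for u
  proof -
    have uc: "u \<in> carrier (HM A n)" and ud: "Ext_cobound R A n u = \<zero>\<^bsub>HM A (n + 1)\<^esub>" using u by (auto simp: a_kernel_iff)
    let ?k = "Ext_cobound R A (n - 1) (precomp (?Q (n - 1)) (h (n - 1)) u)"
    have k0: "precomp (?Q (n - 1)) (h (n - 1)) u \<in> carrier (HM A (n - 1))" by (rule precomp_closed[OF m(1) h' uc])
    then have kb: "?k \<in> coboundaries A n" by blast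
    then have kz: "?k \<in> cocycles A n" using coboundaries_cocycles by blast
    have kc: "?k \<in> carrier (HM A n)" using kz by (simp add: a_kernel_iff)
    have puc: "?pg u \<in> carrier (HM A n)" by (rule mod_hom_closed[OF pg uc])
    interpret M: module R M by (rule M)
    have e: "u = ?pg u \<oplus>\<^bsub>HM A n\<^esub> ?k"
    proof (rule Hom_ext[OF uc module_add_closed[OF HM_module puc kc]])
      fix p assume p: "p \<in> carrier (?Q n)"
      have dp: "res_diff R p \<in> carrier (?Q (n - 1))" by (rule mod_hom_closed[OF d p])
      have hp: "h n p \<in> carrier (?Q (n + 1))" by (rule mod_hom_closed[OF h p])
      have c: "g n p \<in> carrier (?Q n)" "res_diff R (h n p) \<in> carrier (?Q n)" "h (n - 1) (res_diff R p) \<in> carrier (?Q n)"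
        using mod_hom_closed[OF g p] mod_hom_closed[OF d' hp] mod_hom_closed[OF h' dp] by auto
      note uh = Hom_memD[OF uc]
      have z: "u (res_diff R (h n p)) = \<zero>\<^bsub>M\<^esub>"
        using fun_cong[OF ud, of "h n p"] hp by (simp add: Ext_cobound_def precomp_apply Hom_zero)
      have "u p = u (g n p \<oplus>\<^bsub>?Q n\<^esub> (res_diff R (h n p) \<oplus>\<^bsub>?Q n\<^esub> h (n - 1) (res_diff R p)))"
        by (rule arg_cong[OF split[OF p]])
      also have "\<dots> = u (g n p) \<oplus>\<^bsub>M\<^esub> (u (res_diff R (h n p)) \<oplus>\<^bsub>M\<^esub> u (h (n - 1) (res_diff R p)))"
        by (simp only: mod_hom_add[OF uh c(1) module_add_closed[OF m(1) c(2,3)]] mod_hom_add[OF uh c(2,3)])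
      also have "\<dots> = u (g n p) \<oplus>\<^bsub>M\<^esub> u (h (n - 1) (res_diff R p))"
        unfolding z using mod_hom_closed[OF uh c(3)] by simp
      finally show "u p = (?pg u \<oplus>\<^bsub>HM A n\<^esub> ?k) p" using p dp by (simp add: Hom_add precomp_apply Ext_cobound_def)
    qed
    have e': "?pg u = u \<ominus>\<^bsub>HM A n\<^esub> ?k" using module_add_minus_cancel(4)[OF HM_module kc puc] e by simp
    have pz: "?pg u \<in> cocycles A n" unfolding e' by (rule submodule_minus[OF cocycles_submodule u kz])
    interpret E: module R E by (rule E_module)
    have "\<chi> u = \<chi> (?pg u \<oplus>\<^bsub>HM A n\<^esub> ?k)" using e by simp
    also have "\<dots> = \<chi> (?pg u) \<oplus>\<^bsub>E\<^esub> \<chi> ?k" using mod_hom_add[OF l, of "?pg u" ?k] pz kz by simp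
    also have "\<dots> = \<chi> (?pg u)" using kill[OF kb] mod_hom_closed[OF l, of "?pg u"] pz by simp
    finally show ?thesis using pz by simp
  qed
  obtain y where y: "y \<in> carrier (TX A n)" "\<And>u. u \<in> carrier (HM A n) \<Longrightarrow> ev u y = \<psi> (?pg u)"
    using finite_rank_represent[OF S[of n] g[of n, unfolded free] gS[of _ n, unfolded free] \<psi>(1)[unfolded free]]
    unfolding free[symmetric] by blast
  have dyc: "dTX A n y \<in> carrier (TX A (n - 1))" by (rule mod_hom_closed[OF dTX_hom y(1)])
  have evd: "ev v (dTX A n y) = \<zero>\<^bsub>E\<^esub>" if v: "v \<in> carrier (HM A (n - 1))" for v
  proof -
    have cv: "Ext_cobound R A (n - 1) v \<in> coboundaries A n" using v by blast
    then have cz: "Ext_cobound R A (n - 1) v \<in> cocycles A n" using coboundaries_cocycles by blast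
    then have "\<psi> (?pg (Ext_cobound R A (n - 1) v)) = \<chi> (Ext_cobound R A (n - 1) v)" using pg_cyc \<psi>(2) by simp
    moreover have "Ext_cobound R A (n - 1) v \<in> carrier (HM A n)" using cz by (simp add: a_kernel_iff)
    ultimately show ?thesis using ev_cobound[OF v y(1)] y(2) kill[OF cv] by simp
  qed
  have "tensor_map R (?Q (n - 1)) X (g (n - 1)) (\<lambda>x. x) (dTX A n y) = \<zero>\<^bsub>TX A (n - 1)\<^esub>"
  proof -
    have "ev u (?G (n - 1) (dTX A n y)) = \<zero>\<^bsub>E\<^esub>" if u: "u \<in> carrier (HM A (n - 1))" for u
      using ev_natural[OF m(1) m(1) g u dyc] evd[OF precomp_closed[OF m(1) g u]] by simp
    then show ?thesis
      using finite_rank_detect[OF S[of "n - 1"] g[of "n - 1", unfolded free] gS[of _ "n - 1", unfolded free] dyc[unfolded free]]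
      unfolding free[symmetric] by blast
  qed
  moreover have "?G (n - 1) (dTX A n y) = dTX A n (?G n y)"
    by (rule tensor_map_square[OF m m m m d mod_hom_id g mod_hom_id g mod_hom_id d mod_hom_id _ _ y(1)])
      (use gd[of _ n] in simp_all)
  ultimately have 1: "dTX A n (?G n y) = \<zero>\<^bsub>TX A (n - 1)\<^esub>" by simp
  have 2: "ev u (?G n y) = \<chi> u" if u: "u \<in> cocycles A n" for u
  proof -
    have uc: "u \<in> carrier (HM A n)" using u by (simp add: a_kernel_iff)
    have "ev u (?G n y) = ev (?pg u) y" by (rule ev_natural[OF m(1) m(1) g uc y(1)])
    also have "\<dots> = \<psi> (?pg (?pg u))" by (rule y(2)[OF mod_hom_closed[OF pg uc]])
    also have "\<dots> = \<chi> u" using pg_cyc[OF u] pg_cyc[of "?pg u"] \<psi>(2) by simp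
    finally show ?thesis .
  qed
  show ?thesis by (rule that[OF mod_hom_closed[OF G y(1)] 1 2])
qed

end

end

end


section \<open>Sequential limits and duality\<close>

text \<open>Direct sums and inverse limits are both modules of families with componentwise operations.\<close>

lemma pointwise_module:
  fixes D :: "('r, nat \<Rightarrow> 'v, 'k) module_scheme"
  assumes R: "cring R" and Z: "\<And>s. module R (Z s)"
    and cl: "\<And>x s. x \<in> carrier D \<Longrightarrow> x s \<in> carrier (Z s)"
    and simps: "\<And>x y s. (x \<oplus>\<^bsub>D\<^esub> y) s = x s \<oplus>\<^bsub>Z s\<^esub> y s" "\<And>s. \<zero>\<^bsub>D\<^esub> s = \<zero>\<^bsub>Z s\<^esub>"
      "\<And>r x s. (r \<odot>\<^bsub>D\<^esub> x) s = r \<odot>\<^bsub>Z s\<^esub> x s"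
    and add: "\<And>x y. \<lbrakk>x \<in> carrier D; y \<in> carrier D\<rbrakk> \<Longrightarrow> x \<oplus>\<^bsub>D\<^esub> y \<in> carrier D"
    and zero: "\<zero>\<^bsub>D\<^esub> \<in> carrier D"
    and sc: "\<And>r x. \<lbrakk>r \<in> carrier R; x \<in> carrier D\<rbrakk> \<Longrightarrow> r \<odot>\<^bsub>D\<^esub> x \<in> carrier D"
  shows "module R D"
proof -
  have ag: "abelian_group (Z s)" for s by (rule module.axioms(2)[OF Z])
  have am: "abelian_monoid (Z s)" for s by (rule abelian_group.axioms(1)[OF ag])
  show ?thesis
  proof (rule moduleI[OF R])
    show "abelian_group D"
    proof (rule abelian_groupI)
      fix x assume x: "x \<in> carrier D"
      interpret R: cring R by (rule R)
      let ?y = "(\<ominus>\<^bsub>R\<^esub> \<one>\<^bsub>R\<^esub>) \<odot>\<^bsub>D\<^esub> x"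
      have "?y \<oplus>\<^bsub>D\<^esub> x = \<zero>\<^bsub>D\<^esub>"
        by (rule ext) (simp add: simps module_neg_smult[OF Z cl[OF x], symmetric] abelian_group.l_neg[OF ag cl[OF x]])
      then show "\<exists>y\<in>carrier D. y \<oplus>\<^bsub>D\<^esub> x = \<zero>\<^bsub>D\<^esub>" using sc[OF _ x] by (intro bexI[of _ ?y]) auto
    next
      fix x y z assume c: "x \<in> carrier D" "y \<in> carrier D" "z \<in> carrier D"
      show "x \<oplus>\<^bsub>D\<^esub> y \<oplus>\<^bsub>D\<^esub> z = x \<oplus>\<^bsub>D\<^esub> (y \<oplus>\<^bsub>D\<^esub> z)"
        by (rule ext) (simp add: simps abelian_monoid.a_assoc[OF am] cl c)
    next
      fix x y assume c: "x \<in> carrier D" "y \<in> carrier D"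
      show "x \<oplus>\<^bsub>D\<^esub> y = y \<oplus>\<^bsub>D\<^esub> x"
        by (rule ext) (simp add: simps abelian_monoid.a_comm[OF am] cl c)
    next
      fix x assume c: "x \<in> carrier D"
      show "\<zero>\<^bsub>D\<^esub> \<oplus>\<^bsub>D\<^esub> x = x"
        by (rule ext) (simp add: simps abelian_monoid.l_zero[OF am] cl c)
    qed (auto intro: add zero)
  next
    fix a b x assume c: "a \<in> carrier R" "b \<in> carrier R" "x \<in> carrier D"
    show "(a \<oplus>\<^bsub>R\<^esub> b) \<odot>\<^bsub>D\<^esub> x = a \<odot>\<^bsub>D\<^esub> x \<oplus>\<^bsub>D\<^esub> b \<odot>\<^bsub>D\<^esub> x"
      by (rule ext) (simp add: simps module.smult_l_distr[OF Z] cl c)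
    show "(a \<otimes>\<^bsub>R\<^esub> b) \<odot>\<^bsub>D\<^esub> x = a \<odot>\<^bsub>D\<^esub> (b \<odot>\<^bsub>D\<^esub> x)"
      by (rule ext) (simp add: simps module.smult_assoc1[OF Z] cl c)
  next
    fix a x y assume c: "a \<in> carrier R" "x \<in> carrier D" "y \<in> carrier D"
    show "a \<odot>\<^bsub>D\<^esub> (x \<oplus>\<^bsub>D\<^esub> y) = a \<odot>\<^bsub>D\<^esub> x \<oplus>\<^bsub>D\<^esub> a \<odot>\<^bsub>D\<^esub> y"
      by (rule ext) (simp add: simps module.smult_r_distr[OF Z] cl c)
  next
    fix x assume c: "x \<in> carrier D"
    show "\<one>\<^bsub>R\<^esub> \<odot>\<^bsub>D\<^esub> x = x"
      by (rule ext) (simp add: simps module.smult_one[OF Z] cl c)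
  qed (rule sc)
qed

definition direct_sum :: "(nat \<Rightarrow> ('r, 'v, 'c) module_scheme) \<Rightarrow> ('r, nat \<Rightarrow> 'v) module"
  where "direct_sum Z =
    \<lparr>carrier = {x. (\<forall>s. x s \<in> carrier (Z s)) \<and> finite {s. x s \<noteq> \<zero>\<^bsub>Z s\<^esub>}},
     monoid.mult = undefined, monoid.one = undefined,
     ring.zero = (\<lambda>s. \<zero>\<^bsub>Z s\<^esub>), ring.add = (\<lambda>x y s. x s \<oplus>\<^bsub>Z s\<^esub> y s),
     smult = (\<lambda>r x s. r \<odot>\<^bsub>Z s\<^esub> x s)\<rparr>"

lemma direct_sum_carrier:
  "x \<in> carrier (direct_sum Z) \<longleftrightarrow> (\<forall>s. x s \<in> carrier (Z s)) \<and> finite {s. x s \<noteq> \<zero>\<^bsub>Z s\<^esub>}"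
  by (simp add: direct_sum_def)

lemma direct_sum_simps:
  "(x \<oplus>\<^bsub>direct_sum Z\<^esub> y) s = x s \<oplus>\<^bsub>Z s\<^esub> y s" "\<zero>\<^bsub>direct_sum Z\<^esub> s = \<zero>\<^bsub>Z s\<^esub>" "(r \<odot>\<^bsub>direct_sum Z\<^esub> x) s = r \<odot>\<^bsub>Z s\<^esub> x s"
  by (simp_all add: direct_sum_def)

lemma direct_sum_module:
  assumes R: "cring R" and Z: "\<And>s. module R (Z s)"
  shows "module R (direct_sum Z)"
proof -
  let ?D = "direct_sum Z"
  have am: "abelian_monoid (Z s)" for s by (rule abelian_group.axioms(1)[OF module.axioms(2)[OF Z]])
  have add: "x \<oplus>\<^bsub>?D\<^esub> y \<in> carrier ?D" if "x \<in> carrier ?D" "y \<in> carrier ?D" for x y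
  proof -
    have "{s. (x \<oplus>\<^bsub>?D\<^esub> y) s \<noteq> \<zero>\<^bsub>Z s\<^esub>} \<subseteq> {s. x s \<noteq> \<zero>\<^bsub>Z s\<^esub>} \<union> {s. y s \<noteq> \<zero>\<^bsub>Z s\<^esub>}"
      by (auto simp: direct_sum_simps abelian_monoid.l_zero[OF am] module_zero_closed[OF Z])
    then have "finite {s. (x \<oplus>\<^bsub>?D\<^esub> y) s \<noteq> \<zero>\<^bsub>Z s\<^esub>}"
      by (rule finite_subset) (use that in \<open>simp add: direct_sum_carrier\<close>)
    then show ?thesis using that by (simp add: direct_sum_carrier direct_sum_simps module_add_closed[OF Z])
  qed
  have sc: "r \<odot>\<^bsub>?D\<^esub> x \<in> carrier ?D" if "r \<in> carrier R" "x \<in> carrier ?D" for r x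
  proof -
    have "{s. (r \<odot>\<^bsub>?D\<^esub> x) s \<noteq> \<zero>\<^bsub>Z s\<^esub>} \<subseteq> {s. x s \<noteq> \<zero>\<^bsub>Z s\<^esub>}"
      using that by (auto simp: direct_sum_simps module.smult_r_null[OF Z])
    then have "finite {s. (r \<odot>\<^bsub>?D\<^esub> x) s \<noteq> \<zero>\<^bsub>Z s\<^esub>}"
      by (rule finite_subset) (use that in \<open>simp add: direct_sum_carrier\<close>)
    then show ?thesis using that by (simp add: direct_sum_carrier direct_sum_simps module_smult_closed[OF Z])
  qed
  have zero: "\<zero>\<^bsub>?D\<^esub> \<in> carrier ?D" by (simp add: direct_sum_carrier direct_sum_simps module_zero_closed[OF Z])
  have cl: "x s \<in> carrier (Z s)" if "x \<in> carrier ?D" for x s using that by (simp add: direct_sum_carrier)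
  show ?thesis
    by (rule pointwise_module[of R Z, OF R Z]) (rule direct_sum_simps add zero sc cl; assumption?)+
qed

text \<open>A tower \<open>Y\<close> of modules, taken modulo submodules \<open>D\<close>, that is dual to a direct system \<open>Z\<close>
  modulo \<open>B\<close> through a perfect pairing \<open>\<tau>\<close>.\<close>

locale dual_tower = matlis R E \<iota>
  for R :: "('r, 'x) ring_scheme" and E :: "('r, 'e, 'k) module_scheme" and \<iota> :: "'r set \<Rightarrow> 'e" +
  fixes Z :: "nat \<Rightarrow> ('r, 'v, 'c) module_scheme" and B :: "nat \<Rightarrow> 'v set" and \<pi> :: "nat \<Rightarrow> 'v \<Rightarrow> 'v"
    and Y :: "nat \<Rightarrow> ('r, 'y, 'd) module_scheme" and D :: "nat \<Rightarrow> 'y set" and p :: "nat \<Rightarrow> 'y \<Rightarrow> 'y"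
    and \<tau> :: "nat \<Rightarrow> 'y \<Rightarrow> 'v \<Rightarrow> 'e"
  assumes Z: "\<And>s. module R (Z s)" and B: "\<And>s. submodule (B s) R (Z s)"
    and \<pi>: "\<And>s. \<pi> s \<in> mod_hom R (Z s) (Z (Suc s))" and \<pi>B: "\<And>s u. u \<in> B s \<Longrightarrow> \<pi> s u \<in> B (Suc s)"
    and Y: "\<And>s. module R (Y s)" and D: "\<And>s. submodule (D s) R (Y s)"
    and p: "\<And>s. p s \<in> mod_hom R (Y (Suc s)) (Y s)"
    and \<tau>_hom: "\<And>s z. z \<in> carrier (Y s) \<Longrightarrow> \<tau> s z \<in> mod_hom R (Z s) E"
    and \<tau>_hom_left: "\<And>s u. u \<in> carrier (Z s) \<Longrightarrow> (\<lambda>z. \<tau> s z u) \<in> mod_hom R (Y s) E"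
    and \<tau>_B: "\<And>s z u. \<lbrakk>z \<in> carrier (Y s); u \<in> B s\<rbrakk> \<Longrightarrow> \<tau> s z u = \<zero>\<^bsub>E\<^esub>"
    and \<tau>_D: "\<And>s z u. \<lbrakk>z \<in> D s; u \<in> carrier (Z s)\<rbrakk> \<Longrightarrow> \<tau> s z u = \<zero>\<^bsub>E\<^esub>"
    and \<tau>_detect: "\<And>s z. \<lbrakk>z \<in> carrier (Y s); \<And>u. u \<in> carrier (Z s) \<Longrightarrow> \<tau> s z u = \<zero>\<^bsub>E\<^esub>\<rbrakk> \<Longrightarrow> z \<in> D s"
    and \<tau>_represent: "\<And>s \<chi>. \<lbrakk>\<chi> \<in> mod_hom R (Z s) E; \<And>u. u \<in> B s \<Longrightarrow> \<chi> u = \<zero>\<^bsub>E\<^esub>\<rbrakk> \<Longrightarrow>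
       \<exists>z\<in>carrier (Y s). \<forall>u\<in>carrier (Z s). \<tau> s z u = \<chi> u"
    and \<tau>_natural: "\<And>s z u. \<lbrakk>z \<in> carrier (Y (Suc s)); u \<in> carrier (Z s)\<rbrakk> \<Longrightarrow> \<tau> s (p s z) u = \<tau> (Suc s) z (\<pi> s u)"
begin

abbreviation "DS \<equiv> direct_sum Z"
definition "BS = {x \<in> carrier DS. \<forall>s. x s \<in> B s}"

text \<open>The direct limit of the quotients \<open>Z s / B s\<close> is the cokernel of the telescope on \<open>DS / BS\<close>, their
  direct sum.\<close>

definition telescope :: "(nat \<Rightarrow> 'v) \<Rightarrow> nat \<Rightarrow> 'v"
  where "telescope v s = (case s of 0 \<Rightarrow> v 0 | Suc k \<Rightarrow> v (Suc k) \<ominus>\<^bsub>Z (Suc k)\<^esub> \<pi> k (v k))"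

definition single :: "nat \<Rightarrow> 'v \<Rightarrow> nat \<Rightarrow> 'v"
  where "single s u = (\<lambda>t. if t = s then u else \<zero>\<^bsub>Z t\<^esub>)"

lemma DS: "module R DS" by (rule direct_sum_module[OF R_cring Z])

lemma DS_closed: "x \<in> carrier DS \<Longrightarrow> x s \<in> carrier (Z s)" by (simp add: direct_sum_carrier)

lemma Z_zero: "u \<ominus>\<^bsub>Z s\<^esub> \<zero>\<^bsub>Z s\<^esub> = u" if "u \<in> carrier (Z s)" for s u
  using that module_diff_eq_iff[OF Z that module_zero_closed[OF Z] that]
    abelian_monoid.r_zero[OF abelian_group.axioms(1)[OF module.axioms(2)[OF Z]] that] by simp

lemma \<pi>_zero: "\<pi> s \<zero>\<^bsub>Z s\<^esub> = \<zero>\<^bsub>Z (Suc s)\<^esub>" by (rule mod_hom_zero[OF Z Z \<pi>])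

lemma component_hom: "(\<lambda>x. x s) \<in> mod_hom R DS (Z s)"
  by (rule mod_homI) (auto simp: direct_sum_simps DS_closed)

lemma telescope_hom: "telescope \<in> mod_hom R DS DS"
proof (rule mod_homI)
  have comp: "(\<lambda>v. telescope v s) \<in> mod_hom R DS (Z s)" for s
  proof (cases s)
    case 0 then show ?thesis by (simp add: telescope_def component_hom)
  next
    case (Suc k) then show ?thesis unfolding telescope_def
      using mod_hom_diff[OF Z component_hom[of "Suc k"] mod_hom_comp[OF component_hom[of k] \<pi>]] by simp
  qed
  fix x assume x: "x \<in> carrier DS"
  have "{s. telescope x s \<noteq> \<zero>\<^bsub>Z s\<^esub>} \<subseteq> {s. x s \<noteq> \<zero>\<^bsub>Z s\<^esub>} \<union> Suc ` {s. x s \<noteq> \<zero>\<^bsub>Z s\<^esub>}"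
  proof
    fix s assume "s \<in> {s. telescope x s \<noteq> \<zero>\<^bsub>Z s\<^esub>}"
    then show "s \<in> {s. x s \<noteq> \<zero>\<^bsub>Z s\<^esub>} \<union> Suc ` {s. x s \<noteq> \<zero>\<^bsub>Z s\<^esub>}"
      using Z_zero[OF module_zero_closed[OF Z]] by (cases s) (auto simp: telescope_def \<pi>_zero)
  qed
  moreover have "finite ({s. x s \<noteq> \<zero>\<^bsub>Z s\<^esub>} \<union> Suc ` {s. x s \<noteq> \<zero>\<^bsub>Z s\<^esub>})" using x by (simp add: direct_sum_carrier)
  ultimately have "finite {s. telescope x s \<noteq> \<zero>\<^bsub>Z s\<^esub>}" by (rule finite_subset)
  then show "telescope x \<in> carrier DS" using mod_hom_closed[OF comp x] by (simp add: direct_sum_carrier)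
  show "telescope (x \<oplus>\<^bsub>DS\<^esub> y) = telescope x \<oplus>\<^bsub>DS\<^esub> telescope y" if "y \<in> carrier DS" for y
    by (rule ext) (simp add: mod_hom_add[OF comp x that] direct_sum_simps)
  show "telescope (r \<odot>\<^bsub>DS\<^esub> x) = r \<odot>\<^bsub>DS\<^esub> telescope x" if "r \<in> carrier R" for r
    by (rule ext) (simp add: mod_hom_smult[OF comp that x] direct_sum_simps)
qed

lemma BS: "submodule BS R DS"
  using submodule_closed[OF B] module_closed(1,4,5)[OF DS]
  by (intro submodule_criterion[OF DS]) (auto simp: BS_def direct_sum_simps)

lemma single_hom: "single s \<in> mod_hom R (Z s) DS"
proof (rule mod_homI)
  have zz: "\<zero>\<^bsub>Z t\<^esub> \<oplus>\<^bsub>Z t\<^esub> \<zero>\<^bsub>Z t\<^esub> = \<zero>\<^bsub>Z t\<^esub>" for t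
    by (rule abelian_monoid.l_zero[OF abelian_group.axioms(1)[OF module.axioms(2)[OF Z]] module_zero_closed[OF Z]])
  fix u assume u: "u \<in> carrier (Z s)"
  have "finite {t. single s u t \<noteq> \<zero>\<^bsub>Z t\<^esub>}" by (rule finite_subset[of _ "{s}"]) (auto simp: single_def)
  then show "single s u \<in> carrier DS" using u by (auto simp: direct_sum_carrier single_def module_zero_closed[OF Z])
  show "single s (u \<oplus>\<^bsub>Z s\<^esub> u') = single s u \<oplus>\<^bsub>DS\<^esub> single s u'" for u'
    by (rule ext) (simp add: direct_sum_simps single_def zz)
  show "single s (r \<odot>\<^bsub>Z s\<^esub> u) = r \<odot>\<^bsub>DS\<^esub> single s u" if "r \<in> carrier R" for r
    by (rule ext) (simp add: direct_sum_simps single_def module.smult_r_null[OF Z that])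
qed

lemma single_BS: "u \<in> B s \<Longrightarrow> single s u \<in> BS"
  using mod_hom_closed[OF single_hom, of u s] submodule_sub[OF B[of s]] submodule_zero[OF B]
  by (auto simp: BS_def single_def)

lemma DS_minus: "\<lbrakk>x \<in> carrier DS; y \<in> carrier DS\<rbrakk> \<Longrightarrow> (x \<ominus>\<^bsub>DS\<^esub> y) s = x s \<ominus>\<^bsub>Z s\<^esub> y s"
  using mod_hom_minus[OF DS Z component_hom] by simp

lemma telescope_single:
  assumes u: "u \<in> carrier (Z s)"
  shows "telescope (single s u) = single s u \<ominus>\<^bsub>DS\<^esub> single (Suc s) (\<pi> s u)"
proof
  fix t
  have c: "single s u \<in> carrier DS" "single (Suc s) (\<pi> s u) \<in> carrier DS"
    using mod_hom_closed[OF single_hom] u mod_hom_closed[OF \<pi> u] by auto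
  show "telescope (single s u) t = (single s u \<ominus>\<^bsub>DS\<^esub> single (Suc s) (\<pi> s u)) t"
    unfolding DS_minus[OF c]
    using Z_zero[OF u] Z_zero[OF module_zero_closed[OF Z]]
    by (cases t) (auto simp: telescope_def single_def \<pi>_zero)
qed

text \<open>The telescope is injective modulo boundaries: the components of \<open>v\<close> are boundaries one after the
  other.\<close>

lemma telescope_BS:
  assumes v: "v \<in> carrier DS" and t: "telescope v \<in> BS"
  shows "v \<in> BS"
proof -
  have "v s \<in> B s" for s
  proof (induction s)
    case 0 then show ?case using t by (auto simp: BS_def telescope_def dest: spec[of _ 0])
  next
    case (Suc s)
    have "v (Suc s) \<ominus>\<^bsub>Z (Suc s)\<^esub> \<pi> s (v s) \<in> B (Suc s)" using t by (auto simp: BS_def telescope_def dest: spec[of _ "Suc s"])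
    then have "(v (Suc s) \<ominus>\<^bsub>Z (Suc s)\<^esub> \<pi> s (v s)) \<oplus>\<^bsub>Z (Suc s)\<^esub> \<pi> s (v s) \<in> B (Suc s)"
      by (rule submodule_add[OF B _ \<pi>B[OF Suc]])
    then show ?case
      by (simp add: module_add_minus_cancel(2)[OF Z mod_hom_closed[OF \<pi> DS_closed[OF v]] DS_closed[OF v]])
  qed
  then show ?thesis using v by (simp add: BS_def)
qed

text \<open>The functional on the direct sum with components \<open>f\<close>.\<close>

definition total :: "(nat \<Rightarrow> 'v \<Rightarrow> 'e) \<Rightarrow> (nat \<Rightarrow> 'v) \<Rightarrow> 'e"
  where "total f x = (\<Oplus>\<^bsub>E\<^esub>s\<in>{s. x s \<noteq> \<zero>\<^bsub>Z s\<^esub>}. f s (x s))"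

lemma total_hom:
  assumes f: "\<And>s. f s \<in> mod_hom R (Z s) E"
  shows "total f \<in> mod_hom R DS E" "u \<in> carrier (Z s) \<Longrightarrow> total f (single s u) = f s u"
proof -
  interpret E: module R E by (rule E_module)
  have c: "f s (x s) \<in> carrier E" if "x \<in> carrier DS" for s x by (rule mod_hom_closed[OF f DS_closed[OF that]])
  have sup: "total f x = (\<Oplus>\<^bsub>E\<^esub>s\<in>T. f s (x s))" if "x \<in> carrier DS" "finite T" "{s. x s \<noteq> \<zero>\<^bsub>Z s\<^esub>} \<subseteq> T" for x T
    unfolding total_def using that c mod_hom_zero[OF Z E_module f]
    by (intro E.M.add.finprod_mono_neutral_cong_left) auto
  show "total f \<in> mod_hom R DS E"
  proof (rule mod_homI)
    fix x assume x: "x \<in> carrier DS"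
    show "total f x \<in> carrier E" unfolding total_def using c[OF x] by (intro E.M.finsum_closed) auto
    fix y assume y: "y \<in> carrier DS"
    let ?T = "{s. x s \<noteq> \<zero>\<^bsub>Z s\<^esub>} \<union> {s. y s \<noteq> \<zero>\<^bsub>Z s\<^esub>}"
    have T: "finite ?T" using x y by (simp add: direct_sum_carrier)
    have s: "{s. (x \<oplus>\<^bsub>DS\<^esub> y) s \<noteq> \<zero>\<^bsub>Z s\<^esub>} \<subseteq> ?T"
      using abelian_monoid.l_zero[OF abelian_group.axioms(1)[OF module.axioms(2)[OF Z]] module_zero_closed[OF Z]]
      by (auto simp: direct_sum_simps)
    have "total f (x \<oplus>\<^bsub>DS\<^esub> y) = (\<Oplus>\<^bsub>E\<^esub>s\<in>?T. f s (x s) \<oplus>\<^bsub>E\<^esub> f s (y s))"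
      unfolding sup[OF module_add_closed[OF DS x y] T s]
      by (rule E.M.finsum_cong'[OF refl]) (auto simp: direct_sum_simps mod_hom_add[OF f DS_closed[OF x] DS_closed[OF y]] c[OF x] c[OF y])
    also have "\<dots> = (\<Oplus>\<^bsub>E\<^esub>s\<in>?T. f s (x s)) \<oplus>\<^bsub>E\<^esub> (\<Oplus>\<^bsub>E\<^esub>s\<in>?T. f s (y s))"
      by (rule E.M.finsum_addf) (auto simp: c[OF x] c[OF y])
    also have "\<dots> = total f x \<oplus>\<^bsub>E\<^esub> total f y" using sup[OF x T] sup[OF y T] by simp
    finally show "total f (x \<oplus>\<^bsub>DS\<^esub> y) = total f x \<oplus>\<^bsub>E\<^esub> total f y" .
  next
    fix r x assume r: "r \<in> carrier R" and x: "x \<in> carrier DS"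
    let ?T = "{s. x s \<noteq> \<zero>\<^bsub>Z s\<^esub>}"
    have T: "finite ?T" using x by (simp add: direct_sum_carrier)
    have s: "{s. (r \<odot>\<^bsub>DS\<^esub> x) s \<noteq> \<zero>\<^bsub>Z s\<^esub>} \<subseteq> ?T"
      using module.smult_r_null[OF Z r] by (auto simp: direct_sum_simps)
    have "total f (r \<odot>\<^bsub>DS\<^esub> x) = (\<Oplus>\<^bsub>E\<^esub>s\<in>?T. r \<odot>\<^bsub>E\<^esub> f s (x s))"
      unfolding sup[OF module_smult_closed[OF DS r x] T s]
      by (rule E.M.finsum_cong'[OF refl]) (auto simp: direct_sum_simps mod_hom_smult[OF f r DS_closed[OF x]] c[OF x] r)
    also have "\<dots> = r \<odot>\<^bsub>E\<^esub> total f x"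
      unfolding total_def by (rule E.finsum_smult_ldistr[symmetric, OF T r]) (auto simp: c[OF x])
    finally show "total f (r \<odot>\<^bsub>DS\<^esub> x) = r \<odot>\<^bsub>E\<^esub> total f x" .
  qed
  show "total f (single s u) = f s u" if u: "u \<in> carrier (Z s)"
  proof -
    have "{t. single s u t \<noteq> \<zero>\<^bsub>Z t\<^esub>} \<subseteq> {s}" by (auto simp: single_def)
    then show ?thesis
      using sup[OF mod_hom_closed[OF single_hom u], of "{s}"] mod_hom_closed[OF f u] by (simp add: single_def)
  qed
qed

lemma tele_quot_hom: "(\<lambda>v. BS +>\<^bsub>DS\<^esub> telescope v) \<in> mod_hom R DS (quot_mod DS BS)"
  by (rule mod_hom_comp[OF telescope_hom quot_proj_hom[OF DS BS]])

lemma tele_quot_single: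
  assumes u: "u \<in> carrier (Z s)"
  shows "BS +>\<^bsub>DS\<^esub> telescope (single s u) = (BS +>\<^bsub>DS\<^esub> single s u) \<ominus>\<^bsub>quot_mod DS BS\<^esub> (BS +>\<^bsub>DS\<^esub> single (Suc s) (\<pi> s u))"
  unfolding telescope_single[OF u]
  by (rule quot_minus[OF DS BS, symmetric]) (rule mod_hom_closed[OF single_hom] u mod_hom_closed[OF \<pi> u])+

text \<open>A functional on the quotient of the direct sum by the boundaries is, component by component,
  represented by elements of the tower.\<close>

lemma quotient_functional:
  assumes \<psi>: "\<psi> \<in> mod_hom R (quot_mod DS BS) E"
  obtains t where "\<And>s. t s \<in> carrier (Y s)" "\<And>s u. u \<in> carrier (Z s) \<Longrightarrow> \<tau> s (t s) u = \<psi> (BS +>\<^bsub>DS\<^esub> single s u)"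
    and "\<And>s u. u \<in> carrier (Z s) \<Longrightarrow> \<psi> (BS +>\<^bsub>DS\<^esub> telescope (single s u)) = \<tau> s (t s \<ominus>\<^bsub>Y s\<^esub> p s (t (Suc s))) u"
proof -
  note Q = quot_module[OF DS BS]
  have h: "(\<lambda>u. \<psi> (BS +>\<^bsub>DS\<^esub> single s u)) \<in> mod_hom R (Z s) E" for s
    by (rule mod_hom_comp[OF mod_hom_comp[OF single_hom quot_proj_hom[OF DS BS]] \<psi>])
  have k: "\<psi> (BS +>\<^bsub>DS\<^esub> single s u) = \<zero>\<^bsub>E\<^esub>" if "u \<in> B s" for s u
    using coset_eq_zero_iff[OF DS BS, of "single s u"] single_BS[OF that] submodule_sub[OF BS] mod_hom_zero[OF Q E_module \<psi>]
    by (auto simp: quot_zero)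
  have "\<exists>t. \<forall>s. t s \<in> carrier (Y s) \<and> (\<forall>u\<in>carrier (Z s). \<tau> s (t s) u = \<psi> (BS +>\<^bsub>DS\<^esub> single s u))"
    using \<tau>_represent[OF h k] by (intro choice) blast
  then obtain t where t: "\<And>s. t s \<in> carrier (Y s)" "\<And>s u. u \<in> carrier (Z s) \<Longrightarrow> \<tau> s (t s) u = \<psi> (BS +>\<^bsub>DS\<^esub> single s u)" by blast
  show ?thesis
  proof (rule that[OF t])
    fix s u assume u: "u \<in> carrier (Z s)"
    have pu: "\<pi> s u \<in> carrier (Z (Suc s))" by (rule mod_hom_closed[OF \<pi> u])
    have c: "BS +>\<^bsub>DS\<^esub> single s u \<in> carrier (quot_mod DS BS)" "BS +>\<^bsub>DS\<^esub> single (Suc s) (\<pi> s u) \<in> carrier (quot_mod DS BS)"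
      using mod_hom_closed[OF single_hom] u pu by (auto simp: quot_carrier)
    have "\<psi> (BS +>\<^bsub>DS\<^esub> telescope (single s u)) = \<tau> s (t s) u \<ominus>\<^bsub>E\<^esub> \<tau> (Suc s) (t (Suc s)) (\<pi> s u)"
      unfolding tele_quot_single[OF u] by (simp only: mod_hom_minus[OF Q E_module \<psi> c] t(2)[OF u] t(2)[OF pu])
    also have "\<tau> (Suc s) (t (Suc s)) (\<pi> s u) = \<tau> s (p s (t (Suc s))) u" by (rule \<tau>_natural[OF t(1) u, symmetric])
    also have "\<tau> s (t s) u \<ominus>\<^bsub>E\<^esub> \<tau> s (p s (t (Suc s))) u = \<tau> s (t s \<ominus>\<^bsub>Y s\<^esub> p s (t (Suc s))) u"
      by (rule mod_hom_minus[OF Y E_module \<tau>_hom_left[OF u] t(1) mod_hom_closed[OF p t(1)], symmetric])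
    finally show "\<psi> (BS +>\<^bsub>DS\<^esub> telescope (single s u)) = \<tau> s (t s \<ominus>\<^bsub>Y s\<^esub> p s (t (Suc s))) u" .
  qed
qed

text \<open>The first derived limit of the tower vanishes, because the telescope is injective modulo
  boundaries and functionals extend along injections.\<close>

theorem tower_lim1_zero:
  assumes e: "\<And>s. e s \<in> carrier (Y s)"
  obtains t where "\<And>s. t s \<in> carrier (Y s)" "\<And>s. e s \<ominus>\<^bsub>Y s\<^esub> (t s \<ominus>\<^bsub>Y s\<^esub> p s (t (Suc s))) \<in> D s"
proof -
  note Q = quot_module[OF DS BS]
  let ?f = "\<lambda>s. \<tau> s (e s)"
  note f = \<tau>_hom[OF e]
  have "total ?f v = \<zero>\<^bsub>E\<^esub>" if v: "v \<in> carrier DS" "BS +>\<^bsub>DS\<^esub> telescope v = \<zero>\<^bsub>quot_mod DS BS\<^esub>" for v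
  proof -
    interpret E: module R E by (rule E_module)
    have "v \<in> BS" using v coset_eq_zero_iff[OF DS BS mod_hom_closed[OF telescope_hom v(1)]] telescope_BS by (simp add: quot_zero)
    then have "total ?f v = (\<Oplus>\<^bsub>E\<^esub>s\<in>{s. v s \<noteq> \<zero>\<^bsub>Z s\<^esub>}. \<zero>\<^bsub>E\<^esub>)"
      unfolding total_def by (intro E.M.finsum_cong'[OF refl]) (auto simp: BS_def \<tau>_B[OF e])
    then show ?thesis by simp
  qed
  then obtain \<psi> where \<psi>: "\<psi> \<in> mod_hom R (quot_mod DS BS) E" "\<And>v. v \<in> carrier DS \<Longrightarrow> \<psi> (BS +>\<^bsub>DS\<^esub> telescope v) = total ?f v"
    using baer_extend[OF E_baer DS Q tele_quot_hom total_hom(1)[OF f]] by blast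
  obtain t where t: "\<And>s. t s \<in> carrier (Y s)"
    "\<And>s u. u \<in> carrier (Z s) \<Longrightarrow> \<psi> (BS +>\<^bsub>DS\<^esub> telescope (single s u)) = \<tau> s (t s \<ominus>\<^bsub>Y s\<^esub> p s (t (Suc s))) u"
    by (rule quotient_functional[OF \<psi>(1)]) blast
  show ?thesis
  proof (rule that[OF t(1)])
    fix s
    have c: "t s \<ominus>\<^bsub>Y s\<^esub> p s (t (Suc s)) \<in> carrier (Y s)" by (rule module_minus_closed[OF Y t(1) mod_hom_closed[OF p t(1)]])
    show "e s \<ominus>\<^bsub>Y s\<^esub> (t s \<ominus>\<^bsub>Y s\<^esub> p s (t (Suc s))) \<in> D s"
    proof (rule \<tau>_detect[OF module_minus_closed[OF Y e c]])
      fix u assume u: "u \<in> carrier (Z s)"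
      have "\<tau> s (e s) u = \<tau> s (t s \<ominus>\<^bsub>Y s\<^esub> p s (t (Suc s))) u"
        using t(2)[OF u] \<psi>(2)[OF mod_hom_closed[OF single_hom u]] total_hom(2)[OF f u] by simp
      then show "\<tau> s (e s \<ominus>\<^bsub>Y s\<^esub> (t s \<ominus>\<^bsub>Y s\<^esub> p s (t (Suc s)))) u = \<zero>\<^bsub>E\<^esub>"
        using mod_hom_minus[OF Y E_module \<tau>_hom_left[OF u] e c] module_minus_eq_zero_iff[OF E_module]
          mod_hom_closed[OF \<tau>_hom_left[OF u] c] by simp
    qed
  qed
qed

lemma dir_trans_closed: "u \<in> carrier (Z s) \<Longrightarrow> dir_trans \<pi> s k u \<in> carrier (Z (s + k))"
  by (induction k) (auto dest: mod_hom_closed[OF \<pi>])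

text \<open>Vanishing of the direct limit of the \<open>Z s / B s\<close> and of the inverse limit of the \<open>Y s / D s\<close>, in terms
  of representatives.\<close>

definition colim_zero :: bool
  where "colim_zero \<longleftrightarrow> (\<forall>s. \<forall>u\<in>carrier (Z s). \<exists>k. dir_trans \<pi> s k u \<in> B (s + k))"

definition lim_zero :: bool
  where "lim_zero \<longleftrightarrow> (\<forall>z. (\<forall>s. z s \<in> carrier (Y s) \<and> p s (z (Suc s)) \<ominus>\<^bsub>Y s\<^esub> z s \<in> D s) \<longrightarrow> (\<forall>s. z s \<in> D s))"

lemma tau_eq_mod_D:
  assumes "z \<in> carrier (Y s)" "z' \<in> carrier (Y s)" "z \<ominus>\<^bsub>Y s\<^esub> z' \<in> D s" "u \<in> carrier (Z s)"
  shows "\<tau> s z u = \<tau> s z' u"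
  using \<tau>_D[OF assms(3,4)] mod_hom_minus[OF Y E_module \<tau>_hom_left[OF assms(4)] assms(1,2)]
    module_minus_eq_zero_iff[OF E_module] mod_hom_closed[OF \<tau>_hom_left[OF assms(4)]] assms(1,2) by simp

text \<open>A family in the inverse limit gives \<open>u\<close> and all its images in later stages the same value, which is
  zero once \<open>u\<close> has become a boundary.\<close>

lemma colim_zero_imp_lim_zero:
  assumes c: colim_zero shows lim_zero
  unfolding lim_zero_def
proof (intro allI impI)
  fix z s assume z: "\<forall>s. z s \<in> carrier (Y s) \<and> p s (z (Suc s)) \<ominus>\<^bsub>Y s\<^esub> z s \<in> D s"
  show "z s \<in> D s"
  proof (rule \<tau>_detect)
    show "z s \<in> carrier (Y s)" using z by simp
    fix u assume u: "u \<in> carrier (Z s)"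
    have step: "\<tau> s (z s) u = \<tau> (s + k) (z (s + k)) (dir_trans \<pi> s k u)" for k
    proof (induction k)
      case (Suc k)
      have t: "dir_trans \<pi> s k u \<in> carrier (Z (s + k))" by (rule dir_trans_closed[OF u])
      have "\<tau> (s + k) (z (s + k)) (dir_trans \<pi> s k u) = \<tau> (s + k) (p (s + k) (z (Suc (s + k)))) (dir_trans \<pi> s k u)"
        using z mod_hom_closed[OF p] by (intro tau_eq_mod_D[symmetric] t) auto
      then show ?case using Suc \<tau>_natural[OF _ t, of "z (Suc (s + k))"] z by simp
    qed simp
    obtain k where "dir_trans \<pi> s k u \<in> B (s + k)" using c u by (auto simp: colim_zero_def)
    then show "\<tau> s (z s) u = \<zero>\<^bsub>E\<^esub>" using step[of k] \<tau>_B z by simp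
  qed
qed

text \<open>An element \<open>u\<close> that never becomes a boundary is nonzero in the cokernel of the telescope: a
  preimage \<open>v\<close> would agree with the images of \<open>u\<close> at all stages from \<open>s\<close> on, against finiteness of its
  support.  A functional on the cokernel that does not vanish at \<open>u\<close> is represented by a nonzero
  family in the inverse limit.\<close>

lemma lim_zero_imp_colim_zero:
  assumes l: lim_zero shows colim_zero
proof (rule ccontr)
  note Q = quot_module[OF DS BS]
  assume "\<not> colim_zero"
  then obtain s u where u: "u \<in> carrier (Z s)" and nb: "\<And>k. dir_trans \<pi> s k u \<notin> B (s + k)" by (auto simp: colim_zero_def)
  let ?K = "(\<lambda>v. BS +>\<^bsub>DS\<^esub> telescope v) ` carrier DS"
  have K: "submodule ?K R (quot_mod DS BS)" by (rule image_carrier_submodule[OF DS Q tele_quot_hom])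
  have su: "single s u \<in> carrier DS" by (rule mod_hom_closed[OF single_hom u])
  have "BS +>\<^bsub>DS\<^esub> single s u \<notin> ?K"
  proof
    assume "BS +>\<^bsub>DS\<^esub> single s u \<in> ?K"
    then obtain v where v: "v \<in> carrier DS" "BS +>\<^bsub>DS\<^esub> telescope v = BS +>\<^bsub>DS\<^esub> single s u" by (elim imageE) simp
    have tv: "telescope v \<in> carrier DS" by (rule mod_hom_closed[OF telescope_hom v(1)])
    have "telescope v \<ominus>\<^bsub>DS\<^esub> single s u \<in> BS" using v coset_eq_iff[OF DS BS tv su] by simp
    then have d: "telescope v t \<ominus>\<^bsub>Z t\<^esub> single s u t \<in> B t" for t using DS_minus[OF tv su] by (simp add: BS_def)
    have vc: "v t \<in> carrier (Z t)" for t by (rule DS_closed[OF v(1)])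
    have pvc: "\<pi> t (v t) \<in> carrier (Z (Suc t))" for t by (rule mod_hom_closed[OF \<pi> vc])
    \<comment> \<open>modulo boundaries \<open>v\<close> is zero before stage \<open>s\<close>\<close>
    have below: "t < s \<longrightarrow> v t \<in> B t" for t
    proof (induction t)
      case 0
      show ?case using d[of 0] Z_zero[OF vc] by (auto simp: telescope_def single_def)
    next
      case (Suc t)
      show ?case
      proof
        assume "Suc t < s"
        then have "v (Suc t) \<ominus>\<^bsub>Z (Suc t)\<^esub> \<pi> t (v t) \<in> B (Suc t)"
          using d[of "Suc t"] Z_zero[OF module_minus_closed[OF Z vc pvc]] by (simp add: telescope_def single_def)
        then have "(v (Suc t) \<ominus>\<^bsub>Z (Suc t)\<^esub> \<pi> t (v t)) \<oplus>\<^bsub>Z (Suc t)\<^esub> \<pi> t (v t) \<in> B (Suc t)"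
          by (rule submodule_add[OF B]) (use Suc \<open>Suc t < s\<close> \<pi>B in simp)
        then show "v (Suc t) \<in> B (Suc t)" by (simp add: module_add_minus_cancel(2)[OF Z pvc vc])
      qed
    qed
    \<comment> \<open>from stage \<open>s\<close> on it is the image of \<open>u\<close>\<close>
    have above: "v (s + k) \<ominus>\<^bsub>Z (s + k)\<^esub> dir_trans \<pi> s k u \<in> B (s + k)" for k
    proof (induction k)
      case 0
      show ?case
      proof (cases s)
        case 0 then show ?thesis using d[of 0] by (simp add: telescope_def single_def)
      next
        case (Suc t)
        have b: "\<pi> t (v t) \<in> B s" using below[of t] Suc \<pi>B by simp
        have sc: "v s \<ominus>\<^bsub>Z s\<^esub> \<pi> t (v t) \<in> carrier (Z s)" using vc pvc Suc by (intro module_minus_closed[OF Z]) auto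
        have "(v s \<ominus>\<^bsub>Z s\<^esub> \<pi> t (v t)) \<ominus>\<^bsub>Z s\<^esub> u \<in> B s" using d[of s] Suc by (simp add: telescope_def single_def)
        then have "B s +>\<^bsub>Z s\<^esub> (v s \<ominus>\<^bsub>Z s\<^esub> \<pi> t (v t)) = B s +>\<^bsub>Z s\<^esub> u" using coset_eq_iff[OF Z B sc u] by simp
        moreover have "B s +>\<^bsub>Z s\<^esub> v s = B s +>\<^bsub>Z s\<^esub> (v s \<ominus>\<^bsub>Z s\<^esub> \<pi> t (v t))"
        proof (rule coset_eq_iff[OF Z B vc sc, THEN iffD2])
          have pc: "\<pi> t (v t) \<in> carrier (Z s)" using pvc[of t] Suc by simp
          have "v s = \<pi> t (v t) \<oplus>\<^bsub>Z s\<^esub> (v s \<ominus>\<^bsub>Z s\<^esub> \<pi> t (v t))" by (rule module_add_minus_cancel(1)[OF Z pc vc, symmetric])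
          then show "v s \<ominus>\<^bsub>Z s\<^esub> (v s \<ominus>\<^bsub>Z s\<^esub> \<pi> t (v t)) \<in> B s"
            using module_diff_eq_iff[OF Z vc sc pc] b by simp
        qed
        ultimately show ?thesis using coset_eq_iff[OF Z B vc u] by simp
      qed
    next
      case (Suc k)
      let ?t = "s + k" and ?x = "dir_trans \<pi> s k u"
      have xc: "?x \<in> carrier (Z ?t)" by (rule dir_trans_closed[OF u])
      have pxc: "\<pi> ?t ?x \<in> carrier (Z (Suc ?t))" by (rule mod_hom_closed[OF \<pi> xc])
      have "\<pi> ?t (v ?t) \<ominus>\<^bsub>Z (Suc ?t)\<^esub> \<pi> ?t ?x \<in> B (Suc ?t)"
        using \<pi>B[OF Suc] by (simp add: mod_hom_minus[OF Z Z \<pi> vc xc])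
      then have 1: "B (Suc ?t) +>\<^bsub>Z (Suc ?t)\<^esub> \<pi> ?t (v ?t) = B (Suc ?t) +>\<^bsub>Z (Suc ?t)\<^esub> \<pi> ?t ?x"
        using coset_eq_iff[OF Z B pvc pxc] by simp
      have "v (Suc ?t) \<ominus>\<^bsub>Z (Suc ?t)\<^esub> \<pi> ?t (v ?t) \<in> B (Suc ?t)"
        using d[of "Suc ?t"] Z_zero[OF module_minus_closed[OF Z vc pvc]] by (simp add: telescope_def single_def)
      then have "B (Suc ?t) +>\<^bsub>Z (Suc ?t)\<^esub> v (Suc ?t) = B (Suc ?t) +>\<^bsub>Z (Suc ?t)\<^esub> \<pi> ?t (v ?t)"
        using coset_eq_iff[OF Z B vc pvc] by simp
      then show ?case using 1 coset_eq_iff[OF Z B vc pxc] by simp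
    qed
    have fin: "finite {t. v t \<noteq> \<zero>\<^bsub>Z t\<^esub>}" using v(1) by (simp add: direct_sum_carrier)
    obtain N where N: "\<And>t. v t \<noteq> \<zero>\<^bsub>Z t\<^esub> \<Longrightarrow> t < N"
      using fin by (metis (mono_tags) finite_nat_set_iff_bounded mem_Collect_eq)
    have "v (s + N) = \<zero>\<^bsub>Z (s + N)\<^esub>" using N[of "s + N"] by force
    then have "\<zero>\<^bsub>Z (s + N)\<^esub> \<ominus>\<^bsub>Z (s + N)\<^esub> dir_trans \<pi> s N u \<in> B (s + N)" using above[of N] by simp
    then have "\<zero>\<^bsub>Z (s + N)\<^esub> \<ominus>\<^bsub>Z (s + N)\<^esub> (\<zero>\<^bsub>Z (s + N)\<^esub> \<ominus>\<^bsub>Z (s + N)\<^esub> dir_trans \<pi> s N u) \<in> B (s + N)"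
      by (rule submodule_minus[OF B submodule_zero[OF B]])
    moreover have "\<zero>\<^bsub>Z (s + N)\<^esub> \<ominus>\<^bsub>Z (s + N)\<^esub> (\<zero>\<^bsub>Z (s + N)\<^esub> \<ominus>\<^bsub>Z (s + N)\<^esub> dir_trans \<pi> s N u) = dir_trans \<pi> s N u"
      using module_add_minus_cancel(1)[OF Z dir_trans_closed[OF u] module_zero_closed[OF Z], of N]
      by (subst module_diff_eq_iff[OF Z]) (auto intro!: module_minus_closed[OF Z] module_zero_closed[OF Z] dir_trans_closed[OF u])
    ultimately show False using nb by simp
  qed
  moreover have "BS +>\<^bsub>DS\<^esub> single s u \<in> carrier (quot_mod DS BS)" using su by (auto simp: quot_carrier)
  ultimately obtain \<psi> where \<psi>: "\<psi> \<in> mod_hom R (quot_mod DS BS) E" "\<And>y. y \<in> ?K \<Longrightarrow> \<psi> y = \<zero>\<^bsub>E\<^esub>" "\<psi> (BS +>\<^bsub>DS\<^esub> single s u) \<noteq> \<zero>\<^bsub>E\<^esub>"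
    using separates[OF Q K] by blast
  obtain t where t: "\<And>s. t s \<in> carrier (Y s)" "\<And>s u. u \<in> carrier (Z s) \<Longrightarrow> \<tau> s (t s) u = \<psi> (BS +>\<^bsub>DS\<^esub> single s u)"
    "\<And>s u. u \<in> carrier (Z s) \<Longrightarrow> \<psi> (BS +>\<^bsub>DS\<^esub> telescope (single s u)) = \<tau> s (t s \<ominus>\<^bsub>Y s\<^esub> p s (t (Suc s))) u"
    by (rule quotient_functional[OF \<psi>(1)]) blast
  have "p q (t (Suc q)) \<ominus>\<^bsub>Y q\<^esub> t q \<in> D q" for q
  proof -
    have pc: "p q (t (Suc q)) \<in> carrier (Y q)" by (rule mod_hom_closed[OF p t(1)])
    have "t q \<ominus>\<^bsub>Y q\<^esub> p q (t (Suc q)) \<in> D q"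
    proof (rule \<tau>_detect[OF module_minus_closed[OF Y t(1) pc]])
      fix x assume x: "x \<in> carrier (Z q)"
      show "\<tau> q (t q \<ominus>\<^bsub>Y q\<^esub> p q (t (Suc q))) x = \<zero>\<^bsub>E\<^esub>"
        using t(3)[OF x] \<psi>(2) mod_hom_closed[OF single_hom x] by (metis image_eqI)
    qed
    then have "D q +>\<^bsub>Y q\<^esub> t q = D q +>\<^bsub>Y q\<^esub> p q (t (Suc q))" using coset_eq_iff[OF Y D t(1) pc] by simp
    then show ?thesis using coset_eq_iff[OF Y D pc t(1)] by simp
  qed
  then have "t s \<in> D s" using l t(1) unfolding lim_zero_def by blast
  then show False using \<tau>_D[OF _ u] t(2)[OF u] \<psi>(3) by simp
qed

theorem lim_zero_iff_colim_zero: "lim_zero \<longleftrightarrow> colim_zero"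
  using lim_zero_imp_colim_zero colim_zero_imp_lim_zero by blast

end

section \<open>Homology of an inverse limit\<close>

text \<open>The part \<open>C2 \<rightarrow> C1 \<rightarrow> C0\<close> of a tower of complexes, where \<open>Z0\<close> stands for the cycles in \<open>C0\<close>.
  Surjectivity is required of the transition maps of those terms in which elements are going to be
  corrected.\<close>

locale complex_tower =
  fixes R :: "('r, 'x) ring_scheme" and C0 :: "nat \<Rightarrow> ('r, 'a, 'c) module_scheme"
    and C1 :: "nat \<Rightarrow> ('r, 'b, 'd) module_scheme" and C2 :: "nat \<Rightarrow> ('r, 'g, 'e) module_scheme"
    and d1 :: "nat \<Rightarrow> 'b \<Rightarrow> 'a" and d2 :: "nat \<Rightarrow> 'g \<Rightarrow> 'b" and p0 :: "nat \<Rightarrow> 'a \<Rightarrow> 'a" and p1 :: "nat \<Rightarrow> 'b \<Rightarrow> 'b" and p2 :: "nat \<Rightarrow> 'g \<Rightarrow> 'g"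
    and Z0 :: "nat \<Rightarrow> 'a set"
  assumes m0: "\<And>s. module R (C0 s)" and m1: "\<And>s. module R (C1 s)" and m2: "\<And>s. module R (C2 s)"
    and d1: "\<And>s. d1 s \<in> mod_hom R (C1 s) (C0 s)" and d2: "\<And>s. d2 s \<in> mod_hom R (C2 s) (C1 s)"
    and p0: "\<And>s. p0 s \<in> mod_hom R (C0 (Suc s)) (C0 s)" and p1: "\<And>s. p1 s \<in> mod_hom R (C1 (Suc s)) (C1 s)"
    and p2: "\<And>s. p2 s \<in> mod_hom R (C2 (Suc s)) (C2 s)"
    and pd1: "\<And>s y. y \<in> carrier (C1 (Suc s)) \<Longrightarrow> p0 s (d1 (Suc s) y) = d1 s (p1 s y)"
    and pd2: "\<And>s y. y \<in> carrier (C2 (Suc s)) \<Longrightarrow> p1 s (d2 (Suc s) y) = d2 s (p2 s y)"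
    and dd: "\<And>s y. y \<in> carrier (C2 s) \<Longrightarrow> d1 s (d2 s y) = \<zero>\<^bsub>C0 s\<^esub>"
    and s1: "\<And>s. p1 s ` carrier (C1 (Suc s)) = carrier (C1 s)" and s2: "\<And>s. p2 s ` carrier (C2 (Suc s)) = carrier (C2 s)"
    and Z0: "\<And>s. submodule (Z0 s) R (C0 s)" and dZ: "\<And>s. d1 s ` carrier (C1 s) \<subseteq> Z0 s"
begin

text \<open>Vanishing of the homology of the limit complex at \<open>C0\<close>; of the limit of the homology modules at \<open>C0\<close>,
  whose elements are represented by families compatible modulo boundaries; and of the first derived
  limit of the homology modules at \<open>C1\<close>.\<close>

definition homology_lim_zero :: bool
  where "homology_lim_zero \<longleftrightarrow> (\<forall>z. (\<forall>s. z s \<in> Z0 s \<and> p0 s (z (Suc s)) = z s) \<longrightarrow>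
    (\<exists>y. \<forall>s. y s \<in> carrier (C1 s) \<and> p1 s (y (Suc s)) = y s \<and> d1 s (y s) = z s))"

definition lim_homology_zero :: bool
  where "lim_homology_zero \<longleftrightarrow> (\<forall>z. (\<forall>s. z s \<in> Z0 s \<and> p0 s (z (Suc s)) \<ominus>\<^bsub>C0 s\<^esub> z s \<in> d1 s ` carrier (C1 s)) \<longrightarrow>
    (\<forall>s. z s \<in> d1 s ` carrier (C1 s)))"

definition lim1_homology_zero :: bool
  where "lim1_homology_zero \<longleftrightarrow> (\<forall>e. (\<forall>s. e s \<in> a_kernel (C1 s) (C0 s) (d1 s)) \<longrightarrow>
    (\<exists>t. \<forall>s. t s \<in> a_kernel (C1 s) (C0 s) (d1 s) \<and> e s \<ominus>\<^bsub>C1 s\<^esub> (t s \<ominus>\<^bsub>C1 s\<^esub> p1 s (t (Suc s))) \<in> d2 s ` carrier (C2 s)))"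

text \<open>The first derived limit of a tower with surjective maps is zero: choose \<open>x (s + 1)\<close> as a preimage
  of \<open>x s - y s\<close>.\<close>

lemma solve_recursion:
  assumes C: "\<And>s. module R (C s)" and surj: "\<And>s. p s ` carrier (C (Suc s)) = carrier (C s)"
    and y: "\<And>s. y s \<in> carrier (C s)"
  obtains x where "\<And>s. x s \<in> carrier (C s)" "\<And>s. p s (x (Suc s)) = x s \<ominus>\<^bsub>C s\<^esub> y s"
proof -
  have "\<exists>x. \<forall>s. x s \<in> carrier (C s) \<and> p s (x (Suc s)) = x s \<ominus>\<^bsub>C s\<^esub> y s"
  proof (rule dependent_nat_choice)
    show "\<exists>x. x \<in> carrier (C 0)" using y by blast
    fix x s assume "x \<in> carrier (C s)"
    then have "x \<ominus>\<^bsub>C s\<^esub> y s \<in> p s ` carrier (C (Suc s))" unfolding surj by (rule module_minus_closed[OF C _ y])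
    then show "\<exists>x'. x' \<in> carrier (C (Suc s)) \<and> p s x' = x \<ominus>\<^bsub>C s\<^esub> y s" by (elim imageE) auto
  qed
  then show ?thesis using that by blast
qed

text \<open>Adding suitable boundaries turns a family of cycles that is compatible modulo boundaries into a
  compatible one.\<close>

lemma homology_lim_zero_imp:
  assumes H: homology_lim_zero shows lim_homology_zero
  unfolding lim_homology_zero_def
proof (intro allI impI)
  fix z s assume z: "\<forall>s. z s \<in> Z0 s \<and> p0 s (z (Suc s)) \<ominus>\<^bsub>C0 s\<^esub> z s \<in> d1 s ` carrier (C1 s)"
  have zc: "z s \<in> carrier (C0 s)" for s using z submodule_sub[OF Z0] by blast
  have pzc: "p0 s (z (Suc s)) \<in> carrier (C0 s)" for s by (rule mod_hom_closed[OF p0 zc])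
  have "\<exists>y. \<forall>s. y s \<in> carrier (C1 s) \<and> p0 s (z (Suc s)) \<ominus>\<^bsub>C0 s\<^esub> z s = d1 s (y s)"
    using z by (intro choice) (meson imageE)
  then obtain y where y: "\<And>s. y s \<in> carrier (C1 s)" "\<And>s. p0 s (z (Suc s)) \<ominus>\<^bsub>C0 s\<^esub> z s = d1 s (y s)" by blast
  obtain x where x: "\<And>s. x s \<in> carrier (C1 s)" "\<And>s. p1 s (x (Suc s)) = x s \<ominus>\<^bsub>C1 s\<^esub> y s"
    by (rule solve_recursion[of C1 p1 y, OF m1 s1 y(1)]) blast
  have dx: "d1 s (x s) \<in> carrier (C0 s)" "d1 s (y s) \<in> carrier (C0 s)" for s using mod_hom_closed[OF d1] x y by auto
  let ?z = "\<lambda>s. z s \<oplus>\<^bsub>C0 s\<^esub> d1 s (x s)"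
  have "?z s \<in> Z0 s \<and> p0 s (?z (Suc s)) = ?z s" for s
  proof
    show "?z s \<in> Z0 s" using z subsetD[OF dZ imageI[OF x(1)]] by (intro submodule_add[OF Z0]) simp_all
    interpret C: module R "C0 s" by (rule m0)
    have "p0 s (?z (Suc s)) = p0 s (z (Suc s)) \<oplus>\<^bsub>C0 s\<^esub> d1 s (p1 s (x (Suc s)))"
      by (simp add: mod_hom_add[OF p0 zc dx(1)] pd1[OF x(1)])
    also have "p0 s (z (Suc s)) = d1 s (y s) \<oplus>\<^bsub>C0 s\<^esub> z s"
      using module_diff_eq_iff[OF m0 pzc zc dx(2)] y(2) by simp
    also have "d1 s (p1 s (x (Suc s))) = d1 s (x s) \<ominus>\<^bsub>C0 s\<^esub> d1 s (y s)"
      by (simp add: x(2) mod_hom_minus[OF m1 m0 d1 x(1) y(1)])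
    also have "d1 s (y s) \<oplus>\<^bsub>C0 s\<^esub> z s \<oplus>\<^bsub>C0 s\<^esub> (d1 s (x s) \<ominus>\<^bsub>C0 s\<^esub> d1 s (y s))
        = z s \<oplus>\<^bsub>C0 s\<^esub> (d1 s (y s) \<oplus>\<^bsub>C0 s\<^esub> (d1 s (x s) \<ominus>\<^bsub>C0 s\<^esub> d1 s (y s)))"
      using zc dx C.M.minus_closed[OF dx] by (simp add: C.M.a_ac)
    also have "\<dots> = ?z s" by (simp add: module_add_minus_cancel(1)[OF m0 dx(2,1)])
    finally show "p0 s (?z (Suc s)) = ?z s" .
  qed
  then obtain w where w: "\<And>s. w s \<in> carrier (C1 s)" "\<And>s. d1 s (w s) = ?z s"
    using H[unfolded homology_lim_zero_def, rule_format, of ?z] by blast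
  have "d1 s (w s \<ominus>\<^bsub>C1 s\<^esub> x s) = z s"
    using mod_hom_minus[OF m1 m0 d1 w(1) x(1)] w(2) module_add_minus_cancel(4)[OF m0 dx(1) zc] by simp
  then show "z s \<in> d1 s ` carrier (C1 s)" using module_minus_closed[OF m1 w(1) x(1)] by (metis image_eqI)
qed

text \<open>For the converse, a compatible family \<open>z\<close> of boundaries is the image of some family \<open>b\<close>.  The defect
  \<open>p (b (s + 1)) - b s\<close> consists of cycles; vanishing of the derived limit absorbs it up to
  boundaries \<open>d2 (g s)\<close>, and these are absorbed by surjectivity of the maps of \<open>C2\<close>.\<close>

theorem homology_lim_zero_iff:
  assumes lim1: lim1_homology_zero
  shows "homology_lim_zero \<longleftrightarrow> lim_homology_zero"
proof
  assume l: lim_homology_zero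
  show homology_lim_zero
    unfolding homology_lim_zero_def
  proof (intro allI impI)
    fix z assume z: "\<forall>s. z s \<in> Z0 s \<and> p0 s (z (Suc s)) = z s"
    have zc: "z s \<in> carrier (C0 s)" for s using z submodule_sub[OF Z0] by blast
    have "p0 s (z (Suc s)) \<ominus>\<^bsub>C0 s\<^esub> z s \<in> d1 s ` carrier (C1 s)" for s
      using z module_minus_eq_zero_iff[OF m0 zc zc] submodule_zero[OF image_carrier_submodule[OF m1 m0 d1]] by simp
    then have "\<forall>s. z s \<in> d1 s ` carrier (C1 s)" using l z unfolding lim_homology_zero_def by blast
    then have "\<exists>b. \<forall>s. b s \<in> carrier (C1 s) \<and> z s = d1 s (b s)" by (intro choice) (meson imageE)
    then obtain b where b: "\<And>s. b s \<in> carrier (C1 s)" "\<And>s. z s = d1 s (b s)" by blast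
    let ?e = "\<lambda>s. p1 s (b (Suc s)) \<ominus>\<^bsub>C1 s\<^esub> b s"
    have pb: "p1 s (b (Suc s)) \<in> carrier (C1 s)" for s by (rule mod_hom_closed[OF p1 b(1)])
    have ec: "?e s \<in> carrier (C1 s)" for s by (rule module_minus_closed[OF m1 pb b(1)])
    have "?e s \<in> a_kernel (C1 s) (C0 s) (d1 s)" for s
      using ec mod_hom_minus[OF m1 m0 d1 pb b(1)] pd1[OF b(1), symmetric] z module_minus_eq_zero_iff[OF m0 zc zc]
      by (simp add: a_kernel_iff b(2)[symmetric])
    then obtain t where t: "\<And>s. t s \<in> a_kernel (C1 s) (C0 s) (d1 s)"
      "\<And>s. ?e s \<ominus>\<^bsub>C1 s\<^esub> (t s \<ominus>\<^bsub>C1 s\<^esub> p1 s (t (Suc s))) \<in> d2 s ` carrier (C2 s)"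
      using lim1[unfolded lim1_homology_zero_def, rule_format, of ?e] by blast
    have tc: "t s \<in> carrier (C1 s)" "d1 s (t s) = \<zero>\<^bsub>C0 s\<^esub>" for s using t(1) by (auto simp: a_kernel_iff)
    have ptc: "p1 s (t (Suc s)) \<in> carrier (C1 s)" for s by (rule mod_hom_closed[OF p1 tc(1)])
    have "\<exists>g. \<forall>s. g s \<in> carrier (C2 s) \<and> ?e s \<ominus>\<^bsub>C1 s\<^esub> (t s \<ominus>\<^bsub>C1 s\<^esub> p1 s (t (Suc s))) = d2 s (g s)"
      using t(2) by (intro choice) (meson imageE)
    then obtain g where g: "\<And>s. g s \<in> carrier (C2 s)"
      "\<And>s. ?e s \<ominus>\<^bsub>C1 s\<^esub> (t s \<ominus>\<^bsub>C1 s\<^esub> p1 s (t (Suc s))) = d2 s (g s)" by blast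
    obtain x where x: "\<And>s. x s \<in> carrier (C2 s)" "\<And>s. p2 s (x (Suc s)) = x s \<ominus>\<^bsub>C2 s\<^esub> g s"
      by (rule solve_recursion[of C2 p2 g, OF m2 s2 g(1)]) blast
    have dc: "d2 s (x s) \<in> carrier (C1 s)" "d2 s (g s) \<in> carrier (C1 s)" for s using mod_hom_closed[OF d2] x g by auto
    let ?y = "\<lambda>s. (b s \<oplus>\<^bsub>C1 s\<^esub> t s) \<oplus>\<^bsub>C1 s\<^esub> d2 s (x s)"
    have "?y s \<in> carrier (C1 s) \<and> p1 s (?y (Suc s)) = ?y s \<and> d1 s (?y s) = z s" for s
    proof (intro conjI)
      interpret C1: module R "C1 s" by (rule m1)
      interpret C0: module R "C0 s" by (rule m0)
      show "?y s \<in> carrier (C1 s)" using b(1) tc(1) dc(1) by simp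
      have "d1 s (?y s) = (d1 s (b s) \<oplus>\<^bsub>C0 s\<^esub> d1 s (t s)) \<oplus>\<^bsub>C0 s\<^esub> d1 s (d2 s (x s))"
        using b(1) tc(1) dc(1) by (simp add: mod_hom_add[OF d1])
      then show "d1 s (?y s) = z s" using tc(2) dd[OF x(1)] b(2) zc[of s] by simp
      have bt: "b (Suc s) \<oplus>\<^bsub>C1 (Suc s)\<^esub> t (Suc s) \<in> carrier (C1 (Suc s))" by (rule module_add_closed[OF m1 b(1) tc(1)])
      have "p1 s (?y (Suc s)) = (p1 s (b (Suc s)) \<oplus>\<^bsub>C1 s\<^esub> p1 s (t (Suc s))) \<oplus>\<^bsub>C1 s\<^esub> d2 s (p2 s (x (Suc s)))"
        by (simp only: mod_hom_add[OF p1 bt dc(1)] mod_hom_add[OF p1 b(1) tc(1)] pd2[OF x(1)])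
      also have "d2 s (p2 s (x (Suc s))) = d2 s (x s) \<ominus>\<^bsub>C1 s\<^esub> d2 s (g s)"
        by (simp only: x(2) mod_hom_minus[OF m2 m1 d2 x(1) g(1)])
      also have "p1 s (b (Suc s)) \<oplus>\<^bsub>C1 s\<^esub> p1 s (t (Suc s)) = (b s \<oplus>\<^bsub>C1 s\<^esub> t s) \<oplus>\<^bsub>C1 s\<^esub> d2 s (g s)"
      proof -
        let ?k = "t s \<ominus>\<^bsub>C1 s\<^esub> p1 s (t (Suc s))"
        have kc: "?k \<in> carrier (C1 s)" by (rule module_minus_closed[OF m1 tc(1) ptc])
        have "?e s = d2 s (g s) \<oplus>\<^bsub>C1 s\<^esub> ?k" using g(2)[of s] module_diff_eq_iff[OF m1 ec kc dc(2)] by simp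
        then have pb_eq: "p1 s (b (Suc s)) = (d2 s (g s) \<oplus>\<^bsub>C1 s\<^esub> ?k) \<oplus>\<^bsub>C1 s\<^esub> b s"
          using module_diff_eq_iff[OF m1 pb b(1)] kc dc(2) by simp
        have "p1 s (b (Suc s)) \<oplus>\<^bsub>C1 s\<^esub> p1 s (t (Suc s)) = (b s \<oplus>\<^bsub>C1 s\<^esub> (?k \<oplus>\<^bsub>C1 s\<^esub> p1 s (t (Suc s)))) \<oplus>\<^bsub>C1 s\<^esub> d2 s (g s)"
          unfolding pb_eq using kc dc(2) b(1) ptc by (simp add: C1.M.a_ac)
        then show ?thesis by (simp only: module_add_minus_cancel(2)[OF m1 ptc tc(1)])
      qed
      also have "(b s \<oplus>\<^bsub>C1 s\<^esub> t s) \<oplus>\<^bsub>C1 s\<^esub> d2 s (g s) \<oplus>\<^bsub>C1 s\<^esub> (d2 s (x s) \<ominus>\<^bsub>C1 s\<^esub> d2 s (g s)) =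
          (b s \<oplus>\<^bsub>C1 s\<^esub> t s) \<oplus>\<^bsub>C1 s\<^esub> (d2 s (g s) \<oplus>\<^bsub>C1 s\<^esub> (d2 s (x s) \<ominus>\<^bsub>C1 s\<^esub> d2 s (g s)))"
        using b(1) tc(1) dc C1.M.minus_closed[OF dc] by (simp add: C1.M.a_assoc)
      also have "\<dots> = ?y s" by (simp only: module_add_minus_cancel(1)[OF m1 dc(2,1)])
      finally show "p1 s (?y (Suc s)) = ?y s" .
    qed
    then show "\<exists>y. \<forall>s. y s \<in> carrier (C1 s) \<and> p1 s (y (Suc s)) = y s \<and> d1 s (y s) = z s" by (intro exI[of _ ?y]) blast
  qed
qed (rule homology_lim_zero_imp)

end


section \<open>The adic tower\<close>

lemma ideal_pow_ideal:
  assumes "cring R" "ideal I R"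
  shows "ideal (ideal_pow R I s) R"
proof (induction s)
  interpret cring R by fact
  case 0 show ?case using oneideal by simp
next
  interpret cring R by fact
  case (Suc s) then show ?case using ideal_prod_is_ideal[OF assms(2)] by simp
qed

lemma ideal_pow_Suc_subset:
  assumes "cring R" "ideal I R"
  shows "ideal_pow R I (Suc s) \<subseteq> ideal_pow R I s"
proof -
  interpret cring R by fact
  show ?thesis using ideal_prod_inter[OF assms(2) ideal_pow_ideal[OF assms]] by auto
qed

lemma ideal_smult_submodule:
  assumes "module R N" "I \<subseteq> carrier R"
  shows "submodule (ideal_smult R I N) R N"
  unfolding ideal_smult_def
  by (rule submodule_span_submodule[OF assms(1)]) (use assms in \<open>auto intro: module_smult_closed\<close>)

lemma ideal_smult_mono: "I \<subseteq> J \<Longrightarrow> ideal_smult R I N \<subseteq> ideal_smult R J N"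
  unfolding ideal_smult_def by (rule submodule_span_mono) blast

lemma finitely_generated_quot:
  assumes "module R N" "submodule K R N" "finitely_generated R N"
  shows "finitely_generated R (quot_mod N K)"
proof -
  obtain T where T: "finite T" "T \<subseteq> carrier N" "submodule_span R N T = carrier N"
    using assms(3) by (auto simp: finitely_generated_def)
  let ?q = "\<lambda>x. K +>\<^bsub>N\<^esub> x"
  note q = quot_proj_hom[OF assms(1,2)] and Q = quot_module[OF assms(1,2)]
  have sub: "?q ` T \<subseteq> carrier (quot_mod N K)" using T(2) by (auto simp: quot_carrier)
  have sp: "submodule (submodule_span R (quot_mod N K) (?q ` T)) R (quot_mod N K)" by (rule submodule_span_submodule[OF Q sub])
  have "T \<subseteq> {x \<in> carrier N. ?q x \<in> submodule_span R (quot_mod N K) (?q ` T)}"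
    using T(2) submodule_span_incl[of "?q ` T"] by blast
  then have "submodule_span R N T \<subseteq> {x \<in> carrier N. ?q x \<in> submodule_span R (quot_mod N K) (?q ` T)}"
    by (rule submodule_span_least[OF preimage_submodule[OF assms(1) Q q sp]])
  then have "carrier N \<subseteq> {x \<in> carrier N. ?q x \<in> submodule_span R (quot_mod N K) (?q ` T)}" by (simp only: T(3))
  then have "submodule_span R (quot_mod N K) (?q ` T) = carrier (quot_mod N K)"
    using submodule_sub[OF sp] unfolding quot_carrier by blast
  then show ?thesis unfolding finitely_generated_def using T(1) sub by (intro exI[of _ "?q ` T"]) auto
qed

context
  fixes R :: "('r, 'x) ring_scheme" and I and N :: "('r, 'n, 'c) module_scheme"
  assumes N: "module R N" and I: "ideal I R"
begin

lemma adic_submodule: "submodule (ideal_smult R (ideal_pow R I s) N) R N"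
  using ideal_pow_ideal[OF module_cring[OF N] I, of s]
  by (intro ideal_smult_submodule[OF N]) (simp add: additive_subgroup.a_subset ideal.axioms(1))

lemma adic_quot_module: "module R (adic_quot R I N s)"
  unfolding adic_quot_def by (rule quot_module[OF N adic_submodule])

lemma adic_quot_fg: "finitely_generated R N \<Longrightarrow> finitely_generated R (adic_quot R I N s)"
  unfolding adic_quot_def by (rule finitely_generated_quot[OF N adic_submodule])

lemma adic_incl: "(\<lambda>x. x) ` ideal_smult R (ideal_pow R I (Suc s)) N \<subseteq> ideal_smult R (ideal_pow R I s) N"
  using ideal_smult_mono[OF ideal_pow_Suc_subset[OF module_cring[OF N] I]] by simp

lemma adic_proj_hom: "adic_proj R I N s \<in> mod_hom R (adic_quot R I N (Suc s)) (adic_quot R I N s)"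
  unfolding adic_proj_def adic_quot_def
  by (rule coset_map_hom[OF N adic_submodule N adic_submodule mod_hom_id adic_incl])

lemma adic_proj_surj: "adic_proj R I N s ` carrier (adic_quot R I N (Suc s)) = carrier (adic_quot R I N s)"
proof -
  have "adic_proj R I N s ` carrier (adic_quot R I N (Suc s)) =
      (\<lambda>x. adic_proj R I N s (ideal_smult R (ideal_pow R I (Suc s)) N +>\<^bsub>N\<^esub> x)) ` carrier N"
    unfolding adic_quot_def quot_carrier image_image ..
  also have "\<dots> = (\<lambda>x. ideal_smult R (ideal_pow R I s) N +>\<^bsub>N\<^esub> x) ` carrier N"
    unfolding adic_proj_def by (rule image_cong[OF refl], rule coset_map_coset[OF N adic_submodule N adic_submodule mod_hom_id adic_incl])
  finally show ?thesis by (simp add: adic_quot_def quot_carrier)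
qed

end

section \<open>Vanishing of the limits\<close>

lemma coset_map_carrier: "coset_map (M\<lparr>carrier := H\<rparr>) K f = coset_map M K f"
  by (simp add: coset_map_def a_r_coset_def' fun_eq_iff)

text \<open>A class is zero in the direct limit when a representative reaches the submodule \<open>B\<close> at some later
  stage.\<close>

lemma dir_lim_quot_zero_iff:
  assumes Z: "\<And>s. module R (Z s)" and B: "\<And>s. submodule (B s) R (Z s)"
    and \<pi>: "\<And>s. \<pi> s \<in> mod_hom R (Z s) (Z (Suc s))" and \<pi>B: "\<And>s. \<pi> s ` B s \<subseteq> B (Suc s)"
  shows "is_zero (dir_lim (\<lambda>s. quot_mod (Z s) (B s)) (\<lambda>s. coset_map (Z (Suc s)) (B (Suc s)) (\<pi> s))) \<longleftrightarrow>
    (\<forall>s. \<forall>u\<in>carrier (Z s). \<exists>k. dir_trans \<pi> s k u \<in> B (s + k))"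
proof -
  let ?A = "\<lambda>s. quot_mod (Z s) (B s)" and ?f = "\<lambda>s. coset_map (Z (Suc s)) (B (Suc s)) (\<pi> s)"
  let ?cl = "dir_class ?A ?f"
  have cl: "dir_trans \<pi> s k u \<in> carrier (Z (s + k))" if "u \<in> carrier (Z s)" for s k u
    using that by (induction k) (auto dest: mod_hom_closed[OF \<pi>])
  have tr: "dir_trans ?f s k (B s +>\<^bsub>Z s\<^esub> u) = B (s + k) +>\<^bsub>Z (s + k)\<^esub> dir_trans \<pi> s k u" if u: "u \<in> carrier (Z s)" for s k u
  proof (induction k)
    case (Suc k)
    then show ?case by (simp add: coset_map_coset[OF Z B Z B \<pi> \<pi>B cl[OF u]])
  qed simp
  have zero: "B s = B s +>\<^bsub>Z s\<^esub> \<zero>\<^bsub>Z s\<^esub>" for s by (rule coset_zero[OF Z B, symmetric])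
  have \<pi>0: "dir_trans \<pi> s k \<zero>\<^bsub>Z s\<^esub> = \<zero>\<^bsub>Z (s + k)\<^esub>" for s k
    by (induction k) (auto simp: mod_hom_zero[OF Z Z \<pi>])
  have stay: "dir_trans \<pi> s (k + j) u \<in> B (s + (k + j))" if "dir_trans \<pi> s k u \<in> B (s + k)" for s k j u
    using that \<pi>B by (induction j) auto
  have mem: "(t, B t +>\<^bsub>Z t\<^esub> v) \<in> ?cl (s, B s +>\<^bsub>Z s\<^esub> u) \<longleftrightarrow>
      (\<exists>k l. s + k = t + l \<and> B (s + k) +>\<^bsub>Z (s + k)\<^esub> dir_trans \<pi> s k u = B (t + l) +>\<^bsub>Z (t + l)\<^esub> dir_trans \<pi> t l v)"
    if "u \<in> carrier (Z s)" "v \<in> carrier (Z t)" for s t u v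
    using that by (auto simp: dir_class_def tr quot_carrier)
  have z: "\<zero>\<^bsub>dir_lim ?A ?f\<^esub> = ?cl (0, B 0 +>\<^bsub>Z 0\<^esub> \<zero>\<^bsub>Z 0\<^esub>)" using zero by (simp add: dir_lim_def quot_zero)
  have carr: "carrier (dir_lim ?A ?f) = {?cl (s, B s +>\<^bsub>Z s\<^esub> u) | s u. u \<in> carrier (Z s)}"
    by (auto simp: dir_lim_def quot_carrier)
  have ex0: "\<zero>\<^bsub>dir_lim ?A ?f\<^esub> \<in> carrier (dir_lim ?A ?f)" unfolding z carr using module_zero_closed[OF Z] by blast
  show ?thesis
  proof
    assume "is_zero (dir_lim ?A ?f)"
    then have eq: "?cl (s, B s +>\<^bsub>Z s\<^esub> u) = ?cl (0, B 0 +>\<^bsub>Z 0\<^esub> \<zero>\<^bsub>Z 0\<^esub>)" if "u \<in> carrier (Z s)" for s u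
      using that unfolding is_zero_def carr z by blast
    show "\<forall>s. \<forall>u\<in>carrier (Z s). \<exists>k. dir_trans \<pi> s k u \<in> B (s + k)"
    proof (intro allI ballI)
      fix s u assume u: "u \<in> carrier (Z s)"
      have "(s, B s +>\<^bsub>Z s\<^esub> u) \<in> ?cl (s, B s +>\<^bsub>Z s\<^esub> u)" unfolding mem[OF u u] by blast
      then have "(s, B s +>\<^bsub>Z s\<^esub> u) \<in> ?cl (0, B 0 +>\<^bsub>Z 0\<^esub> \<zero>\<^bsub>Z 0\<^esub>)" unfolding eq[OF u] .
      then obtain k l where kl: "k = s + l"
          "B k +>\<^bsub>Z k\<^esub> dir_trans \<pi> 0 k \<zero>\<^bsub>Z 0\<^esub> = B (s + l) +>\<^bsub>Z (s + l)\<^esub> dir_trans \<pi> s l u"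
        unfolding mem[OF module_zero_closed[OF Z] u] by auto
      then have "B (s + l) +>\<^bsub>Z (s + l)\<^esub> dir_trans \<pi> s l u = B (s + l)"
        using \<pi>0[of 0 k] zero[of k] by simp
      then show "\<exists>k. dir_trans \<pi> s k u \<in> B (s + k)" using coset_eq_zero_iff[OF Z B cl[OF u]] by blast
    qed
  next
    assume c: "\<forall>s. \<forall>u\<in>carrier (Z s). \<exists>k. dir_trans \<pi> s k u \<in> B (s + k)"
    have all: "(t, B t +>\<^bsub>Z t\<^esub> v) \<in> ?cl (s, B s +>\<^bsub>Z s\<^esub> u)" if u: "u \<in> carrier (Z s)" and v: "v \<in> carrier (Z t)" for s t u v
    proof -
      obtain k l where kl: "dir_trans \<pi> s k u \<in> B (s + k)" "dir_trans \<pi> t l v \<in> B (t + l)" using c u v by blast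
      let ?k = "k + (t + l)" and ?l = "l + (s + k)"
      have "B (s + ?k) +>\<^bsub>Z (s + ?k)\<^esub> dir_trans \<pi> s ?k u = B (s + ?k)"
        using stay[OF kl(1)] by (simp only: coset_eq_zero_iff[OF Z B cl[OF u]])
      moreover have "B (t + ?l) +>\<^bsub>Z (t + ?l)\<^esub> dir_trans \<pi> t ?l v = B (t + ?l)"
        using stay[OF kl(2)] by (simp only: coset_eq_zero_iff[OF Z B cl[OF v]])
      moreover have "s + ?k = t + ?l" by simp
      ultimately show ?thesis unfolding mem[OF u v] by metis
    qed
    have "?cl (s, B s +>\<^bsub>Z s\<^esub> u) = {(t, y). y \<in> carrier (?A t)}" if u: "u \<in> carrier (Z s)" for s u
    proof (intro equalityI subsetI)
      show "x \<in> {(t, y). y \<in> carrier (?A t)}" if "x \<in> ?cl (s, B s +>\<^bsub>Z s\<^esub> u)" for x using that by (auto simp: dir_class_def)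
      show "x \<in> ?cl (s, B s +>\<^bsub>Z s\<^esub> u)" if "x \<in> {(t, y). y \<in> carrier (?A t)}" for x
        using that all[OF u] by (auto simp: quot_carrier)
    qed
    then have "carrier (dir_lim ?A ?f) \<subseteq> {{(t, y). y \<in> carrier (?A t)}}" unfolding carr by auto
    then show "is_zero (dir_lim ?A ?f)" using ex0 unfolding is_zero_def by blast
  qed
qed

text \<open>Representatives of a compatible family of cosets are compatible modulo \<open>D\<close>.\<close>

lemma inv_lim_quot_zero_iff:
  assumes Y: "\<And>s. module R (Y s)" and D: "\<And>s. submodule (D s) R (Y s)"
    and p: "\<And>s. p s \<in> mod_hom R (Y (Suc s)) (Y s)" and pD: "\<And>s. p s ` D (Suc s) \<subseteq> D s"
  shows "is_zero (inv_lim (\<lambda>s. quot_mod (Y s) (D s)) (\<lambda>s. coset_map (Y s) (D s) (p s))) \<longleftrightarrow>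
    (\<forall>z. (\<forall>s. z s \<in> carrier (Y s) \<and> p s (z (Suc s)) \<ominus>\<^bsub>Y s\<^esub> z s \<in> D s) \<longrightarrow> (\<forall>s. z s \<in> D s))"
proof -
  let ?L = "inv_lim (\<lambda>s. quot_mod (Y s) (D s)) (\<lambda>s. coset_map (Y s) (D s) (p s))"
  let ?c = "\<lambda>z s. D s +>\<^bsub>Y s\<^esub> z s"
  have z: "\<zero>\<^bsub>?L\<^esub> = D" by (simp add: inv_lim_def quot_zero)
  have carr: "carrier ?L = {?c z | z. \<forall>s. z s \<in> carrier (Y s) \<and> p s (z (Suc s)) \<ominus>\<^bsub>Y s\<^esub> z s \<in> D s}"
  proof -
    have comp: "coset_map (Y s) (D s) (p s) (?c z (Suc s)) = ?c z s \<longleftrightarrow> p s (z (Suc s)) \<ominus>\<^bsub>Y s\<^esub> z s \<in> D s"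
      if "\<And>s. z s \<in> carrier (Y s)" for z s
      using coset_map_coset[OF Y D Y D p pD that] coset_eq_iff[OF Y D mod_hom_closed[OF p that] that] by simp
    show ?thesis
    proof (intro equalityI subsetI)
      fix x assume x: "x \<in> carrier ?L"
      then have "\<exists>z. \<forall>s. z s \<in> carrier (Y s) \<and> x s = D s +>\<^bsub>Y s\<^esub> z s"
        by (intro choice) (auto simp: inv_lim_def quot_carrier)
      then obtain z where z: "\<And>s. z s \<in> carrier (Y s)" "x = ?c z" by blast
      then show "x \<in> {?c z | z. \<forall>s. z s \<in> carrier (Y s) \<and> p s (z (Suc s)) \<ominus>\<^bsub>Y s\<^esub> z s \<in> D s}"
        using x comp[OF z(1)] by (auto simp: inv_lim_def)
    next
      fix x assume "x \<in> {?c z | z. \<forall>s. z s \<in> carrier (Y s) \<and> p s (z (Suc s)) \<ominus>\<^bsub>Y s\<^esub> z s \<in> D s}"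
      then obtain z where z: "\<And>s. z s \<in> carrier (Y s)" "\<And>s. p s (z (Suc s)) \<ominus>\<^bsub>Y s\<^esub> z s \<in> D s" "x = ?c z" by blast
      then show "x \<in> carrier ?L" using comp[OF z(1)] by (auto simp: inv_lim_def quot_carrier)
    qed
  qed
  have "D = ?c (\<lambda>s. \<zero>\<^bsub>Y s\<^esub>)" by (rule ext) (simp add: coset_zero[OF Y D])
  moreover have "p s \<zero>\<^bsub>Y (Suc s)\<^esub> \<ominus>\<^bsub>Y s\<^esub> \<zero>\<^bsub>Y s\<^esub> \<in> D s" for s
    using submodule_zero[OF D] module_minus_eq_zero_iff[OF Y module_zero_closed[OF Y] module_zero_closed[OF Y]]
    by (simp add: mod_hom_zero[OF Y Y p])
  ultimately have ex0: "D \<in> carrier ?L"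
    unfolding carr by (intro CollectI exI[of _ "\<lambda>s. \<zero>\<^bsub>Y s\<^esub>"] conjI allI module_zero_closed[OF Y])
  have "?c z = D \<longleftrightarrow> (\<forall>s. z s \<in> D s)" if "\<And>s. z s \<in> carrier (Y s)" for z
    using coset_eq_zero_iff[OF Y D that] by (auto simp: fun_eq_iff)
  then show ?thesis using ex0 unfolding is_zero_def z carr by blast
qed

lemma inv_lim_module:
  assumes R: "cring R" and Z: "\<And>s. module R (Z s)" and f: "\<And>s. f s \<in> mod_hom R (Z (Suc s)) (Z s)"
  shows "module R (inv_lim Z f)"
proof -
  let ?D = "inv_lim Z f"
  have carr: "x \<in> carrier ?D \<longleftrightarrow> (\<forall>s. x s \<in> carrier (Z s)) \<and> (\<forall>s. f s (x (Suc s)) = x s)" for x by (simp add: inv_lim_def)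
  have simps: "(x \<oplus>\<^bsub>?D\<^esub> y) s = x s \<oplus>\<^bsub>Z s\<^esub> y s" "\<zero>\<^bsub>?D\<^esub> s = \<zero>\<^bsub>Z s\<^esub>" "(r \<odot>\<^bsub>?D\<^esub> x) s = r \<odot>\<^bsub>Z s\<^esub> x s" for x y r s
    by (simp_all add: inv_lim_def)
  have cl: "x s \<in> carrier (Z s)" if "x \<in> carrier ?D" for x s using that by (simp add: carr)
  have add: "x \<oplus>\<^bsub>?D\<^esub> y \<in> carrier ?D" if "x \<in> carrier ?D" "y \<in> carrier ?D" for x y
    using that by (simp add: carr simps module_add_closed[OF Z] mod_hom_add[OF f])
  have sc: "r \<odot>\<^bsub>?D\<^esub> x \<in> carrier ?D" if "r \<in> carrier R" "x \<in> carrier ?D" for r x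
    using that by (simp add: carr simps module_smult_closed[OF Z] mod_hom_smult[OF f])
  have zero: "\<zero>\<^bsub>?D\<^esub> \<in> carrier ?D" by (simp add: carr simps module_zero_closed[OF Z] mod_hom_zero[OF Z Z f])
  show ?thesis
    by (rule pointwise_module[of R Z, OF R Z]) (rule simps add zero sc cl; assumption?)+
qed

lemma inv_lim_map_hom:
  assumes Z: "\<And>s. module R (Z s)" and g: "\<And>s. g s \<in> mod_hom R (Z s) (Z' s)"
    and comm: "\<And>s x. x \<in> carrier (Z (Suc s)) \<Longrightarrow> f' s (g (Suc s) x) = g s (f s x)"
  shows "(\<lambda>x s. g s (x s)) \<in> mod_hom R (inv_lim Z f) (inv_lim Z' f')"
  by (rule mod_homI) (auto simp: inv_lim_def comm mod_hom_closed[OF g] mod_hom_add[OF g] mod_hom_smult[OF g])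

lemma homology_zero_iff:
  assumes m: "module R A" "module R B" "module R C" and f: "f \<in> mod_hom R A B" and g: "g \<in> mod_hom R B C"
    and gf: "\<And>x. x \<in> carrier A \<Longrightarrow> g (f x) = \<zero>\<^bsub>C\<^esub>"
  shows "is_zero (homology A f B g C) \<longleftrightarrow> (\<forall>x\<in>carrier B. g x = \<zero>\<^bsub>C\<^esub> \<longrightarrow> x \<in> f ` carrier A)"
proof -
  note k = kernel_submodule[OF m(2,3) g]
  have "f ` carrier A \<subseteq> a_kernel B C g" using gf mod_hom_closed[OF f] by (auto simp: a_kernel_iff)
  then have s: "submodule (f ` carrier A) R (B\<lparr>carrier := a_kernel B C g\<rparr>)"
    by (rule submodule_in_submodule[OF m(2) k image_carrier_submodule[OF m(1,2) f]])
  then show ?thesis unfolding homology_def is_zero_quot_iff[OF submodule_module[OF m(2) k] s]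
    by (auto simp: a_kernel_iff)
qed

section \<open>Assembling the equivalences\<close>

text \<open>The resolution \<open>F\<close> of \<open>X = D(M)\<close> is a parameter because two resolutions matter: the canonical one,
  by which \<open>Tor\<close> is defined, and an arbitrary flat one.\<close>

locale tor_ext = dual_setting R E \<iota> M + bal: balanced R E \<iota> "Hom_mod R M E" F d \<epsilon>
  for R :: "('r, 'x) ring_scheme" and E :: "('r, 'e, 'y) module_scheme" and \<iota> :: "'r set \<Rightarrow> 'e"
    and M :: "('r, 'm, 'c) module_scheme" and F :: "int \<Rightarrow> ('r, 'f, 'd) module_scheme" and d \<epsilon>
begin

abbreviation "stair A i z w \<equiv> tensor_stair R A X F d \<epsilon> i z w"
abbreviation "tcycles A n \<equiv> a_kernel (bal.AF A n) (bal.AF A (n - 1)) (bal.dAF A n)"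
abbreviation "tboundaries A n \<equiv> bal.dAF A (n + 1) ` carrier (bal.AF A (n + 1))"

text \<open>The pairing between cycles of \<open>A \<otimes> F\<close> and cocycles of \<open>Hom(P(A), M)\<close>: carry the cycle over to
  \<open>P(A) \<otimes> X\<close> and evaluate.  By \<open>pairing_stair\<close> the choice of the other end of the staircase does
  not matter.\<close>

definition tor_ext_pairing where
  "tor_ext_pairing A i z u = ev u (SOME w. stair A i z w)"

context
  fixes A :: "('r, 'a, 'k) module_scheme" assumes A: "module R A"
begin

interpretation A: canonical_res R A by (rule canonical_res.intro[OF A])

lemma dAF_Suc_hom: "bal.dAF A (n + 1) \<in> mod_hom R (bal.AF A (n + 1)) (bal.AF A n)"
  using bal.dAF_hom[OF A, of "n + 1"] by simp


lemma tcycles_submodule: "submodule (tcycles A n) R (bal.AF A n)"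
  by (rule kernel_submodule[OF bal.AF_module[OF A] bal.AF_module[OF A] bal.dAF_hom[OF A]])

lemma tboundaries_submodule: "submodule (tboundaries A n) R (bal.AF A n)"
  by (rule image_carrier_submodule[OF bal.AF_module[OF A] bal.AF_module[OF A] dAF_Suc_hom])

lemma dAF_dAF:
  assumes "y \<in> carrier (bal.AF A (n + 1))" shows "bal.dAF A n (bal.dAF A (n + 1) y) = \<zero>\<^bsub>bal.AF A (n - 1)\<^esub>"
proof -
  note m = A bal.F_module
  have dn: "d (n + 1) \<in> mod_hom R (F (n + 1)) (F n)" using res_hom[OF bal.res, of "n + 1"] by simp
  have dd: "\<And>x. x \<in> carrier (F (n + 1)) \<Longrightarrow> d n (d (n + 1) x) = \<zero>\<^bsub>F (n - 1)\<^esub>"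
    using res_dd[OF bal.res, of _ "n + 1"] by simp
  have "bal.dAF A n (bal.dAF A (n + 1) y) = tensor_map R A (F (n - 1)) (\<lambda>a. a) (\<lambda>x. \<zero>\<^bsub>F (n - 1)\<^esub>) y"
    unfolding add_diff_cancel_right'
    by (rule tensor_map_comp[OF m m m mod_hom_id dn mod_hom_id res_hom[OF bal.res] mod_hom_id mod_hom_const_zero[OF m(2)] _ _ assms])
      (simp_all add: dd)
  also have "\<dots> = \<zero>\<^bsub>bal.AF A (n - 1)\<^esub>"
    by (rule tensor_map_zero[OF m m mod_hom_id mod_hom_const_zero[OF m(2)] _ assms]) simp
  finally show ?thesis .
qed

lemma tboundaries_tcycles: "tboundaries A n \<subseteq> tcycles A n"
  using dAF_dAF mod_hom_closed[OF dAF_Suc_hom] by (auto simp: a_kernel_iff)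

lemma ev_boundary:
  assumes u: "u \<in> cocycles A n" and w: "w \<in> dTX A (n + 1) ` carrier (TX A (n + 1))"
  shows "ev u w = \<zero>\<^bsub>E\<^esub>"
proof -
  obtain y where y: "y \<in> carrier (TX A (n + 1))" "w = dTX A (n + 1) y" using w by (rule imageE)
  have u': "u \<in> carrier (HM A n)" "Ext_cobound R A n u = \<zero>\<^bsub>HM A (n + 1)\<^esub>" using u by (auto simp: a_kernel_iff)
  have "ev u w = ev (Ext_cobound R A n u) y"
    using ev_cobound[OF A, of u "n + 1" y] u'(1) y by simp
  also have "\<dots> = \<zero>\<^bsub>E\<^esub>"
    using mod_hom_zero[OF HM_module[OF A] E_module ev_hom_left[OF A.free_res_module y(1)]] u'(2) by simp
  finally show ?thesis .
qed

text \<open>Two possible ends differ by the end of a staircase that starts at zero, which is a boundary, and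
  cocycles evaluate boundaries to zero.\<close>

lemma pairing_stair:
  assumes st: "stair A i z w" and u: "u \<in> cocycles A (int i)"
  shows "tor_ext_pairing A i z u = ev u w"
proof -
  define w' where "w' = (SOME w. stair A i z w)"
  have st': "stair A i z w'" unfolding w'_def using st by (rule someI)
  note c = bal.stair_carrier[OF A st] bal.stair_carrier[OF A st']
  have "z \<ominus>\<^bsub>bal.AF A (int i)\<^esub> z = \<zero>\<^bsub>bal.AF A (int i)\<^esub>"
    using module_minus_eq_zero_iff[OF bal.AF_module[OF A] c(1) c(1)] by simp
  then have d: "stair A i \<zero>\<^bsub>bal.AF A (int i)\<^esub> (w' \<ominus>\<^bsub>TX A (int i)\<^esub> w)" using bal.stair_minus[OF A st' st] by simp
  then have "w' \<ominus>\<^bsub>TX A (int i)\<^esub> w \<in> dTX A (int i + 1) ` carrier (TX A (int i + 1))"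
    using bal.stair_boundary_iff[OF A d] submodule_zero[OF tboundaries_submodule, of "int i"] by simp
  then have "ev u (w' \<ominus>\<^bsub>TX A (int i)\<^esub> w) = \<zero>\<^bsub>E\<^esub>" by (rule ev_boundary[OF u])
  moreover have uh: "u \<in> mod_hom R (free_res R A (int i)) M" using u by (auto simp: a_kernel_iff dest: Hom_memD)
  ultimately have "ev u w' \<ominus>\<^bsub>E\<^esub> ev u w = \<zero>\<^bsub>E\<^esub>"
    using mod_hom_minus[OF TX_module[OF A] E_module ev_hom[OF A.free_res_module uh] c(4) c(2)] by simp
  then show ?thesis
    using module_minus_eq_zero_iff[OF E_module] mod_hom_closed[OF ev_hom[OF A.free_res_module uh]] c
    by (simp add: tor_ext_pairing_def w'_def[symmetric])
qed

lemma tcycle_stair: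
  assumes "z \<in> tcycles A (int i)" obtains w where "stair A i z w"
  using bal.stair_exists[OF A, of z i] assms by (auto simp: a_kernel_iff)

lemma pairing_hom_right:
  assumes z: "z \<in> tcycles A (int i)"
  shows "tor_ext_pairing A i z \<in> mod_hom R ((HM A (int i))\<lparr>carrier := cocycles A (int i)\<rparr>) E"
proof -
  obtain w where w: "stair A i z w" by (rule tcycle_stair[OF z])
  have "(\<lambda>u. ev u w) \<in> mod_hom R ((HM A (int i))\<lparr>carrier := cocycles A (int i)\<rparr>) E"
    by (rule mod_hom_restrict_dom[OF ev_hom_left[OF A.free_res_module bal.stair_carrier(2)[OF A w]] submodule_sub[OF cocycles_submodule[OF A]]])
  then show ?thesis
    by (rule mod_hom_cong[OF submodule_module[OF HM_module[OF A] cocycles_submodule[OF A]]]) (simp add: pairing_stair[OF w])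
qed

lemma pairing_hom_left:
  assumes u: "u \<in> cocycles A (int i)"
  shows "(\<lambda>z. tor_ext_pairing A i z u) \<in> mod_hom R ((bal.AF A (int i))\<lparr>carrier := tcycles A (int i)\<rparr>) E"
proof -
  have uh: "u \<in> mod_hom R (free_res R A (int i)) M" using u by (auto simp: a_kernel_iff dest: Hom_memD)
  note e = ev_hom[OF A.free_res_module uh]
  show ?thesis
  proof (rule mod_homI)
    fix z assume "z \<in> carrier ((bal.AF A (int i))\<lparr>carrier := tcycles A (int i)\<rparr>)"
    then obtain w where w: "stair A i z w" using tcycle_stair by auto
    note wc = bal.stair_carrier(2)[OF A w]
    show "tor_ext_pairing A i z u \<in> carrier E" using mod_hom_closed[OF e wc] by (simp add: pairing_stair[OF w u])
    show "tor_ext_pairing A i (r \<odot>\<^bsub>(bal.AF A (int i))\<lparr>carrier := tcycles A (int i)\<rparr>\<^esub> z) u = r \<odot>\<^bsub>E\<^esub> tor_ext_pairing A i z u" if r: "r \<in> carrier R" for r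
      using mod_hom_smult[OF e r wc] by (simp add: pairing_stair[OF w u] pairing_stair[OF bal.stair_smult[OF A r w] u])
    fix z' assume "z' \<in> carrier ((bal.AF A (int i))\<lparr>carrier := tcycles A (int i)\<rparr>)"
    then obtain w' where w': "stair A i z' w'" using tcycle_stair by auto
    show "tor_ext_pairing A i (z \<oplus>\<^bsub>(bal.AF A (int i))\<lparr>carrier := tcycles A (int i)\<rparr>\<^esub> z') u = tor_ext_pairing A i z u \<oplus>\<^bsub>E\<^esub> tor_ext_pairing A i z' u"
      using mod_hom_add[OF e wc bal.stair_carrier(2)[OF A w']]
      by (simp add: pairing_stair[OF w u] pairing_stair[OF w' u] pairing_stair[OF bal.stair_add[OF A w w'] u])
  qed
qed

lemma pairing_coboundary:
  assumes z: "z \<in> tcycles A (int i)" and u: "u \<in> coboundaries A (int i)"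
  shows "tor_ext_pairing A i z u = \<zero>\<^bsub>E\<^esub>"
proof -
  obtain w where w: "stair A i z w" by (rule tcycle_stair[OF z])
  obtain v where v: "v \<in> carrier (HM A (int i - 1))" "u = Ext_cobound R A (int i - 1) v" using u by (rule imageE)
  have "tor_ext_pairing A i z u = ev u w" using u coboundaries_cocycles[OF A] by (intro pairing_stair[OF w]) blast
  also have "\<dots> = ev v (dTX A (int i) w)" using ev_cobound[OF A v(1) bal.stair_carrier(2)[OF A w]] v(2) by simp
  also have "\<dots> = \<zero>\<^bsub>E\<^esub>"
    using bal.stair_cycle_PX[OF A w] mod_hom_zero[OF TX_module[OF A] E_module ev_hom[OF A.free_res_module Hom_memD[OF v(1)]]] by simp
  finally show ?thesis .
qed

lemma pairing_boundary:
  assumes z: "z \<in> tboundaries A (int i)" and u: "u \<in> cocycles A (int i)"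
  shows "tor_ext_pairing A i z u = \<zero>\<^bsub>E\<^esub>"
proof -
  have "z \<in> tcycles A (int i)" using z tboundaries_tcycles by blast
  then obtain w where w: "stair A i z w" by (rule tcycle_stair)
  then show ?thesis using bal.stair_boundary_iff[OF A w] z ev_boundary[OF u] pairing_stair[OF w u] by simp
qed

context
  assumes noeth: "noetherian_ring R" and fg: "finitely_generated R A"
begin

lemma pairing_detect:
  assumes z: "z \<in> tcycles A (int i)" and 0: "\<And>u. u \<in> cocycles A (int i) \<Longrightarrow> tor_ext_pairing A i z u = \<zero>\<^bsub>E\<^esub>"
  shows "z \<in> tboundaries A (int i)"
proof -
  obtain w where w: "stair A i z w" by (rule tcycle_stair[OF z])
  have "w \<in> dTX A (int i + 1) ` carrier (TX A (int i + 1))"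
    by (rule perfect_detect[OF A noeth fg bal.stair_carrier(2)[OF A w] bal.stair_cycle_PX[OF A w]])
      (simp add: 0 pairing_stair[OF w, symmetric])
  then show ?thesis using bal.stair_boundary_iff[OF A w] by simp
qed

lemma pairing_represent:
  assumes l: "\<chi> \<in> mod_hom R ((HM A (int i))\<lparr>carrier := cocycles A (int i)\<rparr>) E"
    and kill: "\<And>u. u \<in> coboundaries A (int i) \<Longrightarrow> \<chi> u = \<zero>\<^bsub>E\<^esub>"
  shows "\<exists>z\<in>tcycles A (int i). \<forall>u\<in>cocycles A (int i). tor_ext_pairing A i z u = \<chi> u"
proof (rule perfect_represent[OF A noeth fg l])
  show "\<chi> u = \<zero>\<^bsub>E\<^esub>" if "u \<in> coboundaries A (int i)" for u by (rule kill[OF that])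
  fix w assume w: "w \<in> carrier (TX A (int i))" "dTX A (int i) w = \<zero>\<^bsub>TX A (int i - 1)\<^esub>" "\<And>u. u \<in> cocycles A (int i) \<Longrightarrow> ev u w = \<chi> u"
  obtain z where z: "stair A i z w" by (rule bal.stair_exists'[OF A w(1,2)])
  have "z \<in> tcycles A (int i)" using bal.stair_carrier(1)[OF A z] bal.stair_cycle_AF[OF A z] by (simp add: a_kernel_iff)
  then show ?thesis using pairing_stair[OF z] w(3) by (intro bexI[of _ z]) auto
qed

end

end

lemma precomp_cobound:
  assumes A: "module R A" and A': "module R A'" and f: "f \<in> mod_hom R A A'" and u: "u \<in> carrier (HM A' n)"
  shows "Ext_cobound R A n (precomp (free_res R A n) (res_map R f) u) =
    precomp (free_res R A (n + 1)) (res_map R f) (Ext_cobound R A' n u)"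
proof -
  interpret A: canonical_res R A by (rule canonical_res.intro[OF A])
  interpret A': canonical_res R A' by (rule canonical_res.intro[OF A'])
  note rm = res_map_hom[OF A A' f]
  show ?thesis
  proof (rule Hom_ext)
    show "Ext_cobound R A n (precomp (free_res R A n) (res_map R f) u) \<in> carrier (HM A (n + 1))"
      by (rule mod_hom_closed[OF cobound_hom[OF A] precomp_closed[OF A.free_res_module rm u]])
    show "precomp (free_res R A (n + 1)) (res_map R f) (Ext_cobound R A' n u) \<in> carrier (HM A (n + 1))"
      by (rule precomp_closed[OF A.free_res_module rm mod_hom_closed[OF cobound_hom[OF A'] u]])
    fix p assume p: "p \<in> carrier (free_res R A (n + 1))"
    have "res_diff R p \<in> carrier (free_res R A n)" using mod_hom_closed[OF A.res_diff_hom p] by simp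
    then show "Ext_cobound R A n (precomp (free_res R A n) (res_map R f) u) p =
        precomp (free_res R A (n + 1)) (res_map R f) (Ext_cobound R A' n u) p"
      using p mod_hom_closed[OF rm p] res_diff_map[OF A A' f p] by (simp add: Ext_cobound_def precomp_apply)
  qed
qed

lemma pairing_natural:
  assumes A: "module R A" and A': "module R A'" and f: "f \<in> mod_hom R A A'"
    and z: "z \<in> tcycles A (int i)" and u: "u \<in> cocycles A' (int i)"
    and u': "precomp (free_res R A (int i)) (res_map R f) u \<in> cocycles A (int i)"
  shows "tor_ext_pairing A' i (tensor_map R A' (F (int i)) f (\<lambda>x. x) z) u =
    tor_ext_pairing A i z (precomp (free_res R A (int i)) (res_map R f) u)"
proof -
  interpret A: canonical_res R A by (rule canonical_res.intro[OF A])
  interpret A': canonical_res R A' by (rule canonical_res.intro[OF A'])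
  obtain w where w: "stair A i z w" by (rule tcycle_stair[OF A z])
  have "u \<in> carrier (HM A' (int i))" using u by (simp add: a_kernel_iff)
  then show ?thesis
    using pairing_stair[OF A' bal.stair_natural[OF A A' f w] u] pairing_stair[OF A w u']
      ev_natural[OF A.free_res_module A'.free_res_module res_map_hom[OF A A' f] _ bal.stair_carrier(2)[OF A w]] by simp
qed

context
  fixes I and N :: "('r, 'n, 'l) module_scheme"
  assumes N: "module R N" and I: "ideal I R" and fgN: "finitely_generated R N" and noeth: "noetherian_ring R"
begin

private abbreviation "Q \<equiv> adic_quot R I N"
private abbreviation "prj \<equiv> adic_proj R I N"

private lemmas Q = adic_quot_module[OF N I]
private lemmas prj = adic_proj_hom[OF N I]

private abbreviation "Zn n s \<equiv> (HM (Q s) n)\<lparr>carrier := cocycles (Q s) n\<rparr>"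
private abbreviation "Yn n s \<equiv> (bal.AF (Q s) n)\<lparr>carrier := tcycles (Q s) n\<rparr>"
private abbreviation "pin n s \<equiv> precomp (free_res R (Q (Suc s)) n) (res_map R (prj s))"
private abbreviation "pn n s \<equiv> tensor_map R (Q s) (F n) (prj s) (\<lambda>x. x)"

private lemma Zn: "module R (Zn n s)" by (rule submodule_module[OF HM_module[OF Q] cocycles_submodule[OF Q]])
private lemma Yn: "module R (Yn n s)" by (rule submodule_module[OF bal.AF_module[OF Q] tcycles_submodule[OF Q]])
private lemma Bn: "submodule (coboundaries (Q s) n) R (Zn n s)"
  by (rule submodule_in_submodule[OF HM_module[OF Q] cocycles_submodule[OF Q] coboundaries_submodule[OF Q] coboundaries_cocycles[OF Q]])
private lemma Dn: "submodule (tboundaries (Q s) n) R (Yn n s)"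
  by (rule submodule_in_submodule[OF bal.AF_module[OF Q] tcycles_submodule[OF Q] tboundaries_submodule[OF Q] tboundaries_tcycles[OF Q]])

private lemma Q_res: "module R (free_res R (Q s) n)"
  by (rule canonical_res.free_res_module[OF canonical_res.intro[OF Q]])

private lemma pin_full: "pin n s \<in> mod_hom R (HM (Q s) n) (HM (Q (Suc s)) n)"
  by (rule precomp_hom[OF Q_res Q_res M res_map_hom[OF Q Q prj]])

private lemma pin_cobound:
  "u \<in> carrier (HM (Q s) n) \<Longrightarrow> Ext_cobound R (Q (Suc s)) n (pin n s u) = pin (n + 1) s (Ext_cobound R (Q s) n u)"
  by (rule precomp_cobound[OF Q Q prj])

private lemma pin_cocycle:
  assumes u: "u \<in> cocycles (Q s) n" shows "pin n s u \<in> cocycles (Q (Suc s)) n"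
proof -
  have uc: "u \<in> carrier (HM (Q s) n)" "Ext_cobound R (Q s) n u = \<zero>\<^bsub>HM (Q s) (n + 1)\<^esub>" using u by (auto simp: a_kernel_iff)
  have "Ext_cobound R (Q (Suc s)) n (pin n s u) = \<zero>\<^bsub>HM (Q (Suc s)) (n + 1)\<^esub>"
    unfolding pin_cobound[OF uc(1)] uc(2) by (rule mod_hom_zero[OF HM_module[OF Q] HM_module[OF Q] pin_full])
  then show ?thesis using mod_hom_closed[OF pin_full uc(1)] by (simp add: a_kernel_iff)
qed

private lemma pin: "pin n s \<in> mod_hom R (Zn n s) (Zn n (Suc s))"
  by (rule mod_hom_restrict_cod[OF mod_hom_restrict_dom[OF pin_full submodule_sub[OF cocycles_submodule[OF Q]]]])
    (use pin_cocycle in auto)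

private lemma pin_coboundary:
  assumes u: "u \<in> coboundaries (Q s) n" shows "pin n s u \<in> coboundaries (Q (Suc s)) n"
proof -
  obtain v where v: "v \<in> carrier (HM (Q s) (n - 1))" "u = Ext_cobound R (Q s) (n - 1) v" using u by (rule imageE)
  have "pin n s u = Ext_cobound R (Q (Suc s)) (n - 1) (pin (n - 1) s v)"
    using pin_cobound[OF v(1)] v(2) by simp
  then show ?thesis using mod_hom_closed[OF pin_full v(1)] by (rule image_eqI)
qed

private lemma pn_full: "pn n s \<in> mod_hom R (bal.AF (Q (Suc s)) n) (bal.AF (Q s) n)"
  by (rule tensor_map_hom[OF Q bal.F_module Q bal.F_module prj mod_hom_id])

private lemma pn_d:
  assumes "z \<in> carrier (bal.AF (Q (Suc s)) n)"
  shows "pn (n - 1) s (bal.dAF (Q (Suc s)) n z) = bal.dAF (Q s) n (pn n s z)"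
  by (rule tensor_map_square[OF Q bal.F_module Q bal.F_module Q bal.F_module Q bal.F_module
      mod_hom_id res_hom[OF bal.res] prj mod_hom_id prj mod_hom_id mod_hom_id res_hom[OF bal.res] _ _ assms]) (rule refl)+

private lemma pn_d':
  assumes "z \<in> carrier (bal.AF (Q (Suc s)) (n + 1))"
  shows "pn n s (bal.dAF (Q (Suc s)) (n + 1) z) = bal.dAF (Q s) (n + 1) (pn (n + 1) s z)"
  using pn_d[OF assms] by simp

private lemma pn_cycle:
  assumes z: "z \<in> tcycles (Q (Suc s)) n" shows "pn n s z \<in> tcycles (Q s) n"
proof -
  have zc: "z \<in> carrier (bal.AF (Q (Suc s)) n)" "bal.dAF (Q (Suc s)) n z = \<zero>\<^bsub>bal.AF (Q (Suc s)) (n - 1)\<^esub>" using z by (auto simp: a_kernel_iff)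
  have "bal.dAF (Q s) n (pn n s z) = \<zero>\<^bsub>bal.AF (Q s) (n - 1)\<^esub>"
    unfolding pn_d[OF zc(1), symmetric] zc(2) by (rule mod_hom_zero[OF bal.AF_module[OF Q] bal.AF_module[OF Q] pn_full])
  then show ?thesis using mod_hom_closed[OF pn_full zc(1)] by (simp add: a_kernel_iff)
qed

private lemma pn: "pn n s \<in> mod_hom R (Yn n (Suc s)) (Yn n s)"
  by (rule mod_hom_restrict_cod[OF mod_hom_restrict_dom[OF pn_full submodule_sub[OF tcycles_submodule[OF Q]]]])
    (use pn_cycle in auto)

private lemma pn_boundary: "pn n s ` tboundaries (Q (Suc s)) n \<subseteq> tboundaries (Q s) n"
proof
  fix z assume "z \<in> pn n s ` tboundaries (Q (Suc s)) n"
  then obtain y where y: "y \<in> carrier (bal.AF (Q (Suc s)) (n + 1))" "z = pn n s (bal.dAF (Q (Suc s)) (n + 1) y)" by blast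
  then show "z \<in> tboundaries (Q s) n" unfolding pn_d'[OF y(1)] using mod_hom_closed[OF pn_full y(1)] by blast
qed

private lemma pn_surj: "pn n s ` carrier (bal.AF (Q (Suc s)) n) = carrier (bal.AF (Q s) n)"
  by (rule tensor_map_surj[OF Q bal.F_module Q bal.F_module prj mod_hom_id adic_proj_surj[OF N I]]) simp

text \<open>Vanishing of the inverse limit of the homology of \<open>N / I\<^sup>s N \<otimes> F\<close>; this is \<open>U\<^sub>n(N, X)\<close> if \<open>F\<close> is the
  canonical resolution of \<open>X\<close>.\<close>

definition tor_lim_zero :: "int \<Rightarrow> bool"
  where "tor_lim_zero n \<longleftrightarrow> is_zero (inv_lim (\<lambda>s. quot_mod (Yn n s) (tboundaries (Q s) n)) (\<lambda>s. coset_map (Yn n s) (tboundaries (Q s) n) (pn n s)))"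

private lemma tor_lim_zero_iff:
  "tor_lim_zero n \<longleftrightarrow>
    (\<forall>z. (\<forall>s. z s \<in> carrier (Yn n s) \<and> pn n s (z (Suc s)) \<ominus>\<^bsub>Yn n s\<^esub> z s \<in> tboundaries (Q s) n) \<longrightarrow> (\<forall>s. z s \<in> tboundaries (Q s) n))"
  unfolding tor_lim_zero_def by (rule inv_lim_quot_zero_iff) (rule Yn Dn pn pn_boundary)+

private lemma gen_local_cohomology_zero_iff:
  "is_zero (gen_local_cohomology R I N M n) \<longleftrightarrow>
    (\<forall>s. \<forall>u\<in>carrier (Zn n s). \<exists>k. dir_trans (pin n) s k u \<in> coboundaries (Q (s + k)) n)"
proof -
  have "gen_local_cohomology R I N M n = dir_lim (\<lambda>s. quot_mod (Zn n s) (coboundaries (Q s) n))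
      (\<lambda>s. coset_map (Zn n (Suc s)) (coboundaries (Q (Suc s)) n) (pin n s))"
    unfolding gen_local_cohomology_def Ext_def Ext_map_def homology_def coset_map_carrier ..
  moreover have cob: "pin n s ` coboundaries (Q s) n \<subseteq> coboundaries (Q (Suc s)) n" for s
    by (rule image_subsetI) (rule pin_coboundary)
  have "is_zero (dir_lim (\<lambda>s. quot_mod (Zn n s) (coboundaries (Q s) n))
      (\<lambda>s. coset_map (Zn n (Suc s)) (coboundaries (Q (Suc s)) n) (pin n s))) \<longleftrightarrow>
      (\<forall>s. \<forall>u\<in>carrier (Zn n s). \<exists>k. dir_trans (pin n) s k u \<in> coboundaries (Q (s + k)) n)"
    by (rule dir_lim_quot_zero_iff[where R = R]) (rule Zn Bn pin cob)+
  ultimately show ?thesis by simp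
qed

private lemma dual_tower:
  "dual_tower R E \<iota> (Zn (int i)) (\<lambda>s. coboundaries (Q s) (int i)) (pin (int i)) (Yn (int i))
    (\<lambda>s. tboundaries (Q s) (int i)) (pn (int i)) (\<lambda>s. tor_ext_pairing (Q s) i)"
proof (rule dual_tower.intro[OF matlis_axioms], rule dual_tower_axioms.intro, goal_cases)
  case (8 s z) then show ?case using pairing_hom_right[OF Q] by simp
next
  case (9 u s) then show ?case using pairing_hom_left[OF Q] by simp
next
  case (10 z s u) then show ?case using pairing_coboundary[OF Q] by simp
next
  case (11 z s u) then show ?case using pairing_boundary[OF Q] by simp
next
  case (12 z s) then show ?case using pairing_detect[OF Q noeth adic_quot_fg[OF N I fgN]] by simp
next
  case (13 \<chi> s) then show ?case using pairing_represent[OF Q noeth adic_quot_fg[OF N I fgN]] by simp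
next
  case (14 z s u) then show ?case using pairing_natural[OF Q Q prj] pin_cocycle by simp
qed (rule Zn Bn pin pin_coboundary Yn Dn pn; assumption?)+

private lemma AF_neg_zero: "z \<in> carrier (bal.AF (Q s) n) \<Longrightarrow> n < 0 \<Longrightarrow> z = \<zero>\<^bsub>bal.AF (Q s) n\<^esub>"
  by (rule bal.AF_neg[OF Q])

private lemma tor_lim_zero_neg:
  assumes "n < 0" shows "tor_lim_zero n"
proof -
  have "z \<in> tboundaries (Q s) n" if "z \<in> carrier (Yn n s)" for s z
    using AF_neg_zero[of z s n] that assms submodule_zero[OF tboundaries_submodule[OF Q]] by (simp add: a_kernel_iff)
  then show ?thesis unfolding tor_lim_zero_iff by (intro allI impI) simp
qed

text \<open>In degrees \<open>n \<ge> 0\<close> the pairings make the cycles of \<open>N / I\<^sup>s N \<otimes> F\<close> a tower dual to the cocycles of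
  \<open>Hom(P(N / I\<^sup>s N), M)\<close>; in negative degrees both limits are limits of zero modules.\<close>

theorem cohomology_zero_iff_tor_lim_zero:
  "is_zero (gen_local_cohomology R I N M n) \<longleftrightarrow> tor_lim_zero n"
proof (cases "n < 0")
  case False
  then obtain i where n: "n = int i" by (metis nonneg_int_cases not_less)
  interpret W: dual_tower R E \<iota> "Zn (int i)" "\<lambda>s. coboundaries (Q s) (int i)" "pin (int i)" "Yn (int i)"
    "\<lambda>s. tboundaries (Q s) (int i)" "pn (int i)" "\<lambda>s. tor_ext_pairing (Q s) i"
    by (rule dual_tower)
  show ?thesis unfolding n gen_local_cohomology_zero_iff tor_lim_zero_iff
    using W.lim_zero_iff_colim_zero unfolding W.lim_zero_def W.colim_zero_def by simp
next
  case True
  have "u \<in> coboundaries (Q s) n" if u: "u \<in> carrier (Zn n s)" for s u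
  proof -
    have uc: "u \<in> carrier (HM (Q s) n)" using u by (simp add: a_kernel_iff)
    have "u = \<zero>\<^bsub>HM (Q s) n\<^esub>"
    proof (rule Hom_ext[OF uc module_zero_closed[OF HM_module[OF Q]]])
      fix x assume x: "x \<in> carrier (free_res R (Q s) n)"
      then have "x = \<zero>\<^bsub>free_res R (Q s) n\<^esub>"
        using res_neg[OF canonical_res.canonical_resolution[OF canonical_res.intro[OF Q]] True] by simp
      then show "u x = \<zero>\<^bsub>HM (Q s) n\<^esub> x" using mod_hom_zero[OF Q_res M Hom_memD[OF uc]] x by (simp add: Hom_zero)
    qed
    then show ?thesis using submodule_zero[OF coboundaries_submodule[OF Q]] by simp
  qed
  then have "\<exists>k. dir_trans (pin n) s k u \<in> coboundaries (Q (s + k)) n" if "u \<in> carrier (Zn n s)" for s u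
    using that by (intro exI[of _ 0]) simp
  then have "is_zero (gen_local_cohomology R I N M n)"
    unfolding gen_local_cohomology_zero_iff by (intro allI ballI)
  moreover have "tor_lim_zero n" by (rule tor_lim_zero_neg[OF True])
  ultimately show ?thesis by simp
qed

private abbreviation "CC n \<equiv> completion_complex R I N F n"
private abbreviation "CD n \<equiv> completion_diff R I N F d n"

private lemma CC_module: "module R (CC n)"
  unfolding completion_complex_def by (rule inv_lim_module[OF R_cring]) (rule bal.AF_module[OF Q] pn_full)+

private lemma CD_hom: "CD n \<in> mod_hom R (CC n) (CC (n - 1))"
  unfolding completion_complex_def completion_diff_def[abs_def]
  by (rule inv_lim_map_hom) (rule bal.AF_module[OF Q] bal.dAF_hom[OF Q] pn_d; assumption?)+

private lemma left_derived_zero_iff: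
  "is_zero (left_derived_completion R I N F d n) \<longleftrightarrow>
    (\<forall>z. (\<forall>s. z s \<in> tcycles (Q s) n \<and> pn n s (z (Suc s)) = z s) \<longrightarrow>
      (\<exists>y. \<forall>s. y s \<in> carrier (bal.AF (Q s) (n + 1)) \<and> pn (n + 1) s (y (Suc s)) = y s \<and> bal.dAF (Q s) (n + 1) (y s) = z s))"
proof -
  have h: "CD (n + 1) \<in> mod_hom R (CC (n + 1)) (CC n)" using CD_hom[of "n + 1"] by simp
  have carr: "x \<in> carrier (CC k) \<longleftrightarrow> (\<forall>s. x s \<in> carrier (bal.AF (Q s) k)) \<and> (\<forall>s. pn k s (x (Suc s)) = x s)" for x k
    by (simp add: completion_complex_def inv_lim_def)
  have zero: "CD n x = \<zero>\<^bsub>CC (n - 1)\<^esub> \<longleftrightarrow> (\<forall>s. bal.dAF (Q s) n (x s) = \<zero>\<^bsub>bal.AF (Q s) (n - 1)\<^esub>)" for x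
    by (simp add: completion_complex_def completion_diff_def inv_lim_def fun_eq_iff)
  have "CD n (CD (n + 1) x) = \<zero>\<^bsub>CC (n - 1)\<^esub>" if x: "x \<in> carrier (CC (n + 1))" for x
    unfolding zero using x dAF_dAF[OF Q] by (simp add: carr completion_diff_def)
  then have "is_zero (left_derived_completion R I N F d n) \<longleftrightarrow>
      (\<forall>x\<in>carrier (CC n). CD n x = \<zero>\<^bsub>CC (n - 1)\<^esub> \<longrightarrow> x \<in> CD (n + 1) ` carrier (CC (n + 1)))"
    unfolding left_derived_completion_def by (rule homology_zero_iff[OF CC_module CC_module CC_module h CD_hom])
  also have "\<dots> \<longleftrightarrow> (\<forall>z. (\<forall>s. z s \<in> tcycles (Q s) n \<and> pn n s (z (Suc s)) = z s) \<longrightarrow> z \<in> CD (n + 1) ` carrier (CC (n + 1)))"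
    unfolding Ball_def carr zero a_kernel_iff by blast
  also have "\<dots> \<longleftrightarrow> (\<forall>z. (\<forall>s. z s \<in> tcycles (Q s) n \<and> pn n s (z (Suc s)) = z s) \<longrightarrow>
      (\<exists>y. \<forall>s. y s \<in> carrier (bal.AF (Q s) (n + 1)) \<and> pn (n + 1) s (y (Suc s)) = y s \<and> bal.dAF (Q s) (n + 1) (y s) = z s))"
  proof -
    have "z \<in> CD (n + 1) ` carrier (CC (n + 1)) \<longleftrightarrow>
        (\<exists>y. \<forall>s. y s \<in> carrier (bal.AF (Q s) (n + 1)) \<and> pn (n + 1) s (y (Suc s)) = y s \<and> bal.dAF (Q s) (n + 1) (y s) = z s)" for z
      unfolding image_iff Bex_def carr completion_diff_def fun_eq_iff by auto
    then show ?thesis by simp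
  qed
  finally show ?thesis .
qed

text \<open>The transition maps of \<open>N / I\<^sup>s N \<otimes> F\<close> are surjective, and duality in degree \<open>n + 1\<close> makes the first
  derived limit of the homology vanish there, so in degree \<open>n\<close> homology and limit may be
  interchanged.\<close>

theorem tor_lim_zero_iff_left_derived_zero:
  "tor_lim_zero n \<longleftrightarrow> is_zero (left_derived_completion R I N F d n)"
proof (cases "n < 0")
  case False
  then obtain i where n: "n = int i" by (metis nonneg_int_cases not_less)
  have n1: "n + 1 = int (Suc i)" by (simp add: n)
  interpret W: dual_tower R E \<iota> "Zn (int (Suc i))" "\<lambda>s. coboundaries (Q s) (int (Suc i))" "pin (int (Suc i))" "Yn (int (Suc i))"
    "\<lambda>s. tboundaries (Q s) (int (Suc i))" "pn (int (Suc i))" "\<lambda>s. tor_ext_pairing (Q s) (Suc i)"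
    by (rule dual_tower)
  interpret T: complex_tower R "\<lambda>s. bal.AF (Q s) n" "\<lambda>s. bal.AF (Q s) (n + 1)" "\<lambda>s. bal.AF (Q s) (n + 1 + 1)"
    "\<lambda>s. bal.dAF (Q s) (n + 1)" "\<lambda>s. bal.dAF (Q s) (n + 1 + 1)" "pn n" "pn (n + 1)" "pn (n + 1 + 1)" "\<lambda>s. tcycles (Q s) n"
  proof (rule complex_tower.intro, goal_cases)
    case (11 s y) show ?case using dAF_dAF[OF Q, of y s "n + 1"] 11 by simp
  qed (rule bal.AF_module[OF Q] dAF_Suc_hom[OF Q] pn_full pn_d' pn_surj tcycles_submodule[OF Q] tboundaries_tcycles[OF Q]; assumption?)+
  have ker: "a_kernel (bal.AF (Q s) (n + 1)) (bal.AF (Q s) n) (bal.dAF (Q s) (n + 1)) = tcycles (Q s) (n + 1)" for s by simp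
  have "T.lim1_homology_zero"
    unfolding T.lim1_homology_zero_def
  proof (intro allI impI)
    fix e assume e: "\<forall>s. e s \<in> a_kernel (bal.AF (Q s) (n + 1)) (bal.AF (Q s) n) (bal.dAF (Q s) (n + 1))"
    then have "e s \<in> tcycles (Q s) (n + 1)" for s by (simp only: ker)
    then have e': "e s \<in> carrier (Yn (int (Suc i)) s)" for s unfolding n1 by simp
    obtain t where t: "\<And>s. t s \<in> carrier (Yn (int (Suc i)) s)"
      "\<And>s. e s \<ominus>\<^bsub>Yn (int (Suc i)) s\<^esub> (t s \<ominus>\<^bsub>Yn (int (Suc i)) s\<^esub> pn (int (Suc i)) s (t (Suc s))) \<in> tboundaries (Q s) (int (Suc i))"
      by (rule W.tower_lim1_zero[of e, OF e']) blast
    have tk: "t s \<in> tcycles (Q s) (int (Suc i))" for s using t(1) by simp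
    note sm = bal.AF_module[OF Q] tcycles_submodule[OF Q]
    have pt: "pn (int (Suc i)) s (t (Suc s)) \<in> tcycles (Q s) (int (Suc i))" for s by (rule pn_cycle[OF tk])
    have tp: "t s \<ominus>\<^bsub>bal.AF (Q s) (int (Suc i))\<^esub> pn (int (Suc i)) s (t (Suc s)) \<in> tcycles (Q s) (int (Suc i))" for s
      by (rule submodule_minus[OF tcycles_submodule[OF Q] tk pt])
    show "\<exists>t. \<forall>s. t s \<in> a_kernel (bal.AF (Q s) (n + 1)) (bal.AF (Q s) n) (bal.dAF (Q s) (n + 1)) \<and>
        e s \<ominus>\<^bsub>bal.AF (Q s) (n + 1)\<^esub> (t s \<ominus>\<^bsub>bal.AF (Q s) (n + 1)\<^esub> pn (n + 1) s (t (Suc s))) \<in> bal.dAF (Q s) (n + 1 + 1) ` carrier (bal.AF (Q s) (n + 1 + 1))"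
      unfolding ker unfolding n1
      using t(2) tk unfolding submodule_minus_eq[OF sm pt] submodule_minus_eq[OF sm tp] by (intro exI[of _ t]) blast
  qed
  then have "T.homology_lim_zero \<longleftrightarrow> T.lim_homology_zero" by (rule T.homology_lim_zero_iff)
  moreover have "T.homology_lim_zero \<longleftrightarrow> is_zero (left_derived_completion R I N F d n)"
    unfolding T.homology_lim_zero_def left_derived_zero_iff ..
  moreover have "T.lim_homology_zero \<longleftrightarrow> tor_lim_zero n"
  proof -
    have "z s \<in> tcycles (Q s) n \<Longrightarrow> pn n s (z (Suc s)) \<ominus>\<^bsub>Yn n s\<^esub> z s = pn n s (z (Suc s)) \<ominus>\<^bsub>bal.AF (Q s) n\<^esub> z s" for z s
      by (rule submodule_minus_eq[OF bal.AF_module[OF Q] tcycles_submodule[OF Q]])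
    then show ?thesis unfolding T.lim_homology_zero_def tor_lim_zero_iff by (simp cong: conj_cong)
  qed
  ultimately show ?thesis by simp
next
  case True
  have "tor_lim_zero n" by (rule tor_lim_zero_neg[OF True])
  moreover have "is_zero (left_derived_completion R I N F d n)" unfolding left_derived_zero_iff
  proof (intro allI impI)
    fix z assume z: "\<forall>s. z s \<in> tcycles (Q s) n \<and> pn n s (z (Suc s)) = z s"
    then have "z s = \<zero>\<^bsub>bal.AF (Q s) n\<^esub>" for s using AF_neg_zero[of "z s" s n] True by (simp add: a_kernel_iff)
    then show "\<exists>y. \<forall>s. y s \<in> carrier (bal.AF (Q s) (n + 1)) \<and> pn (n + 1) s (y (Suc s)) = y s \<and> bal.dAF (Q s) (n + 1) (y s) = z s"
      using mod_hom_zero[OF bal.AF_module[OF Q] bal.AF_module[OF Q] pn_full]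
        mod_hom_zero[OF bal.AF_module[OF Q] bal.AF_module[OF Q] dAF_Suc_hom[OF Q]] module_zero_closed[OF bal.AF_module[OF Q]]
      by (intro exI[of _ "\<lambda>s. \<zero>\<^bsub>bal.AF (Q s) (n + 1)\<^esub>"]) simp
  qed
  ultimately show ?thesis by simp
qed

end

end

theorem corollary3p2:
  fixes R :: "'r ring" and I :: "'r set"
    and N :: "('r, 'n) module" and M :: "('r, 'm) module"
    and E :: "('r, 'e) module" and \<iota> :: "'r set \<Rightarrow> 'e"
    and F :: "int \<Rightarrow> ('r, 'f) module" and d :: "int \<Rightarrow> 'f \<Rightarrow> 'f" and \<epsilon> :: "'f \<Rightarrow> 'm \<Rightarrow> 'e"
    and c :: int
  assumes "noetherian_local_ring R"
    and "module R N" and "finitely_generated R N"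
    and "module R M"
    and "ideal I R" and "ideal_smult R I M \<noteq> carrier M"
    and "c = grade R I M"
    and "injective_hull R (residue_module R) E \<iota>"
    and "flat_resolution R (matlis_dual R E M) F d \<epsilon>"
  shows "(cohomologically_complete_intersection R I N M
            \<longleftrightarrow> (\<forall>i. i \<noteq> c \<longrightarrow> is_zero (Tor_lim R I N (matlis_dual R E M) i)))
       \<and> ((\<forall>i. i \<noteq> c \<longrightarrow> is_zero (Tor_lim R I N (matlis_dual R E M) i))
            \<longleftrightarrow> (\<forall>i. i \<noteq> c \<longrightarrow> is_zero (left_derived_completion R I N F d i)))"
proof -
  let ?X = "Hom_mod R M E"
  have noeth: "noetherian_ring R" using assms(1) by (simp add: noetherian_local_ring_def)
  interpret matlis R E \<iota> by (rule matlis.intro[OF assms(1,8)])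
  interpret dual_setting R E \<iota> M by (rule dual_setting.intro[OF matlis_axioms dual_setting_axioms.intro[OF assms(4)]])
  interpret X: canonical_res R ?X by (rule canonical_res.intro[OF X_module])
  have "balanced R E \<iota> ?X (free_res R ?X) (\<lambda>_. res_diff R) (res_aug R ?X)"
    by (intro balanced.intro matlis_axioms balanced_axioms.intro X_module X.canonical_resolution)
      (simp add: free_res_def free_imp_baer_dual[OF E_baer])
  then interpret tor: tor_ext R E \<iota> M "free_res R ?X" "\<lambda>_. res_diff R" "res_aug R ?X"
    by (rule tor_ext.intro[OF dual_setting_axioms])
  have flat: "flat_resolution R ?X F d \<epsilon>" using assms(9) by (simp add: matlis_dual_def)
  have "balanced R E \<iota> ?X F d \<epsilon>"
    using flat by (intro balanced.intro matlis_axioms balanced_axioms.intro X_module flat_resolution_imp_resolution[OF flat] flat_imp_baer_dual[OF E_baer])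
      (simp add: flat_resolution_def)
  then interpret lder: tor_ext R E \<iota> M F d \<epsilon>
    by (rule tor_ext.intro[OF dual_setting_axioms])
  note hyps = assms(2,5,3) noeth
  \<comment> \<open>for the canonical resolution, cycles modulo boundaries are \<open>Tor\<close> by definition\<close>
  have Tor: "is_zero (Tor_lim R I N ?X i) \<longleftrightarrow> is_zero (gen_local_cohomology R I N M i)" for i
    unfolding tor.cohomology_zero_iff_tor_lim_zero[OF hyps] tor.tor_lim_zero_def[OF hyps]
      Tor_lim_def Tor_def Tor_map_def homology_def coset_map_carrier by simp
  \<comment> \<open>here \<open>tor_lim_zero\<close>, for the flat resolution \<open>F\<close>, is only an intermediate condition\<close>
  have "is_zero (left_derived_completion R I N F d i) \<longleftrightarrow> is_zero (gen_local_cohomology R I N M i)" for i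
    using lder.cohomology_zero_iff_tor_lim_zero[OF hyps] lder.tor_lim_zero_iff_left_derived_zero[OF hyps] by simp
  then show ?thesis
    using Tor by (simp add: cohomologically_complete_intersection_def matlis_dual_def assms(7))
qed

end
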